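(* Assume the standing setting below. Assume moreover: (i) (nondegeneracy outside $\Sigma$) for every $\delta>0$ there exists $\nu_\delta>0$ such that for all $\theta\in\Theta$, $A_\theta(x)\ge \nu_\delta I$ for all $x\in\Sigma_\delta^C:=\{x\in\mathbb T^N:\operatorname{dist}(x,\Sigma)>\delta\}$; (ii) $p\mapsto H_\theta(x,p)$ is convex for every $x\in\mathbb T^N$ and $\theta\in\Theta$; (iii) (uniform strict convexity on $\Sigma$) for all $x\in\Sigma$, $0<\lambda<1$ and $p,q\in\mathbb R^N$ with $p\neq q$, $$\inf_{\theta\in\Theta}\{\lambda H_\theta(x,p)+(1-\lambda)H_\theta(x,q)-H_\theta(x,\lambda p+(1-\lambda)q)\}>0.$$ Then, with $u$ the Lipschitz viscosity solution of (E) and $c$ the ergodic constant, $u(\cdot,t)+ct\to u_\infty$ uniformly on $\mathbb T^N$ as $t\to+\infty$, where $u_\infty$ is a viscosity solution of the ergodic problem (S).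
   Context: Standing setting. $\mathbb T^N=\mathbb R^N/\mathbb Z^N$ is the flat torus, $\Theta$ is a metric space and $C>0$ is a fixed constant. For every $\theta\in\Theta$: $\sigma_\theta\in W^{1,\infty}(\mathbb T^N;\mathcal M_N)$ with $|\sigma_\theta|,|D\sigma_\theta|\le C$, and $A_\theta=\sigma_\theta\sigma_\theta^T$; $H_\theta\in W^{1,\infty}_{\rm loc}(\mathbb T^N\times\mathbb R^N)$ with $|H_\theta(x,0)|\le C$, and for every $R>0$ there is $C_R>0$ independent of $\theta$ with $|H_\theta(x,p)-H_\theta(y,q)|\le C_R(|x-y|+|p-q|)$ for $x,y\in\mathbb T^N$, $|p|,|q|\le R$. Consider (E) $u_t+\sup_{\theta\in\Theta}\{-\mathrm{tr}(A_\theta(x)D^2u)+H_\theta(x,Du)\}=0$ in $\mathbb T^N\times(0,\infty)$, $u(x,0)=u_0(x)$; (E$_\lambda$) $\lambda v_\lambda+\sup_{\theta}\{-\mathrm{tr}(A_\theta(x)D^2v_\lambda)+H_\theta(x,Dv_\lambda)\}=0$ in $\mathbb T^N$, $\lambda>0$; (S) $\sup_{\theta}\{-\mathrm{tr}(A_\theta(x)D^2v)+H_\theta(x,Dv)\}=c$ in $\mathbb T^N$. It is assumed that there exist viscosity solutions $u\in C(\mathbb T^N\times[0,\infty))$ of (E) and $v_\lambda\in C(\mathbb T^N)$ of (E$_\lambda$) for all $\lambda>0$ with $|u(x,t)-u(y,t)|,|v_\lambda(x)-v_\lambda(y)|\le C|x-y|$ for all $x,y,t,\lambda$. Under this assumption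 a comparison principle holds for (E) and (E$_\lambda$), there is a unique constant $c\in\mathbb R$ (the ergodic constant) for which (S) has a solution $v\in W^{1,\infty}(\mathbb T^N)$, and $u+ct$ is bounded. All solutions are viscosity solutions. $\Sigma:=\{x\in\mathbb T^N: A_\theta(x)=0\text{ for all }\theta\in\Theta\}$ (possibly empty). *)

theory Defs
  imports "HOL-Analysis.Analysis"
begin

text \<open>The torus T^N is represented by Z^N-periodic objects on R^N, with R^N = real^'n.
  Matrices M_N are real^'n^'n (norm = Frobenius norm).\<close>

definition periodic :: "(real^'n \<Rightarrow> 'b) \<Rightarrow> bool" where
  "periodic f \<longleftrightarrow> (\<forall>x k. (\<forall>i. k $ i \<in> \<int>) \<longrightarrow> f (x + k) = f x)"

definition C2_test :: "(real^'n \<Rightarrow> real) \<Rightarrow> (real^'n \<Rightarrow> real^'n) \<Rightarrow> (real^'n \<Rightarrow> real^'n^'n) \<Rightarrow> bool" where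
  "C2_test phi Dphi D2phi \<longleftrightarrow>
     (\<forall>x. (phi has_derivative (\<lambda>h. Dphi x \<bullet> h)) (at x)) \<and>
     (\<forall>x. (Dphi has_derivative (\<lambda>h. D2phi x *v h)) (at x)) \<and>
     continuous_on UNIV D2phi"

definition C21_test :: "(real^'n \<Rightarrow> real \<Rightarrow> real) \<Rightarrow> (real^'n \<Rightarrow> real \<Rightarrow> real)
    \<Rightarrow> (real^'n \<Rightarrow> real \<Rightarrow> real^'n) \<Rightarrow> (real^'n \<Rightarrow> real \<Rightarrow> real^'n^'n) \<Rightarrow> bool" where
  "C21_test phi phit Dphi D2phi \<longleftrightarrow>
     (\<forall>x t. ((\<lambda>z. phi (fst z) (snd z)) has_derivative
              (\<lambda>h. Dphi x t \<bullet> fst h + phit x t * snd h)) (at (x, t))) \<and>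
     (\<forall>x t. ((\<lambda>y. Dphi y t) has_derivative (\<lambda>h. D2phi x t *v h)) (at x)) \<and>
     continuous_on UNIV (\<lambda>z. phit (fst z) (snd z)) \<and>
     continuous_on UNIV (\<lambda>z. Dphi (fst z) (snd z)) \<and>
     continuous_on UNIV (\<lambda>z. D2phi (fst z) (snd z))"

definition diffA :: "('th \<Rightarrow> real^'n \<Rightarrow> real^'n^'n) \<Rightarrow> 'th \<Rightarrow> real^'n \<Rightarrow> real^'n^'n" where
  "diffA \<sigma> \<theta> x = \<sigma> \<theta> x ** transpose (\<sigma> \<theta> x)"

definition Ham :: "('th \<Rightarrow> real^'n \<Rightarrow> real^'n^'n) \<Rightarrow> ('th \<Rightarrow> real^'n \<Rightarrow> real^'n \<Rightarrow> real)
    \<Rightarrow> real^'n \<Rightarrow> real^'n \<Rightarrow> real^'n^'n \<Rightarrow> real" where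
  "Ham \<sigma> H x p X = (SUP \<theta>. - trace (diffA \<sigma> \<theta> x ** X) + H \<theta> x p)"

definition Sigma_set :: "('th \<Rightarrow> real^'n \<Rightarrow> real^'n^'n) \<Rightarrow> (real^'n) set" where
  "Sigma_set \<sigma> = {x. \<forall>\<theta>. diffA \<sigma> \<theta> x = 0}"

text \<open>Sigma_delta^C = {x : dist(x,Sigma) > delta}; dist(x, empty set) = +infinity.\<close>
definition Sigma_compl :: "('th \<Rightarrow> real^'n \<Rightarrow> real^'n^'n) \<Rightarrow> real \<Rightarrow> (real^'n) set" where
  "Sigma_compl \<sigma> \<delta> = {x. Sigma_set \<sigma> = {} \<or> infdist x (Sigma_set \<sigma>) > \<delta>}"

definition visc_sol_E :: "('th \<Rightarrow> real^'n \<Rightarrow> real^'n^'n) \<Rightarrow> ('th \<Rightarrow> real^'n \<Rightarrow> real^'n \<Rightarrow> real)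
    \<Rightarrow> (real^'n \<Rightarrow> real \<Rightarrow> real) \<Rightarrow> bool" where
  "visc_sol_E \<sigma> H u \<longleftrightarrow>
     continuous_on (UNIV \<times> {0<..}) (\<lambda>z. u (fst z) (snd z)) \<and>
     (\<forall>phi phit Dphi D2phi x0 t0. C21_test phi phit Dphi D2phi \<and> t0 > 0 \<and>
        (\<exists>e>0. \<forall>y s. dist y x0 < e \<and> \<bar>s - t0\<bar> < e \<and> s > 0 \<longrightarrow>
            u y s - phi y s \<le> u x0 t0 - phi x0 t0)
        \<longrightarrow> phit x0 t0 + Ham \<sigma> H x0 (Dphi x0 t0) (D2phi x0 t0) \<le> 0) \<and>
     (\<forall>phi phit Dphi D2phi x0 t0. C21_test phi phit Dphi D2phi \<and> t0 > 0 \<and>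
        (\<exists>e>0. \<forall>y s. dist y x0 < e \<and> \<bar>s - t0\<bar> < e \<and> s > 0 \<longrightarrow>
            u y s - phi y s \<ge> u x0 t0 - phi x0 t0)
        \<longrightarrow> phit x0 t0 + Ham \<sigma> H x0 (Dphi x0 t0) (D2phi x0 t0) \<ge> 0)"

text \<open>Viscosity solutions of the stationary equation  lam v + Ham(x,Dv,D^2v) = c  in R^N.
  (E_lambda) is the case c = 0, lam > 0; (S) is the case lam = 0.\<close>
definition visc_sol_stat :: "('th \<Rightarrow> real^'n \<Rightarrow> real^'n^'n) \<Rightarrow> ('th \<Rightarrow> real^'n \<Rightarrow> real^'n \<Rightarrow> real)
    \<Rightarrow> real \<Rightarrow> real \<Rightarrow> (real^'n \<Rightarrow> real) \<Rightarrow> bool" where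
  "visc_sol_stat \<sigma> H lam c v \<longleftrightarrow>
     continuous_on UNIV v \<and>
     (\<forall>phi Dphi D2phi x0. C2_test phi Dphi D2phi \<and>
        (\<exists>e>0. \<forall>y. dist y x0 < e \<longrightarrow> v y - phi y \<le> v x0 - phi x0)
        \<longrightarrow> lam * v x0 + Ham \<sigma> H x0 (Dphi x0) (D2phi x0) \<le> c) \<and>
     (\<forall>phi Dphi D2phi x0. C2_test phi Dphi D2phi \<and>
        (\<exists>e>0. \<forall>y. dist y x0 < e \<longrightarrow> v y - phi y \<ge> v x0 - phi x0)
        \<longrightarrow> lam * v x0 + Ham \<sigma> H x0 (Dphi x0) (D2phi x0) \<ge> c)"

definition standing :: "real \<Rightarrow> ('th \<Rightarrow> real^'n \<Rightarrow> real^'n^'n) \<Rightarrow> ('th \<Rightarrow> real^'n \<Rightarrow> real^'n \<Rightarrow> real) \<Rightarrow> bool" where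
  "standing C \<sigma> H \<longleftrightarrow> C > 0 \<and>
     (\<forall>\<theta>. periodic (\<sigma> \<theta>)) \<and>
     (\<forall>\<theta> x. norm (\<sigma> \<theta> x) \<le> C) \<and>
     (\<forall>\<theta> x y. norm (\<sigma> \<theta> x - \<sigma> \<theta> y) \<le> C * dist x y) \<and>
     (\<forall>\<theta> p. periodic (\<lambda>x. H \<theta> x p)) \<and>
     (\<forall>\<theta> x. \<bar>H \<theta> x 0\<bar> \<le> C) \<and>
     (\<forall>R>0. \<exists>CR>0. \<forall>\<theta> x y p q. norm p \<le> R \<and> norm q \<le> R \<longrightarrow>
          \<bar>H \<theta> x p - H \<theta> y q\<bar> \<le> CR * (dist x y + dist p q))"

end

theory Submission
  imports Defs "HOL-Complex_Analysis.Great_Picard"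
begin

text \<open>After normalising \<open>c = 0\<close>, let \<open>v\<close> be a stationary solution and let \<open>w\<close> range over the (compact)
  \<open>\<omega>\<close>-limit set of the orbit of \<open>u\<close>. It suffices to show that every such \<open>w\<close> is nondecreasing in time: the
  translates of a monotone \<open>w\<close> converge to an element of the \<open>\<omega>\<close>-limit set that is constant in time, and the
  comparison principle makes it attract \<open>u\<close>.

  If \<open>\<Sigma>\<close> is empty, the strong maximum principle gives \<open>w = v + const\<close>. If \<open>\<Sigma>\<close> is nonempty and some \<open>w\<close> is not
  monotone, normalise \<open>v \<le> w - 1\<close> and take the largest \<open>\<mu>\<close> with
  \<open>J = w(x, s) - v(x) + \<eta> s - \<mu> (w(x, 0) - v(x)) \<ge> 0\<close> for all \<open>w\<close>, \<open>x\<close> and \<open>s \<ge> 0\<close>; then \<open>0 < \<mu> < 1\<close> and \<open>J\<close> vanishes somewhere.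
  A zero over \<open>\<Sigma>\<close>, where the equation is of first order, yields \<open>p\<close> and \<open>q\<close> with \<open>\<mu> H(p) \<le> \<eta>\<close>, \<open>H(q) \<le> 0\<close> and
  \<open>sup H(\<mu> p + (1 - \<mu>) q) \<ge> \<eta>\<close>, against strict convexity. So \<open>J\<close> is bounded below near \<open>\<Sigma>\<close>, and
  a zero off \<open>\<Sigma>\<close> contradicts the strong maximum principle in the nondegenerate region.

  Off \<open>\<Sigma>\<close> the doubling of variables avoids Alexandrov's theorem: a combination of two solutions is compared with
  a third one after sup-convolution, a linear change of variables that freezes the diffusion vectors, and
  mollification of the resulting constant-coefficient subsolutions. The constant-coefficient case rests on a random
  walk approximation. On \<open>\<Sigma>\<close> an anchored penalisation suffices.\<close>

section \<open>Test functions and constant coefficients\<close>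

text \<open>The supremum over \<open>\<theta>\<close> is why three functions are handled at once. A
  supersolution only yields an almost optimal \<open>\<theta>\<close>, whereas subsolutions satisfy
  their inequality for every \<open>\<theta>\<close>; so the supersolution selects
  \<open>\<theta>\<close>, both subsolutions are used with it, and convexity in \<open>p\<close>
  merges them. As \<open>\<theta>\<close> comes last, the C^2 function replacing the sum of the two
  subsolutions must serve all frozen coefficients at once, which a convolution does. Freezing costs
  \<open>2 * a\<close> times the squared change of the diffusion vectors; with
  \<open>\<sigma>\<close> Lipschitz and penalties \<open>a * |z - b|^2\<close> tending to zero, this
  vanishes although \<open>a\<close> is large. It needs a linear map between the diffusion vectors
  of different points, hence invertible \<open>\<sigma>\<close>, which fails on
  \<open>\<Sigma>\<close>. In \<open>J\<close> the two times of \<open>w\<close> vary independently.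
  The term \<open>\<eta> * s\<close> makes the minimum over the unbounded range of \<open>s\<close>
  attained, and the gap \<open>v \<le> w - 1\<close> forces \<open>s > 0\<close> at a zero.
  Viscosity inequalities hold at positive times only, so elements of the limit set are first
  extended backwards by one unit of time.\<close>

definition C2fun :: "('e::euclidean_space \<Rightarrow> real) \<Rightarrow> ('e \<Rightarrow> 'e) \<Rightarrow> ('e \<Rightarrow> 'e \<Rightarrow> 'e) \<Rightarrow> bool" where
  "C2fun f g H \<longleftrightarrow>
     (\<forall>z. (f has_derivative (\<lambda>h. g z \<bullet> h)) (at z)) \<and>
     (\<forall>z. (g has_derivative H z) (at z)) \<and>
     (\<forall>h. continuous_on UNIV (\<lambda>z. H z h))"

lemma C2fun_D1: "C2fun f g H \<Longrightarrow> (f has_derivative (\<lambda>h. g z \<bullet> h)) (at z)"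
  and C2fun_D2: "C2fun f g H \<Longrightarrow> (g has_derivative H z) (at z)"
  and C2fun_D3: "C2fun f g H \<Longrightarrow> continuous_on UNIV (\<lambda>z. H z h)"
  by (auto simp: C2fun_def)

lemma C2fun_linear: "C2fun f g H \<Longrightarrow> linear (H z)"
  using C2fun_D2 has_derivative_linear by blast

lemma C2fun_cont: "C2fun f g H \<Longrightarrow> continuous_on S f"
  by (meson C2fun_D1 continuous_on_eq_continuous_at continuous_on_subset has_derivative_continuous
      open_UNIV subset_UNIV)

lemma C2fun_cont1: "C2fun f g H \<Longrightarrow> continuous_on S g"
  by (meson C2fun_D2 continuous_on_eq_continuous_at continuous_on_subset has_derivative_continuous
      open_UNIV subset_UNIV)

lemma C2fun_add:
  assumes "C2fun f g H" "C2fun f1 g1 H1"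
  shows "C2fun (\<lambda>z. f z + f1 z) (\<lambda>z. g z + g1 z) (\<lambda>z h. H z h + H1 z h)"
  unfolding C2fun_def
proof (intro conjI allI)
  fix z h
  show "((\<lambda>z. f z + f1 z) has_derivative (\<lambda>h. (g z + g1 z) \<bullet> h)) (at z)"
    using has_derivative_add[OF C2fun_D1[OF assms(1), of z] C2fun_D1[OF assms(2), of z]]
    by (simp add: inner_add_left)
  show "((\<lambda>z. g z + g1 z) has_derivative (\<lambda>h. H z h + H1 z h)) (at z)"
    using has_derivative_add[OF C2fun_D2[OF assms(1), of z] C2fun_D2[OF assms(2), of z]] .
  show "continuous_on UNIV (\<lambda>z. H z h + H1 z h)"
    by (intro continuous_on_add C2fun_D3[OF assms(1)] C2fun_D3[OF assms(2)])
qed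

lemma C2fun_cmul:
  assumes "C2fun f g H"
  shows "C2fun (\<lambda>z. c * f z) (\<lambda>z. c *\<^sub>R g z) (\<lambda>z h. c *\<^sub>R H z h)"
  unfolding C2fun_def
proof (intro conjI allI)
  fix z h
  show "((\<lambda>z. c * f z) has_derivative (\<lambda>h. (c *\<^sub>R g z) \<bullet> h)) (at z)"
    using has_derivative_mult_right[OF C2fun_D1[OF assms(1), of z], of c] by simp
  show "((\<lambda>z. c *\<^sub>R g z) has_derivative (\<lambda>h. c *\<^sub>R H z h)) (at z)"
    using has_derivative_scaleR_right[OF C2fun_D2[OF assms(1), of z], of c] .
  show "continuous_on UNIV (\<lambda>z. c *\<^sub>R H z h)"
    by (intro continuous_intros C2fun_D3[OF assms(1)])
qed

lemma C2fun_const: "C2fun (\<lambda>z. c) (\<lambda>z. 0) (\<lambda>z h. 0)"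
  by (auto simp: C2fun_def)

lemma C2fun_quad: "C2fun (\<lambda>z. a * (norm (z - c))\<^sup>2) (\<lambda>z. (2 * a) *\<^sub>R (z - c)) (\<lambda>z h. (2 * a) *\<^sub>R h)"
  unfolding C2fun_def power2_norm_eq_inner
  by (auto intro!: derivative_eq_intros simp: inner_commute algebra_simps fun_eq_iff)

text \<open>Chain rule for a linear \<open>M\<close>, so adjoints appear in both derivatives. The
  base points \<open>w\<close> and \<open>v\<close> are separate, since a test function is later
  carried from one point to another.\<close>

lemma C2fun_affine:
  assumes "C2fun f g H" "linear M"
  shows "C2fun (\<lambda>z. f (w + M (z - v))) (\<lambda>z. adjoint M (g (w + M (z - v))))
           (\<lambda>z h. adjoint M (H (w + M (z - v)) (M h)))"
  unfolding C2fun_def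
proof (intro conjI allI)
  fix z h
  have M: "((\<lambda>z. w + M (z - v)) has_derivative M) (at z)" for z
    using assms(2) by (auto intro!: derivative_eq_intros bounded_linear.has_derivative[of M]
        linear_linear[THEN iffD1] simp: linear_conv_bounded_linear)
  have A: "linear (adjoint M)" by (rule adjoint_linear[OF assms(2)])
  show "((\<lambda>z. f (w + M (z - v))) has_derivative (\<lambda>h. adjoint M (g (w + M (z - v))) \<bullet> h)) (at z)"
    using has_derivative_compose[OF M C2fun_D1[OF assms(1)]]
    by (simp add: adjoint_clauses[OF assms(2)])
  show "((\<lambda>z. adjoint M (g (w + M (z - v)))) has_derivative
      (\<lambda>h. adjoint M (H (w + M (z - v)) (M h)))) (at z)"
    using bounded_linear.has_derivative[OF A[unfolded linear_conv_bounded_linear]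
        has_derivative_compose[OF M C2fun_D2[OF assms(1)]]] by simp
  have cM: "continuous_on UNIV (\<lambda>z. w + M (z - v))"
    using M by (meson continuous_on_eq_continuous_at has_derivative_continuous open_UNIV)
  show "continuous_on UNIV (\<lambda>z. adjoint M (H (w + M (z - v)) (M h)))"
    by (intro continuous_on_compose2[OF linear_continuous_on[OF A[unfolded linear_conv_bounded_linear]], of UNIV]
        continuous_on_compose2[OF C2fun_D3[OF assms(1)] cM]) auto
qed

lemma C2fun_compose:
  assumes "C2fun f g H"
    and m: "\<And>t. (m has_real_derivative m' t) (at t)" "\<And>t. (m' has_real_derivative m'' t) (at t)"
      "continuous_on UNIV m''"
  shows "C2fun (\<lambda>z. m (f z)) (\<lambda>z. m' (f z) *\<^sub>R g z)
     (\<lambda>z h. (m'' (f z) * (g z \<bullet> h)) *\<^sub>R g z + m' (f z) *\<^sub>R H z h)"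
  unfolding C2fun_def
proof (intro conjI allI)
  fix z h
  note f = C2fun_D1[OF assms(1)] note g = C2fun_D2[OF assms(1)]
  have 1: "((\<lambda>z. m (f z)) has_derivative (\<lambda>h. m' (f z) * (g z \<bullet> h))) (at z)"
    using has_derivative_compose[OF f m(1)[unfolded has_field_derivative_def]] by simp
  then show "((\<lambda>z. m (f z)) has_derivative (\<lambda>h. (m' (f z) *\<^sub>R g z) \<bullet> h)) (at z)" by simp
  have 2: "((\<lambda>z. m' (f z)) has_derivative (\<lambda>h. m'' (f z) * (g z \<bullet> h))) (at z)"
    using has_derivative_compose[OF f m(2)[unfolded has_field_derivative_def]] by simp
  show "((\<lambda>z. m' (f z) *\<^sub>R g z) has_derivative
      (\<lambda>h. (m'' (f z) * (g z \<bullet> h)) *\<^sub>R g z + m' (f z) *\<^sub>R H z h)) (at z)"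
    using has_derivative_scaleR[OF 2 g] by (simp add: add.commute)
  have "continuous_on UNIV m'"
    using m(2) by (meson DERIV_isCont continuous_at_imp_continuous_on)
  then show "continuous_on UNIV (\<lambda>z. (m'' (f z) * (g z \<bullet> h)) *\<^sub>R g z + m' (f z) *\<^sub>R H z h)"
    by (intro continuous_on_add continuous_on_scaleR continuous_on_mult continuous_on_inner
        continuous_on_const continuous_on_compose2[OF m(3) C2fun_cont[OF assms(1)]]
        continuous_on_compose2[OF _ C2fun_cont[OF assms(1)], of UNIV m']
        C2fun_cont1[OF assms(1)] C2fun_D3[OF assms(1)]) auto
qed

text \<open>Taylor expansion in \<open>r\<close>: the corrected symmetric difference and its first
  derivative vanish at \<open>0\<close>, so only the second-order remainder is left. The comparison
  value \<open>q\<close> is free, so that a modulus of continuity or a plain bound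
  (\<open>q = 0\<close>) can be inserted.\<close>

lemma C2fun_second_difference:
  assumes C: "C2fun f g H" and e: "e > 0"
    and q: "\<And>r. \<bar>r\<bar> \<le> e \<Longrightarrow> \<bar>s \<bullet> H (z + r *\<^sub>R s) s - q\<bar> \<le> \<omega>"
  shows "\<bar>f (z + e *\<^sub>R s) + f (z - e *\<^sub>R s) - 2 * f z - e\<^sup>2 * q\<bar> \<le> e\<^sup>2 * \<omega>"
proof -
  define D where "D n r = (if n = 0 then f (z + r *\<^sub>R s) + f (z + (-r) *\<^sub>R s) - 2 * f z - r\<^sup>2 * q
     else if n = Suc 0 then g (z + r *\<^sub>R s) \<bullet> s - g (z + (-r) *\<^sub>R s) \<bullet> s - 2 * r * q
     else s \<bullet> H (z + r *\<^sub>R s) s + s \<bullet> H (z + (-r) *\<^sub>R s) s - 2 * q)" for n :: nat and r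
  have p: "((\<lambda>r. z + (c * r) *\<^sub>R s) has_derivative (\<lambda>h. (c * h) *\<^sub>R s)) (at r)" for c r
    by (auto intro!: derivative_eq_intros)
  have d0: "((\<lambda>r. f (z + (c * r) *\<^sub>R s)) has_real_derivative c * (g (z + (c * r) *\<^sub>R s) \<bullet> s)) (at r)" for c r
    using has_derivative_compose[OF p[of c r] C2fun_D1[OF C]]
    unfolding has_field_derivative_def by (rule has_derivative_eq_rhs) (auto simp: fun_eq_iff)
  have d1: "((\<lambda>r. g (z + (c * r) *\<^sub>R s) \<bullet> s) has_real_derivative c * (s \<bullet> H (z + (c * r) *\<^sub>R s) s)) (at r)" for c r
    using has_derivative_inner_left[OF has_derivative_compose[OF p[of c r] C2fun_D2[OF C]], of s]
    unfolding has_field_derivative_def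
    by (rule has_derivative_eq_rhs)
      (auto simp: fun_eq_iff linear_cmul[OF C2fun_linear[OF C]] inner_commute)
  note d0' = d0[of 1, simplified] d0[of "-1", simplified]
  note d1' = d1[of 1, simplified] d1[of "-1", simplified]
  have "\<forall>m t. m < 2 \<and> 0 \<le> t \<and> t \<le> e \<longrightarrow> DERIV (D m) t :> D (Suc m) t"
  proof (intro allI impI)
    fix m :: nat and t :: real assume "m < 2 \<and> 0 \<le> t \<and> t \<le> e"
    then consider "m = 0" | "m = Suc 0" by linarith
    then show "DERIV (D m) t :> D (Suc m) t"
    proof cases
      case 1
      show ?thesis unfolding 1 D_def
        by (auto intro!: derivative_eq_intros d0' d1' simp: algebra_simps)
    next
      case 2
      show ?thesis unfolding 2 D_def
        by (auto intro!: derivative_eq_intros d0' d1' simp: algebra_simps)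
    qed
  qed
  from Maclaurin[of e 2 D "D 0", OF e _ refl this] obtain t where t: "0 < t" "t < e"
    and eq: "D 0 e = (\<Sum>m<2. D m 0 / fact m * e ^ m) + D 2 t / fact 2 * e ^ 2" by auto
  have "D 0 0 = 0" "D (Suc 0) 0 = 0" by (auto simp: D_def)
  then have "(\<Sum>m<2. D m 0 / fact m * e ^ m) = 0" by (simp add: numeral_2_eq_2)
  then have eq2: "D 0 e = D 2 t / 2 * e\<^sup>2" using eq by simp
  have "\<bar>D 2 t\<bar> \<le> 2 * \<omega>"
    using q[of t] q[of "-t"] t by (simp add: D_def)
  then have "\<bar>D 2 t / 2\<bar> * e\<^sup>2 \<le> \<omega> * e\<^sup>2" by (intro mult_right_mono) auto
  then have "\<bar>D 0 e\<bar> \<le> \<omega> * e\<^sup>2" unfolding eq2 by (simp add: abs_mult)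
  then show ?thesis by (simp add: D_def mult.commute)
qed

lemma C2fun_local_min:
  assumes C: "C2fun f g H" and e: "e > 0" and min: "\<And>y. dist y z < e \<Longrightarrow> f z \<le> f y"
  shows "s \<bullet> H z s \<ge> 0"
proof (rule field_le_epsilon)
  fix \<omega> :: real assume \<omega>: "\<omega> > 0"
  have "continuous (at 0) (\<lambda>r. s \<bullet> H (z + r *\<^sub>R s) s)"
  proof -
    have "continuous_on UNIV (\<lambda>r. s \<bullet> H (z + r *\<^sub>R s) s)"
      by (intro continuous_intros continuous_on_compose2[OF C2fun_D3[OF C]]) auto
    then show ?thesis by (simp add: continuous_on_eq_continuous_at)
  qed
  from this[unfolded continuous_at_eps_delta, rule_format, OF \<omega>] obtain d where d: "d > 0"
    "\<And>r. \<bar>r\<bar> < d \<Longrightarrow> \<bar>s \<bullet> H (z + r *\<^sub>R s) s - s \<bullet> H z s\<bar> < \<omega>"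
    by (auto simp: dist_real_def)
  define r where "r = min (d/2) (e / (2 * (norm s + 1)))"
  have r: "r > 0" using d e by (auto simp: r_def add_nonneg_pos)
  have "r \<le> d / 2" unfolding r_def by (rule min.cobounded1)
  then have r': "r < d" using d by simp
  have "r * norm s < e"
  proof -
    have "r * norm s \<le> e / (2 * (norm s + 1)) * (norm s + 1)"
      using r by (intro mult_mono) (auto simp: r_def)
    also have "\<dots> = e / 2" using norm_ge_zero[of s] by (simp add: divide_simps add_nonneg_eq_0_iff)
    finally show ?thesis using e by simp
  qed
  then have "f z \<le> f (z + r *\<^sub>R s)" "f z \<le> f (z - r *\<^sub>R s)"
    using r by (auto intro!: min simp: dist_norm)
  moreover have "\<bar>f (z + r *\<^sub>R s) + f (z - r *\<^sub>R s) - 2 * f z - r\<^sup>2 * (s \<bullet> H z s)\<bar> \<le> r\<^sup>2 * \<omega>"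
    by (rule C2fun_second_difference[OF C r]) (use d r' in \<open>force intro: less_imp_le\<close>)
  ultimately have "r\<^sup>2 * (s \<bullet> H z s + \<omega>) \<ge> 0" by (simp add: algebra_simps)
  then show "0 \<le> s \<bullet> H z s + \<omega>" using r by (simp add: zero_le_mult_iff)
qed

section \<open>Mollification with a compactly supported C^2 kernel\<close>

lemma max0_power_deriv:
  assumes "n \<ge> 2"
  shows "((\<lambda>t::real. max 0 t ^ n) has_real_derivative real n * max 0 t ^ (n - 1)) (at t)"
proof -
  consider "t < 0" | "t > 0" | "t = 0" by linarith
  then show ?thesis
  proof cases
    case 1
    have "((\<lambda>t::real. 0) has_real_derivative 0) (at t)" by simp
    then have "((\<lambda>t::real. max 0 t ^ n) has_real_derivative 0) (at t)"
      by (rule has_field_derivative_transform_within_open[of _ _ _ "{..<0}"])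
        (use 1 assms in \<open>auto simp: max_def\<close>)
    then show ?thesis using 1 assms by (simp add: max_absorb1 power_0_left)
  next
    case 2
    have "((\<lambda>t::real. t ^ n) has_real_derivative real n * t ^ (n - 1)) (at t)"
      by (auto intro!: derivative_eq_intros)
    then have "((\<lambda>t::real. max 0 t ^ n) has_real_derivative real n * t ^ (n - 1)) (at t)"
      by (rule has_field_derivative_transform_within_open[of _ _ _ "{0<..}"])
        (use 2 assms in \<open>auto simp: max_def\<close>)
    then show ?thesis using 2 by (simp add: max_def)
  next
    case 3
    have "((\<lambda>h::real. max 0 h ^ n / h) \<longlongrightarrow> 0) (at 0)"
    proof (rule Lim_null_comparison)
      have "\<bar>max 0 h ^ n / h\<bar> \<le> \<bar>h\<bar> ^ (n - 1)" if "h \<noteq> 0" for h :: real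
      proof -
        have "\<bar>max 0 h ^ n\<bar> \<le> \<bar>h\<bar> ^ n" unfolding power_abs by (intro power_mono) auto
        also have "\<dots> = \<bar>h\<bar> ^ (n - 1) * \<bar>h\<bar>" using assms
          by (metis One_nat_def Suc_diff_1 less_le_trans pos2 power_Suc2)
        finally show ?thesis using that by (simp add: field_simps)
      qed
      then show "\<forall>\<^sub>F h in at 0. norm (max 0 h ^ n / h :: real) \<le> \<bar>h\<bar> ^ (n - 1)"
        by (auto simp: eventually_at intro!: exI[of _ 1])
      have "((\<lambda>h::real. \<bar>h\<bar> ^ (n - 1)) \<longlongrightarrow> \<bar>0\<bar> ^ (n - 1)) (at 0)" by (intro tendsto_intros)
      moreover have "\<bar>0::real\<bar> ^ (n - 1) = 0" using assms by (simp add: power_0_left)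
      ultimately show "((\<lambda>h::real. \<bar>h\<bar> ^ (n - 1)) \<longlongrightarrow> 0) (at 0)" by (simp only:)
    qed
    then show ?thesis using assms unfolding 3 has_field_derivative_iff by (simp add: power_0_left)
  qed
qed

definition is_bump :: "real \<Rightarrow> ('e::euclidean_space \<Rightarrow> real) \<Rightarrow> ('e \<Rightarrow> 'e) \<Rightarrow> ('e \<Rightarrow> 'e \<Rightarrow> 'e) \<Rightarrow> bool" where
  "is_bump d \<rho> \<rho>' \<rho>'' \<longleftrightarrow> C2fun \<rho> \<rho>' \<rho>'' \<and> (\<forall>y. \<rho> y \<ge> 0) \<and>
    (\<forall>y. norm y \<ge> d \<longrightarrow> \<rho> y = 0 \<and> \<rho>' y = 0 \<and> (\<forall>h. \<rho>'' y h = 0)) \<and>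
    integral (cbox (-(d *\<^sub>R One)) (d *\<^sub>R One)) \<rho> = 1"

lemma is_bumpD:
  assumes "is_bump d \<rho> \<rho>' \<rho>''"
  shows "C2fun \<rho> \<rho>' \<rho>''" "\<And>y. \<rho> y \<ge> 0" "\<And>y. norm y \<ge> d \<Longrightarrow> \<rho> y = 0" "\<And>y. norm y \<ge> d \<Longrightarrow> \<rho>' y = 0"
    "\<And>y h. norm y \<ge> d \<Longrightarrow> \<rho>'' y h = 0" "integral (cbox (-(d *\<^sub>R One)) (d *\<^sub>R One)) \<rho> = 1"
  using assms by (auto simp: is_bump_def)

text \<open>The cube of the positive part of \<open>d^2 - |y|^2\<close> is of class C^2 across the
  boundary of the ball, which is exactly the regularity that \<open>C2fun\<close> asks for. It is
  normalised by its integral over the enclosing cube.\<close>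

lemma bump_exists:
  fixes d :: real
  assumes d: "d > 0"
  shows "\<exists>\<rho> \<rho>' \<rho>''. is_bump d (\<rho> :: 'e::euclidean_space \<Rightarrow> real) \<rho>' \<rho>''"
proof -
  define f :: "'e \<Rightarrow> real" where "f = (\<lambda>y. d\<^sup>2 + (-1) * (norm (y - 0))\<^sup>2)"
  have f: "C2fun f (\<lambda>z. 0 + (2 * (-1)) *\<^sub>R (z - 0)) (\<lambda>z h. 0 + (2 * (-1)) *\<^sub>R h)"
    unfolding f_def by (rule C2fun_add[OF C2fun_const C2fun_quad])
  define m m' m'' where "m = (\<lambda>t::real. max 0 t ^ 3)" and "m' = (\<lambda>t::real. 3 * max 0 t ^ 2)"
    and "m'' = (\<lambda>t::real. 6 * max 0 t)"
  have m: "\<And>t. (m has_real_derivative m' t) (at t)" "\<And>t. (m' has_real_derivative m'' t) (at t)"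
    "continuous_on UNIV m''"
    unfolding m_def m'_def m''_def using max0_power_deriv[of 3] DERIV_cmult[OF max0_power_deriv[of 2], of 3]
    by (auto intro!: continuous_intros)
  note C = C2fun_compose[OF f m]
  let ?B = "cbox (-(d *\<^sub>R One)) (d *\<^sub>R One) :: 'e set"
  define I where "I = integral ?B (\<lambda>z. m (f z))"
  have neg: "f y \<le> 0" if "norm y \<ge> d" for y using that d by (simp add: f_def)
  have cont: "continuous_on ?B (\<lambda>z. m (f z))" by (rule C2fun_cont[OF C])
  have "I \<ge> 0" unfolding I_def
    by (rule integral_nonneg[OF integrable_continuous[OF cont]]) (simp add: m_def)
  \<comment> \<open>A continuous nonnegative function with integral zero vanishes everywhere, but
    \<open>m (f 0) = d ^ 6\<close>.\<close>
  moreover have "I \<noteq> 0"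
  proof
    assume "I = 0"
    moreover have "Henstock_Kurzweil_Integration.content ?B > 0" using d by (intro content_pos_lt) (simp add: inner_add_left)
    ultimately have "m (f 0) = 0"
      using has_integral_0_cbox_imp_0[OF cont, of 0] d
        integrable_integral[OF integrable_continuous[OF cont]]
      by (auto simp: I_def m_def box_ne_empty mem_box inner_add_left)
    then show False using d by (simp add: m_def f_def)
  qed
  ultimately have I: "I > 0" by simp
  have "integral ?B (\<lambda>z. 1 / I * m (f z)) = 1"
    using I by (simp only: integral_mult_right) (simp add: I_def)
  then show ?thesis using C2fun_cmul[OF C, of "1/I"] I unfolding is_bump_def
    by (intro exI conjI allI impI) (assumption | auto simp: m_def m'_def m''_def dest!: neg)+
qed

text \<open>Correlation rather than convolution: \<open>f\<close> is evaluated at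
  \<open>z + y\<close>. The kernel may be vector valued, so that gradient and Hessian of a
  mollification are again of the form \<open>cv\<close>.\<close>

definition cv :: "real \<Rightarrow> ('e::euclidean_space \<Rightarrow> 'c::euclidean_space) \<Rightarrow> ('e \<Rightarrow> real) \<Rightarrow> 'e \<Rightarrow> 'c" where
  "cv d K f z = integral (cbox (-(d *\<^sub>R One)) (d *\<^sub>R One)) (\<lambda>y. f (z + y) *\<^sub>R K y)"

lemma cv_integrable:
  fixes f :: "'e::euclidean_space \<Rightarrow> real" and K :: "'e \<Rightarrow> 'c::euclidean_space"
  assumes "continuous_on UNIV f" "continuous_on UNIV K"
  shows "(\<lambda>y. f (z + y) *\<^sub>R K y) integrable_on cbox a b"
  by (intro integrable_continuous continuous_intros continuous_on_compose2[OF assms(1)]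
      continuous_on_subset[OF assms(2)]) auto

text \<open>The substitution moves \<open>z\<close> from \<open>f\<close> to the kernel and makes
  the domain of integration independent of \<open>z\<close> near \<open>z0\<close>. Differentiation
  in \<open>z\<close> then concerns the kernel alone, and continuity of \<open>f\<close> is
  enough.\<close>

lemma cv_local:
  assumes f: "continuous_on UNIV f" and K: "continuous_on UNIV K" and d: "d > 0"
    and K0: "\<And>y. norm y \<ge> d \<Longrightarrow> K y = 0" and z: "z \<in> ball z0 1"
  shows "cv d K f z = integral (cbox (z0 - (1 + d) *\<^sub>R One) (z0 + (1 + d) *\<^sub>R One)) (\<lambda>y. f y *\<^sub>R K (y - z))"
proof -
  have "((\<lambda>y. f (z + y) *\<^sub>R K y) has_integral cv d K f z) (cbox (-(d *\<^sub>R One)) (d *\<^sub>R One))"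
    unfolding cv_def by (rule integrable_integral[OF cv_integrable[OF f K]])
  from has_integral_shift_cbox[OF this, of "-z"]
  have 1: "((\<lambda>y. f y *\<^sub>R K (y - z)) has_integral cv d K f z) (cbox (z - d *\<^sub>R One) (z + d *\<^sub>R One))"
    by (simp add: algebra_simps)
  have "((\<lambda>y. f y *\<^sub>R K (y - z)) has_integral cv d K f z) (cbox (z0 - (1 + d) *\<^sub>R One) (z0 + (1 + d) *\<^sub>R One))"
  proof (rule has_integral_on_superset[OF 1])
    fix y assume y: "y \<notin> cbox (z - d *\<^sub>R One) (z + d *\<^sub>R One)"
    have "norm (y - z) \<ge> d"
    proof (rule ccontr)
      assume a: "\<not> norm (y - z) \<ge> d"
      have "\<bar>(y - z) \<bullet> i\<bar> \<le> d" if "i \<in> Basis" for i using Basis_le_norm[OF that, of "y - z"] a by simp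
      then show False using y by (force simp: mem_box inner_diff_left inner_add_left abs_le_iff)
    qed
    then show "f y *\<^sub>R K (y - z) = 0" using K0 by simp
  next
    have b: "\<bar>(z0 - z) \<bullet> i\<bar> \<le> 1" if "i \<in> Basis" for i
      using Basis_le_norm[OF that, of "z0 - z"] z by (simp add: dist_norm)
    have "z0 \<bullet> i - (1 + d) \<le> z \<bullet> i - d" "z \<bullet> i + d \<le> z0 \<bullet> i + (1 + d)" if "i \<in> Basis" for i
      using b[OF that] by (auto simp: inner_diff_left abs_le_iff)
    then show "cbox (z - d *\<^sub>R One) (z + d *\<^sub>R One) \<subseteq> cbox (z0 - (1 + d) *\<^sub>R One) (z0 + (1 + d) *\<^sub>R One)"
      by (auto simp: subset_box inner_diff_left inner_add_left)
  qed
  then show ?thesis by (simp add: integral_unique)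
qed

lemma cv_has_derivative:
  assumes f: "continuous_on UNIV f" and d: "d > 0"
    and K: "\<And>y. (K has_derivative K' y) (at y)" and K': "\<And>h. continuous_on UNIV (\<lambda>y. K' y h)"
    and K0: "\<And>y. norm y \<ge> d \<Longrightarrow> K y = 0" and K'0: "\<And>y h. norm y \<ge> d \<Longrightarrow> K' y h = 0"
  shows "(cv d K f has_derivative (\<lambda>h. - cv d (\<lambda>y. K' y h) f z0)) (at z0)"
proof -
  have cK: "continuous_on UNIV K"
    by (meson K continuous_at_imp_continuous_on has_derivative_continuous)
  define a b where "a = z0 - (1 + d) *\<^sub>R (One::'a)" and "b = z0 + (1 + d) *\<^sub>R (One::'a)"
  define fx where "fx x t = Blinfun (\<lambda>h. - (f t *\<^sub>R K' (t - x) h))" for x t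
  have bl: "bounded_linear (\<lambda>h. - (f t *\<^sub>R K' y h))" for t y
    by (intro bounded_linear_minus bounded_linear_const_scaleR has_derivative_bounded_linear[OF K])
  have fx: "blinfun_apply (fx x t) = (\<lambda>h. - (f t *\<^sub>R K' (t - x) h))" for x t
    unfolding fx_def by (rule bounded_linear_Blinfun_apply[OF bl])
  have D: "((\<lambda>x. integral (cbox a b) (\<lambda>t. f t *\<^sub>R K (t - x))) has_derivative
     blinfun_apply (integral (cbox a b) (fx z0))) (at z0 within ball z0 1)"
  proof (rule leibniz_rule)
    fix x t
    have "((\<lambda>x. t - x) has_derivative (\<lambda>h. - h)) (at x within ball z0 1)"
      by (auto intro!: derivative_eq_intros)
    from has_derivative_compose[OF this K] have "((\<lambda>x. K (t - x)) has_derivative (\<lambda>h. K' (t - x) (- h))) (at x within ball z0 1)" .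
    moreover have "K' (t - x) (- h) = - K' (t - x) h" for h
      using linear_neg[OF has_derivative_linear[OF K]] by simp
    ultimately show "((\<lambda>x. f t *\<^sub>R K (t - x)) has_derivative blinfun_apply (fx x t)) (at x within ball z0 1)"
      unfolding fx using has_derivative_scaleR_right[of "\<lambda>x. K (t - x)" _ _ "f t"] by fastforce
  next
    fix x show "(\<lambda>t. f t *\<^sub>R K (t - x)) integrable_on cbox a b"
      by (intro integrable_continuous continuous_intros continuous_on_compose2[OF cK]
          continuous_on_subset[OF f]) auto
  next
    show "continuous_on (ball z0 1 \<times> cbox a b) (\<lambda>(x, t). fx x t)"
    proof (rule continuous_on_blinfun_componentwise)
      fix i :: 'a assume "i \<in> Basis"
      have "continuous_on (ball z0 1 \<times> cbox a b) (\<lambda>z. - (f (snd z) *\<^sub>R K' (snd z - fst z) i))"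
        by (intro continuous_intros continuous_on_compose2[OF f] continuous_on_compose2[OF K']) auto
      then show "continuous_on (ball z0 1 \<times> cbox a b) (\<lambda>x. blinfun_apply (case x of (x, t) \<Rightarrow> fx x t) i)"
        by (simp add: case_prod_beta fx)
    qed
  qed auto
  have cfx: "continuous_on (cbox a b) (fx z0)"
  proof (rule continuous_on_blinfun_componentwise)
    fix i :: 'a assume "i \<in> Basis"
    show "continuous_on (cbox a b) (\<lambda>x. blinfun_apply (fx z0 x) i)" unfolding fx
      by (intro continuous_intros continuous_on_subset[OF f] continuous_on_compose2[OF K']) auto
  qed
  have ev: "blinfun_apply (integral (cbox a b) (fx z0)) h = - cv d (\<lambda>y. K' y h) f z0" for h
  proof -
    have "blinfun_apply (integral (cbox a b) (fx z0)) h = integral (cbox a b) (\<lambda>t. blinfun_apply (fx z0 t) h)"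
      using integral_linear[OF integrable_continuous[OF cfx] blinfun.bounded_linear_left[of h]]
      by (simp add: o_def)
    also have "\<dots> = - integral (cbox a b) (\<lambda>t. f t *\<^sub>R K' (t - z0) h)" unfolding fx by simp
    also have "\<dots> = - cv d (\<lambda>y. K' y h) f z0" unfolding a_def b_def
      by (subst cv_local[OF f K' d, of _ z0 z0]) (auto simp: K'0)
    finally show ?thesis .
  qed
  have "(cv d K f has_derivative blinfun_apply (integral (cbox a b) (fx z0))) (at z0 within ball z0 1)"
    by (rule has_derivative_transform[OF _ _ D])
      (auto simp: a_def b_def intro!: cv_local[OF f cK d K0, of _ z0])
  then show ?thesis unfolding ev[abs_def, symmetric]
    by (simp add: at_within_open[of z0 "ball z0 1"])
qed

lemma cv_cont:
  assumes "continuous_on UNIV f" "continuous_on UNIV K"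
  shows "continuous_on UNIV (cv d K f)"
  unfolding cv_def
  by (rule integral_continuous_on_param)
    (auto simp: case_prod_beta intro!: continuous_intros continuous_on_compose2[OF assms(1)]
      continuous_on_compose2[OF assms(2)])

text \<open>Each derivative falls on the kernel at \<open>y - z\<close> and produces a minus sign;
  the two signs cancel in the Hessian.\<close>

lemma cv_C2fun:
  fixes \<rho> :: "'e::euclidean_space \<Rightarrow> real"
  assumes f: "continuous_on UNIV f" and d: "d > 0" and C: "C2fun \<rho> \<rho>' \<rho>''"
    and "\<And>y. norm y \<ge> d \<Longrightarrow> \<rho> y = 0" "\<And>y. norm y \<ge> d \<Longrightarrow> \<rho>' y = 0"
      "\<And>y h. norm y \<ge> d \<Longrightarrow> \<rho>'' y h = 0"
  shows "C2fun (cv d \<rho> f) (\<lambda>z. - cv d \<rho>' f z) (\<lambda>z h. cv d (\<lambda>y. \<rho>'' y h) f z)"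
  unfolding C2fun_def
proof (intro conjI allI)
  fix z h
  have "(cv d \<rho> f has_derivative (\<lambda>h. - cv d (\<lambda>y. \<rho>' y \<bullet> h) f z)) (at z)"
    by (rule cv_has_derivative[OF f d]) (use assms in \<open>auto intro!: C2fun_D1[OF C] continuous_intros C2fun_cont1[OF C]\<close>)
  moreover have "cv d (\<lambda>y. \<rho>' y \<bullet> h) f z = cv d \<rho>' f z \<bullet> h" for h
    unfolding cv_def
    using integral_linear[OF cv_integrable[OF f C2fun_cont1[OF C], of z] bounded_linear_inner_left[of h]]
    by (simp add: o_def)
  ultimately show "(cv d \<rho> f has_derivative (\<lambda>h. - cv d \<rho>' f z \<bullet> h)) (at z)" by simp
  have "(cv d \<rho>' f has_derivative (\<lambda>h. - cv d (\<lambda>y. \<rho>'' y h) f z)) (at z)"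
    by (rule cv_has_derivative[OF f d C2fun_D2[OF C] C2fun_D3[OF C]]) (use assms in auto)
  from has_derivative_minus[OF this]
  show "((\<lambda>z. - cv d \<rho>' f z) has_derivative (\<lambda>h. cv d (\<lambda>y. \<rho>'' y h) f z)) (at z)" by simp
  show "continuous_on UNIV (\<lambda>z. cv d (\<lambda>y. \<rho>'' y h) f z)"
    by (rule cv_cont[OF f C2fun_D3[OF C]])
qed


lemma cv_mono:
  fixes \<rho> :: "'e::euclidean_space \<Rightarrow> real"
  assumes "continuous_on UNIV f" "continuous_on UNIV g" "continuous_on UNIV \<rho>"
    and "\<And>y. \<rho> y \<ge> 0" and one: "integral (cbox (-(d *\<^sub>R One)) (d *\<^sub>R One)) \<rho> = 1"
    and le: "\<And>y. norm y < d \<Longrightarrow> f (z + y) \<le> g (z' + y) + c" and 0: "\<And>y. norm y \<ge> d \<Longrightarrow> \<rho> y = 0"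
  shows "cv d \<rho> f z \<le> cv d \<rho> g z' + c"
proof -
  let ?B = "cbox (-(d *\<^sub>R One)) (d *\<^sub>R One) :: 'e set"
  have ig: "(\<lambda>y. g (z' + y) *\<^sub>R \<rho> y) integrable_on ?B" and ic: "(\<lambda>y. c * \<rho> y) integrable_on ?B"
    and i: "(\<lambda>y. f (z + y) *\<^sub>R \<rho> y) integrable_on ?B"
    using cv_integrable[OF assms(2,3)] cv_integrable[OF assms(1,3)]
      integrable_continuous[OF continuous_on_mult_left[OF continuous_on_subset[OF assms(3)]], of _ _ c] by auto
  have "cv d \<rho> f z \<le> integral ?B (\<lambda>y. g (z' + y) *\<^sub>R \<rho> y + c * \<rho> y)"
    unfolding cv_def
  proof (rule integral_le[OF i integrable_add[OF ig ic]])
    fix y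
    show "f (z + y) *\<^sub>R \<rho> y \<le> g (z' + y) *\<^sub>R \<rho> y + c * \<rho> y"
    proof (cases "norm y < d")
      case True
      then show ?thesis using mult_right_mono[OF le[OF True] assms(4)[of y]] by (simp add: algebra_simps)
    qed (use 0 in auto)
  qed
  also have "\<dots> = cv d \<rho> g z' + c * integral ?B \<rho>"
    unfolding cv_def by (subst integral_add[OF ig ic]) simp
  finally show ?thesis using one by simp
qed

section \<open>Random walk averages and global subsolutions with constant coefficients\<close>

definition avg :: "('j::finite \<Rightarrow> 'e::real_vector) \<Rightarrow> real \<Rightarrow> ('e \<Rightarrow> 'c::real_vector) \<Rightarrow> 'e \<Rightarrow> 'c" where
  "avg s e f z = (1 / (2 * real CARD('j))) *\<^sub>R (\<Sum>j\<in>UNIV. f (z + e *\<^sub>R s j) + f (z - e *\<^sub>R s j))"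

lemma avg_const: "avg s e (\<lambda>z. c) z = c"
  by (simp add: avg_def scaleR_2[symmetric] scaleR_sum_left[symmetric] del: sum_constant)
     (simp add: sum_constant_scaleR)

lemma avg_add: "avg s e (\<lambda>z. f z + g z) z = avg s e f z + avg s e g z"
  by (simp add: avg_def scaleR_add_right[symmetric] sum.distrib[symmetric] algebra_simps)

lemma avg_scaleR: "avg s e (\<lambda>z. c *\<^sub>R f z) z = c *\<^sub>R avg s e f z"
  by (simp add: avg_def scaleR_add_right[symmetric] scaleR_sum_right[symmetric] mult.commute)

lemma avg_le:
  fixes f g :: "_ \<Rightarrow> real"
  assumes "\<And>z. f z \<le> g z + c"
  shows "avg s e f z \<le> avg s e g z + c"
proof -
  have "avg s e f z \<le> avg s e (\<lambda>z. g z + c) z"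
    unfolding avg_def real_scaleR_def by (intro mult_left_mono sum_mono add_mono assms) auto
  also have "\<dots> = avg s e g z + c" by (subst avg_add) (simp add: avg_const)
  finally show ?thesis .
qed

lemma avg_pow_le:
  fixes f g :: "_ \<Rightarrow> real"
  assumes "\<And>z. f z \<le> g z + c"
  shows "(avg s e ^^ m) f z \<le> (avg s e ^^ m) g z + c"
  using assms by (induction m arbitrary: z) (auto intro: avg_le)

lemma avg_pow_add:
  fixes f g :: "_ \<Rightarrow> real"
  shows "(avg s e ^^ m) (\<lambda>z. f z + c * g z) = (\<lambda>z. (avg s e ^^ m) f z + c * (avg s e ^^ m) g z)"
proof (induction m)
  case (Suc m)
  have "avg s e (\<lambda>z. (avg s e ^^ m) f z + c *\<^sub>R (avg s e ^^ m) g z) z =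
    avg s e ((avg s e ^^ m) f) z + c *\<^sub>R avg s e ((avg s e ^^ m) g) z" for z
    by (subst avg_add, subst avg_scaleR) simp
  then show ?case by (simp add: Suc fun_eq_iff)
qed auto

lemma C2fun_shift:
  assumes "C2fun f g H"
  shows "C2fun (\<lambda>z. f (z + c)) (\<lambda>z. g (z + c)) (\<lambda>z. H (z + c))"
  unfolding C2fun_def
proof (intro conjI allI)
  have p: "((\<lambda>z. z + c) has_derivative (\<lambda>h. h)) (at z)" for z by (auto intro!: derivative_eq_intros)
  fix z h
  show "((\<lambda>z. f (z + c)) has_derivative (\<lambda>h. g (z + c) \<bullet> h)) (at z)"
    by (rule has_derivative_compose[OF p C2fun_D1[OF assms]])
  show "((\<lambda>z. g (z + c)) has_derivative H (z + c)) (at z)"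
    by (rule has_derivative_compose[OF p C2fun_D2[OF assms]])
  show "continuous_on UNIV (\<lambda>z. H (z + c) h)"
    by (intro continuous_on_compose2[OF C2fun_D3[OF assms]] continuous_intros) auto
qed

lemma C2fun_sum:
  assumes "finite A" "\<And>i. i \<in> A \<Longrightarrow> C2fun (f i) (g i) (H i)"
  shows "C2fun (\<lambda>z. \<Sum>i\<in>A. f i z) (\<lambda>z. \<Sum>i\<in>A. g i z) (\<lambda>z h. \<Sum>i\<in>A. H i z h)"
  using assms by (induction A rule: finite_induct) (auto intro: C2fun_const C2fun_add)

lemma C2fun_avg:
  assumes "C2fun f g H"
  shows "C2fun (avg s e f) (avg s e g) (\<lambda>z h. avg s e (\<lambda>z. H z h) z)"
proof -
  have "C2fun (\<lambda>z. f (z + e *\<^sub>R s j) + f (z - e *\<^sub>R s j)) (\<lambda>z. g (z + e *\<^sub>R s j) + g (z - e *\<^sub>R s j))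
      (\<lambda>z h. H (z + e *\<^sub>R s j) h + H (z - e *\<^sub>R s j) h)" for j
    using C2fun_add[OF C2fun_shift[OF assms, of "e *\<^sub>R s j"] C2fun_shift[OF assms, of "- (e *\<^sub>R s j)"]]
    by simp
  from C2fun_cmul[OF C2fun_sum[OF finite this]]
  show ?thesis unfolding avg_def real_scaleR_def .
qed

definition tr2 :: "('j::finite \<Rightarrow> 'e::euclidean_space) \<Rightarrow> ('e \<Rightarrow> 'e \<Rightarrow> 'e) \<Rightarrow> 'e \<Rightarrow> real" where
  "tr2 s H z = (\<Sum>j\<in>UNIV. s j \<bullet> H z (s j))"

lemma avg_inner: "s j \<bullet> avg s e (\<lambda>z. H z (s j)) z = avg s e (\<lambda>z. s j \<bullet> H z (s j)) z"
  by (simp add: avg_def inner_sum_right inner_add_right)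

text \<open>The vectors \<open>s\<close> do not depend on the point, so the second-order operator
  commutes with averaging over translates.\<close>

lemma tr2_avg: "tr2 s (\<lambda>z h. avg s e (\<lambda>z. H z h) z) z = avg s e (tr2 s H) z"
  unfolding tr2_def avg_inner
  by (simp add: avg_def sum_distrib_left[symmetric] sum_divide_distrib[symmetric] sum.distrib)
     (subst sum.swap, subst (2) sum.swap, simp)


lemma C2fun_avg_pow:
  assumes "C2fun f g H"
  shows "\<exists>g' H'. C2fun ((avg s e ^^ m) f) g' H' \<and> (\<forall>h. (\<lambda>z. H' z h) = (avg s e ^^ m) (\<lambda>z. H z h))"
proof (induction m)
  case 0 then show ?case using assms by auto
next
  case (Suc m)
  then obtain g' H' where 1: "C2fun ((avg s e ^^ m) f) g' H'"
    and 2: "\<And>h. (\<lambda>z. H' z h) = (avg s e ^^ m) (\<lambda>z. H z h)" by blast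
  from C2fun_avg[OF 1, of s e] show ?case by (auto simp: 2)
qed

lemma compact_support_uniform:
  fixes f :: "'a::euclidean_space \<Rightarrow> real"
  assumes f: "continuous_on UNIV f" and 0: "\<And>z. norm z \<ge> R \<Longrightarrow> f z = 0" and e: "e > 0"
  obtains d where "d > 0" "\<And>y z. dist y z \<le> d \<Longrightarrow> \<bar>f y - f z\<bar> \<le> e"
proof -
  have "uniformly_continuous_on (cball 0 (\<bar>R\<bar> + 1)) f"
    by (rule compact_uniformly_continuous[OF continuous_on_subset[OF f]]) auto
  then obtain d where d: "d > 0" "\<And>y z. y \<in> cball 0 (\<bar>R\<bar> + 1) \<Longrightarrow> z \<in> cball 0 (\<bar>R\<bar> + 1) \<Longrightarrow> dist y z < d \<Longrightarrow> dist (f y) (f z) < e"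
    unfolding uniformly_continuous_on_def using e by meson
  show ?thesis
  proof (rule that[of "min (d/2) 1"])
    fix y z :: 'a assume a: "dist y z \<le> min (d/2) 1"
    have n: "\<bar>norm y - norm z\<bar> \<le> 1" using a norm_triangle_ineq3[of y z] by (simp add: dist_norm)
    show "\<bar>f y - f z\<bar> \<le> e"
    proof (cases "norm y \<le> \<bar>R\<bar> + 1 \<and> norm z \<le> \<bar>R\<bar> + 1")
      case True
      then show ?thesis using d(2)[of y z] a d(1) by (force simp: dist_real_def)
    next
      case False
      then have "norm y \<ge> R" "norm z \<ge> R" using n by linarith+
      then show ?thesis using 0 e by simp
    qed
  qed (use d in auto)
qed

lemma compact_support_bounded:
  fixes f :: "'a::euclidean_space \<Rightarrow> real"
  assumes f: "continuous_on UNIV f" and 0: "\<And>z. norm z \<ge> R \<Longrightarrow> f z = 0"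
  obtains B where "B \<ge> 0" "\<And>z. \<bar>f z\<bar> \<le> B"
proof -
  have "bounded (f ` cball 0 \<bar>R\<bar>)"
    by (intro compact_imp_bounded compact_continuous_image continuous_on_subset[OF f]) auto
  then obtain B where B: "\<And>z. norm z \<le> \<bar>R\<bar> \<Longrightarrow> \<bar>f z\<bar> \<le> B" unfolding bounded_iff
    by (metis imageI mem_cball_0 real_norm_def)
  have "\<bar>f z\<bar> \<le> max B 0" for z
    using B[of z] 0[of z] by (cases "norm z \<le> \<bar>R\<bar>") auto
  then show ?thesis using that[of "max B 0"] by auto
qed

lemma compact_support_max:
  fixes f :: "'a::euclidean_space \<Rightarrow> real"
  assumes f: "continuous_on UNIV f" and 0: "\<And>z. norm z \<ge> R \<Longrightarrow> f z = 0"
  shows "\<exists>z. \<forall>y. f y \<le> f z"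
proof -
  obtain z where z: "z \<in> cball 0 (\<bar>R\<bar>+1)" "\<And>y. y \<in> cball 0 (\<bar>R\<bar>+1) \<Longrightarrow> f y \<le> f z"
  proof -
    have "\<exists>x\<in>cball 0 (\<bar>R\<bar>+1). \<forall>y\<in>cball 0 (\<bar>R\<bar>+1). f y \<le> f x"
      by (rule continuous_attains_sup[OF compact_cball _ continuous_on_subset[OF f subset_UNIV]]) auto
    then show ?thesis using that by blast
  qed
  \<comment> \<open>The radius \<open>\<bar>R\<bar> + 1\<close> puts a zero of \<open>f\<close>
    inside the ball, so the maximum over the ball is nonnegative and also dominates the values
    outside.\<close>
  obtain w :: 'a where w: "norm w = \<bar>R\<bar> + 1" using vector_choose_size[of "\<bar>R\<bar>+1"] by auto
  have "f z \<ge> 0" using z(2)[of w] 0[of w] w by auto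
  then have "f y \<le> f z" for y using z(2)[of y] 0[of y] by (cases "norm y \<le> \<bar>R\<bar>+1") auto
  then show ?thesis by blast
qed

lemma cv_support:
  assumes "\<And>z. norm z \<ge> R \<Longrightarrow> k z = (0::real)" "\<And>y. norm y \<ge> d \<Longrightarrow> K y = 0" "norm z \<ge> R + d"
  shows "cv d K k z = 0"
proof -
  have "(\<lambda>y. k (z + y) *\<^sub>R K y) = (\<lambda>y. 0)"
  proof
    fix y
    show "k (z + y) *\<^sub>R K y = 0"
    proof (cases "norm y \<ge> d")
      case False
      have "norm z \<le> norm (z + y) + norm y" using norm_triangle_ineq4[of "z + y" y] by simp
      then have "norm (z + y) \<ge> R" using False assms(3) by simp
      then show ?thesis using assms(1) by simp
    qed (use assms in auto)
  qed
  then show ?thesis by (simp add: cv_def)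
qed

lemma smooth_approx:
  fixes k :: "'e::euclidean_space \<Rightarrow> real"
  assumes k: "continuous_on UNIV k" "\<And>z. norm z \<ge> R \<Longrightarrow> k z = 0" and e: "e > 0"
  shows "\<exists>g g' g'' R'. C2fun g g' g'' \<and> (\<forall>z. \<bar>g z - k z\<bar> \<le> e) \<and>
    (\<forall>z. norm z \<ge> R' \<longrightarrow> g z = 0) \<and> (\<forall>z h. norm z \<ge> R' \<longrightarrow> g'' z h = 0)"
proof -
  obtain d where d: "d > 0" "\<And>y z. dist y z \<le> d \<Longrightarrow> \<bar>k y - k z\<bar> \<le> e"
    using compact_support_uniform[OF k e] by blast
  obtain \<rho> :: "'e \<Rightarrow> real" and \<rho>' \<rho>'' where "is_bump d \<rho> \<rho>' \<rho>''"
    using bump_exists[OF d(1)] by blast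
  note C = is_bumpD(1)[OF this] and pos = is_bumpD(2)[OF this] and z = is_bumpD(3-5)[OF this] and one = is_bumpD(6)[OF this]
  have c: "continuous_on UNIV \<rho>" by (rule C2fun_cont[OF C])
  have const: "cv d \<rho> (\<lambda>_. a) z = a" for a z using one by (simp add: cv_def)
  have "\<bar>cv d \<rho> k x - k x\<bar> \<le> e" for x
  proof -
    have le: "\<bar>k (x + y) - k x\<bar> \<le> e" if "norm y < d" for y using d(2)[of "x + y" x] that by (simp add: dist_norm)
    have "cv d \<rho> k x \<le> cv d \<rho> (\<lambda>_. k x) x + e" "cv d \<rho> (\<lambda>_. k x) x \<le> cv d \<rho> k x + e"
      by (rule cv_mono[OF k(1) _ c pos one]; use le z in \<open>force simp: abs_le_iff\<close>)
         (rule cv_mono[OF _ k(1) c pos one]; use le z in \<open>force simp: abs_le_iff\<close>)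
    then show "\<bar>cv d \<rho> k x - k x\<bar> \<le> e" by (simp add: const)
  qed
  moreover have "cv d \<rho> k x = 0 \<and> cv d (\<lambda>y. \<rho>'' y h) k x = 0" if "norm x \<ge> R + d" for x h
    using that by (auto intro!: cv_support[of R] k z)
  ultimately show ?thesis using cv_C2fun[OF k(1) d(1) C z] by blast
qed

text \<open>One step of the walk acts like the diffusion over a time \<open>e^2 / (2 N)\<close>,
  with \<open>N\<close> the number of vectors: symmetry cancels the first-order terms.\<close>

lemma avg_second_difference:
  fixes s :: "'j::finite \<Rightarrow> 'e::euclidean_space" and f :: "'e \<Rightarrow> real"
  assumes "\<And>j. \<bar>f (z + e *\<^sub>R s j) + f (z - e *\<^sub>R s j) - 2 * f z - e\<^sup>2 * q j\<bar> \<le> e\<^sup>2 * \<omega>"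
  shows "\<bar>avg s e f z - f z - e\<^sup>2 / (2 * real CARD('j)) * sum q UNIV\<bar> \<le> e\<^sup>2 * \<omega>"
proof -
  let ?N = "real CARD('j)"
  let ?S = "\<Sum>j\<in>UNIV. f (z + e *\<^sub>R s j) + f (z - e *\<^sub>R s j) - 2 * f z - e\<^sup>2 * q j"
  have N: "?N \<ge> 1" by (simp add: Suc_leI)
  have "avg s e f z - f z - e\<^sup>2 / (2 * ?N) * sum q UNIV = ?S / (2 * ?N)"
    using N unfolding avg_def by (simp add: sum_subtractf sum.distrib sum_distrib_left[symmetric] sum_distrib_right[symmetric] field_simps)
  moreover have "\<bar>?S\<bar> \<le> (\<Sum>j\<in>(UNIV::'j set). e\<^sup>2 * \<omega>)"
    by (rule order_trans[OF sum_abs sum_mono]) (rule assms)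
  ultimately have "\<bar>avg s e f z - f z - e\<^sup>2 / (2 * ?N) * sum q UNIV\<bar> \<le> (?N * (e\<^sup>2 * \<omega>)) / (2 * ?N)"
    unfolding real_scaleR_def using N by (simp add: abs_divide pos_divide_le_eq mult_ac)
  also have "\<dots> = e\<^sup>2 * \<omega> / 2" using N by simp
  also have "\<dots> \<le> e\<^sup>2 * \<omega>" using assms[of undefined] by (smt (verit) abs_ge_zero field_sum_of_halves)
  finally show ?thesis .
qed

text \<open>The quantity \<open>real m * e\<^sup>2\<close> measures elapsed time, and
  \<open>C\<close> depends on neither \<open>e\<close> nor \<open>m\<close>. For a C^2 approximation
  with bounded second derivatives each step costs at most \<open>C * e\<^sup>2\<close>; the
  approximation error is paid twice, independently of the number of steps.\<close>

lemma avg_pow_near: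
  fixes s :: "'j::finite \<Rightarrow> 'e::euclidean_space" and f :: "'e \<Rightarrow> real"
  assumes f: "continuous_on UNIV f" "\<And>z. norm z \<ge> R \<Longrightarrow> f z = 0" and \<eta>: "\<eta> > 0"
  shows "\<exists>C\<ge>0. \<forall>e m z. e > 0 \<longrightarrow> (avg s e ^^ m) f z \<le> f z + (\<eta> + C * (real m * e\<^sup>2))"
proof -
  obtain g g' g'' R' where g: "C2fun g g' g''" "\<And>z. \<bar>g z - f z\<bar> \<le> \<eta> / 2"
    "\<And>z h. norm z \<ge> R' \<Longrightarrow> g'' z h = 0"
    using smooth_approx[OF f half_gt_zero[OF \<eta>]] by blast
  have "\<exists>B. \<forall>z. \<bar>s j \<bullet> g'' z (s j)\<bar> \<le> B" for j
  proof -
    have "continuous_on UNIV (\<lambda>z. s j \<bullet> g'' z (s j))" by (intro continuous_on_inner continuous_on_const C2fun_D3[OF g(1)])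
    from compact_support_bounded[OF this, of R'] g(3) show ?thesis by (metis inner_zero_right)
  qed
  then obtain B where B: "\<And>j z. \<bar>s j \<bullet> g'' z (s j)\<bar> \<le> B j" by metis
  define C where "C = (\<Sum>j\<in>UNIV. \<bar>B j\<bar>)"
  have C: "B j \<le> C" for j unfolding C_def
    using member_le_sum[of j UNIV "\<lambda>j. \<bar>B j\<bar>"] abs_ge_self[of "B j"] by simp
  have C0: "C \<ge> 0" unfolding C_def by (simp add: sum_nonneg)
  show ?thesis
  proof (intro exI[of _ C] conjI allI impI C0)
    fix e :: real and m z assume e: "e > 0"
    have 1: "avg s e g z \<le> g z + C * e\<^sup>2" for z
    proof -
      have "\<bar>avg s e g z - g z - e\<^sup>2 / (2 * real CARD('j)) * sum (\<lambda>_. 0) (UNIV :: 'j set)\<bar> \<le> e\<^sup>2 * C"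
      proof (rule avg_second_difference, rule C2fun_second_difference[OF g(1) e])
        show "\<bar>s j \<bullet> g'' (z + r *\<^sub>R s j) (s j) - 0\<bar> \<le> C" for j r
          unfolding diff_zero by (rule order_trans[OF B C])
      qed
      then show ?thesis by (simp add: mult.commute)
    qed
    have 2: "(avg s e ^^ m) g z \<le> g z + C * (real m * e\<^sup>2)" for z
    proof (induction m arbitrary: z)
      case (Suc m)
      have "(avg s e ^^ Suc m) g z \<le> avg s e g z + C * (real m * e\<^sup>2)"
        using avg_le[where s = s and e = e and z = z, OF Suc] by simp
      also have "\<dots> \<le> g z + C * e\<^sup>2 + C * (real m * e\<^sup>2)" using 1[of z] by simp
      finally show ?case by (simp add: algebra_simps)
    qed auto
    have "(avg s e ^^ m) f z \<le> (avg s e ^^ m) g z + \<eta> / 2"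
    proof (rule avg_pow_le)
      show "f z \<le> g z + \<eta> / 2" for z using g(2)[of z] unfolding abs_le_iff by linarith
    qed
    with 2[of z] g(2)[of z] show "(avg s e ^^ m) f z \<le> f z + (\<eta> + C * (real m * e\<^sup>2))" by linarith
  qed
qed


lemma finite_modulus:
  fixes f :: "'j::finite \<Rightarrow> 'a::euclidean_space \<Rightarrow> real"
  assumes "\<And>j. continuous_on UNIV (f j)" "\<And>j z. norm z \<ge> R \<Longrightarrow> f j z = 0" "e > 0"
  shows "\<exists>d>0. \<forall>j y z. dist y z \<le> d \<longrightarrow> \<bar>f j y - f j z\<bar> \<le> e"
proof -
  have "\<exists>d>0. \<forall>y z. dist y z \<le> d \<longrightarrow> \<bar>f j y - f j z\<bar> \<le> e" for j
    using compact_support_uniform[OF assms(1)[of j] assms(2)[of _ j] assms(3)] by metis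
  then obtain D where D: "\<And>j. D j > 0" "\<And>j (y::'a) z. dist y z \<le> D j \<Longrightarrow> \<bar>f j y - f j z\<bar> \<le> e" by metis
  show ?thesis
  proof (intro exI[of _ "Min (range D)"] conjI allI impI)
    show "Min (range D) > 0" using D(1) by (subst Min_gr_iff) auto
    fix j and y z :: 'a assume "dist y z \<le> Min (range D)"
    also have "\<dots> \<le> D j" by (rule Min_le) auto
    finally show "\<bar>f j y - f j z\<bar> \<le> e" by (rule D(2))
  qed
qed

text \<open>A viscosity subsolution of a constant-coefficient equation lies below the random-walk average of any
  smooth majorant: along the walk, the maximum of the difference decreases at the rate prescribed by the equation.\<close>

lemma visc_walk:
  fixes s :: "'j::finite \<Rightarrow> 'e::euclidean_space" and k :: "'e \<Rightarrow> real"
  assumes k: "continuous_on UNIV k" "\<And>z. norm z \<ge> R \<Longrightarrow> k z = 0"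
    and visc: "\<And>g g' g'' z. C2fun g g' g'' \<Longrightarrow> (\<And>y. k y - g y \<le> k z - g z) \<Longrightarrow> a \<le> tr2 s g'' z"
    and g: "C2fun g g' g''" "\<And>z. norm z \<ge> R' \<Longrightarrow> g z = 0"
    and e: "e > 0" and mod: "\<And>i j y z. dist y z \<le> e * norm (s i) \<Longrightarrow> \<bar>s j \<bullet> g'' y (s j) - s j \<bullet> g'' z (s j)\<bar> \<le> \<omega>"
    and B: "\<And>z. k z - g z \<le> B"
  shows "k z - (avg s e ^^ m) g z \<le> B - real m * (e\<^sup>2 / (2 * real CARD('j))) * (a - 3 * real CARD('j) * \<omega>)"
proof (induction m arbitrary: z)
  case 0 then show ?case using B by simp
next
  case (Suc m)
  let ?N = "real CARD('j)" define \<tau> where "\<tau> = e\<^sup>2 / (2 * ?N)"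
  have N: "?N \<ge> 1" by (simp add: Suc_leI)
  have \<tau>: "\<tau> \<ge> 0" "e\<^sup>2 = 2 * ?N * \<tau>" using N by (auto simp: \<tau>_def)
  let ?g = "\<lambda>m. (avg s e ^^ m) g"
  obtain h' h'' where h: "C2fun (?g m) h' h''" and h'': "\<And>h. (\<lambda>z. h'' z h) = (avg s e ^^ m) (\<lambda>z. g'' z h)"
    using C2fun_avg_pow[OF g(1)] by metis
  have inner: "s j \<bullet> (avg s e ^^ m) (\<lambda>z. g'' z (s j)) z = (avg s e ^^ m) (\<lambda>z. s j \<bullet> g'' z (s j)) z" for j z
  proof (induction m arbitrary: z)
    case (Suc m)
    have "s j \<bullet> avg s e (\<lambda>z. F z) z = avg s e (\<lambda>z. s j \<bullet> F z) z" for F :: "'e \<Rightarrow> 'e" and z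
      by (rule avg_inner)
    then show ?case using Suc by simp
  qed auto
  have shift: "(avg s e ^^ m) f (z + c) = (avg s e ^^ m) (\<lambda>z. f (z + c)) z" for c z and f :: "'e \<Rightarrow> real"
  proof (induction m arbitrary: z)
    case (Suc m)
    have "avg s e F (z + c) = avg s e (\<lambda>z. F (z + c)) z" for F :: "'e \<Rightarrow> real" and z
      by (simp add: avg_def algebra_simps)
    then show ?case using Suc by simp
  qed auto
  have mod': "\<bar>s j \<bullet> h'' y (s j) - s j \<bullet> h'' z (s j)\<bar> \<le> \<omega>" if d: "dist y z \<le> e * norm (s i)" for i j y z
  proof -
    let ?q = "\<lambda>z. s j \<bullet> g'' z (s j)"
    have y: "y = z + (y - z)" by simp
    have q: "s j \<bullet> h'' z (s j) = (avg s e ^^ m) ?q z" for z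
      using fun_cong[OF h''[of "s j"]] inner by simp
    have dd: "dist (x + (y - z)) x \<le> e * norm (s i)" for x using d by (simp add: dist_norm)
    have "(avg s e ^^ m) ?q y = (avg s e ^^ m) (\<lambda>x. ?q (x + (y - z))) z"
      using shift[of ?q z "y - z"] by simp
    moreover have "(avg s e ^^ m) (\<lambda>x. ?q (x + (y - z))) z \<le> (avg s e ^^ m) ?q z + \<omega>"
      by (rule avg_pow_le) (use mod[OF dd, of j] in \<open>simp add: abs_le_iff, smt (verit)\<close>)
    moreover have "(avg s e ^^ m) ?q z \<le> (avg s e ^^ m) (\<lambda>x. ?q (x + (y - z))) z + \<omega>"
      by (rule avg_pow_le) (use mod[OF dd, of j] in \<open>simp add: abs_le_iff, smt (verit)\<close>)
    ultimately show ?thesis unfolding q by (simp add: abs_le_iff)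
  qed
  have supp: "\<exists>R. \<forall>z. norm z \<ge> R \<longrightarrow> ?g n z = 0" for n
  proof (induction n)
    case 0 then show ?case using g(2) by auto
  next
    case (Suc n)
    then obtain R1 where R1: "\<And>z. norm z \<ge> R1 \<Longrightarrow> ?g n z = 0" by blast
    define S where "S = (\<Sum>j\<in>UNIV. e * norm (s j))"
    have S: "norm (e *\<^sub>R s j) \<le> S" for j unfolding S_def norm_scaleR using e
      by (intro order_trans[OF _ member_le_sum[of j]]) auto
    have "?g (Suc n) z = 0" if "norm z \<ge> R1 + S" for z
    proof -
      have "norm (z + e *\<^sub>R s j) \<ge> R1" "norm (z - e *\<^sub>R s j) \<ge> R1" for j
        using norm_triangle_ineq2[of z "e *\<^sub>R s j"] norm_diff_ineq[of z "e *\<^sub>R s j"] S[of j] that by linarith+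
      then show ?thesis by (simp add: avg_def R1)
    qed
    then show ?case by blast
  qed
  obtain R1 where R1: "\<And>z. norm z \<ge> R1 \<Longrightarrow> ?g (Suc m) z = 0" using supp[of "Suc m"] by blast
  note h1 = C2fun_avg[OF h, of s e]
  \<comment> \<open>The test function is \<open>?g (Suc m)\<close>, at a maximum point
    \<open>x\<close> of \<open>k - ?g (Suc m)\<close>. The bound on its Hessian controls the gain
    from \<open>?g m\<close> to \<open>?g (Suc m)\<close> at \<open>x\<close>, and \<open>x\<close>
    is the worst point, so the estimate holds everywhere.\<close>
  have "\<exists>z. \<forall>y. k y - ?g (Suc m) y \<le> k z - ?g (Suc m) z"
    by (rule compact_support_max[of _ "max R R1"])
      (use k R1 C2fun_cont[OF h1, of UNIV] in \<open>auto intro!: continuous_intros\<close>)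
  then obtain x where x: "\<And>y. k y - ?g (Suc m) y \<le> k x - ?g (Suc m) x" by blast
  have "a \<le> avg s e (tr2 s h'') x"
    using visc[OF h1, of x] x by (simp add: tr2_avg)
  also have "\<dots> \<le> tr2 s h'' x + ?N * \<omega>"
  proof -
    have t: "\<bar>tr2 s h'' y - tr2 s h'' x\<bar> \<le> ?N * \<omega>" if "dist y x \<le> e * norm (s i)" for y i
    proof -
      have "\<bar>tr2 s h'' y - tr2 s h'' x\<bar> \<le> (\<Sum>j\<in>(UNIV::'j set). \<omega>)"
        unfolding tr2_def sum_subtractf[symmetric]
        by (rule order_trans[OF sum_abs sum_mono]) (rule mod'[OF that])
      then show ?thesis by simp
    qed
    have "avg s e (tr2 s h'') x \<le> (1 / (2 * ?N)) * (\<Sum>j\<in>(UNIV :: 'j set). (tr2 s h'' x + ?N * \<omega>) + (tr2 s h'' x + ?N * \<omega>))"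
      unfolding avg_def real_scaleR_def
    proof (intro mult_left_mono sum_mono add_mono)
      fix j
      show "tr2 s h'' (x + e *\<^sub>R s j) \<le> tr2 s h'' x + ?N * \<omega>" "tr2 s h'' (x - e *\<^sub>R s j) \<le> tr2 s h'' x + ?N * \<omega>"
        using t[of "x + e *\<^sub>R s j" j] t[of "x - e *\<^sub>R s j" j] e by (auto simp: dist_norm abs_le_iff)
    qed auto
    also have "\<dots> = tr2 s h'' x + ?N * \<omega>" using N by simp
    finally show ?thesis .
  qed
  finally have a: "tr2 s h'' x \<ge> a - ?N * \<omega>" by simp
  \<comment> \<open>The loss \<open>3 * ?N * \<omega>\<close> per unit of time consists of
    \<open>?N * \<omega>\<close> for undoing the average of the Hessian and
    \<open>2 * ?N * \<omega>\<close> for the Taylor error \<open>e\<^sup>2 * \<omega>\<close>, as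
    \<open>e\<^sup>2 = 2 * ?N * \<tau>\<close>.\<close>
  have "\<bar>avg s e (?g m) x - ?g m x - e\<^sup>2 / (2 * ?N) * (\<Sum>j\<in>UNIV. s j \<bullet> h'' x (s j))\<bar> \<le> e\<^sup>2 * \<omega>"
  proof (rule avg_second_difference, rule C2fun_second_difference[OF h e])
    fix j r assume "\<bar>r\<bar> \<le> e"
    then show "\<bar>s j \<bullet> h'' (x + r *\<^sub>R s j) (s j) - s j \<bullet> h'' x (s j)\<bar> \<le> \<omega>"
      by (intro mod'[of _ _ j]) (auto simp: dist_norm mult_right_mono)
  qed
  then have "avg s e (?g m) x \<ge> ?g m x + \<tau> * tr2 s h'' x - 2 * ?N * \<tau> * \<omega>"
    unfolding tr2_def[symmetric] \<tau>_def[symmetric] using \<tau>(2) by (simp add: abs_le_iff)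
  also have "?g m x + \<tau> * tr2 s h'' x - 2 * ?N * \<tau> * \<omega> \<ge> ?g m x + \<tau> * (a - ?N * \<omega>) - 2 * ?N * \<tau> * \<omega>"
    using mult_left_mono[OF a \<tau>(1)] by simp
  finally have "?g (Suc m) x \<ge> ?g m x + \<tau> * (a - 3 * ?N * \<omega>)" by (simp add: algebra_simps)
  then have "k x - ?g (Suc m) x \<le> B - real m * \<tau> * (a - 3 * ?N * \<omega>) - \<tau> * (a - 3 * ?N * \<omega>)"
    using Suc[of x] unfolding \<tau>_def by linarith
  then show ?case using x[of z] unfolding \<tau>_def[symmetric] by (simp add: algebra_simps)
qed


text \<open>By \<open>visc_walk\<close>, \<open>k\<close> lies below its walk average at time
  \<open>t\<close> minus about \<open>a * t\<close>. This inequality between functions is linear and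
  translation invariant, so it passes to the mollification \<open>\<kappa>\<close>. For the C^2
  function \<open>\<kappa>\<close> the walk average at time \<open>t\<close> is at most
  \<open>\<kappa> + t * q\<close> up to a small multiple of \<open>t\<close>, where \<open>q\<close>
  is the second-order operator applied to \<open>\<kappa>\<close>; dividing by \<open>t\<close>
  gives the pointwise inequality.\<close>

lemma visc_global_mollify:
  fixes s :: "'j::finite \<Rightarrow> 'e::euclidean_space" and k :: "'e \<Rightarrow> real"
  assumes k: "continuous_on UNIV k" "\<And>z. norm z \<ge> R \<Longrightarrow> k z = 0"
    and visc: "\<And>g g' g'' z. C2fun g g' g'' \<Longrightarrow> (\<And>y. k y - g y \<le> k z - g z) \<Longrightarrow> a \<le> tr2 s g'' z"
    and d: "d > 0" and bump: "is_bump d \<rho> \<rho>' \<rho>''"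
  shows "a \<le> tr2 s (\<lambda>z h. cv d (\<lambda>y. \<rho>'' y h) k z) x"
proof -
  note C = is_bumpD(1)[OF bump] and pos = is_bumpD(2)[OF bump] and z = is_bumpD(3-5)[OF bump] and one = is_bumpD(6)[OF bump]
  let ?N = "real CARD('j)"
  have N: "?N \<ge> 1" by (simp add: Suc_leI)
  define \<kappa> H where "\<kappa> = cv d \<rho> k" and "H = (\<lambda>z h. cv d (\<lambda>y. \<rho>'' y h) k z)"
  obtain \<kappa>' where \<kappa>: "C2fun \<kappa> \<kappa>' H" unfolding \<kappa>_def H_def using cv_C2fun[OF k(1) d C z] by blast
  define q where "q = tr2 s H"
  have H0: "H z h = 0" if "norm z \<ge> R + d" for z h
    unfolding H_def by (rule cv_support[of R]) (use that k z in auto)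
  have cq: "continuous_on UNIV q" unfolding q_def tr2_def
    by (intro continuous_on_sum continuous_on_inner continuous_on_const C2fun_D3[OF \<kappa>])
  have q0: "norm z \<ge> R + d \<Longrightarrow> q z = 0" for z by (simp add: q_def tr2_def H0)
  have "a \<le> q x + \<epsilon>" if \<epsilon>: "\<epsilon> > 0" for \<epsilon>
  proof -
    define \<eta> where "\<eta> = \<epsilon> / 10"
    have \<eta>: "\<eta> > 0" using \<epsilon> by (simp add: \<eta>_def)
    obtain C where C0: "C \<ge> 0" and Cq: "\<And>e m z. e > 0 \<Longrightarrow> (avg s e ^^ m) q z \<le> q z + (\<eta> + C * (real m * e\<^sup>2))"
      using avg_pow_near[OF cq q0 \<eta>, where s = s] by blast
    \<comment> \<open>A time so short that the average of \<open>q\<close> along the walk exceeds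
      \<open>q x\<close> by at most \<open>2 * \<eta>\<close>.\<close>
    define t where "t = \<eta> / ((C + 1) * (2 * ?N))"
    have "C * (2 * ?N * t) = \<eta> * (C / (C + 1))" using N C0 by (simp add: t_def)
    also have "\<dots> \<le> \<eta> * 1" using \<eta> C0 by (intro mult_left_mono) auto
    finally have t: "t > 0" "C * (2 * ?N * t) \<le> \<eta>"
      using \<eta> C0 N unfolding t_def by (auto intro!: divide_pos_pos mult_pos_pos add_nonneg_pos simp: less_le_trans)
    \<comment> \<open>The approximation error is \<open>\<eta> * t\<close> rather than
      \<open>\<eta>\<close>, since the final inequality is divided by \<open>t\<close>.\<close>
    obtain g g' g'' R' where g: "C2fun g g' g''" "\<And>z. \<bar>g z - k z\<bar> \<le> \<eta> * t"
      "\<And>z. norm z \<ge> R' \<Longrightarrow> g z = 0" "\<And>z h. norm z \<ge> R' \<Longrightarrow> g'' z h = 0"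
      using smooth_approx[OF k mult_pos_pos[OF \<eta> t(1)]] by blast
    define \<omega> where "\<omega> = \<eta> / (3 * ?N)"
    have \<omega>: "\<omega> > 0" "3 * ?N * \<omega> = \<eta>" using \<eta> N by (auto simp: \<omega>_def)
    have 1: "continuous_on UNIV (\<lambda>z. s j \<bullet> g'' z (s j))" for j
      by (intro continuous_on_inner continuous_on_const C2fun_D3[OF g(1)])
    have 2: "continuous_on UNIV (\<lambda>z. s j \<bullet> H z (s j))" for j
      by (intro continuous_on_inner continuous_on_const C2fun_D3[OF \<kappa>])
    obtain d1 where d1: "d1 > 0" "\<And>j y z. dist y z \<le> d1 \<Longrightarrow> \<bar>s j \<bullet> g'' y (s j) - s j \<bullet> g'' z (s j)\<bar> \<le> \<omega>"
      using finite_modulus[where f = "\<lambda>j z. s j \<bullet> g'' z (s j)", OF 1 _ \<omega>(1), of R'] g(4) inner_zero_right by metis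
    obtain d2 where d2: "d2 > 0" "\<And>j y z. dist y z \<le> d2 \<Longrightarrow> \<bar>s j \<bullet> H y (s j) - s j \<bullet> H z (s j)\<bar> \<le> \<omega>"
      using finite_modulus[where f = "\<lambda>j z. s j \<bullet> H z (s j)", OF 2 _ \<omega>(1), of "R + d"] H0 inner_zero_right by metis
    define S where "S = 1 + (\<Sum>j\<in>UNIV. norm (s j))"
    have S: "norm (s j) \<le> S" for j unfolding S_def
      using member_le_sum[of j UNIV "\<lambda>j. norm (s j)"] by simp
    have S1: "S \<ge> 1" by (simp add: S_def sum_nonneg)
    define e0 where "e0 = min d1 d2 / S"
    have e0: "e0 > 0" using d1 d2 S1 by (simp add: e0_def)
    \<comment> \<open>The number of steps is chosen last: the total time
      \<open>m * e\<^sup>2 / (2 * ?N) = t\<close> is fixed, and a large \<open>m\<close> brings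
      \<open>e\<close> below the moduli of continuity of both Hessians.\<close>
    obtain m :: nat where m: "real m > 2 * ?N * t / e0\<^sup>2" using reals_Archimedean2 by blast
    have m0: "real m > 0" using m e0 t N by (smt (verit) divide_nonneg_pos mult_nonneg_nonneg zero_less_power)
    define e where "e = sqrt (2 * ?N * t / real m)"
    have e2: "e\<^sup>2 = 2 * ?N * t / real m" using N t m0 by (simp add: e_def)
    have e: "e > 0" using N t m0 by (simp add: e_def)
    have "e\<^sup>2 < e0\<^sup>2" unfolding e2 using m m0 e0 by (simp add: field_simps)
    then have "e < e0" using e0 by (simp add: power2_less_imp_less)
    then have eS: "e * norm (s i) \<le> d1" "e * norm (s i) \<le> d2" for i
    proof -
      have "e * norm (s i) \<le> e0 * S" using \<open>e < e0\<close> e S[of i] by (intro mult_mono) auto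
      also have "\<dots> = min d1 d2" using S1 by (simp add: e0_def)
      finally show "e * norm (s i) \<le> d1" "e * norm (s i) \<le> d2" by auto
    qed
    have m\<tau>: "real m * (e\<^sup>2 / (2 * ?N)) = t" and me: "real m * e\<^sup>2 = 2 * ?N * t" unfolding e2 using m0 N by auto
    let ?T = "\<lambda>m. (avg s e ^^ m)"
    have "k z - ?T m g z \<le> \<eta> * t - real m * (e\<^sup>2 / (2 * ?N)) * (a - 3 * ?N * \<omega>)" for z
    proof (rule visc_walk[OF k visc g(1,3) e])
      show "\<bar>s j \<bullet> g'' y (s j) - s j \<bullet> g'' z (s j)\<bar> \<le> \<omega>" if "dist y z \<le> e * norm (s i)" for i j y z
        using d1(2)[OF order_trans[OF that eS(1)]] .
      show "k z - g z \<le> \<eta> * t" for z using g(2)[of z] by (simp add: abs_le_iff)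
    qed
    then have A: "k z \<le> ?T m g z + \<eta> * t - t * (a - \<eta>)" for z unfolding m\<tau> \<omega>(2) by (simp add: algebra_simps)
    have B: "?T m g z \<le> ?T m k z + \<eta> * t" for z
    proof (rule avg_pow_le)
      show "g z \<le> k z + \<eta> * t" for z using g(2)[of z] by (simp add: abs_le_iff)
    qed
    have AB: "k z \<le> ?T m k z + (2 * \<eta> * t - t * (a - \<eta>))" for z using A[of z] B[of z] by linarith
    have cont: "continuous_on UNIV (avg s e f)" if "continuous_on UNIV f" for f :: "'e \<Rightarrow> real"
      unfolding avg_def by (intro continuous_intros continuous_on_compose2[OF that]) auto
    have contm: "continuous_on UNIV (?T m k)" for m
      by (induction m) (auto intro: cont k)
    have comm1: "cv d \<rho> (avg s e f) z = avg s e (cv d \<rho> f) z" if f: "continuous_on UNIV f" for f z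
    proof -
      have i: "(\<lambda>y. f (w + y) * \<rho> y) integrable_on cbox a b" for w a b
        using cv_integrable[OF f C2fun_cont[OF C]] by simp
      have "cv d \<rho> (avg s e f) z = integral (cbox (-(d *\<^sub>R One)) (d *\<^sub>R One))
        (\<lambda>y. (1 / (2 * ?N)) *\<^sub>R (\<Sum>j\<in>UNIV. f (z + e *\<^sub>R s j + y) * \<rho> y + f (z - e *\<^sub>R s j + y) * \<rho> y))"
        unfolding cv_def avg_def
        by (rule arg_cong[where f = "integral _"])
          (simp add: fun_eq_iff sum_distrib_right distrib_right add_ac add_diff_eq)
      also have "\<dots> = (1 / (2 * ?N)) *\<^sub>R (\<Sum>j\<in>UNIV. integral (cbox (-(d *\<^sub>R One)) (d *\<^sub>R One)) (\<lambda>y. f (z + e *\<^sub>R s j + y) * \<rho> y)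
          + integral (cbox (-(d *\<^sub>R One)) (d *\<^sub>R One)) (\<lambda>y. f (z - e *\<^sub>R s j + y) * \<rho> y))"
        by (simp only: integral_cmul integral_sum[OF finite integrable_add[OF i i]] integral_add[OF i i])
      finally show ?thesis unfolding cv_def avg_def by simp
    qed
    have comm: "cv d \<rho> (?T m k) z = ?T m \<kappa> z" for m z
    proof (induction m arbitrary: z)
      case (Suc m)
      have "cv d \<rho> (?T m k) = ?T m \<kappa>" using Suc by auto
      then show ?case by (simp add: comm1[OF contm])
    qed (simp add: \<kappa>_def)
    have lower: "\<kappa> x \<le> ?T m \<kappa> x + (2 * \<eta> * t - t * (a - \<eta>))"
      using cv_mono[OF k(1) contm[of m] C2fun_cont[OF C] pos one, of x x "2 * \<eta> * t - t * (a - \<eta>)"] AB z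
      unfolding comm by (simp add: \<kappa>_def)
    define \<tau> where "\<tau> = e\<^sup>2 / (2 * ?N)"
    have \<tau>: "\<tau> \<ge> 0" "e\<^sup>2 = 2 * ?N * \<tau>" using N by (auto simp: \<tau>_def)
    have step: "avg s e \<kappa> z \<le> (\<kappa> z + \<tau> * q z) + \<tau> * \<eta>" for z
    proof -
      have "\<bar>avg s e \<kappa> z - \<kappa> z - e\<^sup>2 / (2 * ?N) * (\<Sum>j\<in>UNIV. s j \<bullet> H z (s j))\<bar> \<le> e\<^sup>2 * \<omega>"
      proof (rule avg_second_difference, rule C2fun_second_difference[OF \<kappa> e], rule d2)
        fix j r assume "\<bar>r\<bar> \<le> e"
        then have "\<bar>r\<bar> * norm (s j) \<le> e * norm (s j)" by (intro mult_right_mono) auto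
        also have "\<dots> \<le> d2" by (rule eS)
        finally show "dist (z + r *\<^sub>R s j) z \<le> d2" by (simp add: dist_norm)
      qed
      then have "avg s e \<kappa> z \<le> \<kappa> z + \<tau> * q z + e\<^sup>2 * \<omega>" unfolding q_def tr2_def \<tau>_def by linarith
      also have "e\<^sup>2 * \<omega> \<le> \<tau> * \<eta>"
        using \<omega>(1) \<tau>(1) N unfolding \<tau>(2) \<omega>(2)[symmetric] by (simp add: mult_ac mult_left_mono)
      finally show ?thesis by simp
    qed
    \<comment> \<open>Each step adds \<open>\<tau> * q\<close> up to \<open>\<tau> * \<eta>\<close>,
      and the remaining steps average this \<open>q\<close>, which \<open>Cq\<close> keeps below
      \<open>q x + 2 * \<eta>\<close>.\<close>
    have up: "?T i \<kappa> x \<le> \<kappa> x + real i * \<tau> * (q x + 3 * \<eta>)" if "i \<le> m" for i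
      using that
    proof (induction i)
      case (Suc i)
      have "?T (Suc i) \<kappa> x = ?T i (avg s e \<kappa>) x" by (simp add: funpow_swap1)
      also have "\<dots> \<le> ?T i (\<lambda>z. \<kappa> z + \<tau> * q z) x + \<tau> * \<eta>" by (rule avg_pow_le[OF step])
      also have "\<dots> = ?T i \<kappa> x + \<tau> * ?T i q x + \<tau> * \<eta>" by (simp add: avg_pow_add)
      finally have 1: "?T (Suc i) \<kappa> x \<le> ?T i \<kappa> x + \<tau> * ?T i q x + \<tau> * \<eta>" .
      have "?T i q x \<le> q x + 2 * \<eta>"
      proof -
        have "C * (real i * e\<^sup>2) \<le> C * (real m * e\<^sup>2)" using Suc.prems C0 by (intro mult_left_mono mult_right_mono) auto
        also have "\<dots> \<le> \<eta>" unfolding me by (rule t(2))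
        finally show ?thesis using Cq[OF e, of i x] by simp
      qed
      from mult_left_mono[OF this \<tau>(1)] have 2: "\<tau> * ?T i q x \<le> \<tau> * (q x + 2 * \<eta>)" .
      have "?T i \<kappa> x \<le> \<kappa> x + real i * \<tau> * (q x + 3 * \<eta>)" using Suc by simp
      with 1 2 have "?T (Suc i) \<kappa> x \<le> \<kappa> x + real i * \<tau> * (q x + 3 * \<eta>) + \<tau> * (q x + 2 * \<eta>) + \<tau> * \<eta>"
        by linarith
      then show ?case by (simp add: algebra_simps)
    qed simp
    have "?T m \<kappa> x \<le> \<kappa> x + t * (q x + 3 * \<eta>)" using up[of m] unfolding \<tau>_def m\<tau> by simp
    then have "t * (a - \<eta>) \<le> t * (q x + 5 * \<eta>)" using lower by (simp add: algebra_simps)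
    then have "a - \<eta> \<le> q x + 5 * \<eta>" using t(1) by simp
    then show ?thesis using \<eta> by (simp add: \<eta>_def)
  qed
  then show ?thesis unfolding q_def H_def by (rule field_le_epsilon)
qed


section \<open>Localisation: subsolutions with constant coefficients on a ball\<close>

definition touch_above :: "('e::metric_space \<Rightarrow> real) \<Rightarrow> 'e \<Rightarrow> ('e \<Rightarrow> real) \<Rightarrow> bool" where
  "touch_above W z g \<longleftrightarrow> (\<exists>e>0. \<forall>y. dist y z < e \<longrightarrow> W y - g y \<le> W z - g z)"

definition visc_const :: "('j::finite \<Rightarrow> 'e::euclidean_space) \<Rightarrow> real \<Rightarrow> 'e set \<Rightarrow> ('e \<Rightarrow> real) \<Rightarrow> bool" where
  "visc_const s a S W \<longleftrightarrow> (\<forall>g g' g'' z. C2fun g g' g'' \<longrightarrow> z \<in> S \<longrightarrow> touch_above W z g \<longrightarrow> a \<le> tr2 s g'' z)"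

text \<open>The difference of the two functions vanishes near \<open>z\<close>, so the second-order
  condition at a minimum applies with either sign. This lets an explicit formula for a second
  derivative replace the one obtained from the kernel.\<close>

lemma tr2_unique:
  assumes "C2fun f g H" "C2fun f' g' H'" and eq: "\<And>y. y \<in> ball z r \<Longrightarrow> f y = f' y" and r: "r > 0"
  shows "tr2 s H z = tr2 s H' z"
proof -
  have le: "tr2 s H z \<le> tr2 s H' z" if "C2fun f g H" "C2fun f' g' H'" "\<And>y. y \<in> ball z r \<Longrightarrow> f y = f' y"
    for f f' :: "_ \<Rightarrow> real" and g g' H H'
    unfolding tr2_def
  proof (rule sum_mono)
    fix j
    have "s j \<bullet> (H' z (s j) + (-1) *\<^sub>R H z (s j)) \<ge> 0"
      by (rule C2fun_local_min[OF C2fun_add[OF that(2) C2fun_cmul[OF that(1), of "-1"]] r])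
        (use that(3) r in \<open>auto simp: dist_commute\<close>)
    then show "s j \<bullet> H z (s j) \<le> s j \<bullet> H' z (s j)" by (simp add: inner_diff_right)
  qed
  show ?thesis using le[OF assms(1-3)] le[OF assms(2,1)] eq by force
qed

text \<open>Outside the ball, the function is replaced by a steep paraboloid \<open>\<beta>\<close>, which is itself a subsolution;
  then \<open>W - \<beta>\<close> becomes a compactly supported global subsolution.\<close>

lemma visc_const_mollify:
  fixes s :: "'j::finite \<Rightarrow> 'e::euclidean_space"
  assumes W: "continuous_on UNIV W" and r: "r > 0" and visc: "visc_const s a (ball z0 r) W"
    and s: "s i \<noteq> 0" and d: "0 < d" "d < r / 4" and bump: "is_bump d \<rho> \<rho>' \<rho>''" and x: "x \<in> ball z0 (r / 4)"
  shows "a \<le> tr2 s (\<lambda>z h. cv d (\<lambda>y. \<rho>'' y h) W z) x"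
proof -
  note C = is_bumpD(1)[OF bump] and pos = is_bumpD(2)[OF bump] and z = is_bumpD(3-5)[OF bump] and one = is_bumpD(6)[OF bump]
  have "compact (W ` cball z0 r)" by (intro compact_continuous_image continuous_on_subset[OF W]) auto
  then have "bounded (W ` cball z0 r)" by (rule compact_imp_bounded)
  then obtain M where M: "\<And>y. y \<in> cball z0 r \<Longrightarrow> \<bar>W y\<bar> \<le> M"
    unfolding bounded_iff by (metis imageI real_norm_def)
  have M0: "M \<ge> 0" using M[of z0] r by auto
  define S where "S = (\<Sum>j\<in>UNIV. (norm (s j))\<^sup>2)"
  have "(norm (s i))\<^sup>2 \<le> S" unfolding S_def by (rule member_le_sum) auto
  then have S: "S > 0" using s by (smt (verit) zero_less_norm_iff zero_less_power)
  \<comment> \<open>The first summand lifts \<open>\<beta>\<close> from below \<open>- M\<close> on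
    the ball of radius \<open>r / 2\<close> to above \<open>M\<close> at distance
    \<open>3 / 4 * r\<close>; the second makes \<open>a - 2 * \<Lambda> * S\<close> nonpositive, so
    that the zero function is a subsolution at this level too.\<close>
  define \<Lambda> where "\<Lambda> = 8 * M / r\<^sup>2 + \<bar>a\<bar> / S"
  have \<Lambda>: "\<Lambda> \<ge> 0" "\<Lambda> * r\<^sup>2 \<ge> 8 * M" "\<Lambda> * S \<ge> \<bar>a\<bar>"
    using M0 S r by (auto simp: \<Lambda>_def distrib_right)
  define \<beta> where "\<beta> = (\<lambda>y. \<Lambda> * (norm (y - z0))\<^sup>2 + (- \<Lambda> * r\<^sup>2 / 4 - M))"
  have \<beta>: "C2fun \<beta> (\<lambda>y. (2 * \<Lambda>) *\<^sub>R (y - z0) + 0) (\<lambda>y h. (2 * \<Lambda>) *\<^sub>R h + 0)"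
    unfolding \<beta>_def by (rule C2fun_add[OF C2fun_quad C2fun_const])
  have tr\<beta>: "tr2 s (\<lambda>y h. (2 * \<Lambda>) *\<^sub>R h + 0) z = 2 * \<Lambda> * S" for z
    by (simp add: tr2_def S_def sum_distrib_left power2_norm_eq_inner mult.commute)
  have in_le: "\<beta> y \<le> W y" if "dist z0 y \<le> r / 2" for y
  proof -
    have "(norm (y - z0))\<^sup>2 \<le> (r / 2)\<^sup>2" using that by (intro power_mono) (auto simp: dist_norm norm_minus_commute)
    then have "\<Lambda> * (norm (y - z0))\<^sup>2 \<le> \<Lambda> * (r\<^sup>2 / 4)" using \<Lambda>(1) by (intro mult_left_mono) (auto simp: power_divide)
    then have "\<beta> y \<le> - M" by (simp add: \<beta>_def)
    then show ?thesis using M[of y] that r by auto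
  qed
  have out_ge: "W y \<le> \<beta> y" if "dist z0 y \<le> r" "dist z0 y \<ge> 3 / 4 * r" for y
  proof -
    have "(3 / 4 * r)\<^sup>2 \<le> (norm (y - z0))\<^sup>2" using that r by (intro power_mono) (auto simp: dist_norm norm_minus_commute)
    then have "\<Lambda> * (9 / 16 * r\<^sup>2) \<le> \<Lambda> * (norm (y - z0))\<^sup>2" using \<Lambda>(1) by (intro mult_left_mono) (auto simp: power2_eq_square)
    then have "\<beta> y \<ge> \<Lambda> * r\<^sup>2 * (5 / 16) - M" by (simp add: \<beta>_def)
    then have "\<beta> y \<ge> M" using \<Lambda>(2) M0 by simp
    then show ?thesis using M[of y] that by auto
  qed
  define k where "k = (\<lambda>y. if dist z0 y \<le> 3 / 4 * r then max 0 (W y - \<beta> y) else 0)"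
  have k_eq: "k y = max 0 (W y - \<beta> y)" if "dist z0 y \<le> r" for y
    using out_ge[OF that] by (auto simp: k_def)
  have k0: "k y \<ge> 0" for y by (simp add: k_def)
  have contWb: "continuous_on UNIV (\<lambda>y. max 0 (W y - \<beta> y))"
    by (intro continuous_intros W C2fun_cont[OF \<beta>])
  have kc: "continuous_on UNIV k"
  proof -
    have "continuous_on ({y. dist z0 y < r} \<union> {y. dist z0 y > 3 / 4 * r}) k"
    proof (rule continuous_on_open_Un)
      show "continuous_on {y. dist z0 y < r} k"
        using continuous_on_subset[OF contWb] by (rule continuous_on_eq[of _ "\<lambda>y. max 0 (W y - \<beta> y)"]) (auto simp: k_eq)
      show "continuous_on {y. 3 / 4 * r < dist z0 y} k"
        by (rule continuous_on_eq[of _ "\<lambda>y. 0"]) (auto simp: k_def)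
    qed (auto intro!: open_Collect_less continuous_intros)
    moreover have "{y. dist z0 y < r} \<union> {y. dist z0 y > 3 / 4 * r} = UNIV" using r by auto
    ultimately show ?thesis by simp
  qed
  have ksupp: "k y = 0" if "norm y \<ge> norm z0 + r" for y
  proof -
    have "dist z0 y \<ge> r" using that norm_triangle_ineq2[of y z0] by (simp add: dist_norm norm_minus_commute)
    then show ?thesis using r by (simp add: k_def)
  qed
  \<comment> \<open>A maximum of two subsolutions: where \<open>k\<close> is positive, the test
    function plus \<open>\<beta>\<close> touches \<open>W\<close>; where \<open>k\<close> is zero it
    is minimal, so the test function has a minimum as well.\<close>
  have kv: "a - 2 * \<Lambda> * S \<le> tr2 s g'' y" if g: "C2fun g g' g''" and max: "\<And>w. k w - g w \<le> k y - g y" for g g' g'' y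
  proof (cases "k y > 0")
    case True
    then have y: "dist z0 y \<le> 3 / 4 * r" by (auto simp: k_def split: if_splits)
    then have yb: "y \<in> ball z0 r" using r by simp
    have "touch_above W y (\<lambda>y. g y + \<beta> y)"
      unfolding touch_above_def
    proof (intro exI[of _ "r / 4"] conjI allI impI)
      fix w assume "dist w y < r / 4"
      then have "dist z0 w \<le> r" using y dist_triangle[of z0 w y] by (simp add: dist_commute)
      then have "W w - \<beta> w \<le> k w" by (simp add: k_eq)
      also have "\<dots> \<le> k y - g y + g w" using max[of w] by simp
      also have "k y = W y - \<beta> y" using True k_eq[of y] yb by simp
      finally show "W w - (g w + \<beta> w) \<le> W y - (g y + \<beta> y)" by simp
    qed (use r in auto)
    then have "a \<le> tr2 s (\<lambda>z h. g'' z h + ((2 * \<Lambda>) *\<^sub>R h + 0)) y"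
      using visc yb C2fun_add[OF g \<beta>] unfolding visc_const_def by blast
    also have "\<dots> = tr2 s g'' y + tr2 s (\<lambda>y h. (2 * \<Lambda>) *\<^sub>R h + 0) y"
      by (simp add: tr2_def inner_add_right sum.distrib)
    finally show ?thesis unfolding tr\<beta> by simp
  next
    case False
    then have "k y = 0" using k0[of y] by simp
    then have "g y \<le> g w" for w using max[of w] k0[of w] by simp
    then have "0 \<le> tr2 s g'' y" unfolding tr2_def
      by (intro sum_nonneg C2fun_local_min[OF g zero_less_one]) auto
    then show ?thesis using \<Lambda>(3) abs_ge_zero[of a] by simp
  qed
  let ?H = "\<lambda>f z h. cv d (\<lambda>y. \<rho>'' y h) f z"
  have main: "a - 2 * \<Lambda> * S \<le> tr2 s (?H k) x"
    by (rule visc_global_mollify[OF kc ksupp kv d(1) bump])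
  note Ck = cv_C2fun[OF kc d(1) C z] and CW = cv_C2fun[OF W d(1) C z]
  \<comment> \<open>Mollifying a paraboloid gives a paraboloid with the same second derivative;
    \<open>l\<close> and \<open>c\<beta>\<close> are the moments of the kernel that enter the
    lower-order terms.\<close>
  define c\<beta> where "c\<beta> = integral (cbox (-(d *\<^sub>R One)) (d *\<^sub>R One)) (\<lambda>y. (\<Lambda> * (norm y)\<^sup>2 - \<Lambda> * r\<^sup>2 / 4 - M) * \<rho> y)"
  define l where "l = integral (cbox (-(d *\<^sub>R One)) (d *\<^sub>R One)) (\<lambda>y. \<rho> y *\<^sub>R y)"
  have cont\<rho>: "continuous_on A \<rho>" for A by (rule C2fun_cont[OF C])
  have cv\<beta>: "cv d \<rho> \<beta> y = \<Lambda> * (norm (y - z0))\<^sup>2 + ((2 * \<Lambda>) * ((y - z0) \<bullet> l) + c\<beta>)" for y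
  proof -
    let ?B = "cbox (-(d *\<^sub>R One)) (d *\<^sub>R One) :: 'e set"
    have e: "(\<lambda>w. \<beta> (y + w) *\<^sub>R \<rho> w) = (\<lambda>w. (\<Lambda> * (norm (y - z0))\<^sup>2) * \<rho> w + (((2 * \<Lambda>) * ((y - z0) \<bullet> (\<rho> w *\<^sub>R w)))
        + (\<Lambda> * (norm w)\<^sup>2 - \<Lambda> * r\<^sup>2 / 4 - M) * \<rho> w))"
      unfolding \<beta>_def power2_norm_eq_inner
      by (auto simp: fun_eq_iff algebra_simps inner_commute)
    have i1: "(\<lambda>w. (\<Lambda> * (norm (y - z0))\<^sup>2) * \<rho> w) integrable_on ?B"
      and i2: "(\<lambda>w. (2 * \<Lambda>) * ((y - z0) \<bullet> (\<rho> w *\<^sub>R w))) integrable_on ?B"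
      and i3: "(\<lambda>w. (\<Lambda> * (norm w)\<^sup>2 - \<Lambda> * r\<^sup>2 / 4 - M) * \<rho> w) integrable_on ?B"
      and i4: "(\<lambda>w. \<rho> w *\<^sub>R w) integrable_on ?B"
      by (intro integrable_continuous continuous_intros cont\<rho>)+
    have "integral ?B (\<lambda>w. (y - z0) \<bullet> (\<rho> w *\<^sub>R w)) = (y - z0) \<bullet> l"
      unfolding l_def using integral_linear[OF i4 bounded_linear_inner_right[of "y - z0"]] by (simp add: o_def)
    then show ?thesis unfolding cv_def e
      by (simp only: integral_add[OF i1 integrable_add[OF i2 i3]] integral_add[OF i2 i3] integral_mult_right one c\<beta>_def mult_1_right)
  qed
  have "C2fun (\<lambda>y. y \<bullet> l) (\<lambda>y. l) (\<lambda>y h. 0)"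
    unfolding C2fun_def by (auto intro!: derivative_eq_intros simp: inner_commute)
  from C2fun_add[OF C2fun_quad C2fun_add[OF C2fun_cmul[OF C2fun_shift[OF this, of "- z0"]] C2fun_const], of \<Lambda> z0 "2 * \<Lambda>" c\<beta>]
  have C\<beta>: "C2fun (cv d \<rho> \<beta>) (\<lambda>z. (2 * \<Lambda>) *\<^sub>R (z - z0) + ((2 * \<Lambda>) *\<^sub>R l + 0)) (\<lambda>y h. (2 * \<Lambda>) *\<^sub>R h + ((2 * \<Lambda>) *\<^sub>R 0 + 0))"
    unfolding cv\<beta>[abs_def] by simp
  \<comment> \<open>Near \<open>x\<close>, translates by less than \<open>d\<close> stay in the ball
    of radius \<open>r / 2\<close>, where \<open>k = W - \<beta>\<close>; so the mollification of
    \<open>W\<close> is that of \<open>k\<close> plus that of \<open>\<beta>\<close>.\<close>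
  have "tr2 s (?H W) x = tr2 s (\<lambda>z h. ?H k z h + ((2 * \<Lambda>) *\<^sub>R h + ((2 * \<Lambda>) *\<^sub>R 0 + 0))) x"
  proof (rule tr2_unique[OF CW C2fun_add[OF Ck C\<beta>]])
    show "r / 4 - dist z0 x > 0" using x by simp
    fix y assume "y \<in> ball x (r / 4 - dist z0 x)"
    then have y: "dist z0 y < r / 4" using dist_triangle[of z0 y x] by simp
    have *: "W (y + w) = k (y + w) + \<beta> (y + w)" if "norm w < d" for w
    proof -
      have "dist z0 (y + w) \<le> dist z0 y + norm w" using dist_triangle[of z0 "y + w" y] by (simp add: dist_norm)
      then have "dist z0 (y + w) \<le> r / 2" using y that d by simp
      then show ?thesis using in_le k_eq[of "y + w"] r by simp
    qed
    have "(\<lambda>w. W (y + w) *\<^sub>R \<rho> w) = (\<lambda>w. k (y + w) *\<^sub>R \<rho> w + \<beta> (y + w) *\<^sub>R \<rho> w)"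
    proof
      fix w show "W (y + w) *\<^sub>R \<rho> w = k (y + w) *\<^sub>R \<rho> w + \<beta> (y + w) *\<^sub>R \<rho> w"
        using *[of w] z(1)[of w] by (cases "norm w < d") (auto simp: distrib_right)
    qed
    then show "cv d \<rho> W y = cv d \<rho> k y + cv d \<rho> \<beta> y" unfolding cv_def
      using integral_add[OF cv_integrable[OF kc cont\<rho>] cv_integrable[OF C2fun_cont[OF \<beta>] cont\<rho>]] by simp
  qed
  also have "\<dots> = tr2 s (?H k) x + tr2 s (\<lambda>y h. (2 * \<Lambda>) *\<^sub>R h + 0) x"
    by (simp add: tr2_def inner_add_right sum.distrib)
  finally show ?thesis using main unfolding tr\<beta> by simp
qed

lemma mollify_sum:
  fixes F G :: "'e::euclidean_space \<Rightarrow> real"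
  assumes F: "continuous_on UNIV F" and G: "continuous_on UNIV G" and r: "r > 0" and \<eta>: "\<eta> > 0"
  shows "\<exists>P P' P''. C2fun P P' P'' \<and> (\<forall>z\<in>cball z0 r. \<bar>P z - (F z + G z)\<bar> \<le> \<eta>) \<and>
    (\<forall>(s :: 'j::finite \<Rightarrow> 'e) a b z. (\<exists>i. s i \<noteq> 0) \<longrightarrow> visc_const s a (ball z0 r) F \<longrightarrow> visc_const s b (ball z0 r) G \<longrightarrow>
       z \<in> ball z0 (r / 4) \<longrightarrow> a + b \<le> tr2 s P'' z)"
proof -
  have "uniformly_continuous_on (cball z0 (2 * r)) (\<lambda>z. F z + G z)"
    by (intro compact_uniformly_continuous continuous_intros continuous_on_subset[OF F] continuous_on_subset[OF G]) auto
  then obtain d0 where d0: "d0 > 0" "\<And>y z. y \<in> cball z0 (2 * r) \<Longrightarrow> z \<in> cball z0 (2 * r) \<Longrightarrow> dist y z < d0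
     \<Longrightarrow> dist (F y + G y) (F z + G z) < \<eta>"
    unfolding uniformly_continuous_on_def using \<eta> by meson
  define d where "d = min d0 (r / 8)"
  have d: "0 < d" "d < r / 4" "d \<le> d0" using d0 r by (auto simp: d_def)
  obtain \<rho> :: "'e \<Rightarrow> real" and \<rho>' \<rho>'' where bump: "is_bump d \<rho> \<rho>' \<rho>''"
    using bump_exists[OF d(1)] by blast
  note C = is_bumpD(1)[OF bump] and pos = is_bumpD(2)[OF bump] and z = is_bumpD(3-5)[OF bump] and one = is_bumpD(6)[OF bump]
  note c\<rho> = C2fun_cont[OF C]
  have FG: "continuous_on UNIV (\<lambda>z. F z + G z)" by (intro continuous_intros F G)
  show ?thesis
  proof (intro exI conjI ballI allI impI)
    show "C2fun (\<lambda>z. cv d \<rho> F z + cv d \<rho> G z) (\<lambda>z. - cv d \<rho>' F z + - cv d \<rho>' G z)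
      (\<lambda>z h. cv d (\<lambda>y. \<rho>'' y h) F z + cv d (\<lambda>y. \<rho>'' y h) G z)"
      by (intro C2fun_add cv_C2fun F G d C z)
    fix x assume x: "x \<in> cball z0 r"
    have sum: "cv d \<rho> F x + cv d \<rho> G x = cv d \<rho> (\<lambda>z. F z + G z) x"
      unfolding cv_def using integral_add[OF cv_integrable[OF F c\<rho>] cv_integrable[OF G c\<rho>]]
      by (simp add: distrib_right)
    have const: "cv d \<rho> (\<lambda>_. a) z = a" for a z using one by (simp add: cv_def)
    have *: "\<bar>(F (x + y) + G (x + y)) - (F x + G x)\<bar> \<le> \<eta>" if "norm y < d" for y
    proof -
      have "dist z0 (x + y) \<le> dist z0 x + norm y" using dist_triangle[of z0 "x + y" x] by (simp add: dist_norm)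
      then show ?thesis using d0(2)[of "x + y" x] that d x r by (simp add: dist_norm)
    qed
    have "cv d \<rho> (\<lambda>z. F z + G z) x \<le> cv d \<rho> (\<lambda>_. F x + G x) x + \<eta>"
    proof (rule cv_mono[OF FG continuous_on_const c\<rho> pos one _ z(1)])
      show "F (x + y) + G (x + y) \<le> F x + G x + \<eta>" if "norm y < d" for y using *[OF that] by (simp add: abs_le_iff)
    qed
    moreover have "cv d \<rho> (\<lambda>_. F x + G x) x \<le> cv d \<rho> (\<lambda>z. F z + G z) x + \<eta>"
    proof (rule cv_mono[OF continuous_on_const FG c\<rho> pos one _ z(1)])
      show "F x + G x \<le> F (x + y) + G (x + y) + \<eta>" if "norm y < d" for y using *[OF that] by (simp add: abs_le_iff)
    qed
    ultimately show "\<bar>cv d \<rho> F x + cv d \<rho> G x - (F x + G x)\<bar> \<le> \<eta>" by (simp add: const sum)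
  next
    fix s :: "'j \<Rightarrow> 'e" and a b x
    assume "\<exists>i. s i \<noteq> 0" "visc_const s a (ball z0 r) F" "visc_const s b (ball z0 r) G" "x \<in> ball z0 (r / 4)"
    then have "a \<le> tr2 s (\<lambda>z h. cv d (\<lambda>y. \<rho>'' y h) F z) x" "b \<le> tr2 s (\<lambda>z h. cv d (\<lambda>y. \<rho>'' y h) G z) x"
      using visc_const_mollify[OF F r _ _ d(1,2) bump] visc_const_mollify[OF G r _ _ d(1,2) bump] by blast+
    then show "a + b \<le> tr2 s (\<lambda>z h. cv d (\<lambda>y. \<rho>'' y h) F z + cv d (\<lambda>y. \<rho>'' y h) G z) x"
      by (simp add: tr2_def inner_add_right sum.distrib)
  qed
qed

section \<open>Sup-convolutions\<close>

lemma first_order_max: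
  fixes f :: "'e::euclidean_space \<Rightarrow> real"
  assumes C: "C2fun f g H" and r: "r > 0" and max: "\<And>z. z \<in> ball zb r \<Longrightarrow> f z \<le> f zb"
  shows "g zb = 0"
proof -
  have "(\<lambda>h. g zb \<bullet> h) = (\<lambda>h. 0)"
    by (rule differential_zero_maxmin[of zb "ball zb r" f]) (use C2fun_D1[OF C] r max in auto)
  then have "g zb \<bullet> g zb = 0" by meson
  then show ?thesis by simp
qed

lemma small_positive: "\<forall>x\<in>set xs. 0 < x \<Longrightarrow> \<exists>\<eta>>0. \<forall>x\<in>set xs. \<eta> \<le> (x::real)"
proof (induction xs)
  case (Cons a xs)
  then obtain \<eta> where "\<eta> > 0" "\<forall>x\<in>set xs. \<eta> \<le> x" by auto
  then show ?case using Cons.prems by (intro exI[of _ "min a \<eta>"]) (auto simp: min_le_iff_disj)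
qed (auto intro: exI[of _ 1])

text \<open>Three points are tied to a common fourth one instead of to each other; for fixed
  \<open>z\<close>, maximising over \<open>z1\<close>, \<open>z2\<close> and \<open>z3\<close> then
  gives three separate sup-convolutions at the same point. Strictness at \<open>zh\<close>
  localises, and a large \<open>a\<close> makes the penalties themselves small.\<close>

lemma penalised_maximum:
  fixes zh :: "'e::euclidean_space"
  assumes R: "R > 0" and c: "continuous_on (cball zh R) w1" "continuous_on (cball zh R) w2"
      "continuous_on (cball zh R) w3" "continuous_on (cball zh R) \<psi>"
    and \<alpha>: "\<alpha> > 0"
    and strict: "\<And>z. z \<in> cball zh R \<Longrightarrow> w1 z + w2 z + w3 z + \<psi> z \<le> w1 zh + w2 zh + w3 zh + \<psi> zh - \<alpha> * (norm (z - zh))\<^sup>2"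
    and \<eta>: "\<eta> > 0"
  shows "\<exists>a>0. \<exists>b1 b2 b3 zb. b1 \<in> cball zh R \<and> b2 \<in> cball zh R \<and> b3 \<in> cball zh R \<and> zb \<in> cball zh R \<and>
     (\<forall>z1\<in>cball zh R. \<forall>z2\<in>cball zh R. \<forall>z3\<in>cball zh R. \<forall>z\<in>cball zh R.
        w1 z1 + w2 z2 + w3 z3 + \<psi> z - a * ((norm (z - z1))\<^sup>2 + (norm (z - z2))\<^sup>2 + (norm (z - z3))\<^sup>2)
        \<le> w1 b1 + w2 b2 + w3 b3 + \<psi> zb - a * ((norm (zb - b1))\<^sup>2 + (norm (zb - b2))\<^sup>2 + (norm (zb - b3))\<^sup>2)) \<and>
     a * (norm (zb - b1))\<^sup>2 \<le> \<eta> \<and> a * (norm (zb - b2))\<^sup>2 \<le> \<eta> \<and> a * (norm (zb - b3))\<^sup>2 \<le> \<eta> \<and>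
     dist zb zh \<le> \<eta> \<and> dist b1 zh \<le> \<eta> \<and> dist b2 zh \<le> \<eta> \<and> dist b3 zh \<le> \<eta>"
proof -
  let ?B = "cball zh R"
  have bd: "\<exists>M. \<forall>x\<in>?B. \<bar>f x\<bar> \<le> M" if "continuous_on ?B f" for f :: "'e \<Rightarrow> real"
  proof -
    have "bounded (f ` ?B)" using that by (intro compact_imp_bounded compact_continuous_image) auto
    then show ?thesis unfolding bounded_iff by (metis imageI real_norm_def)
  qed
  obtain M1 M2 M3 M4 where M': "\<And>x. x \<in> ?B \<Longrightarrow> \<bar>w1 x\<bar> \<le> M1" "\<And>x. x \<in> ?B \<Longrightarrow> \<bar>w2 x\<bar> \<le> M2"
     "\<And>x. x \<in> ?B \<Longrightarrow> \<bar>w3 x\<bar> \<le> M3" "\<And>x. x \<in> ?B \<Longrightarrow> \<bar>\<psi> x\<bar> \<le> M4" using bd c by metis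
  define M where "M = \<bar>M1\<bar> + \<bar>M2\<bar> + \<bar>M3\<bar> + \<bar>M4\<bar>"
  define \<eta>' where "\<eta>' = min (\<eta> / 6) (\<alpha> * (\<eta> / 2)\<^sup>2 / 3)"
  have \<eta>': "\<eta>' > 0" "3 * \<eta>' \<le> \<eta>" "3 * \<eta>' \<le> \<alpha> * (\<eta> / 2)\<^sup>2" using \<eta> \<alpha> by (auto simp: \<eta>'_def min_def)
  have uc: "\<exists>d>0. \<forall>x\<in>?B. \<forall>y\<in>?B. dist x y < d \<longrightarrow> f x \<le> f y + \<eta>'" if "continuous_on ?B f" for f :: "'e \<Rightarrow> real"
  proof -
    have "uniformly_continuous_on ?B f" by (rule compact_uniformly_continuous[OF that]) auto
    then obtain d where d: "d > 0" "\<And>x y. x \<in> ?B \<Longrightarrow> y \<in> ?B \<Longrightarrow> dist y x < d \<Longrightarrow> dist (f y) (f x) < \<eta>'"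
      unfolding uniformly_continuous_on_def using \<eta>'(1) by meson
    show ?thesis
    proof (intro exI[of _ d] conjI ballI impI d(1))
      fix x y assume "x \<in> ?B" "y \<in> ?B" "dist x y < d"
      then show "f x \<le> f y + \<eta>'" using d(2)[of y x] unfolding dist_real_def by linarith
    qed
  qed
  obtain d1 where d1: "d1 > 0" "\<And>x y. x \<in> ?B \<Longrightarrow> y \<in> ?B \<Longrightarrow> dist x y < d1 \<Longrightarrow> w1 x \<le> w1 y + \<eta>'"
    using uc[OF c(1)] by blast
  obtain d2 where d2: "d2 > 0" "\<And>x y. x \<in> ?B \<Longrightarrow> y \<in> ?B \<Longrightarrow> dist x y < d2 \<Longrightarrow> w2 x \<le> w2 y + \<eta>'"
    using uc[OF c(2)] by blast
  obtain d3 where d3: "d3 > 0" "\<And>x y. x \<in> ?B \<Longrightarrow> y \<in> ?B \<Longrightarrow> dist x y < d3 \<Longrightarrow> w3 x \<le> w3 y + \<eta>'"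
    using uc[OF c(3)] by blast
  note d' = d1(1) d2(1) d3(1) d1(2) d2(2) d3(2)
  define d where "d = min (min d1 d2) (min d3 (\<eta> / 2))"
  have d: "d > 0" "d \<le> d1" "d \<le> d2" "d \<le> d3" "d \<le> \<eta> / 2" using d' \<eta> by (auto simp: d_def)
  \<comment> \<open>As \<open>a * d\<^sup>2 > 2 * M\<close>, comparison with \<open>zh\<close>
    forces the three points within \<open>d\<close> of \<open>zb\<close>; uniform continuity at that
    distance then improves the bound on the penalties from \<open>2 * M\<close> to
    \<open>3 * \<eta>'\<close>.\<close>
  define a where "a = (2 * M + 1) / d\<^sup>2"
  have M0: "M \<ge> 0" by (simp add: M_def)
  have a: "a > 0" "a * d\<^sup>2 = 2 * M + 1" using M0 d by (auto simp: a_def add_nonneg_pos)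
  let ?K = "?B \<times> ?B \<times> ?B \<times> ?B"
  let ?\<Phi> = "\<lambda>(z1, z2, z3, z). w1 z1 + w2 z2 + w3 z3 + \<psi> z - a * ((norm (z - z1))\<^sup>2 + (norm (z - z2))\<^sup>2 + (norm (z - z3))\<^sup>2)"
  have "\<exists>b\<in>?K. \<forall>z\<in>?K. ?\<Phi> z \<le> ?\<Phi> b"
  proof (rule continuous_attains_sup)
    show "compact ?K" by (intro compact_Times) auto
    show "continuous_on ?K ?\<Phi>" unfolding case_prod_beta
      by (intro continuous_intros continuous_on_compose2[OF c(1)] continuous_on_compose2[OF c(2)]
          continuous_on_compose2[OF c(3)] continuous_on_compose2[OF c(4)]) auto
  qed (use R in auto)
  then obtain b1 b2 b3 zb where b: "b1 \<in> ?B" "b2 \<in> ?B" "b3 \<in> ?B" "zb \<in> ?B"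
    and max: "\<And>z1 z2 z3 z. z1 \<in> ?B \<Longrightarrow> z2 \<in> ?B \<Longrightarrow> z3 \<in> ?B \<Longrightarrow> z \<in> ?B \<Longrightarrow> ?\<Phi> (z1, z2, z3, z) \<le> ?\<Phi> (b1, b2, b3, zb)"
    by (auto simp del: mem_cball)
  have zh: "zh \<in> ?B" using R by simp
  let ?p1 = "a * (norm (zb - b1))\<^sup>2" and ?p2 = "a * (norm (zb - b2))\<^sup>2" and ?p3 = "a * (norm (zb - b3))\<^sup>2"
  have pos: "?p1 \<ge> 0" "?p2 \<ge> 0" "?p3 \<ge> 0" using a by auto
  have mx: "w1 zh + w2 zh + w3 zh + \<psi> zh \<le> w1 b1 + w2 b2 + w3 b3 + \<psi> zb - (?p1 + ?p2 + ?p3)"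
    using max[OF zh zh zh zh] by (simp add: distrib_left)
  have "?p1 + ?p2 + ?p3 \<le> 2 * M"
    using mx abs_le_D1[OF M'(1)[OF b(1)]] abs_le_D1[OF M'(2)[OF b(2)]] abs_le_D1[OF M'(3)[OF b(3)]] abs_le_D1[OF M'(4)[OF b(4)]]
      abs_le_D2[OF M'(1)[OF zh]] abs_le_D2[OF M'(2)[OF zh]] abs_le_D2[OF M'(3)[OF zh]] abs_le_D2[OF M'(4)[OF zh]]
      abs_ge_self[of M1] abs_ge_self[of M2] abs_ge_self[of M3] abs_ge_self[of M4]
    unfolding M_def by argo
  then have lt: "?p1 < a * d\<^sup>2" "?p2 < a * d\<^sup>2" "?p3 < a * d\<^sup>2" using pos unfolding a(2) by linarith+
  have near: "dist b zb < d" if "a * (norm (zb - b))\<^sup>2 < a * d\<^sup>2" for b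
    using that a(1) d(1) by (simp add: dist_norm norm_minus_commute power2_less_imp_less)
  have n: "dist b1 zb < d" "dist b2 zb < d" "dist b3 zb < d" by (intro near lt)+
  have "w1 b1 \<le> w1 zb + \<eta>'" "w2 b2 \<le> w2 zb + \<eta>'" "w3 b3 \<le> w3 zb + \<eta>'"
    by (rule d'(4)[OF b(1,4)], use n d in linarith, rule d'(5)[OF b(2,4)], use n d in linarith, rule d'(6)[OF b(3,4)], use n d in linarith)
  then have sum: "?p1 + ?p2 + ?p3 + \<alpha> * (norm (zb - zh))\<^sup>2 \<le> 3 * \<eta>'" using mx strict[OF b(4)] by linarith
  have n0: "\<alpha> * (norm (zb - zh))\<^sup>2 \<ge> 0" using \<alpha> by simp
  have "\<alpha> * (norm (zb - zh))\<^sup>2 \<le> \<alpha> * (\<eta> / 2)\<^sup>2" using sum pos \<eta>'(3) by linarith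
  then have "dist zb zh \<le> \<eta> / 2" using \<alpha> \<eta> by (simp add: dist_norm power2_le_iff_abs_le)
  have "dist b zh \<le> \<eta>" if "dist b zb < d" for b
    using dist_triangle[of b zh zb] that d(5) \<open>dist zb zh \<le> \<eta> / 2\<close> by linarith
  moreover have "?p1 \<le> \<eta>" "?p2 \<le> \<eta>" "?p3 \<le> \<eta>" using sum pos n0 \<eta>'(2) by linarith+
  moreover have "dist zb zh \<le> \<eta>" using \<open>dist zb zh \<le> \<eta> / 2\<close> \<eta> by linarith
  moreover have "dist b1 zh \<le> \<eta>" "dist b2 zh \<le> \<eta>" "dist b3 zh \<le> \<eta>"
    using n \<open>\<And>b. dist b zb < d \<Longrightarrow> dist b zh \<le> \<eta>\<close> by blast+
  moreover have "\<forall>z1\<in>?B. \<forall>z2\<in>?B. \<forall>z3\<in>?B. \<forall>z\<in>?B. ?\<Phi> (z1, z2, z3, z) \<le> ?\<Phi> (b1, b2, b3, zb)"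
    using max by blast
  ultimately show ?thesis using a(1) b unfolding prod.case
    by (intro exI[of _ a] conjI exI[of _ b1] exI[of _ b2] exI[of _ b3] exI[of _ zb])
qed

definition supc :: "real \<Rightarrow> 'e::euclidean_space set \<Rightarrow> ('e \<Rightarrow> real) \<Rightarrow> 'e \<Rightarrow> real" where
  "supc a B w z = (SUP z'\<in>B. w z' - a * (norm (z - z'))\<^sup>2)"

lemma supc_attained:
  assumes "compact B" "B \<noteq> {}" "continuous_on B w"
  shows "\<exists>z'\<in>B. supc a B w z = w z' - a * (norm (z - z'))\<^sup>2 \<and> (\<forall>y\<in>B. w y - a * (norm (z - y))\<^sup>2 \<le> w z' - a * (norm (z - z'))\<^sup>2)"
proof -
  have "continuous_on B (\<lambda>z'. w z' - a * (norm (z - z'))\<^sup>2)" by (intro continuous_intros assms)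
  from continuous_attains_sup[OF assms(1,2) this] obtain z' where z': "z' \<in> B"
    "\<forall>y\<in>B. w y - a * (norm (z - y))\<^sup>2 \<le> w z' - a * (norm (z - z'))\<^sup>2" by blast
  then have "supc a B w z = w z' - a * (norm (z - z'))\<^sup>2"
    unfolding supc_def by (intro cSup_eq_maximum) auto
  with z' show ?thesis by blast
qed

lemma supc_ge:
  assumes "compact B" "continuous_on B w" "y \<in> B"
  shows "w y - a * (norm (z - y))\<^sup>2 \<le> supc a B w z"
  using supc_attained[OF assms(1) _ assms(2), of a z] assms(3) by force

text \<open>Adding \<open>a * (norm z)\<^sup>2\<close> turns the sup-convolution into a supremum of affine functions, i.e. a convex function.\<close>

lemma supc_continuous:
  assumes B: "compact B" "B \<noteq> {}" "continuous_on B w"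
  shows "continuous_on UNIV (supc a B w)"
proof -
  have aff: "w y - a * (norm (z - y))\<^sup>2 + a * (norm z)\<^sup>2 = w y - a * (norm y)\<^sup>2 + 2 * a * (y \<bullet> z)" for y z
    unfolding power2_norm_eq_inner by (simp add: inner_diff_left inner_diff_right inner_commute algebra_simps)
  have "convex_on UNIV (\<lambda>z. supc a B w z + a * (norm z)\<^sup>2)"
  proof (rule convex_onI)
    fix t :: real and x y :: 'a assume t: "0 < t" "t < 1"
    let ?m = "(1 - t) *\<^sub>R x + t *\<^sub>R y"
    obtain z' where z': "z' \<in> B" "supc a B w ?m = w z' - a * (norm (?m - z'))\<^sup>2" using supc_attained[OF B] by blast
    have "supc a B w ?m + a * (norm ?m)\<^sup>2 = w z' - a * (norm z')\<^sup>2 + 2 * a * (z' \<bullet> ?m)"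
      unfolding z'(2) aff ..
    also have "\<dots> = (1 - t) * (w z' - a * (norm (x - z'))\<^sup>2 + a * (norm x)\<^sup>2) + t * (w z' - a * (norm (y - z'))\<^sup>2 + a * (norm y)\<^sup>2)"
      unfolding aff by (simp add: inner_add_right algebra_simps)
    also have "\<dots> \<le> (1 - t) * (supc a B w x + a * (norm x)\<^sup>2) + t * (supc a B w y + a * (norm y)\<^sup>2)"
      using t by (intro add_mono[OF mult_left_mono mult_left_mono] add_right_mono supc_ge[OF B(1,3) z'(1)]) auto
    finally show "supc a B w ?m + a * (norm ?m)\<^sup>2 \<le> (1 - t) * (supc a B w x + a * (norm x)\<^sup>2) + t * (supc a B w y + a * (norm y)\<^sup>2)" .
  qed auto
  from convex_on_continuous[OF open_UNIV this]
  have "continuous_on UNIV (\<lambda>z. (supc a B w z + a * (norm z)\<^sup>2) - a * (norm z)\<^sup>2)"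
    by (rule continuous_on_diff) (intro continuous_intros)
  then show ?thesis by simp
qed

definition supc_near :: "real \<Rightarrow> 'e::euclidean_space set \<Rightarrow> ('e \<Rightarrow> real) \<Rightarrow> 'e \<Rightarrow> 'e \<Rightarrow> real \<Rightarrow> real \<Rightarrow> bool" where
  "supc_near a B w zb b \<gamma> r \<longleftrightarrow> (\<forall>z z'. dist z zb < r \<longrightarrow> z' \<in> B \<longrightarrow>
    (\<forall>y\<in>B. w y - a * (norm (z - y))\<^sup>2 \<le> w z' - a * (norm (z - z'))\<^sup>2) \<longrightarrow> dist z' b < \<gamma>)"

lemma supc_nearD:
  assumes "supc_near a B w zb b \<gamma> r" "dist z zb < r" "z' \<in> B"
    "\<And>y. y \<in> B \<Longrightarrow> w y - a * (norm (z - y))\<^sup>2 \<le> w z' - a * (norm (z - z'))\<^sup>2"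
  shows "dist z' b < \<gamma>"
  using assms unfolding supc_near_def by blast

text \<open>Limits of maximisers are maximisers; a sequence staying away from \<open>b\<close> would
  have a subsequence converging to a second maximiser at \<open>zb\<close>.\<close>

lemma supc_maximiser_near:
  assumes B: "compact B" "continuous_on B w"
    and uniq: "\<And>z'. z' \<in> B \<Longrightarrow> (\<And>y. y \<in> B \<Longrightarrow> w y - a * (norm (zb - y))\<^sup>2 \<le> w z' - a * (norm (zb - z'))\<^sup>2) \<Longrightarrow> z' = b"
    and \<gamma>: "\<gamma> > 0"
  shows "\<exists>r>0. supc_near a B w zb b \<gamma> r"
proof (rule ccontr)
  assume "\<not> ?thesis"
  then have "\<forall>n::nat. \<exists>z z'. dist z zb < 1 / Suc n \<and> z' \<in> B \<and>
    (\<forall>y\<in>B. w y - a * (norm (z - y))\<^sup>2 \<le> w z' - a * (norm (z - z'))\<^sup>2) \<and> dist z' b \<ge> \<gamma>"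
    unfolding supc_near_def
    by (metis divide_pos_pos not_le of_nat_0_less_iff zero_less_Suc zero_less_one)
  then obtain Z Z' where Z: "\<And>n::nat. dist (Z n) zb < 1 / Suc n" "\<And>n. Z' n \<in> B"
    "\<And>n y. y \<in> B \<Longrightarrow> w y - a * (norm (Z n - y))\<^sup>2 \<le> w (Z' n) - a * (norm (Z n - Z' n))\<^sup>2" "\<And>n. dist (Z' n) b \<ge> \<gamma>"
    by metis
  obtain l r where l: "l \<in> B" "strict_mono r" "(Z' \<circ> r) \<longlonglongrightarrow> l"
    using B(1) Z(2) unfolding compact_def by metis
  have "Z \<longlonglongrightarrow> zb"
    by (rule metric_tendsto_imp_tendsto[OF LIMSEQ_inverse_real_of_nat])
      (use Z(1) in \<open>auto simp: inverse_eq_divide intro!: always_eventually less_imp_le\<close>)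
  then have Zr: "(Z \<circ> r) \<longlonglongrightarrow> zb" using l(2) by (rule LIMSEQ_subseq_LIMSEQ)
  have wl: "(\<lambda>n. w ((Z' \<circ> r) n)) \<longlonglongrightarrow> w l"
    by (rule continuous_on_tendsto_compose[OF B(2) l(3) l(1)]) (use Z(2) in auto)
  have "l = b"
  proof (rule uniq[OF l(1)])
    fix y assume y: "y \<in> B"
    show "w y - a * (norm (zb - y))\<^sup>2 \<le> w l - a * (norm (zb - l))\<^sup>2"
    proof (rule LIMSEQ_le)
      show "(\<lambda>n. w y - a * (norm ((Z \<circ> r) n - y))\<^sup>2) \<longlonglongrightarrow> w y - a * (norm (zb - y))\<^sup>2"
        by (intro tendsto_intros Zr)
      show "(\<lambda>n. w ((Z' \<circ> r) n) - a * (norm ((Z \<circ> r) n - (Z' \<circ> r) n))\<^sup>2) \<longlonglongrightarrow> w l - a * (norm (zb - l))\<^sup>2"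
        by (intro tendsto_intros Zr wl l(3))
    qed (use Z(3)[OF y] in auto)
  qed
  with l(3) have "(\<lambda>n. dist ((Z' \<circ> r) n) b) \<longlonglongrightarrow> 0" using tendsto_dist[OF l(3) tendsto_const[of b]] by simp
  then have "\<gamma> \<le> 0" by (rule LIMSEQ_le_const) (use Z(4) in auto)
  then show False using \<gamma> by simp
qed

text \<open>A test function for the sup-convolution at \<open>z\<close> yields one for \<open>w\<close> at the maximiser \<open>z2\<close>, by letting the
  outer point move as \<open>z + M (z' - z2)\<close>. The gradient does not depend on the linear map \<open>M\<close>, which can thus be
  used to replace the diffusion vectors at \<open>z2\<close> by prescribed ones.\<close>

lemma supc_test_transfer:
  assumes B: "compact B" "continuous_on B w" and g: "C2fun g g' g''" and t: "touch_above (supc a B w) z g"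
    and z2: "ball z2 \<rho> \<subseteq> B" "\<rho> > 0" "\<And>y. y \<in> B \<Longrightarrow> w y - a * (norm (z - y))\<^sup>2 \<le> w z2 - a * (norm (z - z2))\<^sup>2"
    and M: "linear M"
  shows "g' z = (2 * a) *\<^sub>R (z2 - z) \<and> (\<exists>\<zeta> \<zeta>' \<zeta>''. C2fun \<zeta> \<zeta>' \<zeta>'' \<and> touch_above w z2 \<zeta> \<and> \<zeta>' z2 = g' z \<and>
    (\<forall>s. tr2 s \<zeta>'' z2 = 2 * a * (\<Sum>j\<in>UNIV. (norm (M (s j) - s j))\<^sup>2) + tr2 (\<lambda>j. M (s j)) g'' z))"
proof -
  have z2B: "z2 \<in> B" using z2 by auto
  have sc: "supc a B w z = w z2 - a * (norm (z - z2))\<^sup>2"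
  proof -
    obtain z' where "z' \<in> B" "supc a B w z = w z' - a * (norm (z - z'))\<^sup>2" using supc_attained[OF B(1) _ B(2)] z2B by blast
    then show ?thesis using z2(3)[of z'] supc_ge[OF B z2B, of a z] by simp
  qed
  obtain e where e: "e > 0" "\<And>y. dist y z < e \<Longrightarrow> supc a B w y - g y \<le> supc a B w z - g z"
    using t by (auto simp: touch_above_def)
  have "- (2 * a) *\<^sub>R (z - z2) + (-1) *\<^sub>R g' z = 0"
  proof (rule first_order_max[of "\<lambda>y. (-a) * (norm (y - z2))\<^sup>2 + (-1) * g y" "\<lambda>y. - (2 * a) *\<^sub>R (y - z2) + (-1) *\<^sub>R g' y" _ e z])
    show "C2fun (\<lambda>y. - a * (norm (y - z2))\<^sup>2 + - 1 * g y) (\<lambda>y. - (2 * a) *\<^sub>R (y - z2) + - 1 *\<^sub>R g' y)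
      (\<lambda>z h. (2 * (-a)) *\<^sub>R h + (-1) *\<^sub>R g'' z h)"
      using C2fun_add[OF C2fun_quad[of "-a" z2] C2fun_cmul[OF g, of "-1"]] by simp
    fix y assume "y \<in> ball z e"
    then have "supc a B w y - g y \<le> supc a B w z - g z" by (intro e(2)) (simp add: dist_commute)
    then show "- a * (norm (y - z2))\<^sup>2 + - 1 * g y \<le> - a * (norm (z - z2))\<^sup>2 + - 1 * g z"
      using supc_ge[OF B z2B, of a y] sc by simp
  qed (use e in auto)
  then have g'z: "g' z = (2 * a) *\<^sub>R (z2 - z)" by (simp add: algebra_simps)
  \<comment> \<open>The outer point moves as \<open>z + M (y - z2)\<close> while the inner point
    moves as \<open>y\<close>; the penalty sees the difference of the two motions.\<close>
  define N where "N = (\<lambda>h. M h - h)"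
  have N: "linear N" unfolding N_def by (intro linear_compose_sub M linear_ident)
  note C = C2fun_add[OF C2fun_affine[OF g M, of z z2] C2fun_affine[OF C2fun_quad[of a 0] N, of "z - z2" z2]]
  let ?\<zeta> = "\<lambda>y. g (z + M (y - z2)) + a * (norm (z - z2 + N (y - z2) - 0))\<^sup>2"
  have "touch_above w z2 ?\<zeta>"
  proof -
    have "continuous (at z2) (\<lambda>y. z + M (y - z2))"
    proof -
      have "isCont M (z2 - z2)" using M by (intro linear_continuous_at) (simp add: linear_conv_bounded_linear)
      from isCont_o2[where f = "\<lambda>y. y - z2" and g = M and a = z2, OF _ this] have "isCont (\<lambda>y. M (y - z2)) z2" by simp
      then show ?thesis by (intro continuous_add continuous_const)
    qed
    then obtain d where d: "d > 0" "\<And>y. dist y z2 < d \<Longrightarrow> dist (z + M (y - z2)) (z + M (z2 - z2)) < e"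
      unfolding continuous_at_eps_delta using e(1) by meson
    show ?thesis unfolding touch_above_def
    proof (intro exI[of _ "min d \<rho>"] conjI allI impI)
      fix y assume y: "dist y z2 < min d \<rho>"
      let ?x = "z + M (y - z2)"
      have "y \<in> B" using y z2(1) by (auto simp: dist_commute)
      have "norm (?x - y) = norm (z - z2 + N (y - z2))" by (simp add: N_def algebra_simps)
      then have "w y - a * (norm (z - z2 + N (y - z2)))\<^sup>2 \<le> supc a B w ?x" using supc_ge[OF B \<open>y \<in> B\<close>, of a ?x] by simp
      also have "\<dots> \<le> supc a B w z - g z + g ?x" using e(2)[of ?x] d(2)[of y] y linear_0[OF M] by simp
      finally show "w y - ?\<zeta> y \<le> w z2 - ?\<zeta> z2" using sc linear_0[OF M] linear_0[OF N] by simp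
    qed (use d z2 in auto)
  qed
  \<comment> \<open>Since \<open>2 * a\<close> times \<open>z - z2\<close> is \<open>- g' z\<close>,
    the two terms are \<open>adjoint M\<close> and \<open>id - adjoint M\<close> applied to
    \<open>g' z\<close>, and \<open>M\<close> drops out.\<close>
  moreover have "adjoint M (g' (z + M (z2 - z2))) + adjoint N ((2 * a) *\<^sub>R (z - z2 + N (z2 - z2) - 0)) = g' z"
  proof (rule vector_eq_ldot[THEN iffD1], intro allI)
    fix x
    have "(2 * a) *\<^sub>R (z - z2) = - g' z" by (simp add: g'z algebra_simps)
    then have "x \<bullet> (adjoint M (g' z) + adjoint N ((2 * a) *\<^sub>R (z - z2))) = x \<bullet> g' z"
      by (simp only: inner_add_right adjoint_works[OF M] adjoint_works[OF N]) (simp add: N_def inner_diff_left)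
    then show "x \<bullet> (adjoint M (g' (z + M (z2 - z2))) + adjoint N ((2 * a) *\<^sub>R (z - z2 + N (z2 - z2) - 0))) = x \<bullet> g' z"
      using linear_0[OF M] linear_0[OF N] by simp
  qed
  moreover have "tr2 s (\<lambda>y h. adjoint M (g'' (z + M (y - z2)) (M h)) + adjoint N ((2 * a) *\<^sub>R N h)) z2
      = 2 * a * (\<Sum>j\<in>UNIV. (norm (M (s j) - s j))\<^sup>2) + tr2 (\<lambda>j. M (s j)) g'' z" for s :: "'b::finite \<Rightarrow> 'a"
    using linear_0[OF M] unfolding tr2_def
    by (simp add: inner_add_right adjoint_works[OF M] adjoint_works[OF N] sum.distrib sum_distrib_left power2_norm_eq_inner)
       (simp add: N_def)
  ultimately show ?thesis using C g'z by (intro conjI exI) (assumption | blast)+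
qed


text \<open>In \<open>C2fun\<close> the continuity of \<open>H z h\<close> in \<open>z\<close> is
  given for each fixed \<open>h\<close>. Expanding \<open>h\<close> along the basis makes it joint,
  and compactness makes it uniform.\<close>

lemma tr2_cont:
  fixes zh :: "'e::euclidean_space"
  assumes C: "C2fun f f' H" and \<gamma>: "\<gamma> > 0"
  shows "\<exists>d>0. \<forall>z (s :: 'j::finite \<Rightarrow> 'e) s'. dist z zh < d \<longrightarrow> (\<forall>j. norm (s j) \<le> K \<and> norm (s' j) \<le> K \<and> dist (s j) (s' j) < d)
    \<longrightarrow> \<bar>tr2 s H z - tr2 s' H zh\<bar> \<le> \<gamma>"
proof -
  let ?N = "real CARD('j)"
  have N: "?N \<ge> 1" by (simp add: Suc_leI)
  let ?S = "cball zh 1 \<times> cball (0::'e) K"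
  have lin: "H z x = (\<Sum>i\<in>Basis. (x \<bullet> i) *\<^sub>R H z i)" for z x
    using linear_sum[OF C2fun_linear[OF C, of z], of "\<lambda>i. (x \<bullet> i) *\<^sub>R i" Basis]
    by (simp add: euclidean_representation linear_cmul[OF C2fun_linear[OF C]])
  have "continuous_on ?S (\<lambda>w. snd w \<bullet> (\<Sum>i\<in>Basis. (snd w \<bullet> i) *\<^sub>R H (fst w) i))"
    by (intro continuous_intros continuous_on_compose2[OF C2fun_D3[OF C]]) auto
  then have "continuous_on ?S (\<lambda>w. snd w \<bullet> H (fst w) (snd w))" unfolding lin[symmetric] .
  then have "uniformly_continuous_on ?S (\<lambda>w. snd w \<bullet> H (fst w) (snd w))"
    by (rule compact_uniformly_continuous) (intro compact_Times compact_cball)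
  moreover have "\<gamma> / ?N > 0" using \<gamma> N by simp
  ultimately obtain d where d: "d > 0" "\<And>w w'. w \<in> ?S \<Longrightarrow> w' \<in> ?S \<Longrightarrow> dist w' w < d \<Longrightarrow>
      dist (snd w' \<bullet> H (fst w') (snd w')) (snd w \<bullet> H (fst w) (snd w)) < \<gamma> / ?N"
    unfolding uniformly_continuous_on_def by meson
  show ?thesis
  proof (intro exI[of _ "min 1 (d / 2)"] conjI allI impI)
    fix z and s s' :: "'j \<Rightarrow> 'e"
    assume z: "dist z zh < min 1 (d / 2)" and s: "\<forall>j. norm (s j) \<le> K \<and> norm (s' j) \<le> K \<and> dist (s j) (s' j) < min 1 (d / 2)"
    have "\<bar>s j \<bullet> H z (s j) - s' j \<bullet> H zh (s' j)\<bar> \<le> \<gamma> / ?N" for j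
    proof -
      have "dist (z, s j) (zh, s' j) \<le> dist z zh + dist (s j) (s' j)"
        unfolding dist_Pair_Pair by (rule sqrt_sum_squares_le_sum) auto
      also have "\<dots> < d" using z s[rule_format, of j] by linarith
      finally show ?thesis using d(2)[of "(zh, s' j)" "(z, s j)"] z s[rule_format, of j]
        by (simp add: dist_commute dist_real_def)
    qed
    then have "\<bar>tr2 s H z - tr2 s' H zh\<bar> \<le> (\<Sum>j\<in>(UNIV::'j set). \<gamma> / ?N)"
      unfolding tr2_def sum_subtractf[symmetric] by (intro order_trans[OF sum_abs sum_mono])
    then show "\<bar>tr2 s H z - tr2 s' H zh\<bar> \<le> \<gamma>" using N by simp
  qed (use d in auto)
qed

section \<open>Families of equations indexed by \<open>\<theta>\<close>, and a substitute for the
  theorem on sums\<close>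

definition equi :: "('th \<Rightarrow> 'e::metric_space \<Rightarrow> 'e \<Rightarrow> real) \<Rightarrow> 'e set \<Rightarrow> bool" where
  "equi G S \<longleftrightarrow> (\<forall>z\<in>S. \<forall>p. \<forall>\<gamma>>0. \<exists>d>0. \<forall>\<theta> z' p'. z' \<in> S \<longrightarrow> dist z' z < d \<longrightarrow> dist p' p < d \<longrightarrow> \<bar>G \<theta> z' p' - G \<theta> z p\<bar> \<le> \<gamma>)"

lemma equiD:
  assumes "equi G S" "z \<in> S" "\<gamma> > 0"
  shows "\<exists>d>0. \<forall>\<theta> z' p'. z' \<in> S \<longrightarrow> dist z' z < d \<longrightarrow> dist p' p < d \<longrightarrow> \<bar>G \<theta> z' p' - G \<theta> z p\<bar> \<le> \<gamma>"
  using assms unfolding equi_def by blast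

text \<open>An upper bound for a supremum is a bound for every \<open>\<theta>\<close>. The
  predicate \<open>\<Gamma>\<close> records what is known about gradients of test functions, such as
  Lipschitz bounds; \<open>sum_principle\<close> returns it for the three gradients that it
  produces.\<close>

definition sub_at :: "('th \<Rightarrow> 'e::euclidean_space \<Rightarrow> 'j::finite \<Rightarrow> 'e) \<Rightarrow> ('th \<Rightarrow> 'e \<Rightarrow> 'e \<Rightarrow> real) \<Rightarrow> ('e \<Rightarrow> bool) \<Rightarrow> 'e set \<Rightarrow> ('e \<Rightarrow> real) \<Rightarrow> bool" where
  "sub_at \<sigma> G \<Gamma> S w \<longleftrightarrow> (\<forall>h h' h'' z. C2fun h h' h'' \<longrightarrow> z \<in> S \<longrightarrow> touch_above w z h \<longrightarrow>
     \<Gamma> (h' z) \<and> (\<forall>\<theta>. G \<theta> z (h' z) \<le> tr2 (\<sigma> \<theta> z) h'' z))"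

text \<open>Here \<open>w\<close> is minus a supersolution, so test functions touch from above as
  well. A lower bound for a supremum over an arbitrary parameter set provides an almost maximising
  \<open>\<theta>\<close> for each \<open>\<gamma>\<close>, not a maximising one.\<close>

definition super_neg_at :: "('th \<Rightarrow> 'e::euclidean_space \<Rightarrow> 'j::finite \<Rightarrow> 'e) \<Rightarrow> ('th \<Rightarrow> 'e \<Rightarrow> 'e \<Rightarrow> real) \<Rightarrow> ('e \<Rightarrow> bool) \<Rightarrow> 'e set \<Rightarrow> ('e \<Rightarrow> real) \<Rightarrow> bool" where
  "super_neg_at \<sigma> G \<Gamma> S w \<longleftrightarrow> (\<forall>h h' h'' z. C2fun h h' h'' \<longrightarrow> z \<in> S \<longrightarrow> touch_above w z h \<longrightarrow>
     \<Gamma> (h' z) \<and> (\<forall>\<gamma>>0. \<exists>\<theta>. tr2 (\<sigma> \<theta> z) h'' z + G \<theta> z (h' z) \<ge> - \<gamma>))"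

text \<open>The constant \<open>\<kappa>\<close> bounds the squared distance between the diffusion vectors at the nearby points involved.\<close>

lemma supc_visc_const:
  fixes \<sigma> :: "'th \<Rightarrow> 'e::euclidean_space \<Rightarrow> 'j::finite \<Rightarrow> 'e"
  assumes B: "compact B" "continuous_on B w" and ne: "B \<noteq> {}" and sub: "sub_at \<sigma> G \<Gamma> S w" and S: "open S" "S \<subseteq> B"
    and a: "a > 0"
    and near: "\<And>z z'. dist z zb < r \<Longrightarrow> z' \<in> B \<Longrightarrow> (\<And>y. y \<in> B \<Longrightarrow> w y - a * (norm (z - y))\<^sup>2 \<le> w z' - a * (norm (z - z'))\<^sup>2)
       \<Longrightarrow> z' \<in> S \<and> dist z' b < \<zeta>"
    and G: "\<And>z z'. dist z zb < r \<Longrightarrow> z' \<in> S \<Longrightarrow> dist z' b < \<zeta> \<Longrightarrow> G \<theta> z' ((2 * a) *\<^sub>R (z' - z)) \<ge> c"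
    and s: "\<And>z'. z' \<in> S \<Longrightarrow> \<exists>M. linear M \<and> (\<forall>j. M (\<sigma> \<theta> z' j) = s j)"
      "\<And>z' j. z' \<in> S \<Longrightarrow> dist z' b < \<zeta> \<Longrightarrow> (norm (s j - \<sigma> \<theta> z' j))\<^sup>2 \<le> \<kappa>"
  shows "visc_const s (c - 2 * a * (real CARD('j) * \<kappa>)) (ball zb r) (supc a B w)"
  unfolding visc_const_def
proof (intro allI impI)
  fix g g' g'' z assume g: "C2fun g g' g''" and z: "z \<in> ball zb r" and t: "touch_above (supc a B w) z g"
  have zr: "dist z zb < r" using z by (simp add: dist_commute)
  show "c - 2 * a * (real CARD('j) * \<kappa>) \<le> tr2 s g'' z"
  proof -
    obtain z2 where z2: "z2 \<in> B" "\<And>y. y \<in> B \<Longrightarrow> w y - a * (norm (z - y))\<^sup>2 \<le> w z2 - a * (norm (z - z2))\<^sup>2"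
      using supc_attained[OF B(1) ne B(2)] by blast
    have z2S: "z2 \<in> S" "dist z2 b < \<zeta>" using near[OF zr z2] by auto
    obtain \<rho> where \<rho>: "\<rho> > 0" "ball z2 \<rho> \<subseteq> B" using S z2S(1) by (meson open_contains_ball order_trans)
    \<comment> \<open>This map carries the diffusion vectors at \<open>z2\<close> to the prescribed
      \<open>s\<close>; the transferred test function pays \<open>2 * a\<close> times the sum of the
      squared displacements, each at most \<open>\<kappa>\<close>.\<close>
    obtain M where M: "linear M" "\<And>j. M (\<sigma> \<theta> z2 j) = s j" using s(1)[OF z2S(1)] by blast
    from supc_test_transfer[OF B g t \<rho>(2,1) z2(2) M(1)] obtain h h' h'' where
      g'z: "g' z = (2 * a) *\<^sub>R (z2 - z)" and h: "C2fun h h' h''" "touch_above w z2 h" "h' z2 = g' z"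
      "tr2 (\<sigma> \<theta> z2) h'' z2 = 2 * a * (\<Sum>j\<in>UNIV. (norm (M (\<sigma> \<theta> z2 j) - \<sigma> \<theta> z2 j))\<^sup>2) + tr2 (\<lambda>j. M (\<sigma> \<theta> z2 j)) g'' z"
      by blast
    have "c \<le> G \<theta> z2 (h' z2)" unfolding h(3) g'z by (rule G[OF zr z2S])
    also have "\<dots> \<le> tr2 (\<sigma> \<theta> z2) h'' z2" using sub h z2S(1) unfolding sub_at_def by blast
    also have "\<dots> = 2 * a * (\<Sum>j\<in>UNIV. (norm (s j - \<sigma> \<theta> z2 j))\<^sup>2) + tr2 s g'' z" unfolding h(4) M(2) ..
    also have "(\<Sum>j\<in>UNIV. (norm (s j - \<sigma> \<theta> z2 j))\<^sup>2) \<le> (\<Sum>j\<in>(UNIV :: 'j set). \<kappa>)"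
      by (rule sum_mono) (rule s(2)[OF z2S])
    finally show ?thesis using a by (simp add: mult_left_mono)
  qed
qed

text \<open>Only \<open>w1\<close> is tested, against the mollification \<open>P\<close> of the sum
  of the sup-convolutions of \<open>w2\<close> and \<open>w3\<close>. This test yields
  \<open>\<theta>\<close>. For this \<open>\<theta>\<close> both sup-convolutions satisfy equations
  with coefficients frozen at the contact point of \<open>w1\<close>, which bounds the second-order
  operator on \<open>P\<close> from below. The gradients \<open>p1\<close>, \<open>p2\<close>,
  \<open>p3\<close> are penalty gradients at the maximum point, so their sum is controlled by
  \<open>\<phi>'\<close>.\<close>

lemma sum_principle:
  fixes \<sigma> :: "'th \<Rightarrow> 'e::euclidean_space \<Rightarrow> 'j::finite \<Rightarrow> 'e"
  assumes R: "R > 0"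
    and c: "continuous_on (cball zh R) w1" "continuous_on (cball zh R) w2" "continuous_on (cball zh R) w3"
    and \<phi>: "C2fun \<phi> \<phi>' \<phi>''"
    and max: "\<And>z. z \<in> cball zh R \<Longrightarrow> w1 z + w2 z + w3 z + \<phi> z \<le> w1 zh + w2 zh + w3 zh + \<phi> zh"
    and sup1: "super_neg_at \<sigma> G1 \<Gamma>1 (ball zh R) w1" and sub2: "sub_at \<sigma> G2 \<Gamma>2 (ball zh R) w2"
    and sub3: "sub_at \<sigma> G3 \<Gamma>3 (ball zh R) w3"
    and K: "K > 0" "\<And>\<theta> j z. z \<in> ball zh R \<Longrightarrow> norm (\<sigma> \<theta> z j) \<le> K"
      "\<And>\<theta> j z z'. z \<in> ball zh R \<Longrightarrow> z' \<in> ball zh R \<Longrightarrow> norm (\<sigma> \<theta> z j - \<sigma> \<theta> z' j) \<le> K * dist z z'"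
    and trans: "\<And>\<theta> z z'. z \<in> ball zh R \<Longrightarrow> z' \<in> ball zh R \<Longrightarrow> \<exists>M. linear M \<and> (\<forall>j. M (\<sigma> \<theta> z j) = \<sigma> \<theta> z' j)"
    and nz: "\<And>\<theta> z. z \<in> ball zh R \<Longrightarrow> \<exists>j. \<sigma> \<theta> z j \<noteq> 0"
    and G: "equi G1 (ball zh R)" "equi G2 (ball zh R)" "equi G3 (ball zh R)"
    and \<gamma>: "\<gamma> > 0"
  shows "\<exists>\<theta> z1 z2 z3 p1 p2 p3. dist z1 zh < \<gamma> \<and> dist z2 zh < \<gamma> \<and> dist z3 zh < \<gamma> \<and> \<Gamma>1 p1 \<and> \<Gamma>2 p2 \<and> \<Gamma>3 p3 \<and>
    norm (p1 + p2 + p3 + \<phi>' zh) < \<gamma> \<and>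
    G1 \<theta> z1 p1 - G2 \<theta> z2 p2 - G3 \<theta> z3 p3 - tr2 (\<sigma> \<theta> zh) \<phi>'' zh \<ge> - \<gamma>"
proof -
  let ?N = "real CARD('j)" let ?B = "cball zh R"
  have N: "?N \<ge> 1" by (simp add: Suc_leI)
  have B: "compact ?B" "?B \<noteq> {}" using R by auto
  define \<epsilon> where "\<epsilon> = \<gamma> / 20"
  have \<epsilon>: "\<epsilon> > 0" using \<gamma> by (simp add: \<epsilon>_def)
  \<comment> \<open>Two quadratic terms with coefficient \<open>\<alpha>\<close> are subtracted, one
    around \<open>zh\<close> and later one around \<open>zb\<close>; together they change the trace
    by at most \<open>4 * \<alpha> * (?N * K\<^sup>2)\<close>.\<close>
  define \<alpha> where "\<alpha> = \<epsilon> / (4 * ?N * K\<^sup>2)"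
  have \<alpha>: "\<alpha> > 0" "4 * \<alpha> * (?N * K\<^sup>2) \<le> \<epsilon>" using \<epsilon> N K(1) by (auto simp: \<alpha>_def)
  define \<psi> where "\<psi> = (\<lambda>z. \<phi> z + (- \<alpha>) * (norm (z - zh))\<^sup>2)"
  define \<psi>' where "\<psi>' = (\<lambda>z. \<phi>' z + (2 * (- \<alpha>)) *\<^sub>R (z - zh))"
  define \<psi>'' where "\<psi>'' = (\<lambda>z h. \<phi>'' z h + (2 * (- \<alpha>)) *\<^sub>R h)"
  have \<psi>: "C2fun \<psi> \<psi>' \<psi>''" unfolding \<psi>_def \<psi>'_def \<psi>''_def by (rule C2fun_add[OF \<phi> C2fun_quad])
  have strict: "w1 z + w2 z + w3 z + \<psi> z \<le> w1 zh + w2 zh + w3 zh + \<psi> zh - \<alpha> * (norm (z - zh))\<^sup>2" if "z \<in> ?B" for z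
    using max[OF that] by (simp add: \<psi>_def)
  obtain d0 where d0: "d0 > 0" "\<And>z (s :: 'j \<Rightarrow> 'e) s'. dist z zh < d0 \<Longrightarrow> (\<And>j. norm (s j) \<le> K \<and> norm (s' j) \<le> K \<and> dist (s j) (s' j) < d0)
      \<Longrightarrow> \<bar>tr2 s \<phi>'' z - tr2 s' \<phi>'' zh\<bar> \<le> \<epsilon>"
    using tr2_cont[OF \<phi> \<epsilon>, of zh K, where 'j = 'j] by blast
  have "continuous (at zh) \<psi>'" using C2fun_cont1[OF \<psi>, of UNIV] by (simp add: continuous_on_eq_continuous_at)
  then obtain d1 where d1: "d1 > 0" "\<And>z. dist z zh < d1 \<Longrightarrow> dist (\<psi>' z) (\<psi>' zh) < \<gamma>"
    unfolding continuous_at_eps_delta using \<gamma> by meson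
  \<comment> \<open>The last entry bounds the cost of freezing: squared displacements of the
    diffusion vectors are at most \<open>K\<^sup>2 * (16 * \<eta> / a)\<close>, and the factor
    \<open>2 * a\<close> cancels the large parameter.\<close>
  have "\<forall>x\<in>set [R / 4, d0 / 4, d0 / (4 * K), d1 / 2, \<gamma> / 2, \<epsilon> / (32 * ?N * K\<^sup>2)]. 0 < x"
    using R d0(1) d1(1) K(1) N \<gamma> \<epsilon> by (auto intro!: divide_pos_pos mult_pos_pos)
  from small_positive[OF this, unfolded list.set ball_simps] obtain \<eta> where \<eta>: "\<eta> > 0" "\<eta> \<le> R / 4" "\<eta> \<le> d0 / 4" "\<eta> \<le> d0 / (4 * K)" "\<eta> \<le> d1 / 2" "\<eta> \<le> \<gamma> / 2" "\<eta> \<le> \<epsilon> / (32 * ?N * K\<^sup>2)"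
    by blast
  from penalised_maximum[OF R c C2fun_cont[OF \<psi>] \<alpha>(1) strict \<eta>(1)]
  obtain a b1 b2 b3 zb where a: "a > 0" and b: "b1 \<in> ?B" "b2 \<in> ?B" "b3 \<in> ?B" "zb \<in> ?B"
    and mx: "\<And>z1 z2 z3 z. z1 \<in> ?B \<Longrightarrow> z2 \<in> ?B \<Longrightarrow> z3 \<in> ?B \<Longrightarrow> z \<in> ?B \<Longrightarrow>
        w1 z1 + w2 z2 + w3 z3 + \<psi> z - a * ((norm (z - z1))\<^sup>2 + (norm (z - z2))\<^sup>2 + (norm (z - z3))\<^sup>2)
        \<le> w1 b1 + w2 b2 + w3 b3 + \<psi> zb - a * ((norm (zb - b1))\<^sup>2 + (norm (zb - b2))\<^sup>2 + (norm (zb - b3))\<^sup>2)"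
    and pen: "a * (norm (zb - b1))\<^sup>2 \<le> \<eta>" "a * (norm (zb - b2))\<^sup>2 \<le> \<eta>" "a * (norm (zb - b3))\<^sup>2 \<le> \<eta>"
    and nearb: "dist zb zh \<le> \<eta>" "dist b1 zh \<le> \<eta>" "dist b2 zh \<le> \<eta>" "dist b3 zh \<le> \<eta>"
    by blast
  \<comment> \<open>The first-order condition at \<open>zb\<close> determines each of the three
    points from the other two. This gives the uniqueness of the maximisers that
    \<open>supc_maximiser_near\<close> asks for.\<close>
  have foc: "(2 * a) *\<^sub>R (z1 - zb) + (2 * a) *\<^sub>R (z2 - zb) + (2 * a) *\<^sub>R (z3 - zb) + \<psi>' zb = 0"
    if "\<And>z. z \<in> ?B \<Longrightarrow> \<psi> z - a * ((norm (z - z1))\<^sup>2 + (norm (z - z2))\<^sup>2 + (norm (z - z3))\<^sup>2)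
      \<le> \<psi> zb - a * ((norm (zb - z1))\<^sup>2 + (norm (zb - z2))\<^sup>2 + (norm (zb - z3))\<^sup>2)" for z1 z2 z3
  proof -
    note C = C2fun_add[OF C2fun_add[OF C2fun_quad[of "-a" z1] C2fun_quad[of "-a" z2]] C2fun_add[OF C2fun_quad[of "-a" z3] \<psi>]]
    have "(2 * (-a)) *\<^sub>R (zb - z1) + (2 * (-a)) *\<^sub>R (zb - z2) + ((2 * (-a)) *\<^sub>R (zb - z3) + \<psi>' zb) = 0"
    proof (rule first_order_max[OF C, of "R / 2"])
      fix z assume "z \<in> ball zb (R / 2)"
      then have "z \<in> ?B" using nearb(1) \<eta>(2) R dist_triangle[of zh z zb] by (auto simp: dist_commute)
      from that[OF this] show "- a * (norm (z - z1))\<^sup>2 + - a * (norm (z - z2))\<^sup>2 + (- a * (norm (z - z3))\<^sup>2 + \<psi> z)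
         \<le> - a * (norm (zb - z1))\<^sup>2 + - a * (norm (zb - z2))\<^sup>2 + (- a * (norm (zb - z3))\<^sup>2 + \<psi> zb)"
        by (simp add: algebra_simps)
    qed (use R in auto)
    then show ?thesis by (simp add: algebra_simps)
  qed
  have focb: "(2 * a) *\<^sub>R (b1 - zb) + (2 * a) *\<^sub>R (b2 - zb) + (2 * a) *\<^sub>R (b3 - zb) + \<psi>' zb = 0"
    by (rule foc) (use mx[OF b(1-3)] in simp)
  have cancel: "(2 * a) *\<^sub>R x = (2 * a) *\<^sub>R y \<Longrightarrow> x = y" for x y :: 'e using a by simp
  have u1: "z' = b1" if z': "z' \<in> ?B" and "\<And>y. y \<in> ?B \<Longrightarrow> w1 y - a * (norm (zb - y))\<^sup>2 \<le> w1 z' - a * (norm (zb - z'))\<^sup>2" for z'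
  proof -
    have "(2 * a) *\<^sub>R (z' - zb) + (2 * a) *\<^sub>R (b2 - zb) + (2 * a) *\<^sub>R (b3 - zb) + \<psi>' zb = 0"
      by (rule foc) (use mx[OF z' b(2,3)] that(2)[OF b(1)] in \<open>fastforce simp: distrib_left\<close>)
    with focb have "(2 * a) *\<^sub>R (z' - zb) = (2 * a) *\<^sub>R (b1 - zb)" by (metis add_right_cancel)
    then show ?thesis using cancel by fastforce
  qed
  have u2: "z' = b2" if z': "z' \<in> ?B" and "\<And>y. y \<in> ?B \<Longrightarrow> w2 y - a * (norm (zb - y))\<^sup>2 \<le> w2 z' - a * (norm (zb - z'))\<^sup>2" for z'
  proof -
    have "(2 * a) *\<^sub>R (b1 - zb) + (2 * a) *\<^sub>R (z' - zb) + (2 * a) *\<^sub>R (b3 - zb) + \<psi>' zb = 0"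
      by (rule foc) (use mx[OF b(1) z' b(3)] that(2)[OF b(2)] in \<open>fastforce simp: distrib_left\<close>)
    with focb have "(2 * a) *\<^sub>R (z' - zb) = (2 * a) *\<^sub>R (b2 - zb)" by (metis add_right_cancel add_left_cancel)
    then show ?thesis using cancel by fastforce
  qed
  have u3: "z' = b3" if z': "z' \<in> ?B" and "\<And>y. y \<in> ?B \<Longrightarrow> w3 y - a * (norm (zb - y))\<^sup>2 \<le> w3 z' - a * (norm (zb - z'))\<^sup>2" for z'
  proof -
    have "(2 * a) *\<^sub>R (b1 - zb) + (2 * a) *\<^sub>R (b2 - zb) + (2 * a) *\<^sub>R (z' - zb) + \<psi>' zb = 0"
      by (rule foc) (use mx[OF b(1,2) z'] that(2)[OF b(3)] in \<open>fastforce simp: distrib_left\<close>)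
    with focb have "(2 * a) *\<^sub>R (z' - zb) = (2 * a) *\<^sub>R (b3 - zb)" by (metis add_right_cancel add_left_cancel)
    then show ?thesis using cancel by fastforce
  qed
  have inb: "z \<in> ball zh R" if "dist z b < R / 4" "dist b zh \<le> \<eta>" for z b
    using that dist_triangle[of z zh b] \<eta>(2) R by (simp add: dist_commute)
  have bb: "b1 \<in> ball zh R" "b2 \<in> ball zh R" "b3 \<in> ball zh R" "zb \<in> ball zh R"
    using nearb \<eta>(2) R by (auto simp: dist_commute)
  let ?p1 = "(2 * a) *\<^sub>R (b1 - zb)" and ?p2 = "(2 * a) *\<^sub>R (b2 - zb)" and ?p3 = "(2 * a) *\<^sub>R (b3 - zb)"
  obtain e1 where e1: "e1 > 0" "\<And>\<theta> z' p'. z' \<in> ball zh R \<Longrightarrow> dist z' b1 < e1 \<Longrightarrow> dist p' ?p1 < e1 \<Longrightarrow> \<bar>G1 \<theta> z' p' - G1 \<theta> b1 ?p1\<bar> \<le> \<epsilon>"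
    using equiD[OF G(1) bb(1) \<epsilon>, of ?p1] by blast
  obtain e2 where e2: "e2 > 0" "\<And>\<theta> z' p'. z' \<in> ball zh R \<Longrightarrow> dist z' b2 < e2 \<Longrightarrow> dist p' ?p2 < e2 \<Longrightarrow> \<bar>G2 \<theta> z' p' - G2 \<theta> b2 ?p2\<bar> \<le> \<epsilon>"
    using equiD[OF G(2) bb(2) \<epsilon>, of ?p2] by blast
  obtain e3 where e3: "e3 > 0" "\<And>\<theta> z' p'. z' \<in> ball zh R \<Longrightarrow> dist z' b3 < e3 \<Longrightarrow> dist p' ?p3 < e3 \<Longrightarrow> \<bar>G3 \<theta> z' p' - G3 \<theta> b3 ?p3\<bar> \<le> \<epsilon>"
    using equiD[OF G(3) bb(3) \<epsilon>, of ?p3] by blast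
  have "\<forall>x\<in>set [R / 4, e1, e2, e3, e1 / (4 * a), e2 / (4 * a), e3 / (4 * a), sqrt (\<eta> / a), d0 / (4 * K)]. 0 < x"
    using R e1(1) e2(1) e3(1) a \<eta>(1) d0(1) K(1) by (auto intro!: divide_pos_pos mult_pos_pos)
  from small_positive[OF this, unfolded list.set ball_simps] obtain \<zeta> where \<zeta>: "\<zeta> > 0" "\<zeta> \<le> R / 4" "\<zeta> \<le> e1" "\<zeta> \<le> e2" "\<zeta> \<le> e3" "\<zeta> \<le> e1 / (4 * a)" "\<zeta> \<le> e2 / (4 * a)" "\<zeta> \<le> e3 / (4 * a)" "\<zeta> \<le> sqrt (\<eta> / a)"
      "\<zeta> \<le> d0 / (4 * K)"
    by blast
  have \<zeta>2: "a * \<zeta>\<^sup>2 \<le> \<eta>"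
  proof -
    have "\<zeta>\<^sup>2 \<le> (sqrt (\<eta> / a))\<^sup>2" using \<zeta>(1,9) by (intro power_mono) auto
    then show ?thesis using a \<eta>(1) by (simp add: field_simps)
  qed
  obtain r1 where r1: "r1 > 0" "supc_near a ?B w1 zb b1 \<zeta> r1"
    using supc_maximiser_near[OF B(1) c(1) u1 \<zeta>(1)] by blast
  obtain r2 where r2: "r2 > 0" "supc_near a ?B w2 zb b2 \<zeta> r2"
    using supc_maximiser_near[OF B(1) c(2) u2 \<zeta>(1)] by blast
  obtain r3 where r3: "r3 > 0" "supc_near a ?B w3 zb b3 \<zeta> r3"
    using supc_maximiser_near[OF B(1) c(3) u3 \<zeta>(1)] by blast
  have "\<forall>x\<in>set [r1, r2, r3, \<zeta>, R / 4, d0 / 4]. 0 < x"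
    using r1(1) r2(1) r3(1) \<zeta>(1) R d0(1) by (auto intro!: divide_pos_pos mult_pos_pos)
  from small_positive[OF this, unfolded list.set ball_simps] obtain r where r: "r > 0" "r \<le> r1" "r \<le> r2" "r \<le> r3" "r \<le> \<zeta>" "r \<le> R / 4" "r \<le> d0 / 4"
    by blast
  have pclose: "dist ((2 * a) *\<^sub>R (z' - z)) ((2 * a) *\<^sub>R (b - zb)) < e" if "dist z' b < \<zeta>" "dist z zb < r" "\<zeta> \<le> e / (4 * a)" for z' b z e
  proof -
    have "dist ((2 * a) *\<^sub>R (z' - z)) ((2 * a) *\<^sub>R (b - zb)) = 2 * a * norm ((z' - b) - (z - zb))"
    proof -
      have eq: "(2 * a) *\<^sub>R (z' - z) - (2 * a) *\<^sub>R (b - zb) = (2 * a) *\<^sub>R ((z' - b) - (z - zb))"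
        by (simp add: scaleR_diff_right)
      show ?thesis unfolding dist_norm eq norm_scaleR using a by simp
    qed
    also have "\<dots> \<le> 2 * a * (dist z' b + dist z zb)"
      using a norm_triangle_ineq4[of "z' - b" "z - zb"] by (simp add: dist_norm)
    also have "\<dots> < 2 * a * (\<zeta> + \<zeta>)" using a that r(5) by (intro mult_strict_left_mono) auto
    also have "\<dots> \<le> e" using that(3) a by (simp add: field_simps)
    finally show ?thesis .
  qed
  let ?A = "supc a ?B w1" and ?W = "supc a ?B w2" and ?V = "supc a ?B w3"
  have cA: "continuous_on UNIV ?A" and cW: "continuous_on UNIV ?W" and cV: "continuous_on UNIV ?V"
    by (rule supc_continuous[OF B c(1)], rule supc_continuous[OF B c(2)], rule supc_continuous[OF B c(3)])
  have top: "?A z + ?W z + ?V z + \<psi> z \<le> ?A zb + ?W zb + ?V zb + \<psi> zb" if z: "z \<in> ?B" for z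
  proof -
    obtain z1 z2 z3 where z123: "z1 \<in> ?B" "?A z = w1 z1 - a * (norm (z - z1))\<^sup>2" "z2 \<in> ?B" "?W z = w2 z2 - a * (norm (z - z2))\<^sup>2"
      "z3 \<in> ?B" "?V z = w3 z3 - a * (norm (z - z3))\<^sup>2"
      using supc_attained[OF B c(1)] supc_attained[OF B c(2)] supc_attained[OF B c(3)] by meson
    have "?A z + ?W z + ?V z + \<psi> z \<le> (w1 b1 - a * (norm (zb - b1))\<^sup>2) + (w2 b2 - a * (norm (zb - b2))\<^sup>2) + (w3 b3 - a * (norm (zb - b3))\<^sup>2) + \<psi> zb"
      using mx[OF z123(1,3,5) z] unfolding z123(2,4,6) by (simp add: distrib_left)
    also have "\<dots> \<le> ?A zb + ?W zb + ?V zb + \<psi> zb"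
      by (intro add_mono supc_ge B c b order_refl)
    finally show ?thesis .
  qed
  \<comment> \<open>Twice the mollification error stays below what the quadratic term around
    \<open>zb\<close> takes away on the sphere of radius \<open>r / 8\<close>, so the maximum point
    \<open>zf\<close> lies inside.\<close>
  define \<eta>2 where "\<eta>2 = \<alpha> * (r / 8)\<^sup>2 / 4"
  have \<eta>2: "\<eta>2 > 0" "2 * \<eta>2 < \<alpha> * (r / 8)\<^sup>2" using \<alpha> r(1) by (auto simp: \<eta>2_def)
  obtain P P' P'' where P: "C2fun P P' P''" and Pn: "\<And>z. z \<in> cball zb r \<Longrightarrow> \<bar>P z - (?W z + ?V z)\<bar> \<le> \<eta>2"
    and Ptr: "\<And>(s :: 'j \<Rightarrow> 'e) a b z. (\<exists>i. s i \<noteq> 0) \<Longrightarrow> visc_const s a (ball zb r) ?W \<Longrightarrow> visc_const s b (ball zb r) ?V \<Longrightarrow>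
       z \<in> ball zb (r / 4) \<Longrightarrow> a + b \<le> tr2 s P'' z"
    using mollify_sum[OF cW cV r(1) \<eta>2(1), where 'j = 'j, of zb] by blast
  let ?g = "\<lambda>z. P z + (\<psi> z + (- \<alpha>) * (norm (z - zb))\<^sup>2)"
  let ?g' = "\<lambda>z. P' z + (\<psi>' z + (2 * (- \<alpha>)) *\<^sub>R (z - zb))"
  let ?g'' = "\<lambda>z h. P'' z h + (\<psi>'' z h + (2 * (- \<alpha>)) *\<^sub>R h)"
  have g: "C2fun ?g ?g' ?g''" by (rule C2fun_add[OF P C2fun_add[OF \<psi> C2fun_quad]])
  have ng: "C2fun (\<lambda>z. -1 * ?g z) (\<lambda>z. -1 *\<^sub>R ?g' z) (\<lambda>z h. -1 *\<^sub>R ?g'' z h)" by (rule C2fun_cmul[OF g])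
  have "\<exists>zf\<in>cball zb (r / 8). \<forall>z\<in>cball zb (r / 8). ?A z + ?g z \<le> ?A zf + ?g zf"
    by (rule continuous_attains_sup[OF _ _ continuous_on_add[OF continuous_on_subset[OF cA] C2fun_cont[OF g]]]) (use r(1) in auto)
  then obtain zf where zf: "zf \<in> cball zb (r / 8)" "\<And>z. z \<in> cball zb (r / 8) \<Longrightarrow> ?A z + ?g z \<le> ?A zf + ?g zf" by blast
  have zfB: "zf \<in> ?B"
    using zf(1) nearb(1) \<eta>(2) r(6) R dist_triangle[of zh zf zb] by (auto simp: dist_commute)
  have zf_in: "dist zf zb < r / 8"
  proof (rule ccontr)
    assume "\<not> dist zf zb < r / 8"
    then have eq: "norm (zf - zb) = r / 8" using zf(1) by (simp add: dist_norm norm_minus_commute)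
    have "?A zb + ?g zb \<le> ?A zf + ?g zf" by (rule zf(2)) (use r in auto)
    moreover have "\<bar>P zb - (?W zb + ?V zb)\<bar> \<le> \<eta>2" "\<bar>P zf - (?W zf + ?V zf)\<bar> \<le> \<eta>2"
      by (rule Pn, use r zf(1) in simp)+
    ultimately have "\<alpha> * (norm (zf - zb))\<^sup>2 \<le> 2 * \<eta>2" using top[OF zfB] by (simp add: abs_le_iff)
    then show False unfolding eq using \<eta>2(2) by simp
  qed
  have touch: "touch_above ?A zf (\<lambda>z. -1 * ?g z)"
    unfolding touch_above_def
  proof (intro exI[of _ "r / 8 - dist zf zb"] conjI allI impI)
    fix y assume "dist y zf < r / 8 - dist zf zb"
    then have "y \<in> cball zb (r / 8)" using dist_triangle[of y zb zf] by (simp add: dist_commute)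
    from zf(2)[OF this] show "?A y - -1 * ?g y \<le> ?A zf - -1 * ?g zf" by simp
  qed (use zf_in in auto)
  obtain z1 where z1: "z1 \<in> ?B" "\<And>y. y \<in> ?B \<Longrightarrow> w1 y - a * (norm (zf - y))\<^sup>2 \<le> w1 z1 - a * (norm (zf - z1))\<^sup>2"
    using supc_attained[OF B c(1)] by blast
  have zfr: "dist zf zb < r" using zf_in r(1) by simp
  have z1b: "dist z1 b1 < \<zeta>" by (rule supc_nearD[OF r1(2) _ z1]) (use zfr r in linarith)
  have z1in: "z1 \<in> ball zh R" by (rule inb[OF _ nearb(2)]) (use z1b \<zeta>(2) in linarith)
  obtain \<rho> where \<rho>: "\<rho> > 0" "ball z1 \<rho> \<subseteq> ?B" using z1in by (meson open_ball open_contains_ball ball_subset_cball order_trans)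
  note T = supc_test_transfer[OF B(1) c(1) ng touch \<rho>(2,1) z1(2) linear_ident, where 'b = 'j]
  have h0: "-1 *\<^sub>R ?g' zf = (2 * a) *\<^sub>R (z1 - zf)" by (rule conjunct1[OF T])
  from conjunct2[OF T]
  obtain h h' h'' where h: "C2fun h h' h''" "touch_above w1 z1 h" "h' z1 = -1 *\<^sub>R ?g' zf"
    and htr0: "\<forall>s :: 'j \<Rightarrow> 'e. tr2 s h'' z1 = 2 * a * (\<Sum>j\<in>UNIV. (norm (s j - s j))\<^sup>2) + tr2 s (\<lambda>z h. -1 *\<^sub>R ?g'' z h) zf"
    by blast
  have htr: "tr2 s h'' z1 = tr2 s (\<lambda>z h. -1 *\<^sub>R ?g'' z h) zf" for s :: "'j \<Rightarrow> 'e"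
    using htr0[rule_format, of s] by simp
  obtain \<theta> where \<theta>: "tr2 (\<sigma> \<theta> z1) h'' z1 + G1 \<theta> z1 (h' z1) \<ge> - \<epsilon>"
    using sup1 h(1,2) z1in \<epsilon> unfolding super_neg_at_def by blast
  define s where "s = \<sigma> \<theta> z1"
  have sK: "norm (s j) \<le> K" for j unfolding s_def by (rule K(2)[OF z1in])
  have S2: "(\<Sum>j\<in>UNIV. (norm (s j))\<^sup>2) \<le> ?N * K\<^sup>2"
    using sum_bounded_above[of UNIV "\<lambda>j. (norm (s j))\<^sup>2" "K\<^sup>2"] sK by (simp add: power_mono)
  have G1: "G1 \<theta> z1 (h' z1) \<le> G1 \<theta> b1 ?p1 + \<epsilon>"
  proof -
    have "dist (h' z1) ?p1 < e1" unfolding h(3) h0 by (rule pclose[OF z1b zfr \<zeta>(6)])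
    then show ?thesis using e1(2)[OF z1in, of "h' z1" \<theta>] z1b \<zeta>(3) by (simp add: abs_le_iff)
  qed
  have sq4: "(norm (x + y + u + v))\<^sup>2 \<le> 4 * ((norm x)\<^sup>2 + (norm y)\<^sup>2 + (norm u)\<^sup>2 + (norm v)\<^sup>2)" for x y u v :: 'e
  proof -
    have "norm (x + y + u + v) \<le> norm x + norm y + norm u + norm v"
      by (intro order_trans[OF norm_triangle_ineq] add_mono order_refl)
    then have "(norm (x + y + u + v))\<^sup>2 \<le> (norm x + norm y + norm u + norm v)\<^sup>2" by (intro power_mono) auto
    also have "\<dots> \<le> 4 * ((norm x)\<^sup>2 + (norm y)\<^sup>2 + (norm u)\<^sup>2 + (norm v)\<^sup>2)"
      using sum_squares_ge_zero[of "norm x - norm y" "norm u - norm v"] sum_squares_ge_zero[of "norm x - norm u" "norm y - norm v"]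
        sum_squares_ge_zero[of "norm x - norm v" "norm y - norm u"]
      by (simp add: power2_eq_square algebra_simps)
    finally show ?thesis .
  qed
  \<comment> \<open>The path from \<open>z1\<close> to \<open>z'\<close> runs through
    \<open>b1\<close>, \<open>zb\<close> and \<open>b\<close>; the two middle pieces are controlled
    by the penalties, the outer ones by \<open>\<zeta>\<close>.\<close>
  have \<kappa>: "(norm (s j - \<sigma> \<theta> z' j))\<^sup>2 \<le> K\<^sup>2 * (16 * \<eta> / a)"
    if z': "z' \<in> ball zh R" "dist z' b < \<zeta>" and penb: "a * (norm (zb - b))\<^sup>2 \<le> \<eta>" for z' b j
  proof -
    have "a * (dist z1 z')\<^sup>2 = a * (norm ((z1 - b1) + (b1 - zb) + (zb - b) + (b - z')))\<^sup>2" by (simp add: dist_norm)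
    also have "\<dots> \<le> a * (4 * ((norm (z1 - b1))\<^sup>2 + (norm (b1 - zb))\<^sup>2 + (norm (zb - b))\<^sup>2 + (norm (b - z'))\<^sup>2))"
      using a by (intro mult_left_mono sq4) auto
    also have "\<dots> \<le> a * (4 * (\<zeta>\<^sup>2 + (norm (b1 - zb))\<^sup>2 + (norm (zb - b))\<^sup>2 + \<zeta>\<^sup>2))"
      using a z1b z'(2) by (intro mult_left_mono add_mono power_mono order_refl) (auto simp: dist_norm norm_minus_commute)
    also have "\<dots> \<le> 16 * \<eta>" using \<zeta>2 pen(1) penb by (simp add: distrib_left norm_minus_commute)
    finally have 1: "(dist z1 z')\<^sup>2 \<le> 16 * \<eta> / a" using a by (simp add: field_simps)
    have "(norm (s j - \<sigma> \<theta> z' j))\<^sup>2 \<le> (K * dist z1 z')\<^sup>2"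
      unfolding s_def by (intro power_mono K(3) z1in z') auto
    also have "\<dots> \<le> K\<^sup>2 * (16 * \<eta> / a)" using mult_left_mono[OF 1, of "K\<^sup>2"] by (simp add: power_mult_distrib)
    finally show ?thesis .
  qed
  have err: "2 * a * (?N * (K\<^sup>2 * (16 * \<eta> / a))) \<le> \<epsilon>"
  proof -
    have "2 * a * (?N * (K\<^sup>2 * (16 * \<eta> / a))) = (32 * ?N * K\<^sup>2) * \<eta>" using a by (simp add: field_simps)
    also have "\<dots> \<le> (32 * ?N * K\<^sup>2) * (\<epsilon> / (32 * ?N * K\<^sup>2))" using \<eta>(7) by (intro mult_left_mono) auto
    also have "\<dots> = \<epsilon>" using N K(1) by simp
    finally show ?thesis .
  qed
  have tr1: "\<exists>M. linear M \<and> (\<forall>j. M (\<sigma> \<theta> z' j) = s j)" if "z' \<in> ball zh R" for z'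
    unfolding s_def by (rule trans[OF that z1in])
  have v2: "visc_const s (G2 \<theta> b2 ?p2 - \<epsilon> - 2 * a * (?N * (K\<^sup>2 * (16 * \<eta> / a)))) (ball zb r) ?W"
  proof (rule supc_visc_const[OF B(1) c(2) B(2) sub2 open_ball ball_subset_cball a])
    fix z z' assume z: "dist z zb < r" and z': "z' \<in> ?B" "\<And>y. y \<in> ?B \<Longrightarrow> w2 y - a * (norm (z - y))\<^sup>2 \<le> w2 z' - a * (norm (z - z'))\<^sup>2"
    have "dist z' b2 < \<zeta>" by (rule supc_nearD[OF r2(2) _ z']) (use z r in linarith)
    moreover from this have "z' \<in> ball zh R" by (intro inb[OF _ nearb(3)]) (use \<zeta>(2) in linarith)
    ultimately show "z' \<in> ball zh R \<and> dist z' b2 < \<zeta>" by blast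
  next
    fix z z' assume z: "dist z zb < r" and z': "z' \<in> ball zh R" "dist z' b2 < \<zeta>"
    show "G2 \<theta> b2 ?p2 - \<epsilon> \<le> G2 \<theta> z' ((2 * a) *\<^sub>R (z' - z))"
      using e2(2)[OF z'(1) _ pclose[OF z'(2) z \<zeta>(7)], of \<theta>] z'(2) \<zeta>(4) by (simp add: abs_le_iff)
  qed (use tr1 \<kappa>[OF _ _ pen(2)] in auto)
  have v3: "visc_const s (G3 \<theta> b3 ?p3 - \<epsilon> - 2 * a * (?N * (K\<^sup>2 * (16 * \<eta> / a)))) (ball zb r) ?V"
  proof (rule supc_visc_const[OF B(1) c(3) B(2) sub3 open_ball ball_subset_cball a])
    fix z z' assume z: "dist z zb < r" and z': "z' \<in> ?B" "\<And>y. y \<in> ?B \<Longrightarrow> w3 y - a * (norm (z - y))\<^sup>2 \<le> w3 z' - a * (norm (z - z'))\<^sup>2"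
    have "dist z' b3 < \<zeta>" by (rule supc_nearD[OF r3(2) _ z']) (use z r in linarith)
    moreover from this have "z' \<in> ball zh R" by (intro inb[OF _ nearb(4)]) (use \<zeta>(2) in linarith)
    ultimately show "z' \<in> ball zh R \<and> dist z' b3 < \<zeta>" by blast
  next
    fix z z' assume z: "dist z zb < r" and z': "z' \<in> ball zh R" "dist z' b3 < \<zeta>"
    show "G3 \<theta> b3 ?p3 - \<epsilon> \<le> G3 \<theta> z' ((2 * a) *\<^sub>R (z' - z))"
      using e3(2)[OF z'(1) _ pclose[OF z'(2) z \<zeta>(8)], of \<theta>] z'(2) \<zeta>(5) by (simp add: abs_le_iff)
  qed (use tr1 \<kappa>[OF _ _ pen(3)] in auto)
  have "(G2 \<theta> b2 ?p2 - \<epsilon> - 2 * a * (?N * (K\<^sup>2 * (16 * \<eta> / a)))) + (G3 \<theta> b3 ?p3 - \<epsilon> - 2 * a * (?N * (K\<^sup>2 * (16 * \<eta> / a)))) \<le> tr2 s P'' zf"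
    by (rule Ptr[OF _ v2 v3]) (use nz[OF z1in, of \<theta>] zf_in r(1) in \<open>auto simp: s_def dist_commute\<close>)
  then have trP: "G2 \<theta> b2 ?p2 + G3 \<theta> b3 ?p3 - 4 * \<epsilon> \<le> tr2 s P'' zf" using err by linarith
  have tr\<phi>: "tr2 (\<sigma> \<theta> zh) \<phi>'' zh \<le> tr2 s \<phi>'' zf + \<epsilon>"
  proof -
    have "\<bar>tr2 s \<phi>'' zf - tr2 (\<sigma> \<theta> zh) \<phi>'' zh\<bar> \<le> \<epsilon>"
    proof (rule d0(2))
      show "dist zf zh < d0" using dist_triangle[of zf zh zb] zfr r(7) nearb(1) \<eta>(3) d0(1) by linarith
      fix j
      have "norm (s j - \<sigma> \<theta> zh j) \<le> K * dist z1 zh" unfolding s_def by (rule K(3)[OF z1in]) (use R in simp)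
      also have "dist z1 zh \<le> \<zeta> + \<eta>" using dist_triangle[of z1 zh b1] z1b nearb(2) by linarith
      also have "K * (\<zeta> + \<eta>) \<le> K * (d0 / (4 * K) + d0 / (4 * K))" using \<zeta>(10) \<eta>(4) K(1) by (intro mult_left_mono) auto
      also have "\<dots> < d0" using K(1) d0(1) by (simp add: field_simps)
      finally show "norm (s j) \<le> K \<and> norm (\<sigma> \<theta> zh j) \<le> K \<and> dist (s j) (\<sigma> \<theta> zh j) < d0"
        using sK K(1,2) R by (simp add: dist_norm)
    qed
    then show ?thesis by (simp add: abs_le_iff)
  qed
  have split: "tr2 s (\<lambda>z h. -1 *\<^sub>R ?g'' z h) zf = - tr2 s P'' zf - tr2 s \<phi>'' zf + 4 * \<alpha> * (\<Sum>j\<in>UNIV. (norm (s j))\<^sup>2)"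
    unfolding tr2_def \<psi>''_def
    by (simp add: inner_add_right inner_diff_right sum.distrib sum_subtractf sum_negf sum_distrib_left power2_norm_eq_inner algebra_simps)
  have "4 * \<alpha> * (\<Sum>j\<in>UNIV. (norm (s j))\<^sup>2) \<le> 4 * \<alpha> * (?N * K\<^sup>2)" using S2 \<alpha>(1) by (intro mult_left_mono) auto
  then have al: "4 * \<alpha> * (\<Sum>j\<in>UNIV. (norm (s j))\<^sup>2) \<le> \<epsilon>" using \<alpha>(2) by linarith
  have "- \<epsilon> \<le> - tr2 s P'' zf - tr2 s \<phi>'' zf + 4 * \<alpha> * (\<Sum>j\<in>UNIV. (norm (s j))\<^sup>2) + (G1 \<theta> b1 ?p1 + \<epsilon>)"
    using \<theta> G1 split unfolding htr s_def[symmetric] by linarith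
  then have main: "G1 \<theta> b1 ?p1 - G2 \<theta> b2 ?p2 - G3 \<theta> b3 ?p3 - tr2 (\<sigma> \<theta> zh) \<phi>'' zh \<ge> - \<gamma>"
    using al trP tr\<phi> \<epsilon> unfolding \<epsilon>_def by linarith
  \<comment> \<open>The gradients in the conclusion belong to the points \<open>b1\<close>,
    \<open>b2\<close>, \<open>b3\<close> themselves: the penalty paraboloid centred at
    \<open>zb\<close> touches there, which yields \<open>\<Gamma>1\<close>, \<open>\<Gamma>2\<close>
    and \<open>\<Gamma>3\<close>.\<close>
  have tb: "(2 * a) *\<^sub>R (b - zb) = (2 * a) *\<^sub>R (b - zb) \<and> touch_above w b (\<lambda>y. a * (norm (y - zb))\<^sup>2)"
    if bin: "b \<in> ball zh R" and bmax: "\<And>y. y \<in> ?B \<Longrightarrow> w y - a * (norm (zb - y))\<^sup>2 \<le> w b - a * (norm (zb - b))\<^sup>2" for b and w :: "'e \<Rightarrow> real"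
  proof -
    obtain \<rho> where \<rho>: "\<rho> > 0" "ball b \<rho> \<subseteq> ?B" using bin by (meson open_ball open_contains_ball ball_subset_cball order_trans)
    have "w y - a * (norm (y - zb))\<^sup>2 \<le> w b - a * (norm (b - zb))\<^sup>2" if "dist y b < \<rho>" for y
    proof -
      have "y \<in> ?B" using \<rho>(2) that by (auto simp: dist_commute)
      from bmax[OF this] show ?thesis by (simp add: norm_minus_commute)
    qed
    then show ?thesis unfolding touch_above_def using \<rho>(1) by blast
  qed
  have t1: "touch_above w1 b1 (\<lambda>y. a * (norm (y - zb))\<^sup>2)"
    using tb[OF bb(1), of w1] mx[OF _ b(2,3,4)] by (fastforce simp: distrib_left)
  have t2: "touch_above w2 b2 (\<lambda>y. a * (norm (y - zb))\<^sup>2)"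
    using tb[OF bb(2), of w2] mx[OF b(1) _ b(3,4)] by (fastforce simp: distrib_left)
  have t3: "touch_above w3 b3 (\<lambda>y. a * (norm (y - zb))\<^sup>2)"
    using tb[OF bb(3), of w3] mx[OF b(1,2) _ b(4)] by (fastforce simp: distrib_left)
  have "\<Gamma>1 ?p1" "\<Gamma>2 ?p2" "\<Gamma>3 ?p3"
    using sup1 sub2 sub3 C2fun_quad[of a zb] t1 t2 t3 bb unfolding super_neg_at_def sub_at_def by blast+
  moreover have "norm (?p1 + ?p2 + ?p3 + \<phi>' zh) < \<gamma>"
  proof -
    have "?p1 + ?p2 + ?p3 = - \<psi>' zb" using focb by (simp add: eq_neg_iff_add_eq_0)
    moreover have "\<psi>' zh = \<phi>' zh" by (simp add: \<psi>'_def)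
    moreover have "dist (\<psi>' zb) (\<psi>' zh) < \<gamma>" by (rule d1(2)) (use nearb(1) \<eta>(5) d1(1) in linarith)
    ultimately show ?thesis by (simp add: dist_norm norm_minus_commute)
  qed
  moreover have "dist b1 zh < \<gamma>" "dist b2 zh < \<gamma>" "dist b3 zh < \<gamma>" using nearb \<eta>(6) \<gamma> by linarith+
  ultimately show ?thesis using main by blast
qed

section \<open>Combinations of solutions\<close>

lemma matrix_apply:
  fixes f :: "real^'n \<Rightarrow> real^'m"
  assumes "linear f"
  shows "matrix f *v x = f x"
  using assms by (intro matrix_works) (simp add: linear_matrix_vector_mul_eq)

text \<open>With \<open>A = \<sigma> \<sigma>^T\<close> and cyclicity of the trace, the columns of
  \<open>\<sigma>\<close> take the role of the vectors \<open>s\<close> in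
  \<open>tr2\<close>.\<close>

lemma trace_diffA: "trace (diffA \<sigma> \<theta> x ** X) = (\<Sum>j\<in>UNIV. column j (\<sigma> \<theta> x) \<bullet> (X *v column j (\<sigma> \<theta> x)))"
proof -
  let ?S = "\<sigma> \<theta> x"
  have "trace (diffA \<sigma> \<theta> x ** X) = trace ((transpose ?S ** X) ** ?S)"
    unfolding diffA_def by (metis matrix_mul_assoc trace_mul_sym)
  also have "\<dots> = (\<Sum>j\<in>UNIV. column j ?S \<bullet> (X *v column j ?S))"
    unfolding matrix_mul_assoc[symmetric]
    by (simp add: trace_def matrix_matrix_mult_def column_def inner_vec_def matrix_vector_mult_def transpose_def)
  finally show ?thesis .
qed

lemma diffA_entry: "diffA \<sigma> \<theta> x $ i $ k = \<sigma> \<theta> x $ i \<bullet> \<sigma> \<theta> x $ k"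
  by (simp add: diffA_def matrix_matrix_mult_def transpose_def inner_vec_def)

lemma trace_mult_bound:
  fixes A X :: "real^'n^'n"
  assumes "\<And>i k. \<bar>A $ i $ k\<bar> \<le> c"
  shows "\<bar>trace (A ** X)\<bar> \<le> (real CARD('n))\<^sup>2 * (c * norm X)"
proof -
  have X: "\<bar>X $ k $ i\<bar> \<le> norm X" for i k
    using component_le_norm_cart[of "X $ k" i] Finite_Cartesian_Product.norm_nth_le[of X k] by linarith
  have c: "c \<ge> 0" using assms[of undefined undefined] by linarith
  have "\<bar>trace (A ** X)\<bar> = \<bar>\<Sum>i\<in>UNIV. \<Sum>k\<in>UNIV. A $ i $ k * X $ k $ i\<bar>"
    by (simp add: trace_def matrix_matrix_mult_def)
  also have "\<dots> \<le> (\<Sum>i\<in>(UNIV::'n set). \<Sum>k\<in>(UNIV::'n set). c * norm X)"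
    by (intro order_trans[OF sum_abs sum_mono] order_trans[OF sum_abs sum_mono])
      (auto simp: abs_mult intro!: mult_mono assms X c)
  also have "\<dots> = (real CARD('n))\<^sup>2 * (c * norm X)" by (simp add: power2_eq_square)
  finally show ?thesis .
qed

text \<open>The Lipschitz constant \<open>L\<close> of solutions is kept apart from
  \<open>C\<close>, because the solution of the ergodic problem comes with a Lipschitz constant of
  its own.\<close>

locale bellman =
  fixes \<sigma> :: "'th \<Rightarrow> real^'n \<Rightarrow> real^'n^'n" and H :: "'th \<Rightarrow> real^'n \<Rightarrow> real^'n \<Rightarrow> real" and C L :: real
  assumes C0: "C > 0" and L0: "L > 0"
    and sig_per: "\<And>\<theta>. periodic (\<sigma> \<theta>)"
    and sig_bd: "\<And>\<theta> x. norm (\<sigma> \<theta> x) \<le> C"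
    and sig_lip: "\<And>\<theta> x y. norm (\<sigma> \<theta> x - \<sigma> \<theta> y) \<le> C * dist x y"
    and H_per: "\<And>\<theta> p. periodic (\<lambda>x. H \<theta> x p)"
    and H_bd: "\<And>\<theta> x. \<bar>H \<theta> x 0\<bar> \<le> C"
    and H_lip: "\<And>R. R > 0 \<Longrightarrow> \<exists>CR>0. \<forall>\<theta> x y p q. norm p \<le> R \<and> norm q \<le> R \<longrightarrow>
          \<bar>H \<theta> x p - H \<theta> y q\<bar> \<le> CR * (dist x y + dist p q)"
    and nondeg: "\<And>\<delta>. \<delta> > 0 \<Longrightarrow> \<exists>\<nu>>0. \<forall>\<theta>. \<forall>x\<in>Sigma_compl \<sigma> \<delta>. \<forall>\<xi>.
                   \<xi> \<bullet> (diffA \<sigma> \<theta> x *v \<xi>) \<ge> \<nu> * (norm \<xi>)\<^sup>2"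
    and conv: "\<And>\<theta> x. convex_on UNIV (H \<theta> x)"
    and strict: "\<And>x s p q. x \<in> Sigma_set \<sigma> \<Longrightarrow> 0 < s \<Longrightarrow> s < 1 \<Longrightarrow> p \<noteq> q \<Longrightarrow>
         (INF \<theta>. s * H \<theta> x p + (1 - s) * H \<theta> x q - H \<theta> x (s *\<^sub>R p + (1 - s) *\<^sub>R q)) > 0"
begin

definition op :: "'th \<Rightarrow> real^'n \<Rightarrow> real^'n \<Rightarrow> real^'n^'n \<Rightarrow> real" where
  "op \<theta> x p X = - trace (diffA \<sigma> \<theta> x ** X) + H \<theta> x p"

lemma Ham_op: "Ham \<sigma> H x p X = (SUP \<theta>. op \<theta> x p X)"
  by (simp add: Ham_def op_def)

lemma diffA_bound: "\<bar>diffA \<sigma> \<theta> x $ i $ k\<bar> \<le> C\<^sup>2"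
proof -
  have r: "norm (\<sigma> \<theta> x $ i) \<le> C" for i using Finite_Cartesian_Product.norm_nth_le[of "\<sigma> \<theta> x" i] sig_bd[of \<theta> x] by linarith
  have "\<bar>diffA \<sigma> \<theta> x $ i $ k\<bar> \<le> norm (\<sigma> \<theta> x $ i) * norm (\<sigma> \<theta> x $ k)"
    unfolding diffA_entry by (rule Cauchy_Schwarz_ineq2)
  also have "\<dots> \<le> C * C" using r C0 by (intro mult_mono) auto
  finally show ?thesis by (simp add: power2_eq_square)
qed

lemma diffA_lip: "\<bar>(diffA \<sigma> \<theta> x - diffA \<sigma> \<theta> y) $ i $ k\<bar> \<le> 2 * C\<^sup>2 * dist x y"
proof -
  let ?S = "\<sigma> \<theta> x" and ?T = "\<sigma> \<theta> y"
  have r: "norm (?S $ i) \<le> C" "norm (?T $ i) \<le> C" for i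
    using Finite_Cartesian_Product.norm_nth_le[of ?S i] Finite_Cartesian_Product.norm_nth_le[of ?T i] sig_bd[of \<theta> x] sig_bd[of \<theta> y] by linarith+
  have d: "norm (?S $ i - ?T $ i) \<le> C * dist x y" for i
    using Finite_Cartesian_Product.norm_nth_le[of "?S - ?T" i] sig_lip[of \<theta> x y] by simp
  have "(diffA \<sigma> \<theta> x - diffA \<sigma> \<theta> y) $ i $ k = (?S $ i - ?T $ i) \<bullet> ?S $ k + ?T $ i \<bullet> (?S $ k - ?T $ k)"
    by (simp add: diffA_entry inner_diff_left inner_diff_right)
  also have "\<bar>\<dots>\<bar> \<le> norm (?S $ i - ?T $ i) * norm (?S $ k) + norm (?T $ i) * norm (?S $ k - ?T $ k)"
    by (intro order_trans[OF abs_triangle_ineq] add_mono Cauchy_Schwarz_ineq2)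
  also have "\<dots> \<le> (C * dist x y) * C + C * (C * dist x y)"
    using r d C0 by (intro add_mono mult_mono) auto
  finally show ?thesis by (simp add: power2_eq_square)
qed

lemma op_lip:
  assumes "R > 0"
  obtains K where "K > 0" "\<And>\<theta> x y p q X Y. norm p \<le> R \<Longrightarrow> norm q \<le> R \<Longrightarrow>
     \<bar>op \<theta> x p X - op \<theta> y q Y\<bar> \<le> K * (dist x y * norm X + norm (X - Y) + dist x y + dist p q)"
proof -
  obtain CR where CR: "CR > 0" "\<And>\<theta> x y p q. norm p \<le> R \<Longrightarrow> norm q \<le> R \<Longrightarrow> \<bar>H \<theta> x p - H \<theta> y q\<bar> \<le> CR * (dist x y + dist p q)"
    using H_lip[OF assms] by blast
  define N where "N = (real CARD('n))\<^sup>2"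
  define K where "K = CR + N * (2 * C\<^sup>2)"
  have N: "N \<ge> 0" by (simp add: N_def)
  have K: "K \<ge> CR" "K \<ge> N * (2 * C\<^sup>2)" "K \<ge> N * C\<^sup>2" using CR N by (auto simp: K_def intro: add_increasing)
  show ?thesis
  proof (rule that[of K])
    show "K > 0" using CR K by simp
    fix \<theta> x y p q X Y assume pq: "norm (p::real^'n) \<le> R" "norm (q::real^'n) \<le> R"
    let ?A = "diffA \<sigma> \<theta> x" and ?B = "diffA \<sigma> \<theta> y"
    have "trace (?A ** X) - trace (?B ** Y) = trace ((?A - ?B) ** X) + trace (?B ** (X - Y))"
      by (simp add: trace_def matrix_matrix_mult_def sum_subtractf[symmetric] sum.distrib[symmetric] algebra_simps)
    then have "\<bar>trace (?A ** X) - trace (?B ** Y)\<bar> \<le> \<bar>trace ((?A - ?B) ** X)\<bar> + \<bar>trace (?B ** (X - Y))\<bar>"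
      by (simp add: abs_triangle_ineq)
    also have "\<dots> \<le> N * ((2 * C\<^sup>2 * dist x y) * norm X) + N * (C\<^sup>2 * norm (X - Y))"
      unfolding N_def by (intro add_mono trace_mult_bound diffA_lip diffA_bound)
    also have "\<dots> = (N * (2 * C\<^sup>2)) * (dist x y * norm X) + (N * C\<^sup>2) * norm (X - Y)" by (simp add: algebra_simps)
    also have "\<dots> \<le> K * (dist x y * norm X) + K * norm (X - Y)"
      by (intro add_mono mult_right_mono K) auto
    finally have 1: "\<bar>trace (?A ** X) - trace (?B ** Y)\<bar> \<le> K * (dist x y * norm X) + K * norm (X - Y)" .
    have "\<bar>H \<theta> x p - H \<theta> y q\<bar> \<le> CR * (dist x y + dist p q)" by (rule CR(2)[OF pq])
    also have "\<dots> \<le> K * (dist x y + dist p q)" by (rule mult_right_mono[OF K(1)]) simp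
    finally have 2: "\<bar>H \<theta> x p - H \<theta> y q\<bar> \<le> K * (dist x y + dist p q)" .
    show "\<bar>op \<theta> x p X - op \<theta> y q Y\<bar> \<le> K * (dist x y * norm X + norm (X - Y) + dist x y + dist p q)"
      using 1 2 unfolding op_def abs_le_iff by (simp add: algebra_simps)
  qed
qed

lemma op_bdd: "bdd_above (range (\<lambda>\<theta>. op \<theta> x p X))"
proof -
  have "norm p + 1 > 0" using norm_ge_zero[of p] by linarith
  then obtain K where K: "K > 0" "\<And>\<theta> x y p' q X Y. norm p' \<le> norm p + 1 \<Longrightarrow> norm q \<le> norm p + 1 \<Longrightarrow>
     \<bar>op \<theta> x p' X - op \<theta> y q Y\<bar> \<le> K * (dist x y * norm X + norm (X - Y) + dist x y + dist p' q)"
    using op_lip[of "norm p + 1"] by metis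
  have "op \<theta> x p X \<le> C + K * (norm X + norm p)" for \<theta>
  proof -
    have "op \<theta> x 0 0 = H \<theta> x 0" by (simp add: op_def trace_def matrix_matrix_mult_def)
    then show ?thesis using K(2)[of p 0 \<theta> x X x 0] H_bd[of \<theta> x] by (simp add: abs_le_iff)
  qed
  then show ?thesis by (intro bdd_aboveI) auto
qed

lemma op_le_Ham: "op \<theta> x p X \<le> Ham \<sigma> H x p X"
  unfolding Ham_op by (rule cSUP_upper[OF _ op_bdd]) auto

lemma Ham_le: "(\<And>\<theta>. op \<theta> x p X \<le> c) \<Longrightarrow> Ham \<sigma> H x p X \<le> c"
  unfolding Ham_op by (rule cSUP_least) auto

lemma Ham_gt: "c < Ham \<sigma> H x p X \<Longrightarrow> \<exists>\<theta>. c < op \<theta> x p X"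
  unfolding Ham_op using less_cSUP_iff[OF _ op_bdd] by auto

text \<open>A supremum of an equicontinuous family inherits its modulus, and \<open>op_lip\<close>
  provides one that is uniform in \<open>\<theta>\<close>.\<close>

lemma Ham_continuous: "continuous_on UNIV (\<lambda>(x, p, X). Ham \<sigma> H x p X)"
  unfolding continuous_on_iff
proof (intro ballI allI impI)
  fix z :: "(real^'n) \<times> (real^'n) \<times> (real^'n^'n)" and e :: real assume e: "e > 0"
  obtain x p X where z: "z = (x, p, X)" by (metis prod_cases3)
  have "norm p + 1 > 0" using norm_ge_zero[of p] by linarith
  then obtain K where K: "K > 0" "\<And>\<theta> x y p' q X Y. norm p' \<le> norm p + 1 \<Longrightarrow> norm q \<le> norm p + 1 \<Longrightarrow>
     \<bar>op \<theta> x p' X - op \<theta> y q Y\<bar> \<le> K * (dist x y * norm X + norm (X - Y) + dist x y + dist p' q)"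
    using op_lip[of "norm p + 1"] by metis
  define d where "d = min 1 (e / (2 * K * (norm X + 3)))"
  have nX: "norm X + 3 > 0" using norm_ge_zero[of X] by linarith
  have d: "d > 0" "d \<le> 1" "d \<le> e / (2 * K * (norm X + 3))"
    using e K(1) nX by (auto simp: d_def)
  have dK: "K * (d * (norm X + 3)) \<le> e / 2"
  proof -
    have "d * (2 * K * (norm X + 3)) \<le> e" using d(3) K(1) nX by (simp add: pos_le_divide_eq)
    then show ?thesis by (simp add: algebra_simps)
  qed
  show "\<exists>d>0. \<forall>z'\<in>UNIV. dist z' z < d \<longrightarrow>
     dist (case z' of (x, p, X) \<Rightarrow> Ham \<sigma> H x p X) (case z of (x, p, X) \<Rightarrow> Ham \<sigma> H x p X) < e"
  proof (intro exI[of _ d] conjI ballI impI d(1))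
    fix z' assume dz: "dist z' z < d"
    obtain y q Y where z': "z' = (y, q, Y)" by (metis prod_cases3)
    have "dist y x < d" "dist (q, Y) (p, X) < d" using dz dist_fst_le[of z' z] dist_snd_le[of z' z] by (auto simp: z z')
    then have d3: "dist x y \<le> d" "dist p q \<le> d" "norm (X - Y) \<le> d"
      using dist_fst_le[of "(q, Y)" "(p, X)"] dist_snd_le[of "(q, Y)" "(p, X)"] by (auto simp: dist_commute dist_norm[of X Y, symmetric])
    have q: "norm q \<le> norm p + 1" using d3(2) d(2) norm_triangle_sub[of q p] by (simp add: dist_norm norm_minus_commute)
    have op: "\<bar>op \<theta> x p X - op \<theta> y q Y\<bar> \<le> e / 2" for \<theta>
    proof -
      have "\<bar>op \<theta> x p X - op \<theta> y q Y\<bar> \<le> K * (dist x y * norm X + norm (X - Y) + dist x y + dist p q)"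
        by (rule K(2)) (use q in auto)
      also have "\<dots> \<le> K * (d * norm X + d + d + d)"
        using d3 K(1) by (intro mult_left_mono add_mono mult_right_mono) auto
      also have "\<dots> = K * (d * (norm X + 3))" by (simp add: algebra_simps)
      finally show ?thesis using dK by linarith
    qed
    have "Ham \<sigma> H x p X \<le> Ham \<sigma> H y q Y + e / 2"
    proof (rule Ham_le)
      fix \<theta> show "op \<theta> x p X \<le> Ham \<sigma> H y q Y + e / 2" using op[of \<theta>] op_le_Ham[of \<theta> y q Y] unfolding abs_le_iff by linarith
    qed
    moreover have "Ham \<sigma> H y q Y \<le> Ham \<sigma> H x p X + e / 2"
    proof (rule Ham_le)
      fix \<theta> show "op \<theta> y q Y \<le> Ham \<sigma> H x p X + e / 2" using op[of \<theta>] op_le_Ham[of \<theta> x p X] unfolding abs_le_iff by linarith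
    qed
    ultimately have "\<bar>Ham \<sigma> H y q Y - Ham \<sigma> H x p X\<bar> \<le> e / 2" unfolding abs_le_iff by linarith
    then show "dist (case z' of (x, p, X) \<Rightarrow> Ham \<sigma> H x p X) (case z of (x, p, X) \<Rightarrow> Ham \<sigma> H x p X) < e"
      using e by (simp add: z z' dist_real_def)
  qed
qed


text \<open>The equation has no second-order terms in time, so the diffusion vectors of the product
  space have zero time components.\<close>

definition sg :: "'th \<Rightarrow> (real^'n) \<times> (real \<times> real) \<Rightarrow> 'n \<Rightarrow> (real^'n) \<times> (real \<times> real)" where
  "sg \<theta> z j = (column j (\<sigma> \<theta> (fst z)), 0)"

end

section \<open>Reading solutions on the product of space with two times\<close>

lemma touch_gradient_bound:
  fixes w :: "'a::euclidean_space \<times> 'b::euclidean_space \<Rightarrow> real"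
  assumes C: "C2fun h h' h''" and t: "touch_above w z h" and e0: "e0 > 0"
    and lip: "\<And>x. dist x (fst z) < e0 \<Longrightarrow> \<bar>w (x, snd z) - w z\<bar> \<le> M * dist x (fst z)"
  shows "norm (fst (h' z)) \<le> M"
proof (rule ccontr)
  assume neg: "\<not> norm (fst (h' z)) \<le> M"
  define v where "v = fst (h' z)"
  obtain e where e: "e > 0" "\<And>y. dist y z < e \<Longrightarrow> w y - h y \<le> w z - h z" using t by (auto simp: touch_above_def)
  have M0: "M \<ge> 0"
  proof -
    obtain d :: 'a where d: "norm d = e0 / 2" using vector_choose_size[of "e0 / 2"] e0 by auto
    have "0 \<le> M * dist (fst z + d) (fst z)" using lip[of "fst z + d"] d e0 by (force simp: dist_norm)
    then show ?thesis using d e0 by (simp add: dist_norm zero_le_mult_iff)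
  qed
  have v0: "norm v > 0" "norm v > M" using neg M0 by (auto simp: v_def)
  define f where "f = (\<lambda>s. h (z + s *\<^sub>R (- v, 0)) + M * (s * norm v))"
  have p: "((\<lambda>s. z + s *\<^sub>R (- v, 0)) has_derivative (\<lambda>s. s *\<^sub>R (- v, 0))) (at 0)"
    by (auto intro!: derivative_eq_intros)
  have "(f has_real_derivative (- (norm v)\<^sup>2 + M * norm v)) (at 0)"
  proof -
    have "((\<lambda>s. h (z + s *\<^sub>R (- v, 0))) has_derivative (\<lambda>s. h' z \<bullet> (s *\<^sub>R (- v, 0)))) (at 0)"
      using has_derivative_compose[OF p C2fun_D1[OF C]] by (simp add: zero_prod_def[symmetric])
    moreover have "(\<lambda>s. h' z \<bullet> (s *\<^sub>R (- v, 0))) = (*) (- (norm v)\<^sup>2)"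
      by (auto simp: fun_eq_iff inner_prod_def v_def power2_norm_eq_inner)
    ultimately have "((\<lambda>s. h (z + s *\<^sub>R (- v, 0))) has_real_derivative (- (norm v)\<^sup>2)) (at 0)"
      unfolding has_field_derivative_def by simp
    then show ?thesis unfolding f_def by (auto intro!: derivative_eq_intros)
  qed
  moreover have "- (norm v)\<^sup>2 + M * norm v < 0" using v0 by (simp add: power2_eq_square)
  ultimately obtain d where d: "d > 0" "\<And>s. 0 < s \<Longrightarrow> s < d \<Longrightarrow> f (0 + s) < f 0"
    using DERIV_neg_dec_right by blast
  define s where "s = min (d / 2) (min e e0 / (2 * norm v))"
  have s: "0 < s" "s < d" using d(1) e(1) e0 v0 by (auto simp: s_def min_def)
  have "s * norm v \<le> min e e0 / (2 * norm v) * norm v" using v0 by (intro mult_right_mono) (auto simp: s_def)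
  then have sv: "s * norm v < e" "s * norm v < e0" using e(1) e0 v0 by auto
  have z: "z + s *\<^sub>R (- v, 0) = (fst z - s *\<^sub>R v, snd z)" by (simp add: prod_eq_iff)
  have "dist (z + s *\<^sub>R (- v, 0)) z < e" using s sv by (simp add: dist_norm norm_Pair)
  from e(2)[OF this] have "h z + w (z + s *\<^sub>R (- v, 0)) - w z \<le> h (z + s *\<^sub>R (- v, 0))" by simp
  moreover have "\<bar>w (z + s *\<^sub>R (- v, 0)) - w z\<bar> \<le> M * (s * norm v)"
    unfolding z using lip[of "fst z - s *\<^sub>R v"] s sv by (simp add: dist_norm)
  ultimately have "f 0 \<le> f s" unfolding f_def abs_le_iff by (simp add: zero_prod_def[symmetric])
  then show False using d(2)[OF s] by simp
qed

lemma touch_gradient_zero: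
  fixes w :: "'a::euclidean_space \<Rightarrow> real"
  assumes C: "C2fun h h' h''" and t: "touch_above w z h" and inv: "\<And>s. w (z + s *\<^sub>R d) = w z"
  shows "h' z \<bullet> d = 0"
proof -
  obtain e where e: "e > 0" "\<And>y. dist y z < e \<Longrightarrow> w y - h y \<le> w z - h z" using t by (auto simp: touch_above_def)
  have p: "((\<lambda>s. z + s *\<^sub>R d) has_derivative (\<lambda>s. s *\<^sub>R d)) (at 0)"
    by (auto intro!: derivative_eq_intros)
  have "((\<lambda>s. h (z + s *\<^sub>R d)) has_derivative (\<lambda>s. h' z \<bullet> (s *\<^sub>R d))) (at 0)"
    using has_derivative_compose[OF p, of h "\<lambda>k. h' z \<bullet> k"] C2fun_D1[OF C, of z] by simp
  moreover have "(\<lambda>s. h' z \<bullet> (s *\<^sub>R d)) = (*) (h' z \<bullet> d)" by (auto simp: fun_eq_iff)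
  ultimately have D: "((\<lambda>s. h (z + s *\<^sub>R d)) has_real_derivative (h' z \<bullet> d)) (at 0)"
    unfolding has_field_derivative_def by simp
  show ?thesis
  proof (rule DERIV_local_min[OF D, of "e / (norm d + 1)"])
    show "0 < e / (norm d + 1)" using e(1) by (simp add: add_nonneg_pos)
    show "\<forall>y. \<bar>0 - y\<bar> < e / (norm d + 1) \<longrightarrow> h (z + 0 *\<^sub>R d) \<le> h (z + y *\<^sub>R d)"
    proof (intro allI impI)
      fix y assume y: "\<bar>0 - y\<bar> < e / (norm d + 1)"
      have "\<bar>y\<bar> * norm d \<le> \<bar>y\<bar> * (norm d + 1)" by (intro mult_left_mono) auto
      also have "\<dots> < e" using y by (simp add: pos_less_divide_eq add_nonneg_pos)
      finally have "dist (z + y *\<^sub>R d) z < e" by (simp add: dist_norm)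
      from e(2)[OF this] inv[of y] show "h (z + 0 *\<^sub>R d) \<le> h (z + y *\<^sub>R d)" by simp
    qed
  qed
qed

text \<open>Freezing the time variables orthogonal to \<open>e\<close> turns a test function on the product space into a
  \<open>C21_test\<close>.\<close>

lemma C2fun_C21_test:
  fixes h :: "(real^'n) \<times> (real \<times> real) \<Rightarrow> real"
  assumes C: "C2fun h h' h''"
  shows "C21_test (\<lambda>x s. m * h (x, b + s *\<^sub>R e)) (\<lambda>x s. m * (snd (h' (x, b + s *\<^sub>R e)) \<bullet> e))
     (\<lambda>x s. m *\<^sub>R fst (h' (x, b + s *\<^sub>R e)))
     (\<lambda>x s. matrix (\<lambda>v. m *\<^sub>R fst (h'' (x, b + s *\<^sub>R e) (v, 0))))"
  unfolding C21_test_def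
proof (intro conjI allI)
  fix x :: "real^'n" and s :: real
  have p: "((\<lambda>z. (fst z, b + snd z *\<^sub>R e)) has_derivative (\<lambda>k. (fst k, snd k *\<^sub>R e))) (at (x, s))"
    by (auto intro!: derivative_eq_intros)
  have "((\<lambda>z. h (fst z, b + snd z *\<^sub>R e)) has_derivative (\<lambda>k. h' (x, b + s *\<^sub>R e) \<bullet> (fst k, snd k *\<^sub>R e))) (at (x, s))"
    using has_derivative_compose[OF p, of h "\<lambda>k. h' (x, b + s *\<^sub>R e) \<bullet> k"] C2fun_D1[OF C] by simp
  from has_derivative_mult_right[OF this, of m]
  show "((\<lambda>z. m * h (fst z, b + snd z *\<^sub>R e)) has_derivative
     (\<lambda>k. m *\<^sub>R fst (h' (x, b + s *\<^sub>R e)) \<bullet> fst k + m * (snd (h' (x, b + s *\<^sub>R e)) \<bullet> e) * snd k)) (at (x, s))"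
    by (rule has_derivative_eq_rhs) (auto simp: fun_eq_iff inner_prod_def algebra_simps)
  have q: "((\<lambda>y. (y, b + s *\<^sub>R e)) has_derivative (\<lambda>k. (k, 0))) (at x)"
    by (auto intro!: derivative_eq_intros)
  have lin: "linear (\<lambda>v. m *\<^sub>R fst (h'' (x, b + s *\<^sub>R e) (v, 0)))"
  proof -
    have l: "linear (h'' (x, b + s *\<^sub>R e))" by (rule C2fun_linear[OF C])
    show ?thesis
      by (rule linearI)
        (use linear_add[OF l, of "(_, 0)" "(_, 0)"] linear_cmul[OF l, of _ "(_, 0)"] in \<open>auto simp: algebra_simps\<close>)
  qed
  have "((\<lambda>y. h' (y, b + s *\<^sub>R e)) has_derivative (\<lambda>k. h'' (x, b + s *\<^sub>R e) (k, 0))) (at x)"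
    using has_derivative_compose[OF q, of h'] C2fun_D2[OF C] by blast
  from has_derivative_scaleR_right[OF has_derivative_fst[OF this], of m]
  show "((\<lambda>y. m *\<^sub>R fst (h' (y, b + s *\<^sub>R e))) has_derivative
     (\<lambda>k. matrix (\<lambda>v. m *\<^sub>R fst (h'' (x, b + s *\<^sub>R e) (v, 0))) *v k)) (at x)"
    unfolding matrix_apply[OF lin] .
next
  have c: "continuous_on UNIV (\<lambda>z. (fst z :: real^'n, b + snd z *\<^sub>R e))" by (intro continuous_intros)
  note c' = continuous_on_compose2[OF C2fun_cont1[OF C, of UNIV] c]
  show "continuous_on UNIV (\<lambda>z. m * (snd (h' (fst z, b + snd z *\<^sub>R e)) \<bullet> e))"
    and "continuous_on UNIV (\<lambda>z. m *\<^sub>R fst (h' (fst z, b + snd z *\<^sub>R e)))"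
    by (intro continuous_intros c'; simp)+
  show "continuous_on UNIV (\<lambda>z. matrix (\<lambda>v. m *\<^sub>R fst (h'' (fst z, b + snd z *\<^sub>R e) (v, 0))))"
    unfolding matrix_def
    by (intro continuous_on_vec_lambda continuous_intros continuous_on_compose2[OF C2fun_D3[OF C] c]) simp
qed

lemma visc_sol_E_sub:
  assumes "visc_sol_E \<sigma> H u" "C21_test phi phit Dphi D2phi" "t0 > 0" "e > 0"
    "\<And>y s. dist y x0 < e \<Longrightarrow> \<bar>s - t0\<bar> < e \<Longrightarrow> s > 0 \<Longrightarrow> u y s - phi y s \<le> u x0 t0 - phi x0 t0"
  shows "phit x0 t0 + Ham \<sigma> H x0 (Dphi x0 t0) (D2phi x0 t0) \<le> 0"
proof -
  have "\<exists>e>0. \<forall>y s. dist y x0 < e \<and> \<bar>s - t0\<bar> < e \<and> s > 0 \<longrightarrow> u y s - phi y s \<le> u x0 t0 - phi x0 t0"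
    using assms(4,5) by blast
  then show ?thesis
    using conjunct1[OF conjunct2[OF assms(1)[unfolded visc_sol_E_def]], rule_format, of phi phit Dphi D2phi t0 x0] assms(2,3)
    by blast
qed

lemma visc_sol_E_super:
  assumes "visc_sol_E \<sigma> H u" "C21_test phi phit Dphi D2phi" "t0 > 0" "e > 0"
    "\<And>y s. dist y x0 < e \<Longrightarrow> \<bar>s - t0\<bar> < e \<Longrightarrow> s > 0 \<Longrightarrow> u y s - phi y s \<ge> u x0 t0 - phi x0 t0"
  shows "phit x0 t0 + Ham \<sigma> H x0 (Dphi x0 t0) (D2phi x0 t0) \<ge> 0"
proof -
  have "\<exists>e>0. \<forall>y s. dist y x0 < e \<and> \<bar>s - t0\<bar> < e \<and> s > 0 \<longrightarrow> u y s - phi y s \<ge> u x0 t0 - phi x0 t0"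
    using assms(4,5) by blast
  then show ?thesis
    using conjunct2[OF conjunct2[OF assms(1)[unfolded visc_sol_E_def]], rule_format, of phi phit Dphi D2phi t0 x0] assms(2,3)
    by blast
qed

context bellman
begin

lemma tr_matrix_sg:
  assumes "linear f"
  shows "trace (diffA \<sigma> \<theta> x ** matrix f) = (\<Sum>j\<in>UNIV. column j (\<sigma> \<theta> x) \<bullet> f (column j (\<sigma> \<theta> x)))"
  by (simp add: trace_diffA matrix_apply[OF assms])

text \<open>Function \<open>w\<close> of space and time is read on the product space with two time variables, along the time direction
  \<open>e\<close>; the first-order part of the equation becomes \<open>GG\<close>.\<close>

definition GG :: "real \<Rightarrow> real \<Rightarrow> real \<Rightarrow> real \<times> real \<Rightarrow> 'th \<Rightarrow> (real^'n) \<times> (real \<times> real) \<Rightarrow> (real^'n) \<times> (real \<times> real) \<Rightarrow> real" where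
  "GG a b k e \<theta> z q = a * (snd q \<bullet> e) + b * H \<theta> (fst z) (k *\<^sub>R fst q)"

text \<open>The second clause says that the time derivative is parallel to \<open>e\<close>: a
  function reading only the time along \<open>e\<close> has no derivative in the other one. This is
  what separates the two time derivatives in the sum of the gradients.\<close>

definition Gam :: "real \<Rightarrow> real \<times> real \<Rightarrow> (real^'n) \<times> (real \<times> real) \<Rightarrow> bool" where
  "Gam M e q \<longleftrightarrow> norm (fst q) \<le> M \<and> (\<forall>d. d \<bullet> e = 0 \<longrightarrow> snd q \<bullet> d = 0)"

lemma equi_GG: "equi (GG a b k e) S"
  unfolding equi_def
proof (intro ballI allI impI)
  fix z p :: "(real^'n) \<times> (real \<times> real)" and \<gamma> :: real assume \<gamma>: "\<gamma> > 0"
  define R where "R = \<bar>k\<bar> * (norm p + 1) + 1"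
  have R: "R > 0" by (simp add: R_def add_nonneg_pos)
  obtain CR where CR: "CR > 0" "\<And>\<theta> x y p q. norm p \<le> R \<Longrightarrow> norm q \<le> R \<Longrightarrow> \<bar>H \<theta> x p - H \<theta> y q\<bar> \<le> CR * (dist x y + dist p q)"
    using H_lip[OF R] by blast
  define D where "D = \<bar>a\<bar> * norm e + \<bar>b\<bar> * (CR * (1 + \<bar>k\<bar>)) + 1"
  have D: "D > 0" using CR(1) by (simp add: D_def add_nonneg_pos)
  show "\<exists>d>0. \<forall>\<theta> z' p'. z' \<in> S \<longrightarrow> dist z' z < d \<longrightarrow> dist p' p < d \<longrightarrow> \<bar>GG a b k e \<theta> z' p' - GG a b k e \<theta> z p\<bar> \<le> \<gamma>"
  proof (intro exI[of _ "min 1 (\<gamma> / D)"] conjI allI impI)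
    fix \<theta> z' p' assume zz: "dist z' z < min 1 (\<gamma> / D)" and pp: "dist p' p < min 1 (\<gamma> / D)"
    let ?d = "min 1 (\<gamma> / D)"
    have f: "dist (fst z') (fst z) \<le> ?d" "dist (fst p') (fst p) \<le> ?d" "dist (snd p') (snd p) \<le> ?d"
      using zz pp dist_fst_le[of z' z] dist_fst_le[of p' p] dist_snd_le[of p' p] by linarith+
    have n: "norm (fst p) \<le> norm p + 1" "norm (fst p') \<le> norm p + 1"
    proof -
      show "norm (fst p) \<le> norm p + 1" using norm_fst_le[of "fst p" "snd p"] by simp
      have "norm (fst p') \<le> norm (fst p) + dist (fst p') (fst p)" using norm_triangle_sub[of "fst p'" "fst p"] by (simp add: dist_norm)
      then show "norm (fst p') \<le> norm p + 1" using f(2) norm_fst_le[of "fst p" "snd p"] by simp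
    qed
    have kn: "norm (k *\<^sub>R fst p) \<le> R" "norm (k *\<^sub>R fst p') \<le> R"
      using mult_left_mono[OF n(1), of "\<bar>k\<bar>"] mult_left_mono[OF n(2), of "\<bar>k\<bar>"] by (auto simp: R_def)
    have d0: "?d \<ge> 0" using \<gamma> D by simp
    have kd: "dist (k *\<^sub>R fst p') (k *\<^sub>R fst p) = \<bar>k\<bar> * dist (fst p') (fst p)"
      by (simp add: dist_norm flip: scaleR_diff_right)
    have "\<bar>H \<theta> (fst z') (k *\<^sub>R fst p') - H \<theta> (fst z) (k *\<^sub>R fst p)\<bar> \<le> CR * (dist (fst z') (fst z) + \<bar>k\<bar> * dist (fst p') (fst p))"
      using CR(2)[OF kn(2,1), of \<theta> "fst z'" "fst z"] kd by simp
    also have "\<dots> \<le> CR * (?d + \<bar>k\<bar> * ?d)" using f CR(1) by (intro mult_left_mono add_mono) auto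
    also have "\<dots> = (CR * (1 + \<bar>k\<bar>)) * ?d" by (simp add: algebra_simps)
    finally have 1: "\<bar>H \<theta> (fst z') (k *\<^sub>R fst p') - H \<theta> (fst z) (k *\<^sub>R fst p)\<bar> \<le> (CR * (1 + \<bar>k\<bar>)) * ?d" .
    have "\<bar>(snd p' - snd p) \<bullet> e\<bar> \<le> norm (snd p' - snd p) * norm e" by (rule Cauchy_Schwarz_ineq2)
    also have "\<dots> \<le> ?d * norm e" using f(3) by (intro mult_right_mono) (auto simp: dist_norm)
    finally have 2: "\<bar>(snd p' - snd p) \<bullet> e\<bar> \<le> ?d * norm e" .
    have "GG a b k e \<theta> z' p' - GG a b k e \<theta> z p = a * ((snd p' - snd p) \<bullet> e) + b * (H \<theta> (fst z') (k *\<^sub>R fst p') - H \<theta> (fst z) (k *\<^sub>R fst p))"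
      by (simp add: GG_def inner_diff_left algebra_simps)
    also have "\<bar>\<dots>\<bar> \<le> \<bar>a\<bar> * (?d * norm e) + \<bar>b\<bar> * ((CR * (1 + \<bar>k\<bar>)) * ?d)"
      by (rule order_trans[OF abs_triangle_ineq]) (unfold abs_mult, intro add_mono mult_left_mono 1 2, auto)
    also have "\<dots> \<le> D * ?d" using d0 by (simp add: D_def algebra_simps)
    also have "\<dots> \<le> D * (\<gamma> / D)" using D by (intro mult_left_mono) auto
    also have "\<dots> = \<gamma>" using D by simp
    finally show "\<bar>GG a b k e \<theta> z' p' - GG a b k e \<theta> z p\<bar> \<le> \<gamma>" .
  qed (use \<gamma> D in auto)
qed

definition lip_t :: "(real^'n \<Rightarrow> real \<Rightarrow> real) \<Rightarrow> bool" where
  "lip_t u \<longleftrightarrow> (\<forall>t\<ge>0. \<forall>x y. \<bar>u x t - u y t\<bar> \<le> L * dist x y)"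

lemma Gam_touch:
  assumes C: "C2fun h h' h''" and t: "touch_above w z h" and u: "lip_t u" and pos: "snd z \<bullet> e > 0"
    and w: "\<And>z. w z = m * u (fst z) (snd z \<bullet> e)"
  shows "Gam (\<bar>m\<bar> * L) e (h' z)"
  unfolding Gam_def
proof (intro conjI allI impI)
  show "norm (fst (h' z)) \<le> \<bar>m\<bar> * L"
  proof (rule touch_gradient_bound[OF C t zero_less_one])
    fix x
    have "\<bar>u x (snd z \<bullet> e) - u (fst z) (snd z \<bullet> e)\<bar> \<le> L * dist x (fst z)" using u pos by (simp add: lip_t_def)
    then show "\<bar>w (x, snd z) - w z\<bar> \<le> (\<bar>m\<bar> * L) * dist x (fst z)"
      unfolding w fst_conv snd_conv right_diff_distrib[symmetric] abs_mult mult.assoc by (intro mult_left_mono) auto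
  qed
  fix d :: "real \<times> real" assume d: "d \<bullet> e = 0"
  have "h' z \<bullet> (0, d) = 0"
    by (rule touch_gradient_zero[OF C t]) (simp add: w inner_add_left d)
  then show "snd (h' z) \<bullet> d = 0" by (simp add: inner_prod_def)
qed

lemma touch_slice:
  fixes h :: "(real^'n) \<times> (real \<times> real) \<Rightarrow> real"
  assumes t: "touch_above w z h" and e: "e \<bullet> e = 1" and w: "\<And>z. w z = m * u (fst z) (snd z \<bullet> e)"
  shows "\<exists>d>0. \<forall>y s. dist y (fst z) < d \<and> \<bar>s - snd z \<bullet> e\<bar> < d \<longrightarrow>
     m * u y s - h (y, (snd z - (snd z \<bullet> e) *\<^sub>R e) + s *\<^sub>R e) \<le> m * u (fst z) (snd z \<bullet> e) - h z"
proof -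
  obtain d where d: "d > 0" "\<And>y. dist y z < d \<Longrightarrow> w y - h y \<le> w z - h z" using t by (auto simp: touch_above_def)
  have ne: "norm e = 1" using e by (simp add: norm_eq_sqrt_inner)
  show ?thesis
  proof (intro exI[of _ "d / 2"] conjI allI impI)
    fix y s assume a: "dist y (fst z) < d / 2 \<and> \<bar>s - snd z \<bullet> e\<bar> < d / 2"
    let ?\<tau> = "(snd z - (snd z \<bullet> e) *\<^sub>R e) + s *\<^sub>R e"
    have "?\<tau> - snd z = (s - snd z \<bullet> e) *\<^sub>R e" by (simp add: algebra_simps)
    then have "dist ?\<tau> (snd z) = \<bar>s - snd z \<bullet> e\<bar>" by (simp add: dist_norm ne)
    then have "dist (y, ?\<tau>) z < d"
      using a sqrt_sum_squares_le_sum[of "dist y (fst z)" "dist ?\<tau> (snd z)"] by (simp add: dist_prod_def)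
    from d(2)[OF this] show "m * u y s - h (y, ?\<tau>) \<le> m * u (fst z) (snd z \<bullet> e) - h z"
      by (simp add: w inner_add_left inner_diff_left e)
  qed (use d in auto)
qed

text \<open>If \<open>h\<close> touches \<open>m * u\<close>, then \<open>h / m\<close> touches
  \<open>u\<close>; multiplying the resulting inequality by \<open>m\<close> leaves
  \<open>m * H\<close> at the rescaled gradient, whence the parameters of \<open>GG\<close>.\<close>

lemma sub_embed:
  assumes u: "visc_sol_E \<sigma> H u" "lip_t u" and m: "m > 0" and e: "e \<bullet> e = 1"
    and S: "\<And>z. z \<in> S \<Longrightarrow> snd z \<bullet> e > 0" and w: "w = (\<lambda>z. m * u (fst z) (snd z \<bullet> e))"
  shows "sub_at sg (GG 1 m (1 / m) e) (Gam (m * L) e) S w"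
  unfolding sub_at_def
proof (intro allI impI)
  fix h h' h'' z assume C: "C2fun h h' h''" and z: "z \<in> S" and t: "touch_above w z h"
  have w': "w z = m * u (fst z) (snd z \<bullet> e)" for z by (simp add: w)
  define x0 t0 where "x0 = fst z" and "t0 = snd z \<bullet> e"
  define b where "b = snd z - t0 *\<^sub>R e"
  have zb: "(x0, b + t0 *\<^sub>R e) = z" by (simp add: b_def x0_def t0_def)
  have t0: "t0 > 0" using S[OF z] by (simp add: t0_def)
  note test = C2fun_C21_test[OF C, of "1 / m" b e]
  obtain d where d: "d > 0" "\<And>y s. dist y x0 < d \<Longrightarrow> \<bar>s - t0\<bar> < d \<Longrightarrow> m * u y s - h (y, b + s *\<^sub>R e) \<le> m * u x0 t0 - h z"
    using touch_slice[OF t e w', folded x0_def t0_def, folded b_def] by blast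
  have "u y s - 1 / m * h (y, b + s *\<^sub>R e) \<le> u x0 t0 - 1 / m * h (x0, b + t0 *\<^sub>R e)"
    if "dist y x0 < d" "\<bar>s - t0\<bar> < d" for y s
    using divide_right_mono[OF d(2)[OF that], of m] m unfolding zb by (simp add: diff_divide_distrib)
  then have ineq: "1 / m * (snd (h' (x0, b + t0 *\<^sub>R e)) \<bullet> e) + Ham \<sigma> H x0 ((1 / m) *\<^sub>R fst (h' (x0, b + t0 *\<^sub>R e)))
     (matrix (\<lambda>v. (1 / m) *\<^sub>R fst (h'' (x0, b + t0 *\<^sub>R e) (v, 0)))) \<le> 0"
    by (rule visc_sol_E_sub[OF u(1) test t0 d(1)])
  have lin: "linear (\<lambda>v. (1 / m) *\<^sub>R fst (h'' z (v, 0)))"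
  proof -
    have l: "linear (h'' z)" by (rule C2fun_linear[OF C])
    show ?thesis
      by (rule linearI)
        (use linear_add[OF l, of "(_, 0)" "(_, 0)"] linear_cmul[OF l, of _ "(_, 0)"] in \<open>auto simp: algebra_simps\<close>)
  qed
  show "Gam (m * L) e (h' z) \<and> (\<forall>\<theta>. GG 1 m (1 / m) e \<theta> z (h' z) \<le> tr2 (sg \<theta> z) h'' z)"
  proof (intro conjI allI)
    show "Gam (m * L) e (h' z)" using Gam_touch[OF C t u(2) S[OF z] w'] m by simp
    fix \<theta>
    have "trace (diffA \<sigma> \<theta> x0 ** matrix (\<lambda>v. (1 / m) *\<^sub>R fst (h'' z (v, 0)))) = 1 / m * tr2 (sg \<theta> z) h'' z"
      unfolding tr_matrix_sg[OF lin] tr2_def sg_def x0_def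
      by (simp add: inner_prod_def sum_divide_distrib sum_distrib_left)
    then have "1 / m * (snd (h' z) \<bullet> e) - 1 / m * tr2 (sg \<theta> z) h'' z + H \<theta> x0 ((1 / m) *\<^sub>R fst (h' z)) \<le> 0"
      using ineq op_le_Ham[of \<theta> x0 "(1 / m) *\<^sub>R fst (h' z)" "matrix (\<lambda>v. (1 / m) *\<^sub>R fst (h'' z (v, 0)))"]
      unfolding zb op_def by linarith
    then have "m * (1 / m * (snd (h' z) \<bullet> e) - 1 / m * tr2 (sg \<theta> z) h'' z + H \<theta> x0 ((1 / m) *\<^sub>R fst (h' z))) \<le> 0"
      using m by (simp add: mult_le_0_iff)
    then show "GG 1 m (1 / m) e \<theta> z (h' z) \<le> tr2 (sg \<theta> z) h'' z"
      using m by (simp add: GG_def algebra_simps x0_def)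
  qed
qed

text \<open>Touching \<open>- u\<close> from above by \<open>h\<close> is touching \<open>u\<close>
  from below by \<open>- h\<close>; the lower bound on the supremum leaves an almost optimal
  \<open>\<theta>\<close>.\<close>

lemma super_embed:
  assumes u: "visc_sol_E \<sigma> H u" "lip_t u" and e: "e \<bullet> e = 1"
    and S: "\<And>z. z \<in> S \<Longrightarrow> snd z \<bullet> e > 0" and w: "w = (\<lambda>z. - u (fst z) (snd z \<bullet> e))"
  shows "super_neg_at sg (GG (-1) 1 (-1) e) (Gam L e) S w"
  unfolding super_neg_at_def
proof (intro allI impI)
  fix h h' h'' z assume C: "C2fun h h' h''" and z: "z \<in> S" and t: "touch_above w z h"
  have w': "w z = (-1) * u (fst z) (snd z \<bullet> e)" for z by (simp add: w)
  define x0 t0 where "x0 = fst z" and "t0 = snd z \<bullet> e"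
  define b where "b = snd z - t0 *\<^sub>R e"
  have zb: "(x0, b + t0 *\<^sub>R e) = z" by (simp add: b_def x0_def t0_def)
  have t0: "t0 > 0" using S[OF z] by (simp add: t0_def)
  note test = C2fun_C21_test[OF C, of "-1" b e]
  obtain d where d: "d > 0" "\<And>y s. dist y x0 < d \<Longrightarrow> \<bar>s - t0\<bar> < d \<Longrightarrow> (-1) * u y s - h (y, b + s *\<^sub>R e) \<le> (-1) * u x0 t0 - h z"
    using touch_slice[OF t e w', folded x0_def t0_def, folded b_def] by blast
  have "u y s - (-1) * h (y, b + s *\<^sub>R e) \<ge> u x0 t0 - (-1) * h (x0, b + t0 *\<^sub>R e)"
    if "dist y x0 < d" "\<bar>s - t0\<bar> < d" for y s
    using d(2)[OF that] unfolding zb by simp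
  then have ineq: "(-1) * (snd (h' (x0, b + t0 *\<^sub>R e)) \<bullet> e) + Ham \<sigma> H x0 ((-1) *\<^sub>R fst (h' (x0, b + t0 *\<^sub>R e)))
     (matrix (\<lambda>v. (-1) *\<^sub>R fst (h'' (x0, b + t0 *\<^sub>R e) (v, 0)))) \<ge> 0"
    by (rule visc_sol_E_super[OF u(1) test t0 d(1)])
  have lin: "linear (\<lambda>v. (-1) *\<^sub>R fst (h'' z (v, 0)))"
  proof -
    have l: "linear (h'' z)" by (rule C2fun_linear[OF C])
    show ?thesis
      by (rule linearI)
        (use linear_add[OF l, of "(_, 0)" "(_, 0)"] linear_cmul[OF l, of _ "(_, 0)"] in \<open>auto simp: algebra_simps\<close>)
  qed
  show "Gam L e (h' z) \<and> (\<forall>\<gamma>>0. \<exists>\<theta>. tr2 (sg \<theta> z) h'' z + GG (-1) 1 (-1) e \<theta> z (h' z) \<ge> - \<gamma>)"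
  proof (intro conjI allI impI)
    show "Gam L e (h' z)" using Gam_touch[OF C t u(2) S[OF z] w'] by simp
    fix \<gamma> :: real assume "\<gamma> > 0"
    then obtain \<theta> where \<theta>: "snd (h' z) \<bullet> e - \<gamma> < op \<theta> x0 ((-1) *\<^sub>R fst (h' z)) (matrix (\<lambda>v. (-1) *\<^sub>R fst (h'' z (v, 0))))"
      using ineq Ham_gt[of "snd (h' z) \<bullet> e - \<gamma>" x0 "(-1) *\<^sub>R fst (h' z)" "matrix (\<lambda>v. (-1) *\<^sub>R fst (h'' z (v, 0)))"] unfolding zb by force
    have "trace (diffA \<sigma> \<theta> x0 ** matrix (\<lambda>v. (-1) *\<^sub>R fst (h'' z (v, 0)))) = - tr2 (sg \<theta> z) h'' z"
      unfolding tr_matrix_sg[OF lin] tr2_def sg_def x0_def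
      by (simp add: inner_prod_def sum_negf)
    then show "\<exists>\<theta>. tr2 (sg \<theta> z) h'' z + GG (-1) 1 (-1) e \<theta> z (h' z) \<ge> - \<gamma>"
      using \<theta> by (intro exI[of _ \<theta>]) (simp add: op_def GG_def x0_def)
  qed
qed


definition KH :: real where
  "KH = (SOME K. K > 0 \<and> (\<forall>\<theta> x y p q. norm p \<le> L + 1 \<and> norm q \<le> L + 1 \<longrightarrow> \<bar>H \<theta> x p - H \<theta> y q\<bar> \<le> K * (dist x y + dist p q)))"

lemma KH: "KH > 0" "norm p \<le> L + 1 \<Longrightarrow> norm q \<le> L + 1 \<Longrightarrow> \<bar>H \<theta> x p - H \<theta> y q\<bar> \<le> KH * (dist x y + dist p q)"
proof -
  have "L + 1 > 0" using L0 by simp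
  from someI_ex[OF H_lip[OF this]] show "KH > 0"
    "norm p \<le> L + 1 \<Longrightarrow> norm q \<le> L + 1 \<Longrightarrow> \<bar>H \<theta> x p - H \<theta> y q\<bar> \<le> KH * (dist x y + dist p q)"
    unfolding KH_def[symmetric] by blast+
qed

lemma open_Sigma_compl: "open (Sigma_compl \<sigma> \<delta>)"
proof (cases "Sigma_set \<sigma> = {}")
  case False
  then have "Sigma_compl \<sigma> \<delta> = {x. \<delta> < infdist x (Sigma_set \<sigma>)}" by (auto simp: Sigma_compl_def)
  then show ?thesis by (simp add: open_Collect_less continuous_on_infdist)
qed (simp add: Sigma_compl_def)

lemma diffA_quadratic: "\<xi> \<bullet> (diffA \<sigma> \<theta> x *v \<xi>) = (norm (transpose (\<sigma> \<theta> x) *v \<xi>))\<^sup>2"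
  unfolding diffA_def power2_norm_eq_inner
  by (simp add: dot_lmul_matrix vector_transpose_matrix matrix_vector_mul_assoc[symmetric])

lemma sigma_invertible:
  assumes "\<nu> > 0" "\<And>\<xi>. \<xi> \<bullet> (diffA \<sigma> \<theta> x *v \<xi>) \<ge> \<nu> * (norm \<xi>)\<^sup>2"
  shows "invertible (\<sigma> \<theta> x)"
proof -
  have "\<xi> = 0" if "transpose (\<sigma> \<theta> x) *v \<xi> = 0" for \<xi>
  proof -
    have "\<nu> * (norm \<xi>)\<^sup>2 \<le> 0" using assms(2)[of \<xi>] that unfolding diffA_quadratic by simp
    then show ?thesis using assms(1) by (simp add: mult_le_0_iff)
  qed
  then have "invertible (transpose (\<sigma> \<theta> x))"
    unfolding invertible_left_inverse matrix_left_invertible_ker by blast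
  from transpose_invertible[OF this] show ?thesis by simp
qed

text \<open>The map is \<open>\<sigma>(z')\<close> composed with the inverse of
  \<open>\<sigma>(z)\<close> in space, and the identity in time. This is where nondegeneracy enters,
  and why the sum principle is confined to the complement of \<open>\<Sigma>\<close>.\<close>

lemma sg_transfer:
  assumes "invertible (\<sigma> \<theta> (fst z))"
  shows "\<exists>M. linear M \<and> (\<forall>j. M (sg \<theta> z j) = sg \<theta> z' j)"
proof -
  obtain B where B: "B ** \<sigma> \<theta> (fst z) = mat 1" using assms unfolding invertible_def by blast
  let ?Q = "\<sigma> \<theta> (fst z') ** B"
  have col: "A *v column j B = column j (A ** B)" for A B :: "real^'n^'n" and j
    by (simp add: vec_eq_iff column_def matrix_vector_mult_def matrix_matrix_mult_def)
  have "?Q ** \<sigma> \<theta> (fst z) = \<sigma> \<theta> (fst z')"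
    unfolding matrix_mul_assoc[symmetric] B by simp
  then have "(\<lambda>w. (?Q *v fst w, snd w)) (sg \<theta> z j) = sg \<theta> z' j" for j
    by (simp add: sg_def col)
  moreover have "linear (\<lambda>w. (?Q *v fst w, snd w :: real \<times> real))"
    by (rule linearI) (auto simp: matrix_vector_right_distrib matrix_vector_mult_scaleR)
  ultimately show ?thesis by blast
qed

lemma norm_column_le: "norm (column j A) \<le> norm A" for A :: "real^'n^'n"
proof -
  have "(norm (column j A))\<^sup>2 = (\<Sum>i\<in>UNIV. (A $ i $ j)\<^sup>2)"
    unfolding power2_norm_eq_inner inner_vec_def by (simp add: column_def power2_eq_square)
  also have "\<dots> \<le> (\<Sum>i\<in>UNIV. (norm (A $ i))\<^sup>2)"
    using component_le_norm_cart by (intro sum_mono) (simp add: abs_le_square_iff[symmetric])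
  also have "\<dots> = (norm A)\<^sup>2"
    by (simp add: power2_norm_eq_inner inner_vec_def)
  finally show ?thesis by (simp add: power2_le_iff_abs_le)
qed

lemma sg_norm: "norm (sg \<theta> z j) = norm (column j (\<sigma> \<theta> (fst z)))"
  by (simp add: sg_def norm_Pair)

lemma sg_norm_bound: "norm (sg \<theta> z j) \<le> C"
  unfolding sg_norm using norm_column_le sig_bd by (rule order_trans)

lemma sg_lip: "norm (sg \<theta> z j - sg \<theta> z' j) \<le> C * dist z z'"
proof -
  have "sg \<theta> z j - sg \<theta> z' j = (column j (\<sigma> \<theta> (fst z) - \<sigma> \<theta> (fst z')), 0)"
    by (simp add: sg_def column_def vec_eq_iff)
  then have "norm (sg \<theta> z j - sg \<theta> z' j) = norm (column j (\<sigma> \<theta> (fst z) - \<sigma> \<theta> (fst z')))" by (simp add: norm_Pair)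
  also have "\<dots> \<le> C * dist (fst z) (fst z')" by (rule order_trans[OF norm_column_le sig_lip])
  also have "\<dots> \<le> C * dist z z'" using dist_fst_le[of z z'] C0 by (intro mult_left_mono) auto
  finally show ?thesis .
qed

lemma visc_sol_E_continuous: "visc_sol_E \<sigma> H u \<Longrightarrow> continuous_on (UNIV \<times> {0<..}) (\<lambda>z. u (fst z) (snd z))"
  unfolding visc_sol_E_def by blast

text \<open>From nonlinear equations to a linear inequality for \<open>\<phi>\<close>: all three
  functions are used with one \<open>\<theta>\<close>, convexity bounds \<open>H\<close> at the
  combined gradient by the two subsolution inequalities, and the mismatch of gradients costs
  \<open>KH\<close> times the norm of the space gradient of \<open>\<phi>\<close>.\<close>

lemma diff_off_Sigma:
  fixes xh :: "real^'n" and rh th :: real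
  assumes U: "visc_sol_E \<sigma> H U" "lip_t U" and W: "visc_sol_E \<sigma> H W" "lip_t W" and V: "visc_sol_E \<sigma> H V" "lip_t V"
    and mn: "m > 0" "n > 0" "m + n = 1" and off: "\<delta> > 0" "xh \<in> Sigma_compl \<sigma> \<delta>"
    and pos: "rh > 0" "th > 0" and \<phi>: "C2fun \<phi> \<phi>' \<phi>''"
    and \<rho>: "\<rho> > 0" "\<And>x r t. dist (x, r, t) (xh, rh, th) < \<rho> \<Longrightarrow>
       - U x r + m * W x t + n * V x t + \<phi> (x, r, t) \<le> - U xh rh + m * W xh th + n * V xh th + \<phi> (xh, rh, th)"
    and \<gamma>: "\<gamma> > 0"
  shows "\<exists>\<theta>. fst (snd (\<phi>' (xh, rh, th))) + snd (snd (\<phi>' (xh, rh, th))) + KH * norm (fst (\<phi>' (xh, rh, th)))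
     - tr2 (sg \<theta> (xh, rh, th)) \<phi>'' (xh, rh, th) \<ge> - \<gamma>"
proof -
  let ?zh = "(xh, rh, th)" let ?er = "(1, 0) :: real \<times> real" and ?et = "(0, 1) :: real \<times> real"
  obtain d where d: "d > 0" "ball xh d \<subseteq> Sigma_compl \<sigma> \<delta>"
    using open_Sigma_compl off(2) by (meson open_contains_ball)
  define R where "R = min (min (\<rho> / 2) (d / 2)) (min (rh / 2) (th / 2))"
  have R: "R > 0" "R < \<rho>" "R < d" "R < rh" "R < th" using \<rho>(1) d(1) pos by (auto simp: R_def)
  have near: "dist (fst z) xh \<le> dist z ?zh" "\<bar>fst (snd z) - rh\<bar> \<le> dist z ?zh" "\<bar>snd (snd z) - th\<bar> \<le> dist z ?zh" for z
    using dist_fst_le[of z ?zh] dist_snd_le[of z ?zh] dist_fst_le[of "snd z" "snd ?zh"] dist_snd_le[of "snd z" "snd ?zh"]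
    by (auto simp: dist_real_def)
  have tpos: "fst (snd z) > 0" "snd (snd z) > 0" "fst z \<in> Sigma_compl \<sigma> \<delta>" if "z \<in> cball ?zh R" for z
  proof -
    have "dist z ?zh \<le> R" using that by (simp add: dist_commute)
    then show "fst (snd z) > 0" "snd (snd z) > 0" "fst z \<in> Sigma_compl \<sigma> \<delta>"
      using near[of z] R d(2) by (auto simp: dist_commute subset_iff)
  qed
  obtain \<nu> where \<nu>: "\<nu> > 0" "\<And>\<theta> x \<xi>. x \<in> Sigma_compl \<sigma> \<delta> \<Longrightarrow> \<xi> \<bullet> (diffA \<sigma> \<theta> x *v \<xi>) \<ge> \<nu> * (norm \<xi>)\<^sup>2"
    using nondeg[OF off(1)] by blast
  have inv: "invertible (\<sigma> \<theta> (fst z))" if "z \<in> cball ?zh R" for \<theta> z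
    by (rule sigma_invertible[OF \<nu>(1) \<nu>(2)[OF tpos(3)[OF that]]])
  define w1 where "w1 = (\<lambda>z :: (real^'n) \<times> real \<times> real. - U (fst z) (snd z \<bullet> ?er))"
  define w2 where "w2 = (\<lambda>z :: (real^'n) \<times> real \<times> real. m * W (fst z) (snd z \<bullet> ?et))"
  define w3 where "w3 = (\<lambda>z :: (real^'n) \<times> real \<times> real. n * V (fst z) (snd z \<bullet> ?et))"
  have cont: "continuous_on (cball ?zh R) (\<lambda>z. u (fst z) (f (snd z)))"
    if u: "visc_sol_E \<sigma> H u" and f: "f = fst \<or> f = snd" for u and f :: "real \<times> real \<Rightarrow> real"
    by (rule continuous_on_compose2[OF visc_sol_E_continuous[OF u], of _ "\<lambda>z. (fst z, f (snd z))", simplified])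
      (use f tpos in \<open>auto intro!: continuous_intros\<close>)
  have c: "continuous_on (cball ?zh R) w1" "continuous_on (cball ?zh R) w2" "continuous_on (cball ?zh R) w3"
    unfolding w1_def w2_def w3_def inner_prod_def
    using cont[OF U(1), of fst] cont[OF W(1), of snd] cont[OF V(1), of snd] by (auto intro!: continuous_intros)
  have mx: "w1 z + w2 z + w3 z + \<phi> z \<le> w1 ?zh + w2 ?zh + w3 ?zh + \<phi> ?zh" if "z \<in> cball ?zh R" for z
  proof -
    obtain x r t where z: "z = (x, r, t)" by (metis prod_cases3)
    have "dist (x, r, t) ?zh < \<rho>" using that R(2) unfolding z by (simp add: dist_commute)
    from \<rho>(2)[OF this] show ?thesis by (simp add: w1_def w2_def w3_def inner_prod_def z)
  qed
  have s1: "super_neg_at sg (GG (-1) 1 (-1) ?er) (Gam L ?er) (ball ?zh R) w1"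
    by (rule super_embed[OF U _ _ w1_def]) (use tpos in \<open>auto simp: inner_prod_def\<close>)
  have s2: "sub_at sg (GG 1 m (1 / m) ?et) (Gam (m * L) ?et) (ball ?zh R) w2"
    by (rule sub_embed[OF W mn(1) _ _ w2_def]) (use tpos in \<open>auto simp: inner_prod_def\<close>)
  have s3: "sub_at sg (GG 1 n (1 / n) ?et) (Gam (n * L) ?et) (ball ?zh R) w3"
    by (rule sub_embed[OF V mn(2) _ _ w3_def]) (use tpos in \<open>auto simp: inner_prod_def\<close>)
  \<comment> \<open>One error comes from the sum principle and two from the time derivatives; with
    factor \<open>KH\<close>, one more comes from the gradient mismatch and two from moving
    \<open>H\<close> between points at distance at most \<open>2 * \<gamma>'\<close>.\<close>
  define \<gamma>' where "\<gamma>' = \<gamma> / (3 + 3 * KH)"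
  have \<gamma>': "\<gamma>' > 0" "3 * \<gamma>' + 3 * KH * \<gamma>' = \<gamma>"
  proof -
    have "3 + 3 * KH > 0" using KH(1) by simp
    then show "\<gamma>' > 0" using \<gamma> by (simp add: \<gamma>'_def)
    have "3 * \<gamma>' + 3 * KH * \<gamma>' = \<gamma>' * (3 + 3 * KH)" by (simp add: algebra_simps)
    also have "\<dots> = \<gamma>" unfolding \<gamma>'_def by (rule nonzero_eq_divide_eq[THEN iffD1, OF _ refl]) (use \<open>3 + 3 * KH > 0\<close> in linarith)
    finally show "3 * \<gamma>' + 3 * KH * \<gamma>' = \<gamma>" .
  qed
  have nz: "\<exists>j. sg \<theta> z j \<noteq> 0" if z: "z \<in> ball ?zh R" for \<theta> z
  proof (rule ccontr)
    assume "\<not> ?thesis"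
    then have "column j (\<sigma> \<theta> (fst z)) = 0" for j using sg_norm[of \<theta> z j] by simp
    then have "\<sigma> \<theta> (fst z) = 0" by (simp add: vec_eq_iff column_def)
    moreover have "invertible (\<sigma> \<theta> (fst z))" using z by (intro inv) simp
    then obtain B where "B ** \<sigma> \<theta> (fst z) = mat 1" unfolding invertible_def by blast
    ultimately have "(mat 1 :: real^'n^'n) = 0" by (simp add: vec_eq_iff matrix_matrix_mult_def)
    then have "(mat 1 :: real^'n^'n) $ undefined $ undefined = 0" by simp
    then show False by (simp add: mat_def)
  qed
  have tr: "\<exists>M. linear M \<and> (\<forall>j. M (sg \<theta> z j) = sg \<theta> z' j)" if "z \<in> ball ?zh R" for \<theta> z z'
    by (rule sg_transfer[OF inv]) (use that in simp)
  obtain \<theta> z1 z2 z3 p1 p2 p3 where z: "dist z1 ?zh < \<gamma>'" "dist z2 ?zh < \<gamma>'" "dist z3 ?zh < \<gamma>'"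
    and G: "Gam L ?er p1" "Gam (m * L) ?et p2" "Gam (n * L) ?et p3"
    and p: "norm (p1 + p2 + p3 + \<phi>' ?zh) < \<gamma>'"
    and main: "GG (-1) 1 (-1) ?er \<theta> z1 p1 - GG 1 m (1 / m) ?et \<theta> z2 p2 - GG 1 n (1 / n) ?et \<theta> z3 p3 - tr2 (sg \<theta> ?zh) \<phi>'' ?zh \<ge> - \<gamma>'"
    using sum_principle[OF R(1) c \<phi> mx s1 s2 s3 C0 sg_norm_bound sg_lip tr nz equi_GG equi_GG equi_GG \<gamma>'(1)]
    by blast
  have g: "snd (snd p1) = 0" "fst (snd p2) = 0" "fst (snd p3) = 0"
    "norm (fst p1) \<le> L" "norm (fst p2) \<le> m * L" "norm (fst p3) \<le> n * L"
    using G unfolding Gam_def by (auto simp: inner_prod_def dest: spec[of _ "(0, 1)"] spec[of _ "(1, 0)"])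
  let ?s = "p1 + p2 + p3 + \<phi>' ?zh"
  have ns: "norm (fst ?s) < \<gamma>'" "\<bar>fst (snd ?s)\<bar> < \<gamma>'" "\<bar>snd (snd ?s)\<bar> < \<gamma>'"
    using p norm_fst_le[of "fst ?s" "snd ?s"] norm_snd_le[of "snd ?s" "fst ?s"] norm_fst_le[of "fst (snd ?s)" "snd (snd ?s)"]
      norm_snd_le[of "snd (snd ?s)" "fst (snd ?s)"] unfolding prod.collapse real_norm_def by linarith+
  define P2 P3 where "P2 = (1 / m) *\<^sub>R fst p2" and "P3 = (1 / n) *\<^sub>R fst p3"
  have P: "m *\<^sub>R P2 = fst p2" "n *\<^sub>R P3 = fst p3" "norm P2 \<le> L" "norm P3 \<le> L"
    using mn g(5,6) by (auto simp: P2_def P3_def field_simps)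
  have P23: "norm (m *\<^sub>R P2 + n *\<^sub>R P3) \<le> L"
  proof -
    have "norm (m *\<^sub>R P2 + n *\<^sub>R P3) \<le> m * L + n * L" unfolding P(1,2) using norm_triangle_mono[OF g(5,6)] .
    then show ?thesis using mn(3) by (simp flip: distrib_right)
  qed
  have xd: "dist (fst z1) (fst z2) \<le> 2 * \<gamma>'" "dist (fst z1) (fst z3) \<le> 2 * \<gamma>'"
    using near(1)[of z1] near(1)[of z2] near(1)[of z3] z dist_triangle2[of "fst z1" "fst z2" xh] dist_triangle2[of "fst z1" "fst z3" xh]
    by linarith+
  have h1: "H \<theta> (fst z1) (- fst p1) \<le> H \<theta> (fst z1) (m *\<^sub>R P2 + n *\<^sub>R P3) + KH * (norm (fst (\<phi>' ?zh)) + \<gamma>')"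
  proof -
    have "dist (- fst p1) (m *\<^sub>R P2 + n *\<^sub>R P3) = norm (fst ?s - fst (\<phi>' ?zh))"
      unfolding P(1,2) dist_norm by (subst norm_minus_cancel[symmetric]) (simp add: algebra_simps)
    also have "\<dots> \<le> norm (fst (\<phi>' ?zh)) + \<gamma>'" using norm_triangle_ineq4[of "fst ?s" "fst (\<phi>' ?zh)"] ns(1) by linarith
    finally have "dist (- fst p1) (m *\<^sub>R P2 + n *\<^sub>R P3) \<le> norm (fst (\<phi>' ?zh)) + \<gamma>'" .
    then have "KH * dist (- fst p1) (m *\<^sub>R P2 + n *\<^sub>R P3) \<le> KH * (norm (fst (\<phi>' ?zh)) + \<gamma>')"
      using KH(1) by (intro mult_left_mono) auto
    moreover have "\<bar>H \<theta> (fst z1) (- fst p1) - H \<theta> (fst z1) (m *\<^sub>R P2 + n *\<^sub>R P3)\<bar> \<le> KH * (dist (fst z1) (fst z1) + dist (- fst p1) (m *\<^sub>R P2 + n *\<^sub>R P3))"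
      by (rule KH(2)) (use g(4) P23 in auto)
    ultimately show ?thesis unfolding abs_le_iff by simp
  qed
  have h2: "H \<theta> (fst z1) (m *\<^sub>R P2 + n *\<^sub>R P3) \<le> m * H \<theta> (fst z1) P2 + n * H \<theta> (fst z1) P3"
    using conv[of \<theta> "fst z1"] mn unfolding convex_on_def by simp
  have h3: "H \<theta> (fst z1) P2 \<le> H \<theta> (fst z2) P2 + KH * (2 * \<gamma>')" "H \<theta> (fst z1) P3 \<le> H \<theta> (fst z3) P3 + KH * (2 * \<gamma>')"
  proof -
    have "\<bar>H \<theta> (fst z1) P2 - H \<theta> (fst z2) P2\<bar> \<le> KH * (dist (fst z1) (fst z2) + dist P2 P2)"
      "\<bar>H \<theta> (fst z1) P3 - H \<theta> (fst z3) P3\<bar> \<le> KH * (dist (fst z1) (fst z3) + dist P3 P3)"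
      by (rule KH(2); use P in simp)+
    moreover have "KH * dist (fst z1) (fst z2) \<le> KH * (2 * \<gamma>')" "KH * dist (fst z1) (fst z3) \<le> KH * (2 * \<gamma>')"
      using xd KH(1) by (auto intro!: mult_left_mono)
    ultimately show "H \<theta> (fst z1) P2 \<le> H \<theta> (fst z2) P2 + KH * (2 * \<gamma>')" "H \<theta> (fst z1) P3 \<le> H \<theta> (fst z3) P3 + KH * (2 * \<gamma>')"
      unfolding abs_le_iff by auto
  qed
  have h4: "m * H \<theta> (fst z1) P2 + n * H \<theta> (fst z1) P3 \<le> m * H \<theta> (fst z2) P2 + n * H \<theta> (fst z3) P3 + KH * (2 * \<gamma>')"
  proof -
    have "m * H \<theta> (fst z1) P2 + n * H \<theta> (fst z1) P3 \<le> m * (H \<theta> (fst z2) P2 + KH * (2 * \<gamma>')) + n * (H \<theta> (fst z3) P3 + KH * (2 * \<gamma>'))"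
      using mn h3 by (intro add_mono mult_left_mono) auto
    also have "\<dots> = m * H \<theta> (fst z2) P2 + n * H \<theta> (fst z3) P3 + (m + n) * (KH * (2 * \<gamma>'))" by (simp add: algebra_simps)
    finally show ?thesis unfolding mn(3) by simp
  qed
  have "- fst (snd p1) + H \<theta> (fst z1) (- fst p1) - (snd (snd p2) + m * H \<theta> (fst z2) P2) - (snd (snd p3) + n * H \<theta> (fst z3) P3)
      - tr2 (sg \<theta> ?zh) \<phi>'' ?zh \<ge> - \<gamma>'"
    using main unfolding GG_def P2_def P3_def by (simp add: inner_prod_def)
  moreover have "- fst (snd p1) \<le> fst (snd (\<phi>' ?zh)) + \<gamma>'" "- (snd (snd p2) + snd (snd p3)) \<le> snd (snd (\<phi>' ?zh)) + \<gamma>'"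
    using ns(2,3) g(1-3) by (simp_all add: abs_less_iff)
  ultimately have "fst (snd (\<phi>' ?zh)) + snd (snd (\<phi>' ?zh)) + KH * norm (fst (\<phi>' ?zh)) - tr2 (sg \<theta> ?zh) \<phi>'' ?zh \<ge> - (3 * \<gamma>' + 3 * KH * \<gamma>')"
    using h1 h2 h4 by (simp add: distrib_left)
  then show ?thesis unfolding \<gamma>'(2) by blast
qed

end

section \<open>Inequalities at points of \<open>\<Sigma>\<close>\<close>

lemma C21_test_quad:
  fixes c1 c2 c3 :: "real^'n"
  assumes g: "\<And>s. (g has_real_derivative g' s) (at s)" "continuous_on UNIV g'"
  shows "C21_test (\<lambda>x s. g s + a1 * (norm (x - c1))\<^sup>2 + a2 * (norm (x - c2))\<^sup>2 + a3 * (norm (x - c3))\<^sup>2) (\<lambda>x s. g' s)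
    (\<lambda>x s. (2 * a1) *\<^sub>R (x - c1) + (2 * a2) *\<^sub>R (x - c2) + (2 * a3) *\<^sub>R (x - c3)) (\<lambda>x s. (2 * (a1 + a2 + a3)) *\<^sub>R mat 1)"
  unfolding C21_test_def
proof (intro conjI allI)
  fix x :: "real^'n" and t :: real
  have gd: "((\<lambda>z. g (snd z)) has_derivative (\<lambda>h. g' t * snd h)) (at (x, t))"
    using has_derivative_compose[OF has_derivative_snd[OF has_derivative_ident], of g "(*) (g' t)" "(x, t)" UNIV]
      g(1)[of t] unfolding has_field_derivative_def by simp
  show "((\<lambda>z. g (snd z) + a1 * (norm (fst z - c1))\<^sup>2 + a2 * (norm (fst z - c2))\<^sup>2 + a3 * (norm (fst z - c3))\<^sup>2) has_derivative
     (\<lambda>h. ((2 * a1) *\<^sub>R (x - c1) + (2 * a2) *\<^sub>R (x - c2) + (2 * a3) *\<^sub>R (x - c3)) \<bullet> fst h + g' t * snd h)) (at (x, t))"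
    unfolding power2_norm_eq_inner
    by (rule has_derivative_eq_rhs, (rule derivative_eq_intros gd refl)+) (auto simp: fun_eq_iff inner_commute algebra_simps)
  have m: "((2 * (a1 + a2 + a3)) *\<^sub>R mat 1) *v h = (2 * a1) *\<^sub>R h + (2 * a2) *\<^sub>R h + (2 * a3) *\<^sub>R h" for h :: "real^'n"
    by (simp add: scaleR_matrix_vector_assoc[symmetric] algebra_simps)
  show "((\<lambda>y. (2 * a1) *\<^sub>R (y - c1) + (2 * a2) *\<^sub>R (y - c2) + (2 * a3) *\<^sub>R (y - c3)) has_derivative
     (\<lambda>h. ((2 * (a1 + a2 + a3)) *\<^sub>R mat 1) *v h)) (at x)"
    unfolding m by (auto intro!: derivative_eq_intros)
next
  show "continuous_on UNIV (\<lambda>z :: (real^'n) \<times> real. g' (snd z))"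
    by (intro continuous_on_compose2[OF g(2)] continuous_intros) auto
qed (auto intro!: continuous_intros)

context bellman
begin

lemma Sigma_sigma_zero:
  assumes "x \<in> Sigma_set \<sigma>"
  shows "\<sigma> \<theta> x = 0"
proof -
  have "\<sigma> \<theta> x $ i \<bullet> \<sigma> \<theta> x $ i = 0" for i
    using assms diffA_entry[of \<sigma> \<theta> x i i] by (simp add: Sigma_set_def)
  then show ?thesis by (simp add: vec_eq_iff)
qed

lemma trace_near_Sigma:
  assumes "xh \<in> Sigma_set \<sigma>" "k \<ge> 0"
  shows "0 \<le> trace (diffA \<sigma> \<theta> x ** (k *\<^sub>R mat 1))"
    "trace (diffA \<sigma> \<theta> x ** (k *\<^sub>R mat 1)) \<le> k * (real CARD('n) * (C * dist x xh)\<^sup>2)"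
proof -
  have s: "norm (column j (\<sigma> \<theta> x)) \<le> C * dist x xh" for j
    using order_trans[OF norm_column_le sig_lip[of \<theta> x xh, unfolded Sigma_sigma_zero[OF assms(1)] diff_0_right]] .
  have eq: "trace (diffA \<sigma> \<theta> x ** (k *\<^sub>R mat 1)) = k * (\<Sum>j\<in>UNIV. (norm (column j (\<sigma> \<theta> x)))\<^sup>2)"
    unfolding trace_diffA scaleR_matrix_vector_assoc[symmetric]
    by (simp add: sum_distrib_left power2_norm_eq_inner)
  show "0 \<le> trace (diffA \<sigma> \<theta> x ** (k *\<^sub>R mat 1))" unfolding eq using assms(2) by (simp add: sum_nonneg)
  have "(\<Sum>j\<in>(UNIV::'n set). (norm (column j (\<sigma> \<theta> x)))\<^sup>2) \<le> (\<Sum>j\<in>(UNIV::'n set). (C * dist x xh)\<^sup>2)"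
    by (intro sum_mono power_mono s) auto
  then show "trace (diffA \<sigma> \<theta> x ** (k *\<^sub>R mat 1)) \<le> k * (real CARD('n) * (C * dist x xh)\<^sup>2)"
    unfolding eq using assms(2) by (intro mult_left_mono) auto
qed

text \<open>The penalisation is anchored at the point \<open>xh\<close> of \<open>\<Sigma>\<close> and uses test functions whose Hessian is of order
  \<open>\<delta> powr -4\<close>, while the maximum points are at distance \<open>O(\<delta> ^ 3)\<close> of \<open>xh\<close>. Since the diffusion matrix vanishes
  quadratically at \<open>xh\<close>, all second-order terms are negligible.\<close>

lemma on_Sigma_approx:
  fixes V :: "real^'n \<Rightarrow> real"
  assumes U: "visc_sol_E \<sigma> H U" "lip_t U" and W: "visc_sol_E \<sigma> H W" "lip_t W" and V: "visc_sol_E \<sigma> H (\<lambda>x t. V x)" "lip_t (\<lambda>x t. V x)"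
    and mn: "m > 0" "n \<ge> 0" "m + n = 1" and xh: "xh \<in> Sigma_set \<sigma>" and pos: "rh > 0" "th > 0"
    and f: "\<And>r t. ((\<lambda>r. f r t) has_real_derivative fr r t) (at r)" "\<And>r t. ((\<lambda>t. f r t) has_real_derivative ft r t) (at t)"
      "continuous_on UNIV (\<lambda>z. f (fst z) (snd z))" "continuous_on UNIV (\<lambda>z. fr (fst z) (snd z))" "continuous_on UNIV (\<lambda>z. ft (fst z) (snd z))"
    and \<rho>: "\<rho> > 0" "\<And>x r t. dist x xh < \<rho> \<Longrightarrow> \<bar>r - rh\<bar> < \<rho> \<Longrightarrow> \<bar>t - th\<bar> < \<rho> \<Longrightarrow>
       U xh rh - m * W xh th - n * V xh - f rh th \<le> U x r - m * W x t - n * V x - f r t"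
    and \<gamma>: "\<gamma> > 0"
  shows "\<exists>p q. norm p \<le> 4 * L / m \<and> norm q \<le> 4 * L / n \<and> (\<forall>\<theta>. m * H \<theta> xh p \<le> ft rh th + \<gamma>) \<and> (n > 0 \<longrightarrow> (\<forall>\<theta>. H \<theta> xh q \<le> \<gamma>)) \<and>
     (\<exists>\<theta>. fr rh th + H \<theta> xh (m *\<^sub>R p + n *\<^sub>R q) \<ge> - \<gamma>)"
proof -
  define \<rho>' where "\<rho>' = min (\<rho> / 2) (min (rh / 2) (th / 2))"
  have \<rho>': "\<rho>' > 0" "\<rho>' < \<rho>" "\<rho>' < rh" "\<rho>' < th" using \<rho>(1) pos by (auto simp: \<rho>'_def)
  define M where "M = 4 * L / m + 4 * L / n"
  have M: "4 * L / m \<le> M" "4 * L / n \<le> M" "M > 0" using L0 mn by (auto simp: M_def intro: add_pos_nonneg)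
  define R where "R = 2 * M + 2 * L"
  have R: "R > 0" using M L0 by (simp add: R_def)
  obtain CR where CR: "CR > 0" "\<And>\<theta> x y p q. norm p \<le> R \<Longrightarrow> norm q \<le> R \<Longrightarrow> \<bar>H \<theta> x p - H \<theta> y q\<bar> \<le> CR * (dist x y + dist p q)"
    using H_lip[OF R] by blast
  have "isCont (\<lambda>z. fr (fst z) (snd z)) (rh, th)" "isCont (\<lambda>z. ft (fst z) (snd z)) (rh, th)"
    using f(4,5) by (auto simp: continuous_on_eq_continuous_at)
  then obtain d1 d2 where d: "d1 > 0" "\<And>z. dist z (rh, th) < d1 \<Longrightarrow> \<bar>fr (fst z) (snd z) - fr rh th\<bar> < \<gamma> / 4"
    "d2 > 0" "\<And>z. dist z (rh, th) < d2 \<Longrightarrow> \<bar>ft (fst z) (snd z) - ft rh th\<bar> < \<gamma> / 4"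
    using \<gamma> unfolding continuous_at_eps_delta dist_real_def fst_conv snd_conv
    by (metis zero_less_divide_iff zero_less_numeral)
  let ?N = "real CARD('n)"
  \<comment> \<open>One constant dominating all error coefficients below. The summand with
    \<open>1 / n\<close> belongs to the test for \<open>V\<close>, whose Hessian is scaled by
    \<open>1 / n\<close>; for \<open>n = 0\<close> it is \<open>0\<close> by the convention for
    division.\<close>
  define E where "E = 54 * (?N * C\<^sup>2 * L\<^sup>2) * (1 + 1 / n + 1 / m) + CR * (3 * L) + CR * (2 * L) + 2 * L + 3 * L + 1"
  have N: "?N \<ge> 1" by (simp add: Suc_leI)
  have E: "E \<ge> 3 * L" "E \<ge> 2 * L + 1" "E > 0"
    using L0 CR(1) mn N unfolding E_def by (auto intro!: add_nonneg_nonneg add_nonneg_pos)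
  have "\<forall>x\<in>set [1, \<gamma> / (4 * E), \<rho>' / (2 * E), d1 / (4 * E), d2 / (4 * E)]. 0 < x"
    using \<gamma> E(3) \<rho>'(1) d(1,3) by auto
  from small_positive[OF this, unfolded list.set ball_simps] obtain \<delta> where \<delta>: "\<delta> > 0" "\<delta> \<le> 1"
    "\<delta> \<le> \<gamma> / (4 * E)" "\<delta> \<le> \<rho>' / (2 * E)" "\<delta> \<le> d1 / (4 * E)" "\<delta> \<le> d2 / (4 * E)" by blast
  have E\<delta>: "E * \<delta> \<le> \<gamma> / 4" "E * \<delta> < \<rho>'" "2 * (E * \<delta>) < d1" "2 * (E * \<delta>) < d2"
    using \<delta> E(3) \<rho>'(1) d(1,3) by (auto simp: field_simps)
  have p\<delta>: "\<delta> ^ Suc k \<le> \<delta>" for k using \<delta>(1,2) power_le_one[of \<delta> k] by (simp add: mult_le_cancel_left1)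
  \<comment> \<open>These exponents also make the gradient of the anchor term negligible, being
    \<open>2 * b\<close> times a distance of order \<open>\<delta> ^ 3\<close>; it would otherwise
    disturb the relation between the gradient for \<open>U\<close> and the combination of
    \<open>p\<close> and \<open>q\<close>.\<close>
  define a b where "a = 1 / \<delta> ^ 4" and "b = 1 / \<delta> ^ 2"
  have ab: "a > 0" "b > 0" "b \<le> a" using \<delta>(1,2) power_le_one[of \<delta> 2]
    by (auto simp: a_def b_def power_decreasing divide_left_mono)
  let ?B = "cball xh \<rho>'"
  let ?K = "?B \<times> ?B \<times> ?B \<times> cball rh \<rho>' \<times> cball th \<rho>'"
  let ?\<Phi> = "\<lambda>(x1, x2, x3, r, t). U x1 r - m * W x2 t - n * V x3 - f r t + a * (norm (x1 - x2))\<^sup>2 + a * (norm (x1 - x3))\<^sup>2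
     + b * (norm (x1 - xh))\<^sup>2 + (r - rh)\<^sup>2 + (t - th)\<^sup>2"
  have tp: "r > 0" if "r \<in> cball rh \<rho>'" for r using that \<rho>'(3) by (auto simp: dist_real_def)
  have tp': "t > 0" if "t \<in> cball th \<rho>'" for t using that \<rho>'(4) by (auto simp: dist_real_def)
  have cV: "continuous_on S V" for S
  proof -
    have "continuous_on UNIV (\<lambda>x. (\<lambda>z. V (fst z)) (x, 1 :: real))"
      by (rule continuous_on_compose2[OF visc_sol_E_continuous[OF V(1)]]) (auto intro!: continuous_intros)
    then show ?thesis by (auto intro: continuous_on_subset)
  qed
  have "\<exists>w\<in>?K. \<forall>z\<in>?K. ?\<Phi> w \<le> ?\<Phi> z"
  proof (rule continuous_attains_inf)
    show "compact ?K" by (intro compact_Times) auto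
    have "continuous_on ?K (\<lambda>z. U (fst z) (fst (snd (snd (snd z)))))"
      by (rule continuous_on_compose2[OF visc_sol_E_continuous[OF U(1)], of _ "\<lambda>z. (fst z, fst (snd (snd (snd z))))", simplified])
        (use tp in \<open>auto intro!: continuous_intros\<close>)
    moreover have "continuous_on ?K (\<lambda>z. W (fst (snd z)) (snd (snd (snd (snd z)))))"
      by (rule continuous_on_compose2[OF visc_sol_E_continuous[OF W(1)], of _ "\<lambda>z. (fst (snd z), snd (snd (snd (snd z))))", simplified])
        (use tp' in \<open>auto intro!: continuous_intros\<close>)
    moreover have "continuous_on ?K (\<lambda>z. f (fst (snd (snd (snd z)))) (snd (snd (snd (snd z)))))"
      by (rule continuous_on_compose2[OF f(3), of _ "\<lambda>z. (fst (snd (snd (snd z))), snd (snd (snd (snd z))))", simplified])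
        (auto intro!: continuous_intros)
    moreover have "continuous_on ?K (\<lambda>z. V (fst (snd (snd z))))"
      by (intro continuous_on_compose2[OF cV[of UNIV]] continuous_intros) auto
    ultimately show "continuous_on ?K ?\<Phi>" unfolding case_prod_beta by (intro continuous_intros)
  qed (use \<rho>' in auto)
  then obtain x1 x2 x3 r t where in_K: "x1 \<in> ?B" "x2 \<in> ?B" "x3 \<in> ?B" "r \<in> cball rh \<rho>'" "t \<in> cball th \<rho>'"
    and min: "\<And>y1 y2 y3 r' t'. y1 \<in> ?B \<Longrightarrow> y2 \<in> ?B \<Longrightarrow> y3 \<in> ?B \<Longrightarrow> r' \<in> cball rh \<rho>' \<Longrightarrow> t' \<in> cball th \<rho>' \<Longrightarrow>
       ?\<Phi> (x1, x2, x3, r, t) \<le> ?\<Phi> (y1, y2, y3, r', t')"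
    by (auto simp del: mem_cball)
  have ctr: "xh \<in> ?B" "rh \<in> cball rh \<rho>'" "th \<in> cball th \<rho>'" using \<rho>' by auto
  define A B D where "A = norm (x1 - x2)" and "B = norm (x1 - x3)" and "D = norm (x1 - xh)"
  have nn: "A \<ge> 0" "B \<ge> 0" "D \<ge> 0" by (auto simp: A_def B_def D_def)
  have lw: "U xh rh - m * W xh th - n * V xh - f rh th \<le> U x1 r - m * W x1 t - n * V x1 - f r t"
    by (rule \<rho>(2)) (use in_K \<rho>' in \<open>auto simp: dist_commute dist_real_def\<close>)
  have "\<bar>W x1 t - W x2 t\<bar> \<le> L * dist x1 x2" using W(2) tp'[OF in_K(5)] unfolding lip_t_def by (meson less_imp_le)
  then have "W x1 t - W x2 t \<ge> - (L * A)" unfolding A_def dist_norm[symmetric] abs_le_iff by linarith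
  then have Wl: "m * (W x1 t - W x2 t) \<ge> - (L * A)"
  proof -
    assume "W x1 t - W x2 t \<ge> - (L * A)"
    then have "m * (W x1 t - W x2 t) \<ge> m * (- (L * A))" using mn by (intro mult_left_mono) auto
    moreover have "m * (L * A) \<le> 1 * (L * A)" using mn L0 nn by (intro mult_right_mono) auto
    ultimately show ?thesis by simp
  qed
  have "\<bar>V x1 - V x3\<bar> \<le> L * dist x1 x3" using V(2) unfolding lip_t_def by (meson order_refl)
  then have "V x1 - V x3 \<ge> - (L * B)" unfolding B_def dist_norm[symmetric] abs_le_iff by linarith
  then have Vl: "n * (V x1 - V x3) \<ge> - (L * B)"
  proof -
    assume "V x1 - V x3 \<ge> - (L * B)"
    then have "n * (V x1 - V x3) \<ge> n * (- (L * B))" using mn by (intro mult_left_mono) auto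
    moreover have "n * (L * B) \<le> 1 * (L * B)" using mn L0 nn by (intro mult_right_mono) auto
    ultimately show ?thesis by simp
  qed
  \<comment> \<open>Comparison with the centre, where all penalties vanish; the Lipschitz bounds
    move \<open>W\<close> and \<open>V\<close> to the common point \<open>x1\<close>, at which the
    assumed minimum applies.\<close>
  have "a * A\<^sup>2 + a * B\<^sup>2 + b * D\<^sup>2 + (r - rh)\<^sup>2 + (t - th)\<^sup>2 \<le> L * A + L * B"
    using min[OF ctr(1,1,1,2,3)] lw Wl Vl by (simp add: A_def B_def D_def algebra_simps)
  moreover have young: "L * X \<le> a * X\<^sup>2 / 2 + L\<^sup>2 / (2 * a)" for X
  proof -
    have "0 \<le> (a * X - L)\<^sup>2 / (2 * a)" using ab by simp
    also have "\<dots> = a * X\<^sup>2 / 2 + L\<^sup>2 / (2 * a) - L * X" using ab by (simp add: power2_eq_square field_simps)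
    finally show ?thesis by simp
  qed
  ultimately have tot: "a * A\<^sup>2 / 2 + a * B\<^sup>2 / 2 + b * D\<^sup>2 + (r - rh)\<^sup>2 + (t - th)\<^sup>2 \<le> L\<^sup>2 / a"
  proof -
    assume 1: "a * A\<^sup>2 + a * B\<^sup>2 + b * D\<^sup>2 + (r - rh)\<^sup>2 + (t - th)\<^sup>2 \<le> L * A + L * B"
    have "L\<^sup>2 / (2 * a) = (L\<^sup>2 / a) / 2" by simp
    then show ?thesis using 1 young[of A] young[of B] by linarith
  qed
  have La: "L\<^sup>2 / a = L\<^sup>2 * \<delta> ^ 4" by (simp add: a_def)
  have nn2: "a * A\<^sup>2 \<ge> 0" "a * B\<^sup>2 \<ge> 0" "b * D\<^sup>2 \<ge> 0" "(r - rh)\<^sup>2 \<ge> 0" "(t - th)\<^sup>2 \<ge> 0" using ab by auto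
  have AB: "X \<le> 2 * L * \<delta> ^ 4" if "a * X\<^sup>2 / 2 \<le> L\<^sup>2 / a" for X
  proof -
    have "X\<^sup>2 \<le> 2 * L\<^sup>2 / a / a" using that ab by (simp add: field_simps)
    also have "\<dots> = 2 * (L * \<delta> ^ 4)\<^sup>2" by (simp add: a_def power_mult_distrib power2_eq_square)
    also have "\<dots> \<le> (2 * L * \<delta> ^ 4)\<^sup>2" by (simp add: power_mult_distrib)
    finally show ?thesis by (rule power2_le_imp_le) (use L0 \<delta> in auto)
  qed
  have A: "A \<le> 2 * L * \<delta> ^ 4" and B: "B \<le> 2 * L * \<delta> ^ 4" by (intro AB; use tot nn2 in linarith)+
  have D: "D \<le> L * \<delta> ^ 3"
  proof -
    have "b * D\<^sup>2 \<le> L\<^sup>2 * \<delta> ^ 4" using tot nn2 La by linarith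
    then have "D\<^sup>2 \<le> L\<^sup>2 * \<delta> ^ 4 * \<delta>\<^sup>2" using \<delta>(1) by (simp add: b_def field_simps)
    also have "\<dots> = (L * \<delta> ^ 3)\<^sup>2" by (simp add: power_mult_distrib power_mult[symmetric] power_add[symmetric])
    finally show ?thesis by (rule power2_le_imp_le) (use L0 \<delta> in auto)
  qed
  have rt: "\<bar>X\<bar> \<le> L * \<delta>" if "X\<^sup>2 \<le> L\<^sup>2 / a" for X
  proof -
    have "X\<^sup>2 \<le> (L * \<delta>\<^sup>2)\<^sup>2" using that La by (simp add: power_mult_distrib power_mult[symmetric])
    then have "\<bar>X\<bar> \<le> L * \<delta>\<^sup>2" using L0 \<delta> by (simp add: power2_le_iff_abs_le)
    also have "\<dots> \<le> L * \<delta>" using p\<delta>[of 1] L0 by (intro mult_left_mono) (auto simp: power2_eq_square)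
    finally show ?thesis .
  qed
  have r: "\<bar>r - rh\<bar> \<le> L * \<delta>" and t: "\<bar>t - th\<bar> \<le> L * \<delta>" by (intro rt; use tot nn2 in linarith)+
  have \<delta>43: "\<delta> ^ 4 \<le> \<delta> ^ 3" using \<delta> by (simp add: power_decreasing)
  have X3: "dist x1 xh \<le> 3 * L * \<delta> ^ 3" "dist x2 xh \<le> 3 * L * \<delta> ^ 3" "dist x3 xh \<le> 3 * L * \<delta> ^ 3"
  proof -
    have "2 * L * \<delta> ^ 4 \<le> 2 * L * \<delta> ^ 3" using L0 \<delta>43 by (intro mult_left_mono) auto
    moreover have "L * \<delta> ^ 3 \<ge> 0" using L0 \<delta>(1) by simp
    moreover have "dist x2 xh \<le> A + D" "dist x3 xh \<le> B + D" "dist x1 xh = D"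
      using dist_triangle[of x2 xh x1] dist_triangle[of x3 xh x1] by (auto simp: A_def B_def D_def dist_norm norm_minus_commute)
    ultimately show "dist x1 xh \<le> 3 * L * \<delta> ^ 3" "dist x2 xh \<le> 3 * L * \<delta> ^ 3" "dist x3 xh \<le> 3 * L * \<delta> ^ 3"
      using A B D by linarith+
  qed
  have X1: "3 * L * \<delta> ^ 3 \<le> 3 * L * \<delta>" using p\<delta>[of 2] L0 by (intro mult_left_mono) (auto simp: numeral_3_eq_3)
  have EL: "3 * L * \<delta> \<le> E * \<delta>" "L * \<delta> \<le> E * \<delta>" using E(1) L0 \<delta>(1) by (auto intro!: mult_right_mono)
  have inx: "dist x1 xh < \<rho>'" "dist x2 xh < \<rho>'" "dist x3 xh < \<rho>'" using X3 X1 EL E\<delta>(2) by linarith+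
  have inr: "\<bar>r - rh\<bar> < \<rho>'" "\<bar>t - th\<bar> < \<rho>'" using r t EL E\<delta>(2) by linarith+
  have drt: "dist (r, t) (rh, th) \<le> 2 * (E * \<delta>)"
    using sqrt_sum_squares_le_sum[of "dist r rh" "dist t th"] r t EL by (simp add: dist_prod_def dist_real_def)
  have tr: "trace (diffA \<sigma> \<theta> x ** (k *\<^sub>R mat 1)) \<le> c * (9 * (?N * C\<^sup>2 * L\<^sup>2)) * \<delta>" "trace (diffA \<sigma> \<theta> x ** (k *\<^sub>R mat 1)) \<ge> 0"
    if "dist x xh \<le> 3 * L * \<delta> ^ 3" "k = c / \<delta> ^ 4" "c \<ge> 0" for \<theta> x k c
  proof -
    have k: "k \<ge> 0" using that \<delta>(1) by simp
    have "trace (diffA \<sigma> \<theta> x ** (k *\<^sub>R mat 1)) \<le> k * (?N * (C * dist x xh)\<^sup>2)" by (rule trace_near_Sigma[OF xh k])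
    also have "\<dots> \<le> k * (?N * (C * (3 * L * \<delta> ^ 3))\<^sup>2)" using that(1) k C0 by (intro mult_left_mono power_mono) auto
    also have "\<dots> = c * (9 * (?N * C\<^sup>2 * L\<^sup>2)) * \<delta>\<^sup>2"
      unfolding that(2) using \<delta>(1) by (simp add: field_simps power_mult_distrib flip: power_add power_mult)
    also have "\<dots> \<le> c * (9 * (?N * C\<^sup>2 * L\<^sup>2)) * \<delta>"
      using that(3) p\<delta>[of 1] by (intro mult_left_mono) (auto simp: power2_eq_square)
    finally show "trace (diffA \<sigma> \<theta> x ** (k *\<^sub>R mat 1)) \<le> c * (9 * (?N * C\<^sup>2 * L\<^sup>2)) * \<delta>" .
    show "trace (diffA \<sigma> \<theta> x ** (k *\<^sub>R mat 1)) \<ge> 0" by (rule trace_near_Sigma[OF xh k])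
  qed
  define p q where "p = (2 * a / m) *\<^sub>R (x2 - x1)" and "q = (2 * a / n) *\<^sub>R (x3 - x1)"
  have np: "norm p \<le> 4 * L / m" "norm q \<le> 4 * L / n"
  proof -
    have "2 * a * A \<le> 4 * L" "2 * a * B \<le> 4 * L" using A B \<delta>(1) by (auto simp: a_def field_simps)
    then have "2 * a * A / m \<le> 4 * L / m" "2 * a * B / n \<le> 4 * L / n" using mn by (auto intro: divide_right_mono)
    then show "norm p \<le> 4 * L / m" "norm q \<le> 4 * L / n" using ab mn
      by (auto simp: p_def q_def A_def B_def norm_minus_commute)
  qed
  \<comment> \<open>For \<open>n = 0\<close> division by zero makes \<open>q = 0\<close>. The
    identity survives because \<open>x3\<close> then enters \<open>?\<Phi>\<close> only through its
    penalty, so that \<open>x3 = x1\<close>.\<close>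
  have nq: "n *\<^sub>R q = (2 * a) *\<^sub>R (x3 - x1)"
  proof (cases "n = 0")
    case True
    have "?\<Phi> (x1, x2, x3, r, t) \<le> ?\<Phi> (x1, x2, x1, r, t)" by (rule min[OF in_K(1,2,1,4,5)])
    then have "x3 = x1" using True ab by (simp add: mult_le_0_iff)
    then show ?thesis by (simp add: q_def)
  qed (simp add: q_def)
  have mp: "m *\<^sub>R p = (2 * a) *\<^sub>R (x2 - x1)" using mn by (simp add: p_def)
  have "\<delta> * E = 54 * (?N * C\<^sup>2 * L\<^sup>2) * \<delta> + 54 * (?N * C\<^sup>2 * L\<^sup>2) * \<delta> * (1 / n) + 54 * (?N * C\<^sup>2 * L\<^sup>2) * \<delta> * (1 / m)
     + CR * (3 * L * \<delta>) + CR * (2 * L * \<delta>) + 2 * L * \<delta> + 3 * L * \<delta> + \<delta>"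
    by (simp add: E_def algebra_simps)
  moreover have nnE: "0 \<le> 54 * (?N * C\<^sup>2 * L\<^sup>2) * \<delta>" "0 \<le> 54 * (?N * C\<^sup>2 * L\<^sup>2) * \<delta> * (1 / n)" "0 \<le> 54 * (?N * C\<^sup>2 * L\<^sup>2) * \<delta> * (1 / m)"
    "0 \<le> CR * (3 * L * \<delta>)" "0 \<le> CR * (2 * L * \<delta>)" "0 \<le> L * \<delta>"
    using \<delta>(1) mn L0 CR(1) by auto
  ultimately have small: "54 * (?N * C\<^sup>2 * L\<^sup>2) * \<delta> + CR * (3 * L * \<delta>) + CR * (2 * L * \<delta>) + 2 * (L * \<delta>) \<le> \<gamma> / 4"
    "54 * (?N * C\<^sup>2 * L\<^sup>2) * \<delta> * (1 / n) + CR * (3 * L * \<delta>) \<le> \<gamma> / 4"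
    "54 * (?N * C\<^sup>2 * L\<^sup>2) * \<delta> * (1 / m) \<le> \<gamma> / 4" "CR * (3 * L * \<delta>) + 2 * (L * \<delta>) \<le> \<gamma> / 4"
    using E\<delta>(1) \<delta>(1) unfolding mult.commute[of E] by linarith+
  have Hx: "\<bar>H \<theta> x p' - H \<theta> xh p'\<bar> \<le> CR * (3 * L * \<delta>)" if "norm p' \<le> R" "dist x xh \<le> 3 * L * \<delta> ^ 3" for \<theta> x p'
  proof -
    have "\<bar>H \<theta> x p' - H \<theta> xh p'\<bar> \<le> CR * (dist x xh + dist p' p')" by (rule CR(2)[OF that(1,1)])
    also have "\<dots> \<le> CR * (3 * L * \<delta>)" using that(2) X1 CR(1) by (intro mult_left_mono) auto
    finally show ?thesis .
  qed
  have c1: "m * H \<theta> xh p \<le> ft rh th + \<gamma>" for \<theta>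
  proof -
    let ?g = "\<lambda>s. (1 / m) * (- f r s + (s - th)\<^sup>2)" let ?g' = "\<lambda>s. (1 / m) * (- ft r s + 2 * (s - th))"
    have g: "(?g has_real_derivative ?g' s) (at s)" for s by (rule DERIV_cmult) (auto intro!: derivative_eq_intros f(2))
    have g': "continuous_on UNIV ?g'"
    proof -
      have "continuous_on UNIV (\<lambda>s. (r, s))" by (intro continuous_intros)
      from continuous_on_compose2[OF f(5) this] have "continuous_on UNIV (ft r)" by simp
      then show ?thesis by (intro continuous_on_mult_left continuous_on_add continuous_on_minus continuous_on_diff continuous_on_id continuous_on_const) simp
    qed
    have "?g' t + Ham \<sigma> H x2 ((2 * (a / m)) *\<^sub>R (x2 - x1) + (2 * 0) *\<^sub>R (x2 - 0) + (2 * 0) *\<^sub>R (x2 - 0)) ((2 * (a / m + 0 + 0)) *\<^sub>R mat 1) \<le> 0"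
    proof (rule visc_sol_E_sub[OF W(1) C21_test_quad[OF g g', of "a / m" x1 0 0 0 0]])
      show "t > 0" using tp' in_K by blast
      show "min (\<rho>' - dist x2 xh) (\<rho>' - \<bar>t - th\<bar>) > 0" using inx inr by simp
      fix y s assume ys: "dist y x2 < min (\<rho>' - dist x2 xh) (\<rho>' - \<bar>t - th\<bar>)" "\<bar>s - t\<bar> < min (\<rho>' - dist x2 xh) (\<rho>' - \<bar>t - th\<bar>)"
      have "y \<in> ?B" using ys dist_triangle[of y xh x2] by (simp add: dist_commute)
      moreover have "s \<in> cball th \<rho>'" using ys by (auto simp: dist_real_def)
      ultimately have "?\<Phi> (x1, x2, x3, r, t) \<le> ?\<Phi> (x1, y, x3, r, s)" using min in_K by blast
      then have "m * W y s \<le> m * W x2 t - (- f r t + (t - th)\<^sup>2 + a * (norm (x2 - x1))\<^sup>2) + (- f r s + (s - th)\<^sup>2 + a * (norm (y - x1))\<^sup>2)"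
        by (simp add: norm_minus_commute)
      from divide_right_mono[OF this, of m] mn(1)
      show "W y s - ((1 / m) * (- f r s + (s - th)\<^sup>2) + a / m * (norm (y - x1))\<^sup>2 + 0 * (norm (y - 0))\<^sup>2 + 0 * (norm (y - 0))\<^sup>2)
        \<le> W x2 t - ((1 / m) * (- f r t + (t - th)\<^sup>2) + a / m * (norm (x2 - x1))\<^sup>2 + 0 * (norm (x2 - 0))\<^sup>2 + 0 * (norm (x2 - 0))\<^sup>2)"
        by (simp add: add_divide_distrib diff_divide_distrib)
    qed
    moreover have "2 * (a / m + 0 + 0) = 2 / m / \<delta> ^ 4" "2 * (a / m) = 2 * a / m" by (simp_all add: a_def)
    ultimately have "?g' t + Ham \<sigma> H x2 p ((2 / m / \<delta> ^ 4) *\<^sub>R mat 1) \<le> 0" by (simp only: p_def mult_zero_right scaleR_zero_left add_0_right)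
    then have "?g' t + op \<theta> x2 p ((2 / m / \<delta> ^ 4) *\<^sub>R mat 1) \<le> 0" using op_le_Ham[of \<theta> x2 p "(2 / m / \<delta> ^ 4) *\<^sub>R mat 1"] by linarith
    moreover have "trace (diffA \<sigma> \<theta> x2 ** ((2 / m / \<delta> ^ 4) *\<^sub>R mat 1)) \<le> (2 / m) * (9 * (?N * C\<^sup>2 * L\<^sup>2)) * \<delta>"
      by (rule tr(1)[OF X3(2)]) (use mn in auto)
    moreover have "\<bar>H \<theta> x2 p - H \<theta> xh p\<bar> \<le> CR * (3 * L * \<delta>)"
      by (rule Hx[OF _ X3(2)]) (use np(1) M R_def L0 in linarith)
    ultimately have "?g' t + H \<theta> xh p \<le> (2 / m) * (9 * (?N * C\<^sup>2 * L\<^sup>2)) * \<delta> + CR * (3 * L * \<delta>)"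
      unfolding op_def abs_le_iff by linarith
    then have "m * (?g' t + H \<theta> xh p) \<le> m * ((2 / m) * (9 * (?N * C\<^sup>2 * L\<^sup>2)) * \<delta> + CR * (3 * L * \<delta>))"
      using mn by (intro mult_left_mono) auto
    also have "\<dots> = 18 * (?N * C\<^sup>2 * L\<^sup>2) * \<delta> + m * (CR * (3 * L * \<delta>))" using mn by (simp add: algebra_simps)
    also have "m * (CR * (3 * L * \<delta>)) \<le> 1 * (CR * (3 * L * \<delta>))" by (rule mult_right_mono) (use mn nnE in auto)
    finally have "- ft r t + 2 * (t - th) + m * H \<theta> xh p \<le> 18 * (?N * C\<^sup>2 * L\<^sup>2) * \<delta> + CR * (3 * L * \<delta>)"
      using mn by (simp add: distrib_left)
    moreover have "\<bar>ft r t - ft rh th\<bar> \<le> \<gamma> / 4"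
      using d(4)[of "(r, t)"] drt E\<delta>(4) by simp
    ultimately have e: "- ft r t + 2 * (t - th) + m * H \<theta> xh p \<le> 18 * (?N * C\<^sup>2 * L\<^sup>2) * \<delta> + CR * (3 * L * \<delta>)"
      and e': "\<bar>ft r t - ft rh th\<bar> \<le> \<gamma> / 4" by blast+
    have e1: "18 * (?N * C\<^sup>2 * L\<^sup>2) * \<delta> + CR * (3 * L * \<delta>) \<le> \<gamma> / 4" using small(1) nnE by linarith
    have e2: "2 * (L * \<delta>) \<le> \<gamma> / 4" using small(4) nnE by linarith
    have e3: "- (t - th) \<le> L * \<delta>" by (rule abs_le_D2[OF t])
    have "m * H \<theta> xh p \<le> \<gamma> / 4 + ft r t - 2 * (t - th)" using e e1 by linarith
    also have "\<dots> \<le> \<gamma> / 4 + (ft rh th + \<gamma> / 4) + \<gamma> / 4" using abs_le_D1[OF e'] e2 e3 by argo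
    also have "\<dots> \<le> ft rh th + \<gamma>" using \<gamma> by simp
    finally show "m * H \<theta> xh p \<le> ft rh th + \<gamma>" .
  qed
  have c2: "H \<theta> xh q \<le> \<gamma>" if n: "n > 0" for \<theta>
  proof -
    have "0 + Ham \<sigma> H x3 ((2 * (a / n)) *\<^sub>R (x3 - x1) + (2 * 0) *\<^sub>R (x3 - 0) + (2 * 0) *\<^sub>R (x3 - 0)) ((2 * (a / n + 0 + 0)) *\<^sub>R mat 1) \<le> 0"
    proof (rule visc_sol_E_sub[OF V(1) C21_test_quad[of "\<lambda>s. 0" "\<lambda>s. 0" "a / n" x1 0 0 0 0], of 1])
      show "\<rho>' - dist x3 xh > 0" using inx by simp
      fix y s assume ys: "dist y x3 < \<rho>' - dist x3 xh"
      have "y \<in> ?B" using ys dist_triangle[of y xh x3] by (simp add: dist_commute)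
      then have "?\<Phi> (x1, x2, x3, r, t) \<le> ?\<Phi> (x1, x2, y, r, t)" using min in_K by blast
      then have "n * V y \<le> n * V x3 - (a * (norm (x3 - x1))\<^sup>2) + (a * (norm (y - x1))\<^sup>2)"
        by (simp add: norm_minus_commute)
      from divide_right_mono[OF this, of n] n
      show "V y - (0 + a / n * (norm (y - x1))\<^sup>2 + 0 * (norm (y - 0))\<^sup>2 + 0 * (norm (y - 0))\<^sup>2)
        \<le> V x3 - (0 + a / n * (norm (x3 - x1))\<^sup>2 + 0 * (norm (x3 - 0))\<^sup>2 + 0 * (norm (x3 - 0))\<^sup>2)"
        by (simp add: add_divide_distrib diff_divide_distrib)
    qed auto
    moreover have "2 * (a / n + 0 + 0) = 2 / n / \<delta> ^ 4" "2 * (a / n) = 2 * a / n" by (simp_all add: a_def)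
    ultimately have "Ham \<sigma> H x3 q ((2 / n / \<delta> ^ 4) *\<^sub>R mat 1) \<le> 0" by (simp only: q_def mult_zero_right scaleR_zero_left add_0_right add_0_left)
    then have "op \<theta> x3 q ((2 / n / \<delta> ^ 4) *\<^sub>R mat 1) \<le> 0" using op_le_Ham[of \<theta> x3 q "(2 / n / \<delta> ^ 4) *\<^sub>R mat 1"] by linarith
    moreover have "trace (diffA \<sigma> \<theta> x3 ** ((2 / n / \<delta> ^ 4) *\<^sub>R mat 1)) \<le> (2 / n) * (9 * (?N * C\<^sup>2 * L\<^sup>2)) * \<delta>"
      by (rule tr(1)[OF X3(3)]) (use mn(2) in auto)
    moreover have "(2 / n) * (9 * (?N * C\<^sup>2 * L\<^sup>2)) * \<delta> = (1 / 3) * (54 * (?N * C\<^sup>2 * L\<^sup>2) * \<delta> * (1 / n))" by simp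
    moreover have "\<bar>H \<theta> x3 q - H \<theta> xh q\<bar> \<le> CR * (3 * L * \<delta>)"
      by (rule Hx[OF _ X3(3)]) (use np(2) M R_def L0 in linarith)
    ultimately show "H \<theta> xh q \<le> \<gamma>" using small(2) nnE \<gamma> unfolding op_def abs_le_iff by linarith
  qed
  have c3: "\<exists>\<theta>. fr rh th + H \<theta> xh (m *\<^sub>R p + n *\<^sub>R q) \<ge> - \<gamma>"
  proof -
    let ?g = "\<lambda>s. f s t - (s - rh)\<^sup>2" let ?g' = "\<lambda>s. fr s t - 2 * (s - rh)"
    have g: "(?g has_real_derivative ?g' s) (at s)" for s by (auto intro!: derivative_eq_intros f(1))
    have g': "continuous_on UNIV ?g'"
    proof -
      have "continuous_on UNIV (\<lambda>s. (s, t))" by (intro continuous_intros)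
      from continuous_on_compose2[OF f(4) this] have "continuous_on UNIV (\<lambda>s. fr s t)" by simp
      then show ?thesis by (intro continuous_on_mult_left continuous_on_add continuous_on_minus continuous_on_diff continuous_on_id continuous_on_const) simp
    qed
    let ?p1 = "(2 * (- a)) *\<^sub>R (x1 - x2) + (2 * (- a)) *\<^sub>R (x1 - x3) + (2 * (- b)) *\<^sub>R (x1 - xh)"
    let ?X = "(2 * (- a + - a + - b)) *\<^sub>R mat 1 :: real^'n^'n"
    have sup: "?g' r + Ham \<sigma> H x1 ?p1 ?X \<ge> 0"
    proof (rule visc_sol_E_super[OF U(1) C21_test_quad[OF g g', of "- a" x2 "- a" x3 "- b" xh]])
      show "r > 0" using tp in_K by blast
      show "min (\<rho>' - dist x1 xh) (\<rho>' - \<bar>r - rh\<bar>) > 0" using inx inr by simp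
      fix y s assume ys: "dist y x1 < min (\<rho>' - dist x1 xh) (\<rho>' - \<bar>r - rh\<bar>)" "\<bar>s - r\<bar> < min (\<rho>' - dist x1 xh) (\<rho>' - \<bar>r - rh\<bar>)"
      have "y \<in> ?B" using ys dist_triangle[of y xh x1] by (simp add: dist_commute)
      moreover have "s \<in> cball rh \<rho>'" using ys by (auto simp: dist_real_def)
      ultimately have "?\<Phi> (x1, x2, x3, r, t) \<le> ?\<Phi> (y, x2, x3, s, t)" using min in_K by blast
      then show "U y s - (f s t - (s - rh)\<^sup>2 + - a * (norm (y - x2))\<^sup>2 + - a * (norm (y - x3))\<^sup>2 + - b * (norm (y - xh))\<^sup>2)
        \<ge> U x1 r - (f r t - (r - rh)\<^sup>2 + - a * (norm (x1 - x2))\<^sup>2 + - a * (norm (x1 - x3))\<^sup>2 + - b * (norm (x1 - xh))\<^sup>2)"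
        by simp
    qed
    \<comment> \<open>Since \<open>b \<le> a\<close>, the Hessian coefficient
      \<open>4 * a + 2 * b\<close> is at most \<open>6 / \<delta> ^ 4\<close>; together with the
      factor \<open>9\<close> of \<open>tr\<close> this is the \<open>54\<close> in
      \<open>E\<close>.\<close>
    define c where "c = (4 * a + 2 * b) * \<delta> ^ 4"
    have c: "c \<ge> 0" "c \<le> 6" "4 * a + 2 * b = c / \<delta> ^ 4"
    proof -
      show "c \<ge> 0" "4 * a + 2 * b = c / \<delta> ^ 4" using ab \<delta>(1) by (auto simp: c_def)
      have "c \<le> (6 * a) * \<delta> ^ 4" unfolding c_def using ab \<delta>(1) by (intro mult_right_mono) auto
      then show "c \<le> 6" using \<delta>(1) by (simp add: a_def)
    qed
    have X: "?X = - ((c / \<delta> ^ 4) *\<^sub>R mat 1)" unfolding c(3)[symmetric] by (simp add: scaleR_left_distrib scaleR_left_diff_distrib)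
    obtain \<theta> where \<theta>: "- ?g' r - \<gamma> / 4 < op \<theta> x1 ?p1 ?X"
      using sup Ham_gt[of "- ?g' r - \<gamma> / 4" x1 ?p1 ?X] \<gamma> by force
    have trX: "trace (diffA \<sigma> \<theta> x1 ** ?X) = - trace (diffA \<sigma> \<theta> x1 ** ((c / \<delta> ^ 4) *\<^sub>R mat 1))"
      unfolding X by (simp add: trace_def matrix_matrix_mult_def sum_negf)
    have "trace (diffA \<sigma> \<theta> x1 ** ((c / \<delta> ^ 4) *\<^sub>R mat 1)) \<le> c * (9 * (?N * C\<^sup>2 * L\<^sup>2)) * \<delta>"
      by (rule tr(1)[OF X3(1) refl c(1)])
    also have "\<dots> \<le> 6 * (9 * (?N * C\<^sup>2 * L\<^sup>2)) * \<delta>"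
      using c(2) \<delta>(1) by (intro mult_right_mono) auto
    finally have t1: "- trace (diffA \<sigma> \<theta> x1 ** ?X) \<le> 54 * (?N * C\<^sup>2 * L\<^sup>2) * \<delta>" unfolding trX by simp
    have p1: "?p1 = (m *\<^sub>R p + n *\<^sub>R q) - (2 * b) *\<^sub>R (x1 - xh)"
      unfolding mp nq by (simp add: algebra_simps)
    have bD: "norm ((2 * b) *\<^sub>R (x1 - xh)) \<le> 2 * L * \<delta>"
    proof -
      have "2 * b * D \<le> 2 * b * (L * \<delta> ^ 3)" using D ab by (intro mult_left_mono) auto
      also have "\<dots> = 2 * L * \<delta>" using \<delta>(1) by (simp add: b_def power3_eq_cube power2_eq_square)
      finally show ?thesis using ab by (simp add: D_def)
    qed
    have nmpq: "norm (m *\<^sub>R p + n *\<^sub>R q) \<le> 2 * M"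
    proof -
      have "norm (m *\<^sub>R p + n *\<^sub>R q) \<le> m * norm p + n * norm q"
        using norm_triangle_ineq[of "m *\<^sub>R p" "n *\<^sub>R q"] mn by simp
      also have "\<dots> \<le> 1 * M + 1 * M" using mn np M by (intro add_mono mult_mono) auto
      finally show ?thesis by simp
    qed
    have L\<delta>: "2 * L * \<delta> \<le> 2 * L" using L0 \<delta> by simp
    have np1: "norm ?p1 \<le> R" "norm (m *\<^sub>R p + n *\<^sub>R q) \<le> R"
      using norm_triangle_ineq4[of "m *\<^sub>R p + n *\<^sub>R q" "(2 * b) *\<^sub>R (x1 - xh)"] bD nmpq L\<delta> L0 unfolding p1 R_def by linarith+
    have "\<bar>H \<theta> x1 ?p1 - H \<theta> xh (m *\<^sub>R p + n *\<^sub>R q)\<bar> \<le> CR * (dist x1 xh + dist ?p1 (m *\<^sub>R p + n *\<^sub>R q))"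
      by (rule CR(2)[OF np1])
    also have "\<dots> \<le> CR * (3 * L * \<delta> + 2 * L * \<delta>)"
    proof -
      have "dist ?p1 (m *\<^sub>R p + n *\<^sub>R q) \<le> 2 * L * \<delta>" unfolding p1 dist_norm using bD by simp
      then show ?thesis using X3(1) X1 CR(1) by (intro mult_left_mono add_mono) auto
    qed
    also have "\<dots> = CR * (3 * L * \<delta>) + CR * (2 * L * \<delta>)" by (simp add: algebra_simps)
    finally have Hd: "\<bar>H \<theta> x1 ?p1 - H \<theta> xh (m *\<^sub>R p + n *\<^sub>R q)\<bar> \<le> CR * (3 * L * \<delta>) + CR * (2 * L * \<delta>)" .
    have frb: "\<bar>fr r t - fr rh th\<bar> \<le> \<gamma> / 4"
      using d(2)[of "(r, t)"] drt E\<delta>(3) by simp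
    have "fr rh th + H \<theta> xh (m *\<^sub>R p + n *\<^sub>R q) \<ge> - \<gamma>"
      using \<theta>[unfolded op_def] t1 abs_le_D1[OF Hd] small(1) abs_le_D2[OF r] abs_le_D1[OF frb] \<gamma> by argo
    then show "\<exists>\<theta>. fr rh th + H \<theta> xh (m *\<^sub>R p + n *\<^sub>R q) \<ge> - \<gamma>" by blast
  qed
  show ?thesis using np c1 c2 c3 by blast
qed


text \<open>Limit of \<open>on_Sigma_approx\<close> along convergent gradients. The inequalities
  valid for all \<open>\<theta>\<close> pass to the limit one by one. In the last one the parameter
  changes along the sequence, so the Lipschitz bound uniform in \<open>\<theta>\<close> is used, and
  \<open>\<gamma>\<close> remains.\<close>

lemma on_Sigma:
  fixes V :: "real^'n \<Rightarrow> real"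
  assumes U: "visc_sol_E \<sigma> H U" "lip_t U" and W: "visc_sol_E \<sigma> H W" "lip_t W" and V: "visc_sol_E \<sigma> H (\<lambda>x t. V x)" "lip_t (\<lambda>x t. V x)"
    and mn: "m > 0" "n \<ge> 0" "m + n = 1" and xh: "xh \<in> Sigma_set \<sigma>" and pos: "rh > 0" "th > 0"
    and f: "\<And>r t. ((\<lambda>r. f r t) has_real_derivative fr r t) (at r)" "\<And>r t. ((\<lambda>t. f r t) has_real_derivative ft r t) (at t)"
      "continuous_on UNIV (\<lambda>z. f (fst z) (snd z))" "continuous_on UNIV (\<lambda>z. fr (fst z) (snd z))" "continuous_on UNIV (\<lambda>z. ft (fst z) (snd z))"
    and \<rho>: "\<rho> > 0" "\<And>x r t. dist x xh < \<rho> \<Longrightarrow> \<bar>r - rh\<bar> < \<rho> \<Longrightarrow> \<bar>t - th\<bar> < \<rho> \<Longrightarrow>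
       U xh rh - m * W xh th - n * V xh - f rh th \<le> U x r - m * W x t - n * V x - f r t"
  shows "\<exists>p q. (\<forall>\<theta>. m * H \<theta> xh p \<le> ft rh th) \<and> (n > 0 \<longrightarrow> (\<forall>\<theta>. H \<theta> xh q \<le> 0)) \<and>
     (\<forall>\<gamma>>0. \<exists>\<theta>. fr rh th + H \<theta> xh (m *\<^sub>R p + n *\<^sub>R q) \<ge> - \<gamma>)"
proof -
  have "\<forall>k::nat. \<exists>p q. norm p \<le> 4 * L / m \<and> norm q \<le> 4 * L / n \<and> (\<forall>\<theta>. m * H \<theta> xh p \<le> ft rh th + 1 / Suc k) \<and> (n > 0 \<longrightarrow> (\<forall>\<theta>. H \<theta> xh q \<le> 1 / Suc k)) \<and>
     (\<exists>\<theta>. fr rh th + H \<theta> xh (m *\<^sub>R p + n *\<^sub>R q) \<ge> - (1 / Suc k))"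
    using on_Sigma_approx[OF U W V mn xh pos f \<rho>] by simp
  then obtain p q \<theta> where pq: "\<And>k. norm (p k) \<le> 4 * L / m" "\<And>k. norm (q k) \<le> 4 * L / n"
    "\<And>k \<theta>. m * H \<theta> xh (p k) \<le> ft rh th + 1 / Suc k" "\<And>k \<theta>. n > 0 \<Longrightarrow> H \<theta> xh (q k) \<le> 1 / Suc k"
    "\<And>k. fr rh th + H (\<theta> k) xh (m *\<^sub>R p k + n *\<^sub>R q k) \<ge> - (1 / Suc k)" by metis
  define M where "M = 4 * L / m + 4 * L / n"
  have M: "4 * L / m \<le> M" "4 * L / n \<le> M" "M > 0" using L0 mn by (auto simp: M_def intro: add_pos_nonneg)
  have "\<forall>k. (p k, q k) \<in> cball 0 M \<times> cball 0 M" using pq(1,2) M by (force intro: order_trans)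
  then obtain l r where l: "l \<in> cball 0 M \<times> cball 0 M" "strict_mono r" "((\<lambda>k. (p k, q k)) \<circ> r) \<longlonglongrightarrow> l"
    by (rule seq_compactE[OF compact_imp_seq_compact[OF compact_Times[OF compact_cball compact_cball]]])
  obtain p0 q0 where l0: "l = (p0, q0)" by (cases l)
  have lim: "(\<lambda>k. p (r k)) \<longlonglongrightarrow> p0" "(\<lambda>k. q (r k)) \<longlonglongrightarrow> q0"
    using tendsto_fst[OF l(3)] tendsto_snd[OF l(3)] by (auto simp: l0 o_def)
  have inv: "(\<lambda>k. 1 / real (Suc (r k))) \<longlonglongrightarrow> 0"
    using LIMSEQ_subseq_LIMSEQ[OF LIMSEQ_inverse_real_of_nat l(2)] by (simp add: o_def inverse_eq_divide)
  have Hc: "continuous_on UNIV (H \<theta> xh)" for \<theta>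
    by (rule convex_on_continuous[OF open_UNIV conv])
  have Hlim: "(\<lambda>k. H \<theta> xh (s k)) \<longlonglongrightarrow> H \<theta> xh s0" if "s \<longlonglongrightarrow> s0" for \<theta> s s0
    using continuous_on_tendsto_compose[OF Hc that] by simp
  have 1: "m * H \<theta> xh p0 \<le> ft rh th" for \<theta>
  proof (rule LIMSEQ_le)
    show "(\<lambda>k. m * H \<theta> xh (p (r k))) \<longlonglongrightarrow> m * H \<theta> xh p0" by (intro tendsto_intros Hlim lim)
    show "(\<lambda>k. ft rh th + 1 / Suc (r k)) \<longlonglongrightarrow> ft rh th" using tendsto_add[OF tendsto_const inv] by simp
  qed (use pq(3) in auto)
  have 2: "H \<theta> xh q0 \<le> 0" if "n > 0" for \<theta>
    by (rule LIMSEQ_le[OF Hlim[OF lim(2)] inv]) (use pq(4)[OF that] in auto)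
  have 3: "\<exists>\<theta>. fr rh th + H \<theta> xh (m *\<^sub>R p0 + n *\<^sub>R q0) \<ge> - \<gamma>" if \<gamma>: "\<gamma> > 0" for \<gamma>
  proof -
    define R where "R = 2 * M"
    have "R > 0" using M by (simp add: R_def)
    from H_lip[OF this] obtain CR where CR: "CR > 0" "\<And>\<theta> x y p q. norm p \<le> R \<Longrightarrow> norm q \<le> R \<Longrightarrow> \<bar>H \<theta> x p - H \<theta> y q\<bar> \<le> CR * (dist x y + dist p q)"
      by blast
    define S where "S = (\<lambda>k. m *\<^sub>R p (r k) + n *\<^sub>R q (r k))"
    define S0 where "S0 = m *\<^sub>R p0 + n *\<^sub>R q0"
    have bound: "norm (m *\<^sub>R a + n *\<^sub>R b) \<le> R" if "norm a \<le> M" "norm b \<le> M" for a b :: "real^'n"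
    proof -
      have "norm (m *\<^sub>R a + n *\<^sub>R b) \<le> m * norm a + n * norm b"
        using norm_triangle_ineq[of "m *\<^sub>R a" "n *\<^sub>R b"] mn by simp
      also have "\<dots> \<le> 1 * M + 1 * M" using mn that M by (intro add_mono mult_mono) auto
      finally show ?thesis by (simp add: R_def)
    qed
    have "(\<lambda>k. CR * dist (S k) S0 + 1 / Suc (r k)) \<longlonglongrightarrow> CR * dist S0 S0 + 0"
      unfolding S_def S0_def by (intro tendsto_intros lim inv)
    then have "\<forall>\<^sub>F k in sequentially. CR * dist (S k) S0 + 1 / Suc (r k) < \<gamma>"
      using \<gamma> by (intro order_tendstoD(2)) auto
    then obtain k where k: "CR * dist (S k) S0 + 1 / Suc (r k) < \<gamma>" unfolding eventually_sequentially by blast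
    have "norm (S k) \<le> R" unfolding S_def by (rule bound) (use pq(1,2) M in \<open>auto intro: order_trans\<close>)
    moreover have "norm S0 \<le> R" unfolding S0_def using bound l(1) by (auto simp: l0)
    ultimately have "\<bar>H (\<theta> (r k)) xh (S k) - H (\<theta> (r k)) xh S0\<bar> \<le> CR * (dist xh xh + dist (S k) S0)" by (rule CR(2))
    then have "fr rh th + H (\<theta> (r k)) xh S0 \<ge> - \<gamma>" using pq(5)[of "r k", folded fun_cong[OF S_def]] k unfolding S_def abs_le_iff by simp
    then show ?thesis unfolding S0_def by blast
  qed
  show ?thesis using 1 2 3 by blast
qed

definition solution :: "(real^'n \<Rightarrow> real \<Rightarrow> real) \<Rightarrow> bool" where
  "solution u \<longleftrightarrow> continuous_on (UNIV \<times> {0..}) (\<lambda>z. u (fst z) (snd z)) \<and> (\<forall>t\<ge>0. periodic (\<lambda>x. u x t)) \<and> lip_t u \<and> visc_sol_E \<sigma> H u"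

lemma solutionD:
  assumes "solution u"
  shows "continuous_on (UNIV \<times> {0..}) (\<lambda>z. u (fst z) (snd z))" "t \<ge> 0 \<Longrightarrow> periodic (\<lambda>x. u x t)" "lip_t u" "visc_sol_E \<sigma> H u"
  using assms by (auto simp: solution_def)

text \<open>The entries of \<open>diffA\<close> are continuous, so \<open>\<Sigma>\<close> is closed
  and a point outside has positive distance.\<close>

lemma not_Sigma_compl:
  assumes "x \<notin> Sigma_set \<sigma>"
  shows "\<exists>\<delta>>0. x \<in> Sigma_compl \<sigma> \<delta>"
proof (cases "Sigma_set \<sigma> = {}")
  case False
  have "continuous_on UNIV (\<lambda>x. diffA \<sigma> \<theta> x $ i $ k)" for \<theta> i k
  proof -
    have "continuous_on UNIV (\<sigma> \<theta>)"
      unfolding continuous_on_iff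
    proof (intro ballI allI impI)
      fix x :: "real^'n" and e :: real assume "e > 0"
      have "dist (\<sigma> \<theta> y) (\<sigma> \<theta> x) < e" if "dist y x < e / C" for y
        using sig_lip[of \<theta> y x] that C0 by (simp add: dist_norm pos_less_divide_eq mult.commute)
      then show "\<exists>d>0. \<forall>x'\<in>UNIV. dist x' x < d \<longrightarrow> dist (\<sigma> \<theta> x') (\<sigma> \<theta> x) < e"
        using \<open>e > 0\<close> C0 by (intro exI[of _ "e / C"]) auto
    qed
    then show ?thesis unfolding diffA_entry by (intro continuous_intros)
  qed
  then have "closed {x. diffA \<sigma> \<theta> x $ i $ k = 0}" for \<theta> i k by (intro closed_Collect_eq) auto
  moreover have "Sigma_set \<sigma> = (\<Inter>\<theta>. \<Inter>i. \<Inter>k. {x. diffA \<sigma> \<theta> x $ i $ k = 0})"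
    by (auto simp: Sigma_set_def vec_eq_iff)
  ultimately have "closed (Sigma_set \<sigma>)" by (metis (no_types, lifting) closed_INT)
  then have "infdist x (Sigma_set \<sigma>) > 0"
    using assms False by (metis in_closed_iff_infdist_zero infdist_nonneg less_le)
  then show ?thesis unfolding Sigma_compl_def by (intro exI[of _ "infdist x (Sigma_set \<sigma>) / 2"]) auto
qed (auto simp: Sigma_compl_def intro: exI[of _ 1])

end

section \<open>Stability and comparison\<close>

lemma C2fun_1d:
  fixes e :: "'e::euclidean_space"
  assumes m: "\<And>t. (m has_real_derivative m' t) (at t)" "\<And>t. (m' has_real_derivative m'' t) (at t)"
      "continuous_on UNIV m''"
  shows "C2fun (\<lambda>z. m (z \<bullet> e)) (\<lambda>z. m' (z \<bullet> e) *\<^sub>R e) (\<lambda>z h. (m'' (z \<bullet> e) * (e \<bullet> h)) *\<^sub>R e)"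
proof -
  have "C2fun (\<lambda>z. z \<bullet> e) (\<lambda>z. e) (\<lambda>z h. 0)"
    unfolding C2fun_def by (auto intro!: derivative_eq_intros simp: inner_commute)
  from C2fun_compose[OF this m] show ?thesis by simp
qed

lemma C21_test_add_quad:
  assumes "C21_test phi phit Dphi D2phi"
  shows "C21_test (\<lambda>x t. phi x t + a * ((norm (x - x0))\<^sup>2 + (t - t0)\<^sup>2)) (\<lambda>x t. phit x t + 2 * a * (t - t0))
     (\<lambda>x t. Dphi x t + (2 * a) *\<^sub>R (x - x0)) (\<lambda>x t. D2phi x t + (2 * a) *\<^sub>R mat 1)"
  unfolding C21_test_def
proof (intro conjI allI)
  fix x :: "real^'a" and t :: real
  have p: "((\<lambda>z. phi (fst z) (snd z)) has_derivative (\<lambda>h. Dphi x t \<bullet> fst h + phit x t * snd h)) (at (x, t))"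
    "((\<lambda>y. Dphi y t) has_derivative (\<lambda>h. D2phi x t *v h)) (at x)"
    using assms by (auto simp: C21_test_def)
  show "((\<lambda>z. phi (fst z) (snd z) + a * ((norm (fst z - x0))\<^sup>2 + (snd z - t0)\<^sup>2)) has_derivative
      (\<lambda>h. (Dphi x t + (2 * a) *\<^sub>R (x - x0)) \<bullet> fst h + (phit x t + 2 * a * (t - t0)) * snd h)) (at (x, t))"
    unfolding power2_norm_eq_inner
    by (rule has_derivative_eq_rhs, (rule derivative_eq_intros p refl)+) (auto simp: fun_eq_iff inner_commute algebra_simps)
  have m: "(D2phi x t + (2 * a) *\<^sub>R mat 1) *v h = D2phi x t *v h + (2 * a) *\<^sub>R h" for h
    by (simp add: matrix_vector_mult_add_rdistrib scaleR_matrix_vector_assoc[symmetric])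
  show "((\<lambda>y. Dphi y t + (2 * a) *\<^sub>R (y - x0)) has_derivative (\<lambda>h. (D2phi x t + (2 * a) *\<^sub>R mat 1) *v h)) (at x)"
    unfolding m by (rule has_derivative_eq_rhs, (rule derivative_eq_intros p refl)+) auto
qed (use assms in \<open>auto simp: C21_test_def intro!: continuous_intros\<close>)

lemma C21_test_add_linear:
  assumes "C21_test phi phit Dphi D2phi"
  shows "C21_test (\<lambda>x t. phi x (t + b) + (a * t + k)) (\<lambda>x t. phit x (t + b) + a) (\<lambda>x t. Dphi x (t + b)) (\<lambda>x t. D2phi x (t + b))"
  unfolding C21_test_def
proof (intro conjI allI)
  fix x :: "real^'a" and t :: real
  have p: "((\<lambda>z. phi (fst z) (snd z)) has_derivative (\<lambda>h. Dphi x (t + b) \<bullet> fst h + phit x (t + b) * snd h)) (at (x, t + b))"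
    "((\<lambda>y. Dphi y (t + b)) has_derivative (\<lambda>h. D2phi x (t + b) *v h)) (at x)"
    using assms by (auto simp: C21_test_def)
  have q: "((\<lambda>z. (fst z, snd z + b)) has_derivative (\<lambda>h. (fst h, snd h))) (at (x, t))"
    by (auto intro!: derivative_eq_intros)
  have "((\<lambda>z. phi (fst z) (snd z + b)) has_derivative (\<lambda>h. Dphi x (t + b) \<bullet> fst h + phit x (t + b) * snd h)) (at (x, t))"
    using has_derivative_compose[OF q, of "\<lambda>z. phi (fst z) (snd z)"] p(1) by simp
  then show "((\<lambda>z. phi (fst z) (snd z + b) + (a * snd z + k)) has_derivative
      (\<lambda>h. Dphi x (t + b) \<bullet> fst h + (phit x (t + b) + a) * snd h)) (at (x, t))"
    by (auto intro!: derivative_eq_intros simp: algebra_simps)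
  show "((\<lambda>y. Dphi y (t + b)) has_derivative (\<lambda>h. D2phi x (t + b) *v h)) (at x)" by (rule p)
next
  have q: "continuous_on UNIV (\<lambda>z. (fst z :: real^'a, snd z + b))" by (intro continuous_intros)
  have c: "continuous_on UNIV (\<lambda>z. phit (fst z) (snd z))" "continuous_on UNIV (\<lambda>z. Dphi (fst z) (snd z))" "continuous_on UNIV (\<lambda>z. D2phi (fst z) (snd z))"
    using assms by (auto simp: C21_test_def)
  show "continuous_on UNIV (\<lambda>z. phit (fst z) (snd z + b) + a)" "continuous_on UNIV (\<lambda>z. Dphi (fst z) (snd z + b))"
    "continuous_on UNIV (\<lambda>z. D2phi (fst z) (snd z + b))"
    using continuous_on_compose2[OF c(1) q] continuous_on_compose2[OF c(2) q] continuous_on_compose2[OF c(3) q]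
    by (auto intro!: continuous_intros)
qed

text \<open>Two uses: \<open>a = 0\<close> gives translations in time and additive constants, and
  \<open>a = c\<close> normalises the ergodic constant to zero.\<close>

lemma visc_sol_E_shift:
  assumes u: "visc_sol_E \<sigma> H u" and b: "b \<ge> 0" and H: "\<And>x p X. Ham \<sigma> H' x p X = Ham \<sigma> H x p X - a"
  shows "visc_sol_E \<sigma> H' (\<lambda>x t. u x (t + b) + (a * t + k))"
  unfolding visc_sol_E_def
proof (intro conjI allI impI)
  have "continuous_on (UNIV \<times> {0<..}) (\<lambda>z. u (fst z) (snd z))" using u by (simp add: visc_sol_E_def)
  moreover have "continuous_on (UNIV \<times> {0<..}) (\<lambda>z. (fst z, snd z + b))" by (intro continuous_intros)
  moreover have "(\<lambda>z. (fst z, snd z + b)) ` (UNIV \<times> {0<..}) \<subseteq> UNIV \<times> {0<..}" using b by auto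
  ultimately have "continuous_on (UNIV \<times> {0<..}) (\<lambda>z. u (fst z) (snd z + b))"
    using continuous_on_compose2 by fastforce
  then show "continuous_on (UNIV \<times> {0<..}) (\<lambda>z. u (fst z) (snd z + b) + (a * snd z + k))"
    by (intro continuous_intros)
next
  fix phi phit Dphi D2phi x0 t0
  assume "C21_test phi phit Dphi D2phi \<and> 0 < t0 \<and> (\<exists>e>0. \<forall>y s. dist y x0 < e \<and> \<bar>s - t0\<bar> < e \<and> 0 < s \<longrightarrow>
    u y (s + b) + (a * s + k) - phi y s \<le> u x0 (t0 + b) + (a * t0 + k) - phi x0 t0)"
  then obtain e where C: "C21_test phi phit Dphi D2phi" and t0: "0 < t0" and e: "e > 0"
    "\<And>y s. dist y x0 < e \<Longrightarrow> \<bar>s - t0\<bar> < e \<Longrightarrow> 0 < s \<Longrightarrow> u y (s + b) + (a * s + k) - phi y s \<le> u x0 (t0 + b) + (a * t0 + k) - phi x0 t0"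
    by blast
  have "phit x0 (t0 + b + - b) + - a + Ham \<sigma> H x0 (Dphi x0 (t0 + b + - b)) (D2phi x0 (t0 + b + - b)) \<le> 0"
  proof (rule visc_sol_E_sub[OF u C21_test_add_linear[OF C, of "- b" "- a" "a * b - k"], of "t0 + b" "min e t0"])
    fix y s assume "dist y x0 < min e t0" "\<bar>s - (t0 + b)\<bar> < min e t0"
    then show "u y s - (phi y (s + - b) + (- a * s + (a * b - k))) \<le> u x0 (t0 + b) - (phi x0 (t0 + b + - b) + (- a * (t0 + b) + (a * b - k)))"
      using e(2)[of y "s - b"] unfolding abs_less_iff by (simp add: algebra_simps)
  qed (use t0 b e in auto)
  then show "phit x0 t0 + Ham \<sigma> H' x0 (Dphi x0 t0) (D2phi x0 t0) \<le> 0" by (simp add: H)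
next
  fix phi phit Dphi D2phi x0 t0
  assume "C21_test phi phit Dphi D2phi \<and> 0 < t0 \<and> (\<exists>e>0. \<forall>y s. dist y x0 < e \<and> \<bar>s - t0\<bar> < e \<and> 0 < s \<longrightarrow>
    u y (s + b) + (a * s + k) - phi y s \<ge> u x0 (t0 + b) + (a * t0 + k) - phi x0 t0)"
  then obtain e where C: "C21_test phi phit Dphi D2phi" and t0: "0 < t0" and e: "e > 0"
    "\<And>y s. dist y x0 < e \<Longrightarrow> \<bar>s - t0\<bar> < e \<Longrightarrow> 0 < s \<Longrightarrow> u y (s + b) + (a * s + k) - phi y s \<ge> u x0 (t0 + b) + (a * t0 + k) - phi x0 t0"
    by blast
  have "phit x0 (t0 + b + - b) + - a + Ham \<sigma> H x0 (Dphi x0 (t0 + b + - b)) (D2phi x0 (t0 + b + - b)) \<ge> 0"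
  proof (rule visc_sol_E_super[OF u C21_test_add_linear[OF C, of "- b" "- a" "a * b - k"], of "t0 + b" "min e t0"])
    fix y s assume "dist y x0 < min e t0" "\<bar>s - (t0 + b)\<bar> < min e t0"
    then show "u y s - (phi y (s + - b) + (- a * s + (a * b - k))) \<ge> u x0 (t0 + b) - (phi x0 (t0 + b + - b) + (- a * (t0 + b) + (a * b - k)))"
      using e(2)[of y "s - b"] unfolding abs_less_iff by (simp add: algebra_simps)
  qed (use t0 b e in auto)
  then show "phit x0 t0 + Ham \<sigma> H' x0 (Dphi x0 t0) (D2phi x0 t0) \<ge> 0" by (simp add: H)
qed

text \<open>The quadratic term makes the maximum strict, so it survives the passage from
  \<open>w\<close> to a uniformly close \<open>u n\<close>. The same \<open>d\<close> scales the
  perturbation and bounds the displacement, which leaves a single parameter to send to zero.\<close>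

lemma perturbed_maximum:
  fixes w :: "real^'n \<Rightarrow> real \<Rightarrow> real"
  assumes un: "\<And>n::nat. continuous_on (UNIV \<times> {0<..}) (\<lambda>z. u n (fst z) (snd z))"
    and lim: "\<And>e. e > 0 \<Longrightarrow> \<exists>n. \<forall>x t. t \<ge> 0 \<longrightarrow> \<bar>u n x t - w x t\<bar> \<le> e"
    and phi: "continuous_on UNIV (\<lambda>z. phi (fst z) (snd z))" and t0: "t0 > 0" and e: "e > 0"
    and max: "\<And>y s. dist y x0 < e \<Longrightarrow> \<bar>s - t0\<bar> < e \<Longrightarrow> 0 < s \<Longrightarrow> w y s - phi y s \<le> w x0 t0 - phi x0 t0"
    and d: "d > (0::real)"
  obtains y s e' n where "dist y x0 < d" "\<bar>s - t0\<bar> < d" "s > 0" "e' > 0"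
     "\<forall>y' s'. dist y' y < e' \<longrightarrow> \<bar>s' - s\<bar> < e' \<longrightarrow>
     u n y' s' - (phi y' s' + d * ((norm (y' - x0))\<^sup>2 + (s' - t0)\<^sup>2)) \<le> u n y s - (phi y s + d * ((norm (y - x0))\<^sup>2 + (s - t0)\<^sup>2))"
proof -
  define r where "r = min (min e t0) d / 2"
  have r: "r > 0" "r < e" "r < t0" "r < d" using e t0 d by (auto simp: r_def min_def)
  \<comment> \<open>Twice this error is half the gap \<open>d * r\<^sup>2\<close> that the quadratic
    term creates at distance \<open>r\<close>, so the maximum point is interior.\<close>
  define \<eta> where "\<eta> = d * r\<^sup>2 / 4"
  have \<eta>: "\<eta> > 0" using d r by (simp add: \<eta>_def)
  obtain n where n: "\<And>x t. t \<ge> 0 \<Longrightarrow> \<bar>u n x t - w x t\<bar> \<le> \<eta>" using lim[OF \<eta>] by blast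
  let ?K = "cball x0 r \<times> cball t0 r"
  let ?\<Phi> = "\<lambda>z. u n (fst z) (snd z) - (phi (fst z) (snd z) + d * ((norm (fst z - x0))\<^sup>2 + (snd z - t0)\<^sup>2))"
  have pos: "s > 0" if "s \<in> cball t0 r" for s using that r by (auto simp: dist_real_def)
  have "\<exists>z\<in>?K. \<forall>y\<in>?K. ?\<Phi> y \<le> ?\<Phi> z"
  proof (rule continuous_attains_sup)
    show "compact ?K" by (intro compact_Times) auto
    show "continuous_on ?K ?\<Phi>"
      using pos by (intro continuous_intros continuous_on_subset[OF un] continuous_on_subset[OF phi]) auto
  qed (use r in auto)
  then obtain y s where ys: "y \<in> cball x0 r" "s \<in> cball t0 r"
    and mx: "\<And>y' s'. y' \<in> cball x0 r \<Longrightarrow> s' \<in> cball t0 r \<Longrightarrow> ?\<Phi> (y', s') \<le> ?\<Phi> (y, s)"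
    by (auto simp del: mem_cball)
  have "?\<Phi> (x0, t0) \<le> ?\<Phi> (y, s)" by (rule mx) (use r in auto)
  moreover have "w y s - phi y s \<le> w x0 t0 - phi x0 t0"
    by (rule max) (use ys r pos in \<open>auto simp: dist_commute dist_real_def\<close>)
  moreover have "\<bar>u n y s - w y s\<bar> \<le> \<eta>" "\<bar>u n x0 t0 - w x0 t0\<bar> \<le> \<eta>" using pos[OF ys(2)] t0 by (auto intro!: n)
  ultimately have "d * ((norm (y - x0))\<^sup>2 + (s - t0)\<^sup>2) \<le> 2 * \<eta>" unfolding abs_le_iff by simp
  then have "d * ((norm (y - x0))\<^sup>2 + (s - t0)\<^sup>2) \<le> d * (r\<^sup>2 / 2)" by (simp add: \<eta>_def)
  then have "(norm (y - x0))\<^sup>2 + (s - t0)\<^sup>2 \<le> r\<^sup>2 / 2" using d by (simp only: mult_le_cancel_left_pos)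
  moreover have "r\<^sup>2 / 2 < r\<^sup>2" using r by simp
  ultimately have "(norm (y - x0))\<^sup>2 < r\<^sup>2" "(s - t0)\<^sup>2 < r\<^sup>2"
    using zero_le_power2[of "norm (y - x0)"] zero_le_power2[of "s - t0"] by linarith+
  then have n: "dist y x0 < r" "\<bar>s - t0\<bar> < r"
    using r by (auto simp: dist_norm power2_less_imp_less abs_square_less_1 intro: power2_less_imp_less[of "\<bar>s - t0\<bar>" r, simplified])
  show ?thesis
  proof (rule that[of y s "min (r - dist y x0) (r - \<bar>s - t0\<bar>)" n], goal_cases)
    case 5
    show ?case
    proof (intro allI impI)
    fix y' s' assume a: "dist y' y < min (r - dist y x0) (r - \<bar>s - t0\<bar>)" "\<bar>s' - s\<bar> < min (r - dist y x0) (r - \<bar>s - t0\<bar>)"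
    have "y' \<in> cball x0 r" using a dist_triangle[of y' x0 y] by (simp add: dist_commute)
    moreover have "s' \<in> cball t0 r" using a by (auto simp: dist_real_def)
    ultimately show "u n y' s' - (phi y' s' + d * ((norm (y' - x0))\<^sup>2 + (s' - t0)\<^sup>2)) \<le> u n y s - (phi y s + d * ((norm (y - x0))\<^sup>2 + (s - t0)\<^sup>2))"
      using mx[of y' s'] by simp
    qed
  qed (use n r pos[OF ys(2)] in auto)
qed

context bellman
begin

text \<open>The local \<open>F\<close> is the left-hand side of the equation for a test function
  perturbed by \<open>a\<close> times a quadratic. It is jointly continuous in \<open>a\<close> and
  the point, so inequalities at nearby points pass to the limit. Minima are treated as maxima of the
  negatives.\<close>

lemma visc_limit:
  assumes un: "\<And>n::nat. visc_sol_E \<sigma> H (u n)"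
    and lim: "\<And>e. e > 0 \<Longrightarrow> \<exists>n. \<forall>x t. t \<ge> 0 \<longrightarrow> \<bar>u n x t - w x t\<bar> \<le> e"
    and cw: "continuous_on (UNIV \<times> {0<..}) (\<lambda>z. w (fst z) (snd z))"
  shows "visc_sol_E \<sigma> H w"
proof -
  define F where "F phit Dphi D2phi x0 t0 a z = phit (fst z) (snd z) + 2 * a * (snd z - t0) +
      Ham \<sigma> H (fst z) (Dphi (fst z) (snd z) + (2 * a) *\<^sub>R (fst z - x0)) (D2phi (fst z) (snd z) + (2 * a) *\<^sub>R mat 1)"
    for phit :: "real^'n \<Rightarrow> real \<Rightarrow> real" and Dphi D2phi x0 t0 a z
  have Fc: "\<exists>d>0. \<forall>y s. dist y x0 < d \<longrightarrow> \<bar>s - t0\<bar> < d \<longrightarrow>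
     \<bar>F phit Dphi D2phi x0 t0 d (y, s) - F phit Dphi D2phi x0 t0 0 (x0, t0)\<bar> < \<eta> \<and>
     \<bar>F phit Dphi D2phi x0 t0 (- d) (y, s) - F phit Dphi D2phi x0 t0 0 (x0, t0)\<bar> < \<eta>"
    if C: "C21_test phi phit Dphi D2phi" and \<eta>: "\<eta> > 0" for phi phit Dphi D2phi x0 t0 \<eta>
  proof -
    have c: "continuous_on UNIV (\<lambda>z. phit (fst z) (snd z))" "continuous_on UNIV (\<lambda>z. Dphi (fst z) (snd z))" "continuous_on UNIV (\<lambda>z. D2phi (fst z) (snd z))"
      using C by (auto simp: C21_test_def)
    have cf: "continuous_on UNIV (\<lambda>w. h (fst (snd w)) (snd (snd w)))" if "continuous_on UNIV (\<lambda>z. h (fst z) (snd z))"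
      for h :: "real^'n \<Rightarrow> real \<Rightarrow> 'b::topological_space"
      by (rule continuous_on_compose2[OF that, of UNIV snd]) (auto intro!: continuous_intros)
    note c' = cf[OF c(1)] cf[OF c(2)] cf[OF c(3)]
    have "continuous_on UNIV (\<lambda>w. (case (fst (snd w), Dphi (fst (snd w)) (snd (snd w)) + (2 * fst w) *\<^sub>R (fst (snd w) - x0),
        D2phi (fst (snd w)) (snd (snd w)) + (2 * fst w) *\<^sub>R mat 1) of (x, p, X) \<Rightarrow> Ham \<sigma> H x p X))"
      by (rule continuous_on_compose2[OF Ham_continuous, of UNIV]) (auto intro!: continuous_intros c')
    then have "continuous_on UNIV (\<lambda>w. F phit Dphi D2phi x0 t0 (fst w) (snd w))"
      unfolding F_def by (auto intro!: continuous_intros c')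
    then have "isCont (\<lambda>w. F phit Dphi D2phi x0 t0 (fst w) (snd w)) (0, x0, t0)"
      by (simp add: continuous_on_eq_continuous_at)
    from this[unfolded continuous_at_eps_delta, rule_format, OF \<eta>] obtain D where D: "D > 0"
      "\<And>w. dist w (0, x0, t0) < D \<Longrightarrow> \<bar>F phit Dphi D2phi x0 t0 (fst w) (snd w) - F phit Dphi D2phi x0 t0 0 (x0, t0)\<bar> < \<eta>"
      by (auto simp: dist_real_def)
    show ?thesis
    proof (intro exI[of _ "D / 4"] conjI allI impI)
      fix y s assume a: "dist y x0 < D / 4" "\<bar>s - t0\<bar> < D / 4"
      have "dist (y, s) (x0, t0) \<le> dist y x0 + \<bar>s - t0\<bar>"
        using sqrt_sum_squares_le_sum[of "dist y x0" "dist s t0"] by (simp add: dist_prod_def dist_real_def)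
      then have b: "dist (y, s) (x0, t0) < D / 2" using a by linarith
      have "dist (c, y, s) (0, x0, t0) < D" if "\<bar>c\<bar> \<le> D / 4" for c
        using sqrt_sum_squares_le_sum[of "dist c 0" "dist (y, s) (x0, t0)"] that b by (simp add: dist_prod_def[of "(c, y, s)"])
      then show "\<bar>F phit Dphi D2phi x0 t0 (D / 4) (y, s) - F phit Dphi D2phi x0 t0 0 (x0, t0)\<bar> < \<eta>"
        "\<bar>F phit Dphi D2phi x0 t0 (- (D / 4)) (y, s) - F phit Dphi D2phi x0 t0 0 (x0, t0)\<bar> < \<eta>"
        using D(2)[of "(D / 4, y, s)"] D(2)[of "(- (D / 4), y, s)"] D(1) by auto
    qed (use D in auto)
  qed
  have cphi: "continuous_on UNIV (\<lambda>z. phi (fst z) (snd z))" if "C21_test phi phit Dphi D2phi" for phi :: "real^'n \<Rightarrow> real \<Rightarrow> real" and phit Dphi D2phi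
  proof -
    have "isCont (\<lambda>z. phi (fst z) (snd z)) (x, t)" for x t
      by (rule has_derivative_continuous[OF conjunct1[OF that[unfolded C21_test_def], rule_format]])
    then show ?thesis unfolding continuous_on_eq_continuous_within by auto
  qed
  have cun: "continuous_on (UNIV \<times> {0<..}) (\<lambda>z. u n (fst z) (snd z))" for n using visc_sol_E_continuous[OF un] .
  show ?thesis unfolding visc_sol_E_def
  proof (intro conjI allI impI cw)
    fix phi phit Dphi D2phi x0 t0
    assume "C21_test phi phit Dphi D2phi \<and> 0 < t0 \<and> (\<exists>e>0. \<forall>y s. dist y x0 < e \<and> \<bar>s - t0\<bar> < e \<and> 0 < s \<longrightarrow> w y s - phi y s \<le> w x0 t0 - phi x0 t0)"
    then obtain e where C: "C21_test phi phit Dphi D2phi" and t0: "0 < t0" and e: "e > 0"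
      "\<And>y s. dist y x0 < e \<Longrightarrow> \<bar>s - t0\<bar> < e \<Longrightarrow> 0 < s \<Longrightarrow> w y s - phi y s \<le> w x0 t0 - phi x0 t0" by blast
    have "F phit Dphi D2phi x0 t0 0 (x0, t0) \<le> 0 + \<eta>" if \<eta>: "\<eta> > 0" for \<eta>
    proof -
      obtain d where d: "d > 0" "\<And>y s. dist y x0 < d \<Longrightarrow> \<bar>s - t0\<bar> < d \<Longrightarrow> \<bar>F phit Dphi D2phi x0 t0 d (y, s) - F phit Dphi D2phi x0 t0 0 (x0, t0)\<bar> < \<eta>"
        using Fc[OF C \<eta>] by blast
      obtain y s e' n where ys: "dist y x0 < d" "\<bar>s - t0\<bar> < d" "s > 0" "e' > 0"
        "\<forall>y' s'. dist y' y < e' \<longrightarrow> \<bar>s' - s\<bar> < e' \<longrightarrow>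
          u n y' s' - (phi y' s' + d * ((norm (y' - x0))\<^sup>2 + (s' - t0)\<^sup>2)) \<le> u n y s - (phi y s + d * ((norm (y - x0))\<^sup>2 + (s - t0)\<^sup>2))"
        by (rule perturbed_maximum[of u w phi, OF cun lim cphi[OF C] t0 e d(1)])
      have "F phit Dphi D2phi x0 t0 d (y, s) \<le> 0"
        unfolding F_def fst_conv snd_conv
        by (rule visc_sol_E_sub[OF un C21_test_add_quad[OF C] ys(3,4)]) (use ys(5) in blast)
      then show ?thesis using d(2)[OF ys(1,2)] unfolding abs_less_iff by linarith
    qed
    then have "F phit Dphi D2phi x0 t0 0 (x0, t0) \<le> 0" by (rule field_le_epsilon)
    then show "phit x0 t0 + Ham \<sigma> H x0 (Dphi x0 t0) (D2phi x0 t0) \<le> 0" by (simp add: F_def)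
  next
    fix phi phit Dphi D2phi x0 t0
    assume "C21_test phi phit Dphi D2phi \<and> 0 < t0 \<and> (\<exists>e>0. \<forall>y s. dist y x0 < e \<and> \<bar>s - t0\<bar> < e \<and> 0 < s \<longrightarrow> w y s - phi y s \<ge> w x0 t0 - phi x0 t0)"
    then obtain e where C: "C21_test phi phit Dphi D2phi" and t0: "0 < t0" and e: "e > 0"
      "\<And>y s. dist y x0 < e \<Longrightarrow> \<bar>s - t0\<bar> < e \<Longrightarrow> 0 < s \<Longrightarrow> - w y s - - phi y s \<le> - w x0 t0 - - phi x0 t0" by force
    have "0 \<le> F phit Dphi D2phi x0 t0 0 (x0, t0) + \<eta>" if \<eta>: "\<eta> > 0" for \<eta>
    proof -
      obtain d where d: "d > 0" "\<And>y s. dist y x0 < d \<Longrightarrow> \<bar>s - t0\<bar> < d \<Longrightarrow> \<bar>F phit Dphi D2phi x0 t0 (- d) (y, s) - F phit Dphi D2phi x0 t0 0 (x0, t0)\<bar> < \<eta>"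
        using Fc[OF C \<eta>] by blast
      have lim': "\<exists>n. \<forall>x t. t \<ge> 0 \<longrightarrow> \<bar>- u n x t - - w x t\<bar> \<le> e" if "e > 0" for e
        using lim[OF that] by (simp add: abs_minus_commute)
      obtain y s e' n where ys: "dist y x0 < d" "\<bar>s - t0\<bar> < d" "s > 0" "e' > 0"
        "\<forall>y' s'. dist y' y < e' \<longrightarrow> \<bar>s' - s\<bar> < e' \<longrightarrow>
          - u n y' s' - (- phi y' s' + d * ((norm (y' - x0))\<^sup>2 + (s' - t0)\<^sup>2)) \<le> - u n y s - (- phi y s + d * ((norm (y - x0))\<^sup>2 + (s - t0)\<^sup>2))"
        by (rule perturbed_maximum[of "\<lambda>n x t. - u n x t" "\<lambda>x t. - w x t" "\<lambda>x t. - phi x t",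
            OF continuous_on_minus[OF cun] lim' continuous_on_minus[OF cphi[OF C]] t0 e d(1)])
      have "F phit Dphi D2phi x0 t0 (- d) (y, s) \<ge> 0"
        unfolding F_def fst_conv snd_conv
      proof (rule visc_sol_E_super[OF un[of n] C21_test_add_quad[OF C] ys(3,4)])
        fix y' s' assume "dist y' y < e'" "\<bar>s' - s\<bar> < e'"
        then show "u n y s - (phi y s + - d * ((norm (y - x0))\<^sup>2 + (s - t0)\<^sup>2)) \<le> u n y' s' - (phi y' s' + - d * ((norm (y' - x0))\<^sup>2 + (s' - t0)\<^sup>2))"
          using ys(5)[rule_format, of y' s'] by simp
      qed
      then show ?thesis using d(2)[OF ys(1,2)] unfolding abs_less_iff by linarith
    qed
    then have "0 \<le> F phit Dphi D2phi x0 t0 0 (x0, t0)" by (rule field_le_epsilon)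
    then show "phit x0 t0 + Ham \<sigma> H x0 (Dphi x0 t0) (D2phi x0 t0) \<ge> 0" by (simp add: F_def)
  qed
qed

end

section \<open>Periodic solutions: translation, compactness in space, limits\<close>

lemma periodic_cube:
  assumes "periodic (f :: real^'n \<Rightarrow> 'b)"
  shows "\<exists>y\<in>cbox 0 1. f x = f y"
proof
  let ?y = "\<chi> i. frac (x $ i)" and ?k = "\<chi> i. of_int \<lfloor>x $ i\<rfloor>"
  have "x = ?y + ?k" by (simp add: vec_eq_iff frac_def)
  moreover have "\<forall>i. ?k $ i \<in> \<int>" by simp
  ultimately show "f x = f ?y" using assms unfolding periodic_def by metis
  show "?y \<in> cbox 0 1" by (simp add: mem_box_cart frac_lt_1 less_imp_le)
qed

text \<open>Lets \<open>periodic_cube\<close> move two functions to one and the same point of the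
  unit cube.\<close>

lemma periodic_pair:
  "periodic f \<Longrightarrow> periodic g \<Longrightarrow> periodic (\<lambda>x. (f x, g x))"
  by (simp add: periodic_def)

context bellman
begin

lemma solution_shift:
  assumes u: "solution u" and b: "b \<ge> 0"
  shows "solution (\<lambda>x t. u x (t + b) + k)"
  unfolding solution_def
proof (intro conjI allI impI)
  have "continuous_on (UNIV \<times> {0..}) (\<lambda>z. (fst z :: real^'n, snd z + b))" by (intro continuous_intros)
  from continuous_on_compose2[OF solutionD(1)[OF u] this]
  have "continuous_on (UNIV \<times> {0..}) (\<lambda>z. u (fst z) (snd z + b))" using b by fastforce
  then show "continuous_on (UNIV \<times> {0..}) (\<lambda>z. u (fst z) (snd z + b) + k)" by (intro continuous_intros)
  show "periodic (\<lambda>x. u x (t + b) + k)" if "t \<ge> 0" for t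
    using solutionD(2)[OF u, of "t + b"] that b by (simp add: periodic_def)
  show "lip_t (\<lambda>x t. u x (t + b) + k)" using solutionD(3)[OF u] b by (simp add: lip_t_def)
  show "visc_sol_E \<sigma> H (\<lambda>x t. u x (t + b) + k)"
    using visc_sol_E_shift[OF solutionD(4)[OF u] b, of H 0 k] by simp
qed

lemma solution_bounded:
  assumes u: "solution u"
  shows "\<exists>B. \<forall>x. \<forall>t\<in>{0..T}. \<bar>u x t\<bar> \<le> B"
proof -
  have "compact ((\<lambda>z. u (fst z) (snd z)) ` (cbox 0 1 \<times> {0..T}))"
    by (intro compact_continuous_image compact_Times continuous_on_subset[OF solutionD(1)[OF u]]) auto
  from compact_imp_bounded[OF this] obtain B where "\<forall>z\<in>cbox 0 1 \<times> {0..T}. \<bar>u (fst z) (snd z)\<bar> \<le> B"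
    unfolding bounded_iff by auto
  then have B: "\<bar>u y t\<bar> \<le> B" if "y \<in> cbox 0 1" "t \<in> {0..T}" for y t using that by force
  have "\<bar>u x t\<bar> \<le> B" if t: "t \<in> {0..T}" for x t
  proof -
    obtain y where "y \<in> cbox 0 1" "u x t = u y t"
      using periodic_cube[OF solutionD(2)[OF u], of t x] t by auto
    then show ?thesis using B[OF _ t, of y] by simp
  qed
  then show ?thesis by blast
qed

lemma solution_uniform:
  assumes u: "solution u" and e: "e > 0"
  shows "\<exists>d>0. \<forall>x. \<forall>t\<in>{0..T}. \<forall>s\<in>{0..T}. \<bar>t - s\<bar> < d \<longrightarrow> \<bar>u x t - u x s\<bar> < e"
proof -
  have "uniformly_continuous_on (cbox 0 1 \<times> {0..T}) (\<lambda>z. u (fst z) (snd z))"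
    by (intro compact_uniformly_continuous compact_Times continuous_on_subset[OF solutionD(1)[OF u]]) auto
  from this[unfolded uniformly_continuous_on_def, rule_format, OF e] obtain d where d: "d > 0"
    "\<And>z z'. z \<in> cbox 0 1 \<times> {0..T} \<Longrightarrow> z' \<in> cbox 0 1 \<times> {0..T} \<Longrightarrow> dist z' z < d \<Longrightarrow> dist (u (fst z') (snd z')) (u (fst z) (snd z)) < e"
    by blast
  have "\<bar>u x t - u x s\<bar> < e" if ts: "t \<in> {0..T}" "s \<in> {0..T}" "\<bar>t - s\<bar> < d" for x t s
  proof -
    obtain y where y: "y \<in> cbox 0 1" "(u x t, u x s) = (u y t, u y s)"
      using periodic_cube[OF periodic_pair[OF solutionD(2)[OF u] solutionD(2)[OF u]], of t s x] ts by auto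
    have "dist (u y t) (u y s) < e" using d(2)[of "(y, s)" "(y, t)"] y(1) ts by (simp add: dist_Pair_Pair dist_real_def)
    then show ?thesis using y(2) by (simp add: dist_real_def)
  qed
  then show ?thesis using d(1) by blast
qed

text \<open>The statement does not mention \<open>V\<close>: some stationary solution is needed to apply \<open>on_Sigma\<close>, where it has weight 0.\<close>

lemma interior_min:
  fixes V :: "real^'n \<Rightarrow> real"
  assumes U: "visc_sol_E \<sigma> H U" "lip_t U" and W: "visc_sol_E \<sigma> H W" "lip_t W"
    and V: "visc_sol_E \<sigma> H (\<lambda>x t. V x)" "lip_t (\<lambda>x t. V x)"
    and pos: "rh > 0" "th > 0"
    and g: "\<And>t. (g has_real_derivative g' t) (at t)" "\<And>t. (g' has_real_derivative g'' t) (at t)" "continuous_on UNIV g''"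
    and \<rho>: "\<rho> > 0" "\<And>x r t. dist x xh < \<rho> \<Longrightarrow> \<bar>r - rh\<bar> < \<rho> \<Longrightarrow> \<bar>t - th\<bar> < \<rho> \<Longrightarrow>
       W x t - U x r - (g t + k * (t - r)\<^sup>2) \<le> W xh th - U xh rh - (g th + k * (th - rh)\<^sup>2)"
  shows "g' th \<le> 0"
proof (cases "xh \<in> Sigma_set \<sigma>")
  case True
  have cg: "continuous_on UNIV (\<lambda>z::real\<times>real. g (snd z))" "continuous_on UNIV (\<lambda>z::real\<times>real. g' (snd z))"
    by (rule continuous_on_compose2[OF DERIV_continuous_on[OF g(1)], of UNIV snd] continuous_on_compose2[OF DERIV_continuous_on[OF g(2)], of UNIV snd],
      auto intro!: continuous_intros)+
  \<comment> \<open>Weights \<open>1\<close> and \<open>0\<close> compare \<open>U\<close> and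
    \<open>W\<close> alone, at one gradient \<open>p\<close>. The contributions of
    \<open>k * (t - r)\<^sup>2\<close> to the two time derivatives are opposite and cancel.\<close>
  have "\<exists>p q. (\<forall>\<theta>. 1 * H \<theta> xh p \<le> - g' th - 2 * k * (th - rh)) \<and> (0 > (0::real) \<longrightarrow> (\<forall>\<theta>. H \<theta> xh q \<le> 0)) \<and>
     (\<forall>\<gamma>>0. \<exists>\<theta>. 2 * k * (th - rh) + H \<theta> xh (1 *\<^sub>R p + 0 *\<^sub>R q) \<ge> - \<gamma>)"
  proof (rule on_Sigma[OF U W V _ _ _ True pos, of _ _ "\<lambda>r t. - (g t + k * (t - r)\<^sup>2)" "\<lambda>r t. 2 * k * (t - r)" "\<lambda>r t. - g' t - 2 * k * (t - r)" \<rho>])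
    show "((\<lambda>r. - (g t + k * (t - r)\<^sup>2)) has_real_derivative 2 * k * (t - r)) (at r)"
      "((\<lambda>t. - (g t + k * (t - r)\<^sup>2)) has_real_derivative - g' t - 2 * k * (t - r)) (at t)" for r t
      by (rule DERIV_cong, (rule derivative_eq_intros g refl)+, simp add: algebra_simps)+
    fix x r t assume "dist x xh < \<rho>" "\<bar>r - rh\<bar> < \<rho>" "\<bar>t - th\<bar> < \<rho>"
    from \<rho>(2)[OF this]
    show "U xh rh - 1 * W xh th - 0 * V xh - - (g th + k * (th - rh)\<^sup>2) \<le> U x r - 1 * W x t - 0 * V x - - (g t + k * (t - r)\<^sup>2)"
      by simp
  qed (use \<rho>(1) cg in \<open>auto intro!: continuous_intros\<close>)
  then obtain p where p: "\<And>\<theta>. H \<theta> xh p \<le> - g' th - 2 * k * (th - rh)"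
    "\<And>\<gamma>. \<gamma> > 0 \<Longrightarrow> \<exists>\<theta>. 2 * k * (th - rh) + H \<theta> xh p \<ge> - \<gamma>" by auto
  have "g' th \<le> 0 + \<gamma>" if "\<gamma> > 0" for \<gamma>
  proof -
    obtain \<theta> where "2 * k * (th - rh) + H \<theta> xh p \<ge> - \<gamma>" using p(2)[OF \<open>\<gamma> > 0\<close>] by blast
    then show ?thesis using p(1)[of \<theta>] by linarith
  qed
  then show ?thesis by (rule field_le_epsilon)
next
  case False
  then obtain \<delta> where \<delta>: "\<delta> > 0" "xh \<in> Sigma_compl \<sigma> \<delta>" using not_Sigma_compl by blast
  define e1 e2 where "e1 = (0 :: real^'n, 0 :: real, 1 :: real)" and "e2 = (0 :: real^'n, - 1 :: real, 1 :: real)"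
  have 1: "C2fun (\<lambda>z. - g (z \<bullet> e1)) (\<lambda>z. - g' (z \<bullet> e1) *\<^sub>R e1) (\<lambda>z h. (- g'' (z \<bullet> e1) * (e1 \<bullet> h)) *\<^sub>R e1)"
    using C2fun_1d[of "\<lambda>t. - g t" "\<lambda>t. - g' t" "\<lambda>t. - g'' t" e1] g by (auto intro!: derivative_intros continuous_intros)
  have "((\<lambda>t. (- k) * t\<^sup>2) has_real_derivative (- 2 * k * t)) (at t)" "((\<lambda>t. - 2 * k * t) has_real_derivative (- 2 * k)) (at t)" for t
    by (rule DERIV_cong, (rule derivative_eq_intros g refl)+, simp)+
  from C2fun_1d[OF this continuous_on_const, of e2]
  have 2: "C2fun (\<lambda>z. (- k) * (z \<bullet> e2)\<^sup>2) (\<lambda>z. (- 2 * k * (z \<bullet> e2)) *\<^sub>R e2) (\<lambda>z h. (- 2 * k * (e2 \<bullet> h)) *\<^sub>R e2)" .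
  define \<phi>' \<phi>'' where "\<phi>' = (\<lambda>z. - g' (z \<bullet> e1) *\<^sub>R e1 + (- 2 * k * (z \<bullet> e2)) *\<^sub>R e2)"
    and "\<phi>'' = (\<lambda>z h. (- g'' (z \<bullet> e1) * (e1 \<bullet> h)) *\<^sub>R e1 + (- 2 * k * (e2 \<bullet> h)) *\<^sub>R e2)"
  have 3: "C2fun (\<lambda>z. - g (z \<bullet> e1) + (- k) * (z \<bullet> e2)\<^sup>2) \<phi>' \<phi>''" unfolding \<phi>'_def \<phi>''_def by (rule C2fun_add[OF 1 2])
  have t: "tr2 (sg \<theta> z) \<phi>'' z = 0" for \<theta> z by (simp add: tr2_def sg_def \<phi>''_def e1_def e2_def)
  have d: "\<phi>' (xh, rh, th) = (0, 2 * k * (th - rh), - g' th - 2 * k * (th - rh))"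
    by (simp add: \<phi>'_def e1_def e2_def algebra_simps)
  have "g' th \<le> 0 + \<gamma>" if "\<gamma> > 0" for \<gamma>
  proof -
    \<comment> \<open>The lemma asks for two positive weights, so \<open>W\<close> is split into
      halves. The test function depends on the times only, so its space gradient and
      \<open>tr2\<close> vanish.\<close>
    have "\<exists>\<theta>. fst (snd (\<phi>' (xh, rh, th))) + snd (snd (\<phi>' (xh, rh, th))) + KH * norm (fst (\<phi>' (xh, rh, th)))
       - tr2 (sg \<theta> (xh, rh, th)) \<phi>'' (xh, rh, th) \<ge> - \<gamma>"
    proof (rule diff_off_Sigma[OF U W W, of "1/2" "1/2", OF _ _ _ \<delta> pos 3 \<rho>(1) _ that])
      fix x r t assume a: "dist (x, r, t) (xh, rh, th) < \<rho>"
      have "dist x xh < \<rho>" using dist_fst_le[of "(x, r, t)" "(xh, rh, th)"] a by simp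
      moreover have "\<bar>r - rh\<bar> < \<rho>" "\<bar>t - th\<bar> < \<rho>" using dist_snd_le[of "(x, r, t)" "(xh, rh, th)"]
          dist_snd_le[of "(r, t)" "(rh, th)"] dist_fst_le[of "(r, t)" "(rh, th)"] a by (auto simp: dist_real_def)
      ultimately show "- U x r + 1 / 2 * W x t + 1 / 2 * W x t + (- g ((x, r, t) \<bullet> e1) + (- k) * ((x, r, t) \<bullet> e2)\<^sup>2)
        \<le> - U xh rh + 1 / 2 * W xh th + 1 / 2 * W xh th + (- g ((xh, rh, th) \<bullet> e1) + (- k) * ((xh, rh, th) \<bullet> e2)\<^sup>2)"
        using \<rho>(2)[of x r t] by (simp add: e1_def e2_def)
    qed auto
    then show ?thesis unfolding d t by simp
  qed
  then show ?thesis by (rule field_le_epsilon)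
qed

lemma solution_limit:
  assumes lim: "\<And>e. e > 0 \<Longrightarrow> \<exists>z. solution z \<and> (\<forall>x t. t \<ge> 0 \<longrightarrow> \<bar>z x t - w x t\<bar> \<le> e)"
  shows "solution w"
proof -
  have c: "continuous_on (UNIV \<times> {0..}) (\<lambda>z. w (fst z) (snd z))"
    unfolding continuous_on_iff
  proof (intro ballI allI impI)
    fix z0 :: "(real^'n) \<times> real" and e :: real assume z0: "z0 \<in> UNIV \<times> {0..}" and e: "0 < e"
    then obtain u where u: "solution u" "\<And>x t. t \<ge> 0 \<Longrightarrow> \<bar>u x t - w x t\<bar> \<le> e / 4" using lim[of "e / 4"] by auto
    from solutionD(1)[OF u(1), unfolded continuous_on_iff, rule_format, OF z0, of "e / 4"] e
    obtain d where d: "d > 0" "\<And>z. z \<in> UNIV \<times> {0..} \<Longrightarrow> dist z z0 < d \<Longrightarrow> dist (u (fst z) (snd z)) (u (fst z0) (snd z0)) < e / 4"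
      by auto
    show "\<exists>d>0. \<forall>z\<in>UNIV \<times> {0..}. dist z z0 < d \<longrightarrow> dist (w (fst z) (snd z)) (w (fst z0) (snd z0)) < e"
    proof (intro exI conjI ballI impI, rule d(1))
      fix z :: "(real^'n) \<times> real" assume z: "z \<in> UNIV \<times> {0..}" "dist z z0 < d"
      have "snd z \<ge> 0" "snd z0 \<ge> 0" using z z0 by auto
      then show "dist (w (fst z) (snd z)) (w (fst z0) (snd z0)) < e"
        using d(2)[OF z] u(2)[of "snd z" "fst z"] u(2)[of "snd z0" "fst z0"] e
        unfolding dist_real_def abs_le_iff abs_less_iff by linarith
    qed
  qed
  have per: "periodic (\<lambda>x. w x t)" if t: "t \<ge> 0" for t
    unfolding periodic_def
  proof (intro allI impI)
    fix x k :: "real^'n" assume k: "\<forall>i. k $ i \<in> \<int>"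
    have "\<bar>w (x + k) t - w x t\<bar> \<le> 0 + e" if e: "e > 0" for e
    proof -
      obtain u where u: "solution u" "\<And>x t. t \<ge> 0 \<Longrightarrow> \<bar>u x t - w x t\<bar> \<le> e / 2" using lim[of "e / 2"] e by auto
      have "u (x + k) t = u x t" using solutionD(2)[OF u(1) t] k by (simp add: periodic_def)
      then show ?thesis using u(2)[OF t, of x] u(2)[OF t, of "x + k"] unfolding abs_le_iff by linarith
    qed
    then have "\<bar>w (x + k) t - w x t\<bar> \<le> 0" by (rule field_le_epsilon)
    then show "w (x + k) t = w x t" by simp
  qed
  have lip: "lip_t w"
    unfolding lip_t_def
  proof (intro allI impI)
    fix t :: real and x y :: "real^'n" assume t: "t \<ge> 0"
    have "\<bar>w x t - w y t\<bar> \<le> L * dist x y + e" if e: "e > 0" for e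
    proof -
      obtain u where u: "solution u" "\<And>x t. t \<ge> 0 \<Longrightarrow> \<bar>u x t - w x t\<bar> \<le> e / 2" using lim[of "e / 2"] e by auto
      have "\<bar>u x t - u y t\<bar> \<le> L * dist x y" using solutionD(3)[OF u(1)] t by (simp add: lip_t_def)
      then show ?thesis using u(2)[OF t, of x] u(2)[OF t, of y] unfolding abs_le_iff by linarith
    qed
    then show "\<bar>w x t - w y t\<bar> \<le> L * dist x y" by (rule field_le_epsilon)
  qed
  have "\<forall>n. \<exists>z. solution z \<and> (\<forall>x t. t \<ge> 0 \<longrightarrow> \<bar>z x t - w x t\<bar> \<le> inverse (real (Suc n)))"
    using lim by simp
  from choice[OF this] obtain z where z: "\<And>n. solution (z n)" "\<And>n x t. t \<ge> 0 \<Longrightarrow> \<bar>z n x t - w x t\<bar> \<le> inverse (real (Suc n))"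
    by blast
  have "visc_sol_E \<sigma> H w"
  proof (rule visc_limit[of z])
    show "visc_sol_E \<sigma> H (z n)" for n by (rule solutionD(4)[OF z(1)])
    show "continuous_on (UNIV \<times> {0<..}) (\<lambda>z. w (fst z) (snd z))" by (rule continuous_on_subset[OF c]) auto
    fix e :: real assume "e > 0"
    then obtain n where "inverse (real (Suc n)) < e" using reals_Archimedean by blast
    then show "\<exists>n. \<forall>x t. t \<ge> 0 \<longrightarrow> \<bar>z n x t - w x t\<bar> \<le> e" using z(2)[of _ n] by (meson less_imp_le order_trans)
  qed
  then show ?thesis using c per lip by (simp add: solution_def)
qed

end

section \<open>Comparison principle and contraction in the sup norm\<close>

locale bellman_erg = bellman \<sigma> H C L
  for \<sigma> :: "'th \<Rightarrow> real^'n \<Rightarrow> real^'n^'n" and H :: "'th \<Rightarrow> real^'n \<Rightarrow> real^'n \<Rightarrow> real" and C L :: real +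
  fixes v0 :: "real^'n \<Rightarrow> real" and u :: "real^'n \<Rightarrow> real \<Rightarrow> real"
  assumes v0: "solution (\<lambda>x t. v0 x)" and u: "solution u"
begin

text \<open>Only the time is doubled here: \<open>interior_min\<close> accepts a maximum with a
  common space point. The exponential \<open>g\<close> equals the small \<open>\<gamma>\<close> at
  \<open>ts\<close> but exceeds the range of \<open>W - U - M\<close> before \<open>T\<close>, which
  keeps the maximum away from the terminal time; its positive derivative then contradicts
  \<open>interior_min\<close>.\<close>

lemma comparison:
  assumes U: "solution U" and W: "solution W" and init: "\<And>x. W x 0 \<le> U x 0 + M" and ts: "ts \<ge> 0"
  shows "W xs ts \<le> U xs ts + M"
proof (rule ccontr)
  define a where "a = W xs ts - U xs ts - M"
  assume "\<not> W xs ts \<le> U xs ts + M"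
  then have a: "a > 0" by (simp add: a_def)
  define T where "T = ts + 1"
  obtain B1 where B1: "\<And>x t. t \<in> {0..T} \<Longrightarrow> \<bar>U x t\<bar> \<le> B1" using solution_bounded[OF U] by blast
  obtain B2 where B2: "\<And>x t. t \<in> {0..T} \<Longrightarrow> \<bar>W x t\<bar> \<le> B2" using solution_bounded[OF W] by blast
  obtain d1 where d1: "d1 > 0" "\<And>x t s. t \<in> {0..T} \<Longrightarrow> s \<in> {0..T} \<Longrightarrow> \<bar>t - s\<bar> < d1 \<Longrightarrow> \<bar>U x t - U x s\<bar> < a / 4"
    using solution_uniform[OF U, of "a / 4" T] a by auto
  obtain d2 where d2: "d2 > 0" "\<And>x t s. t \<in> {0..T} \<Longrightarrow> s \<in> {0..T} \<Longrightarrow> \<bar>t - s\<bar> < d2 \<Longrightarrow> \<bar>W x t - W x s\<bar> < a / 4"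
    using solution_uniform[OF W, of "a / 4" T] a by auto
  define d where "d = min (min d1 d2) (1/4)"
  have d: "d > 0" "d \<le> d1" "d \<le> d2" "d \<le> 1/4" using d1 d2 by (auto simp: d_def)
  define G where "G = \<bar>B1 + B2 - M\<bar> + 1"
  have G: "G > 0" "G > B1 + B2 - M" by (auto simp: G_def)
  define \<gamma> where "\<gamma> = a / 4"
  have \<gamma>: "\<gamma> > 0" using a by (simp add: \<gamma>_def)
  \<comment> \<open>By \<open>exp x \<ge> 1 + x\<close>, this rate raises \<open>g\<close> from
    \<open>\<gamma>\<close> at \<open>ts\<close> to at least \<open>G\<close> at
    \<open>ts + 1 / 2\<close>.\<close>
  define \<Lambda> where "\<Lambda> = 2 * G / \<gamma>"
  define g where "g t = \<gamma> * exp (\<Lambda> * (t - ts))" for t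
  have g0: "g t > 0" for t using \<gamma> by (simp add: g_def)
  have g1: "g t \<ge> G" if "t \<ge> ts + 1/2" for t
  proof -
    have "\<Lambda> > 0" using G \<gamma> by (simp add: \<Lambda>_def)
    then have "\<Lambda> * (t - ts) \<ge> \<Lambda> * (1/2)" using that by (intro mult_left_mono) auto
    then have "exp (\<Lambda> * (t - ts)) \<ge> \<Lambda> * (1/2)" using exp_ge_add_one_self[of "\<Lambda> * (t - ts)"] by linarith
    then have "g t \<ge> \<gamma> * (\<Lambda> * (1/2))" unfolding g_def using \<gamma> by (intro mult_left_mono) auto
    then show ?thesis using \<gamma> by (simp add: \<Lambda>_def)
  qed
  \<comment> \<open>Forces \<open>\<bar>t - r\<bar> < d\<close> at the maximum, a time difference
    over which \<open>U\<close> and \<open>W\<close> vary by less than \<open>\<gamma>\<close>; thus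
    \<open>init\<close> excludes a maximum at time \<open>0\<close>.\<close>
  define k where "k = G / d\<^sup>2"
  have k: "k > 0" using G d by (simp add: k_def)
  have k1: "\<bar>t - r\<bar> < d" if "k * (t - r)\<^sup>2 < G" for t r
  proof (rule ccontr)
    assume "\<not> \<bar>t - r\<bar> < d"
    then have "d\<^sup>2 \<le> (t - r)\<^sup>2" using d(1) by (metis abs_le_square_iff abs_of_pos not_less)
    then have "k * d\<^sup>2 \<le> k * (t - r)\<^sup>2" using k by simp
    then show False using that d(1) by (simp add: k_def)
  qed
  define F where "F x r t = W x t - U x r - (g t + k * (t - r)\<^sup>2)" for x r t
  have "continuous_on (cbox 0 1 \<times> ({0..T} \<times> {0..T})) (\<lambda>z. F (fst z) (fst (snd z)) (snd (snd z)))"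
    unfolding F_def g_def
    by (intro continuous_intros continuous_on_compose2[OF solutionD(1)[OF U], of _ "\<lambda>z. (fst z, fst (snd z))", simplified]
       continuous_on_compose2[OF solutionD(1)[OF W], of _ "\<lambda>z. (fst z, snd (snd z))", simplified]) auto
  moreover have "compact (cbox (0::real^'n) 1 \<times> ({0..T} \<times> {0..T}))" by (intro compact_Times) auto
  moreover have "(0, ts, ts) \<in> cbox (0::real^'n) 1 \<times> ({0..T} \<times> {0..T})"
    using ts by (auto simp: T_def mem_box_cart)
  ultimately obtain z where z: "z \<in> cbox 0 1 \<times> ({0..T} \<times> {0..T})"
    "\<And>z'. z' \<in> cbox 0 1 \<times> ({0..T} \<times> {0..T}) \<Longrightarrow> F (fst z') (fst (snd z')) (snd (snd z')) \<le> F (fst z) (fst (snd z)) (snd (snd z))"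
    using continuous_attains_sup[of "cbox 0 1 \<times> ({0..T} \<times> {0..T})" "\<lambda>z. F (fst z) (fst (snd z)) (snd (snd z))"] by blast
  obtain xh rh th where zz: "z = (xh, rh, th)" by (metis prod.collapse)
  have rt: "rh \<in> {0..T}" "th \<in> {0..T}" using z(1) zz by auto
  have mx: "F x r t \<le> F xh rh th" if "r \<in> {0..T}" "t \<in> {0..T}" for x r t
  proof -
    have "\<exists>y\<in>cbox 0 1. (W x t, U x r) = (W y t, U y r)"
      by (rule periodic_cube[OF periodic_pair[OF solutionD(2)[OF W] solutionD(2)[OF U]]]) (use that in auto)
    then obtain y where "y \<in> cbox 0 1" "(W x t, U x r) = (W y t, U y r)" by blast
    then show ?thesis using z(2)[of "(y, r, t)"] that by (simp add: F_def zz)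
  qed
  have "F xs ts ts \<le> F xh rh th" by (rule mx) (use ts in \<open>auto simp: T_def\<close>)
  moreover have "F xs ts ts = a + M - \<gamma>" by (simp add: F_def a_def g_def)
  ultimately have Fh: "F xh rh th \<ge> M + 3 * \<gamma>" unfolding \<gamma>_def by linarith
  have bd: "W xh th - U xh rh \<le> B1 + B2" using B1[OF rt(1), of xh] B2[OF rt(2), of xh] unfolding abs_le_iff by linarith
  have kk: "k * (th - rh)\<^sup>2 \<ge> 0" using k by simp
  have "g th < G" using Fh bd kk \<gamma> G(2) unfolding F_def by linarith
  then have th: "th < ts + 1/2" using g1[of th] by linarith
  have "k * (th - rh)\<^sup>2 < G" using Fh bd g0[of th] \<gamma> G(2) unfolding F_def by linarith
  then have close: "\<bar>th - rh\<bar> < d" by (rule k1)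
  have cl: "\<bar>U xh th - U xh rh\<bar> < \<gamma>" "\<bar>W xh th - W xh rh\<bar> < \<gamma>"
    using d1(2)[OF rt(2,1), of xh] d2(2)[OF rt(2,1), of xh] close d unfolding \<gamma>_def by linarith+
  have Fh': "W xh th - U xh rh > M + 2 * \<gamma>" using Fh kk g0[of th] \<gamma> unfolding F_def by linarith
  have "th \<noteq> 0"
  proof
    assume "th = 0"
    then show False using Fh' cl init[of xh] \<gamma> unfolding abs_less_iff by auto
  qed
  moreover have "rh \<noteq> 0"
  proof
    assume "rh = 0"
    then show False using Fh' cl init[of xh] \<gamma> unfolding abs_less_iff by auto
  qed
  ultimately have pos: "rh > 0" "th > 0" using rt by auto
  have g': "(g has_real_derivative \<Lambda> * g t) (at t)" "((\<lambda>t. \<Lambda> * g t) has_real_derivative \<Lambda> * (\<Lambda> * g t)) (at t)" for t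
    unfolding g_def by (auto intro!: derivative_eq_intros)
  have "\<Lambda> * g th \<le> 0"
  proof (rule interior_min[OF solutionD(4,3)[OF U] solutionD(4,3)[OF W] solutionD(4,3)[OF v0] pos g', of "min (min rh th) (1/4)" xh k])
    show "continuous_on UNIV (\<lambda>t. \<Lambda> * (\<Lambda> * g t))" unfolding g_def by (intro continuous_intros)
    fix x r t assume "\<bar>r - rh\<bar> < min (min rh th) (1 / 4)" "\<bar>t - th\<bar> < min (min rh th) (1 / 4)"
    then have "r \<in> {0..T}" "t \<in> {0..T}" using th close d(4) unfolding abs_less_iff T_def by auto
    from mx[OF this, of x]
    show "W x t - U x r - (g t + k * (t - r)\<^sup>2) \<le> W xh th - U xh rh - (g th + k * (th - rh)\<^sup>2)" by (simp add: F_def)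
  qed (use pos in auto)
  moreover have "\<Lambda> > 0" using G \<gamma> by (simp add: \<Lambda>_def)
  ultimately show False using g0[of th] by (simp add: mult_le_0_iff)
qed

lemma contraction:
  assumes U: "solution U" and W: "solution W" and s: "s \<ge> 0" and init: "\<And>x. \<bar>W x s - U x s\<bar> \<le> M" and t: "t \<ge> s"
  shows "\<bar>W x t - U x t\<bar> \<le> M"
proof -
  note S = solution_shift[OF U s, of 0] solution_shift[OF W s, of 0]
  have "W x (t - s + s) + 0 \<le> U x (t - s + s) + 0 + M"
    by (rule comparison[OF S(1) S(2)]) (use init t in \<open>auto simp: abs_le_iff algebra_simps\<close>)
  moreover have "U x (t - s + s) + 0 \<le> W x (t - s + s) + 0 + M"
    by (rule comparison[OF S(2) S(1)]) (use init t in \<open>auto simp: abs_le_iff algebra_simps\<close>)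
  ultimately show ?thesis by (simp add: abs_le_iff)
qed

end

context bellman_erg
begin

section \<open>The limit set\<close>

lemma v0_bounded: "\<exists>B. \<forall>x. \<bar>v0 x\<bar> \<le> B"
  using solution_bounded[OF v0, of 0] by force

definition ulim :: "(nat \<Rightarrow> real^'n \<Rightarrow> real \<Rightarrow> real) \<Rightarrow> (real^'n \<Rightarrow> real \<Rightarrow> real) \<Rightarrow> bool" where
  "ulim z w \<longleftrightarrow> (\<forall>e>0. \<exists>N. \<forall>n\<ge>N. \<forall>x t. t \<ge> 0 \<longrightarrow> \<bar>z n x t - w x t\<bar> \<le> e)"

lemma ulim_tendsto:
  assumes "ulim z w" "t \<ge> 0"
  shows "(\<lambda>n. z n x t) \<longlonglongrightarrow> w x t"
proof (rule LIMSEQ_I)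
  fix e :: real assume "e > 0"
  then obtain N where "\<forall>n\<ge>N. \<forall>x t. t \<ge> 0 \<longrightarrow> \<bar>z n x t - w x t\<bar> \<le> e / 2" using assms(1) unfolding ulim_def by (meson half_gt_zero)
  then have "norm (z n x t - w x t) < e" if "n \<ge> N" for n
    using \<open>e > 0\<close> assms(2) that by (auto intro: le_less_trans[of _ "e / 2"])
  then show "\<exists>no. \<forall>n\<ge>no. norm (z n x t - w x t) < e" by blast
qed

text \<open>Arzela-Ascoli is applied at time \<open>0\<close> only. By \<open>contraction\<close>, a
  sequence that is uniformly Cauchy there is so at all later times, and the limit is uniform in
  \<open>t \<ge> 0\<close>.\<close>

lemma solution_compact:
  assumes z: "\<And>n. solution (z n)" and bd: "\<And>n x. \<bar>z n x 0\<bar> \<le> B"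
  shows "\<exists>r w. strict_mono (r :: nat \<Rightarrow> nat) \<and> solution w \<and> ulim (\<lambda>n. z (r n)) w"
proof -
  have "\<exists>g k. strict_mono (k :: nat \<Rightarrow> nat) \<and> (\<forall>e>0. \<exists>N. \<forall>n x. n \<ge> N \<and> x \<in> cbox 0 1 \<longrightarrow> norm (z (k n) x 0 - g x) < e)"
  proof (rule Arzela_Ascoli[of "cbox (0 :: real^'n) 1" "\<lambda>n x. z n x 0" B])
    fix x :: "real^'n" and e :: real assume e: "0 < e"
    show "\<exists>d>0. \<forall>n y. y \<in> cbox 0 1 \<and> norm (x - y) < d \<longrightarrow> norm (z n x 0 - z n y 0) < e"
    proof (intro exI conjI allI impI)
      show "e / L > 0" using e L0 by simp
      fix n y assume "y \<in> cbox 0 1 \<and> norm (x - y) < e / L"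
      then have "L * dist x y < e" using L0 by (simp add: dist_norm pos_less_divide_eq mult.commute)
      moreover have "\<bar>z n x 0 - z n y 0\<bar> \<le> L * dist x y" using solutionD(3)[OF z] by (simp add: lip_t_def)
      ultimately show "norm (z n x 0 - z n y 0) < e" by simp
    qed
  qed (use bd in auto)
  then obtain g k where k: "strict_mono (k :: nat \<Rightarrow> nat)"
    and g: "\<And>e. e > 0 \<Longrightarrow> \<exists>N. \<forall>n x. n \<ge> N \<and> x \<in> cbox 0 1 \<longrightarrow> norm (z (k n) x 0 - g x) < e" by blast
  have cau: "\<exists>N. \<forall>m\<ge>N. \<forall>n\<ge>N. \<forall>x t. t \<ge> 0 \<longrightarrow> \<bar>z (k m) x t - z (k n) x t\<bar> \<le> e" if e: "e > 0" for e
  proof -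
    obtain N where N: "\<And>n x. n \<ge> N \<Longrightarrow> x \<in> cbox 0 1 \<Longrightarrow> \<bar>z (k n) x 0 - g x\<bar> < e / 2" using g[of "e / 2"] e by auto
    have "\<bar>z (k m) x t - z (k n) x t\<bar> \<le> e" if mn: "m \<ge> N" "n \<ge> N" and t: "t \<ge> 0" for m n x t
    proof (rule contraction[OF z z order_refl _ t])
      fix x
      have "\<exists>y\<in>cbox 0 1. (z (k m) x 0, z (k n) x 0) = (z (k m) y 0, z (k n) y 0)"
        by (rule periodic_cube[OF periodic_pair[OF solutionD(2)[OF z] solutionD(2)[OF z]]]) auto
      then obtain y where y: "y \<in> cbox 0 1" "z (k m) x 0 = z (k m) y 0" "z (k n) x 0 = z (k n) y 0" by blast
      show "\<bar>z (k m) x 0 - z (k n) x 0\<bar> \<le> e" using N[OF mn(1) y(1)] N[OF mn(2) y(1)] unfolding y(2,3) by argo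
    qed
    then show ?thesis by blast
  qed
  define w where "w x t = lim (\<lambda>n. z (k n) x t)" for x t
  have "Cauchy (\<lambda>n. z (k n) x t)" if t: "t \<ge> 0" for x t
    unfolding Cauchy_iff
  proof (intro allI impI)
    fix e :: real assume e: "e > 0"
    then obtain N where "\<forall>m\<ge>N. \<forall>n\<ge>N. \<forall>x t. t \<ge> 0 \<longrightarrow> \<bar>z (k m) x t - z (k n) x t\<bar> \<le> e / 2" using cau[of "e / 2"] by auto
    then have "norm (z (k m) x t - z (k n) x t) < e" if "m \<ge> N" "n \<ge> N" for m n
      using t e that by (auto intro: le_less_trans[of _ "e / 2"])
    then show "\<exists>M. \<forall>m\<ge>M. \<forall>n\<ge>M. norm (z (k m) x t - z (k n) x t) < e" by blast
  qed
  then have lim: "(\<lambda>n. z (k n) x t) \<longlonglongrightarrow> w x t" if "t \<ge> 0" for x t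
    using that by (simp add: w_def Cauchy_convergent_iff convergent_LIMSEQ_iff)
  have U: "ulim (\<lambda>n. z (k n)) w"
    unfolding ulim_def
  proof (intro allI impI)
    fix e :: real assume e: "e > 0"
    then obtain N where N: "\<And>m n x t. m \<ge> N \<Longrightarrow> n \<ge> N \<Longrightarrow> t \<ge> 0 \<Longrightarrow> \<bar>z (k m) x t - z (k n) x t\<bar> \<le> e" using cau[of e] by blast
    have "\<bar>z (k m) x t - w x t\<bar> \<le> e" if "m \<ge> N" "t \<ge> 0" for m x t
    proof (rule LIMSEQ_le_const2)
      show "(\<lambda>n. \<bar>z (k m) x t - z (k n) x t\<bar>) \<longlonglongrightarrow> \<bar>z (k m) x t - w x t\<bar>" by (intro tendsto_intros lim that)
      show "\<exists>M. \<forall>n\<ge>M. \<bar>z (k m) x t - z (k n) x t\<bar> \<le> e" using N that by blast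
    qed
    then show "\<exists>N. \<forall>n\<ge>N. \<forall>x t. t \<ge> 0 \<longrightarrow> \<bar>z (k n) x t - w x t\<bar> \<le> e" by blast
  qed
  have "solution w"
  proof (rule solution_limit)
    fix e :: real assume "e > 0"
    then obtain N where "\<forall>n\<ge>N. \<forall>x t. t \<ge> 0 \<longrightarrow> \<bar>z (k n) x t - w x t\<bar> \<le> e" using U unfolding ulim_def by blast
    then show "\<exists>f. solution f \<and> (\<forall>x t. t \<ge> 0 \<longrightarrow> \<bar>f x t - w x t\<bar> \<le> e)" using z by blast
  qed
  then show ?thesis using k U by blast
qed

text \<open>The \<open>\<omega>\<close>-limit set of \<^term>\<open>u\<close> under time translations.\<close>
definition omega :: "(real^'n \<Rightarrow> real \<Rightarrow> real) \<Rightarrow> bool" where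
  "omega w \<longleftrightarrow> (\<forall>e>0. \<forall>T. \<exists>s\<ge>T. s \<ge> 0 \<and> (\<forall>x t. t \<ge> 0 \<longrightarrow> \<bar>u x (t + s) - w x t\<bar> \<le> e))"

lemma omegaD: "omega w \<Longrightarrow> e > 0 \<Longrightarrow> \<exists>s\<ge>T. s \<ge> 0 \<and> (\<forall>x t. t \<ge> 0 \<longrightarrow> \<bar>u x (t + s) - w x t\<bar> \<le> e)"
  by (auto simp: omega_def)

lemma omega_solution:
  assumes "omega w"
  shows "solution w"
proof (rule solution_limit)
  fix e :: real assume "e > 0"
  then obtain s where s: "s \<ge> 0" "\<And>x t. t \<ge> 0 \<Longrightarrow> \<bar>u x (t + s) - w x t\<bar> \<le> e" using omegaD[OF assms, of e] by blast
  show "\<exists>z. solution z \<and> (\<forall>x t. t \<ge> 0 \<longrightarrow> \<bar>z x t - w x t\<bar> \<le> e)"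
    by (rule exI[of _ "\<lambda>x t. u x (t + s) + 0"]) (use solution_shift[OF u s(1), of 0] s(2) in auto)
qed

lemma u_bounded: "\<exists>B>0. \<forall>x t. t \<ge> 0 \<longrightarrow> \<bar>u x t - v0 x\<bar> \<le> B"
proof -
  obtain B1 B2 where B: "\<And>x. \<bar>u x 0\<bar> \<le> B1" "\<And>x. \<bar>v0 x\<bar> \<le> B2"
    using solution_bounded[OF u, of 0] v0_bounded by auto
  have "\<bar>u x t - v0 x\<bar> \<le> \<bar>B1 + B2\<bar> + 1" if "t \<ge> 0" for x t
  proof (rule contraction[OF v0 u order_refl _ that])
    show "\<bar>u x 0 - v0 x\<bar> \<le> \<bar>B1 + B2\<bar> + 1" for x using B(1)[of x] B(2)[of x] by linarith
  qed
  then show ?thesis by (intro exI[of _ "\<bar>B1 + B2\<bar> + 1"]) auto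
qed

lemma omega_bounded: "\<exists>B>0. \<forall>w x t. omega w \<longrightarrow> t \<ge> 0 \<longrightarrow> \<bar>w x t - v0 x\<bar> \<le> B"
proof -
  obtain B where B: "B > 0" "\<And>x t. t \<ge> 0 \<Longrightarrow> \<bar>u x t - v0 x\<bar> \<le> B" using u_bounded by blast
  have "\<bar>w x t - v0 x\<bar> \<le> B + 1" if w: "omega w" and t: "t \<ge> 0" for w x t
  proof -
    obtain s where s: "s \<ge> 0" "\<And>x t. t \<ge> 0 \<Longrightarrow> \<bar>u x (t + s) - w x t\<bar> \<le> 1" using omegaD[OF w, of 1 0] by auto
    show ?thesis using s(2)[OF t, of x] B(2)[of "t + s" x] s(1) t by linarith
  qed
  then show ?thesis using B(1) by (intro exI[of _ "B + 1"]) auto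
qed

lemma omega_limit:
  assumes "\<And>e. e > 0 \<Longrightarrow> \<exists>z. omega z \<and> (\<forall>x t. t \<ge> 0 \<longrightarrow> \<bar>z x t - w x t\<bar> \<le> e)"
  shows "omega w"
  unfolding omega_def
proof (intro allI impI)
  fix e T :: real assume "e > 0"
  then obtain z where z: "omega z" "\<And>x t. t \<ge> 0 \<Longrightarrow> \<bar>z x t - w x t\<bar> \<le> e / 2" using assms[of "e / 2"] by auto
  obtain s where s: "s \<ge> T" "s \<ge> 0" "\<And>x t. t \<ge> 0 \<Longrightarrow> \<bar>u x (t + s) - z x t\<bar> \<le> e / 2" using omegaD[OF z(1), of "e / 2" T] \<open>e > 0\<close> by auto
  have "\<bar>u x (t + s) - w x t\<bar> \<le> e" if "t \<ge> 0" for x t using z(2)[OF that, of x] s(3)[OF that, of x] by argo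
  then show "\<exists>s\<ge>T. s \<ge> 0 \<and> (\<forall>x t. t \<ge> 0 \<longrightarrow> \<bar>u x (t + s) - w x t\<bar> \<le> e)" using s by blast
qed

lemma omega_shift:
  assumes w: "omega w" and b: "b \<ge> 0"
  shows "omega (\<lambda>x t. w x (t + b))"
  unfolding omega_def
proof (intro allI impI)
  fix e T :: real assume "e > 0"
  then obtain s where s: "s \<ge> T" "s \<ge> 0" "\<And>x t. t \<ge> 0 \<Longrightarrow> \<bar>u x (t + s) - w x t\<bar> \<le> e" using omegaD[OF w, of e T] by auto
  have "\<bar>u x (t + (s + b)) - w x (t + b)\<bar> \<le> e" if "t \<ge> 0" for x t using s(3)[of "t + b" x] that b by (simp add: algebra_simps)
  then show "\<exists>s\<ge>T. s \<ge> 0 \<and> (\<forall>x t. t \<ge> 0 \<longrightarrow> \<bar>u x (t + s) - w x (t + b)\<bar> \<le> e)" using s b by (intro exI[of _ "s + b"]) auto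
qed

lemma translates_compact:
  assumes s: "\<And>n. s n \<ge> 0" "\<And>T::real. \<exists>N. \<forall>n\<ge>N. s n \<ge> T"
  shows "\<exists>r w. strict_mono (r :: nat \<Rightarrow> nat) \<and> omega w \<and> ulim (\<lambda>n x t. u x (t + s (r n))) w"
proof -
  obtain B where B: "\<And>x t. t \<ge> 0 \<Longrightarrow> \<bar>u x t - v0 x\<bar> \<le> B" using u_bounded by blast
  obtain B2 where B2: "\<And>x. \<bar>v0 x\<bar> \<le> B2" using v0_bounded by blast
  have "\<exists>r w. strict_mono (r :: nat \<Rightarrow> nat) \<and> solution w \<and> ulim (\<lambda>n x t. u x (t + s (r n)) + 0) w"
  proof (rule solution_compact[where z = "\<lambda>n x t. u x (t + s n) + 0"])
    show "solution (\<lambda>x t. u x (t + s n) + 0)" for n by (rule solution_shift[OF u s(1)])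
    show "\<bar>u x (0 + s n) + 0\<bar> \<le> B + B2" for n x using B[OF s(1), of x n] B2[of x] by (simp add: abs_le_iff)
  qed
  then obtain r w where r: "strict_mono (r :: nat \<Rightarrow> nat)" and w: "ulim (\<lambda>n x t. u x (t + s (r n))) w" by auto
  have "omega w"
    unfolding omega_def
  proof (intro allI impI)
    fix e T :: real assume "e > 0"
    then obtain N1 where N1: "\<forall>n\<ge>N1. \<forall>x t. t \<ge> 0 \<longrightarrow> \<bar>u x (t + s (r n)) - w x t\<bar> \<le> e" using w unfolding ulim_def by blast
    obtain N2 where N2: "\<forall>n\<ge>N2. s n \<ge> T" using s(2) by blast
    have "r (max N1 N2) \<ge> N2" using seq_suble[OF r, of "max N1 N2"] by simp
    then show "\<exists>s\<ge>T. s \<ge> 0 \<and> (\<forall>x t. t \<ge> 0 \<longrightarrow> \<bar>u x (t + s) - w x t\<bar> \<le> e)"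
      using N1 N2 s(1) by (intro exI[of _ "s (r (max N1 N2))"]) auto
  qed
  then show ?thesis using r w by blast
qed

lemma omega_nonempty: "\<exists>w. omega w"
proof -
  have "\<exists>N. \<forall>n\<ge>N. real n \<ge> T" for T by (meson of_nat_le_iff order_trans real_arch_simple)
  from translates_compact[of real, OF _ this] show ?thesis by auto
qed

text \<open>The limit set is invariant backwards in time: translate by \<open>s n - 1\<close>
  instead of \<open>s n\<close> and extract a limit. Time \<open>0\<close> of \<open>w\<close>
  becomes the interior time \<open>1\<close> of \<open>w'\<close>, where viscosity inequalities are
  available.\<close>

lemma omega_back:
  assumes w: "omega w"
  shows "\<exists>w'. omega w' \<and> (\<forall>x t. t \<ge> 0 \<longrightarrow> w' x (t + 1) = w x t)"
proof -
  have "\<forall>n. \<exists>s\<ge>real (Suc n). s \<ge> 0 \<and> (\<forall>x t. t \<ge> 0 \<longrightarrow> \<bar>u x (t + s) - w x t\<bar> \<le> inverse (real (Suc n)))"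
    using omegaD[OF w] by simp
  from choice[OF this] obtain s where s: "\<And>n. s n \<ge> real (Suc n)" "\<And>n x t. t \<ge> 0 \<Longrightarrow> \<bar>u x (t + s n) - w x t\<bar> \<le> inverse (real (Suc n))"
    by blast
  have "\<exists>N. \<forall>n\<ge>N. s n - 1 \<ge> T" for T
  proof -
    obtain N :: nat where "real N \<ge> T" using real_arch_simple by blast
    then show ?thesis using s(1) by (intro exI[of _ N] allI impI) (smt (verit) of_nat_Suc of_nat_mono)
  qed
  moreover have "s n - 1 \<ge> 0" for n using s(1)[of n] by simp
  ultimately obtain r w' where r: "strict_mono (r :: nat \<Rightarrow> nat)" and w': "omega w'" "ulim (\<lambda>n x t. u x (t + (s (r n) - 1))) w'"
    using translates_compact[of "\<lambda>n. s n - 1"] by blast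
  have "w' x (t + 1) = w x t" if t: "t \<ge> 0" for x t
  proof (rule LIMSEQ_unique)
    show "(\<lambda>n. u x (t + 1 + (s (r n) - 1))) \<longlonglongrightarrow> w' x (t + 1)" using ulim_tendsto[OF w'(2), of "t + 1" x] t by simp
    have "(\<lambda>n. u x (t + s n)) \<longlonglongrightarrow> w x t"
      by (rule LIM_zero_cancel, rule tendsto_0_le[OF LIMSEQ_inverse_real_of_nat, of _ 1], rule always_eventually)
        (use s(2)[OF t, of x] in auto)
    then have "(\<lambda>n. u x (t + s (r n))) \<longlonglongrightarrow> w x t" using LIMSEQ_subseq_LIMSEQ[OF _ r] by (auto simp: comp_def)
    then show "(\<lambda>n. u x (t + 1 + (s (r n) - 1))) \<longlonglongrightarrow> w x t" by (simp add: algebra_simps)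
  qed
  then show ?thesis using w'(1) by blast
qed

lemma omega_compact:
  assumes z: "\<And>n. omega (z n)"
  shows "\<exists>r w. strict_mono (r :: nat \<Rightarrow> nat) \<and> omega w \<and> ulim (\<lambda>n. z (r n)) w"
proof -
  obtain B where B: "\<And>w x t. omega w \<Longrightarrow> t \<ge> 0 \<Longrightarrow> \<bar>w x t - v0 x\<bar> \<le> B" using omega_bounded by blast
  obtain B2 where B2: "\<And>x. \<bar>v0 x\<bar> \<le> B2" using v0_bounded by blast
  have "\<bar>z n x 0\<bar> \<le> B + B2" for n x using B[OF z order_refl, of n x] B2[of x] unfolding abs_le_iff by linarith
  from solution_compact[of z, OF omega_solution[OF z] this]
  obtain r w where r: "strict_mono (r :: nat \<Rightarrow> nat)" and w: "ulim (\<lambda>n. z (r n)) w" by blast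
  have "omega w"
  proof (rule omega_limit)
    fix e :: real assume "e > 0"
    then obtain N where "\<forall>n\<ge>N. \<forall>x t. t \<ge> 0 \<longrightarrow> \<bar>z (r n) x t - w x t\<bar> \<le> e" using w unfolding ulim_def by blast
    then show "\<exists>f. omega f \<and> (\<forall>x t. t \<ge> 0 \<longrightarrow> \<bar>f x t - w x t\<bar> \<le> e)" using z by blast
  qed
  then show ?thesis using r w by blast
qed

end

section \<open>Strong maximum principle and convergence\<close>

lemma C2fun_gauss_exponent:
  fixes l :: "'a::euclidean_space"
  shows "C2fun (\<lambda>z. (norm (fst z - l))\<^sup>2 + a * ((fst (snd z) - r0)\<^sup>2 + (snd (snd z) - t0)\<^sup>2))
     (\<lambda>z. (2 *\<^sub>R (fst z - l), 2 * a * (fst (snd z) - r0), 2 * a * (snd (snd z) - t0)))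
     (\<lambda>z h. (2 *\<^sub>R fst h, 2 * a * fst (snd h), 2 * a * snd (snd h)))"
  unfolding C2fun_def
proof (intro conjI allI)
  fix z :: "'a \<times> real \<times> real"
  show "((\<lambda>z. (norm (fst z - l))\<^sup>2 + a * ((fst (snd z) - r0)\<^sup>2 + (snd (snd z) - t0)\<^sup>2)) has_derivative
      (\<lambda>h. (2 *\<^sub>R (fst z - l), 2 * a * (fst (snd z) - r0), 2 * a * (snd (snd z) - t0)) \<bullet> h)) (at z)"
    unfolding power2_norm_eq_inner
    by (rule has_derivative_eq_rhs, (rule derivative_eq_intros refl)+) (auto simp: fun_eq_iff inner_commute algebra_simps inner_prod_def)
  show "((\<lambda>z. (2 *\<^sub>R (fst z - l), 2 * a * (fst (snd z) - r0), 2 * a * (snd (snd z) - t0))) has_derivative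
      (\<lambda>h. (2 *\<^sub>R fst h, 2 * a * fst (snd h), 2 * a * snd (snd h)))) (at z)"
    by (rule has_derivative_eq_rhs, (rule derivative_eq_intros refl)+) (auto simp: fun_eq_iff algebra_simps)
qed auto

context bellman
begin

text \<open>The barrier is \<open>\<epsilon> * exp (- k * (|x - l|^2 + a * ((r - r0)^2 + (t - t0)^2)))\<close>. The value of \<open>a\<close> makes it small on the
  time boundary, and for the value of \<open>k\<close> the second-order term dominates outside the ball of radius \<open>\<rho>\<close> around \<open>l\<close>.\<close>

lemma strong_maximum:
  fixes l :: "real^'n"
  assumes U: "visc_sol_E \<sigma> H U" "lip_t U" and W: "visc_sol_E \<sigma> H W" "lip_t W" and V: "visc_sol_E \<sigma> H V" "lip_t V"
    and mn: "m > 0" "n > 0" "m + n = 1" and d: "\<delta> > 0" and \<tau>: "\<tau> > 0" "\<tau> < r0" "\<tau> < t0" and \<gamma>: "\<gamma>0 > 0" and \<rho>: "\<rho> > 0"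
    and J: "\<And>x r t. J x r t = U x r - m * W x t - n * V x t + \<beta> * (r - t) + c"
    and nonneg: "\<And>x r t. \<bar>r - r0\<bar> \<le> \<tau> \<Longrightarrow> \<bar>t - t0\<bar> \<le> \<tau> \<Longrightarrow> J x r t \<ge> 0"
    and near: "\<And>x r t. \<bar>r - r0\<bar> \<le> \<tau> \<Longrightarrow> \<bar>t - t0\<bar> \<le> \<tau> \<Longrightarrow> dist x l \<le> \<rho> \<Longrightarrow> J x r t \<ge> \<gamma>0"
    and off: "\<And>x r t. \<bar>r - r0\<bar> \<le> \<tau> \<Longrightarrow> \<bar>t - t0\<bar> \<le> \<tau> \<Longrightarrow> x \<notin> Sigma_compl \<sigma> \<delta> \<Longrightarrow> J x r t \<ge> \<gamma>0"
    and zero: "J x2 r0 t0 = 0"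
  shows False
proof -
  obtain \<nu> where \<nu>: "\<nu> > 0" "\<And>\<theta> x \<xi>. x \<in> Sigma_compl \<sigma> \<delta> \<Longrightarrow> \<xi> \<bullet> (diffA \<sigma> \<theta> x *v \<xi>) \<ge> \<nu> * (norm \<xi>)\<^sup>2"
    using nondeg[OF d] by blast
  define R where "R = dist x2 l"
  have R: "R > \<rho>" using near[of r0 t0 x2] zero \<tau>(1) \<gamma> unfolding R_def by force
  \<comment> \<open>A point on the time boundary at distance at least \<open>\<rho>\<close> from
    \<open>l\<close> then has \<open>Q \<ge> \<rho>\<^sup>2 + 2 * R\<^sup>2\<close>, where the
    barrier is nonpositive.\<close>
  define a where "a = 2 * R\<^sup>2 / \<tau>\<^sup>2"
  have a: "a > 0" "a * \<tau>\<^sup>2 = 2 * R\<^sup>2" using R \<rho> \<tau> by (auto simp: a_def)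
  define N where "N = real CARD('n)"
  \<comment> \<open>The summands offset the time derivatives, the first-order term and the trace of
    the part of the Hessian that is linear in \<open>k\<close>; the final \<open>1\<close> makes the
    concluding inequality strict.\<close>
  define k where "k = (2 * a * \<tau> + 2 * KH * R + N * C\<^sup>2 + 1) / (2 * \<nu> * \<rho>\<^sup>2)"
  have "2 * a * \<tau> + 2 * KH * R + N * C\<^sup>2 + 1 > 0" using a \<tau> KH(1) R \<rho> by (auto simp: N_def intro!: add_nonneg_pos)
  then have k: "k > 0" "2 * k * \<nu> * \<rho>\<^sup>2 = 2 * a * \<tau> + 2 * KH * R + N * C\<^sup>2 + 1" using \<nu> \<rho> by (auto simp: k_def)
  define Q where "Q z = (norm (fst z - l))\<^sup>2 + a * ((fst (snd z) - r0)\<^sup>2 + (snd (snd z) - t0)\<^sup>2)" for z :: "(real^'n) \<times> real \<times> real"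
  have Q0: "Q z \<ge> 0" for z using a by (simp add: Q_def)
  \<comment> \<open>The value of the exponential at
    \<open>Q = \<rho>\<^sup>2 + 2 * R\<^sup>2\<close>. At the given zero of \<open>J\<close> one has
    \<open>Q = R\<^sup>2\<close>, so the barrier is positive and \<open>F\<close> negative
    there.\<close>
  define \<kappa> where "\<kappa> = exp (- k * (\<rho>\<^sup>2 + 2 * R\<^sup>2))"
  have \<kappa>: "\<kappa> > 0" by (simp add: \<kappa>_def)
  define \<epsilon> where "\<epsilon> = \<gamma>0 / 2"
  have \<epsilon>: "\<epsilon> > 0" "\<epsilon> < \<gamma>0" using \<gamma> by (auto simp: \<epsilon>_def)
  define F where "F z = J (fst z) (fst (snd z)) (snd (snd z)) - \<epsilon> * (exp (- k * Q z) - \<kappa>)" for z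
  have far: "F (x, r, t) \<ge> 0" if "\<bar>r - r0\<bar> \<le> \<tau>" "\<bar>t - t0\<bar> \<le> \<tau>" "Q (x, r, t) \<ge> \<rho>\<^sup>2 + 2 * R\<^sup>2" for x r t
  proof -
    have "exp (- k * Q (x, r, t)) \<le> \<kappa>" unfolding \<kappa>_def using that k by simp
    then have "\<epsilon> * (exp (- k * Q (x, r, t)) - \<kappa>) \<le> 0" using \<epsilon> by (simp add: mult_le_0_iff)
    then show ?thesis using nonneg[OF that(1,2), of x] by (simp add: F_def)
  qed
  have Jbig: "F (x, r, t) \<ge> 0" if "J x r t \<ge> \<gamma>0" for x r t
  proof -
    have "exp (- k * Q (x, r, t)) \<le> 1" using k(1) Q0[of "(x, r, t)"] by simp
    then have "\<epsilon> * (exp (- k * Q (x, r, t)) - \<kappa>) \<le> \<epsilon> * 1" using \<epsilon> \<kappa> by (intro mult_left_mono; linarith)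
    then show ?thesis using that \<epsilon> unfolding F_def fst_conv snd_conv by linarith
  qed
  \<comment> \<open>The radius is large enough because
    \<open>(2 * R)\<^sup>2 > \<rho>\<^sup>2 + 2 * R\<^sup>2\<close>. Hence a minimum point with
    negative value is interior, and \<open>near\<close> and \<open>off\<close> place it outside the
    ball around \<open>l\<close> and in the nondegenerate region.\<close>
  let ?K = "cball l (2 * R) \<times> (cball r0 \<tau> \<times> cball t0 \<tau>)"
  have inK: "\<bar>r - r0\<bar> \<le> \<tau>" "\<bar>t - t0\<bar> \<le> \<tau>" "r > 0" "t > 0" if "r \<in> cball r0 \<tau>" "t \<in> cball t0 \<tau>" for r t
    using that \<tau> by (auto simp: dist_real_def abs_le_iff)
  have "\<exists>z\<in>?K. \<forall>z'\<in>?K. F z \<le> F z'"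
  proof (rule continuous_attains_inf)
    show "compact ?K" by (intro compact_Times compact_cball)
    show "continuous_on ?K F" unfolding F_def J Q_def
      by (intro continuous_intros continuous_on_compose2[OF visc_sol_E_continuous[OF U(1)], of _ "\<lambda>z. (fst z, fst (snd z))", simplified]
       continuous_on_compose2[OF visc_sol_E_continuous[OF W(1)], of _ "\<lambda>z. (fst z, snd (snd z))", simplified]
       continuous_on_compose2[OF visc_sol_E_continuous[OF V(1)], of _ "\<lambda>z. (fst z, snd (snd z))", simplified])
       (use inK in \<open>auto simp del: mem_cball\<close>)
    have "(l, r0, t0) \<in> ?K" using R \<rho> \<tau> by auto
    then show "?K \<noteq> {}" by blast
  qed
  then obtain zh where zh: "zh \<in> ?K" "\<And>z. z \<in> ?K \<Longrightarrow> F zh \<le> F z" by blast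
  obtain xh rh th where z: "zh = (xh, rh, th)" by (metis prod.collapse)
  have mem: "xh \<in> cball l (2 * R)" "rh \<in> cball r0 \<tau>" "th \<in> cball t0 \<tau>" using zh(1) z by auto
  note rt = inK[OF mem(2,3)]
  have neg: "F zh < 0"
  proof -
    have "R\<^sup>2 < \<rho>\<^sup>2 + 2 * R\<^sup>2" using R \<rho> by (auto intro: add_pos_pos)
    then have "\<kappa> < exp (- k * R\<^sup>2)" unfolding \<kappa>_def using k(1) by simp
    then have "F (x2, r0, t0) < 0" using zero \<epsilon> by (simp add: F_def Q_def R_def dist_norm)
    moreover have "F zh \<le> F (x2, r0, t0)" by (rule zh(2)) (use \<tau> R \<rho> in \<open>auto simp: R_def dist_commute\<close>)
    ultimately show ?thesis by linarith
  qed
  have nJ: "J xh rh th < \<gamma>0" using Jbig[of xh rh th] neg z by force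
  have xl: "dist xh l > \<rho>" using near[OF rt(1,2), of xh] nJ by force
  have xS: "xh \<in> Sigma_compl \<sigma> \<delta>" using off[OF rt(1,2), of xh] nJ by force
  have Qh: "Q (xh, rh, th) < \<rho>\<^sup>2 + 2 * R\<^sup>2" using far[OF rt(1,2), of xh] neg z by force
  have "\<rho>\<^sup>2 \<le> (norm (xh - l))\<^sup>2" using xl \<rho> by (simp add: dist_norm power_mono)
  then have "a * ((rh - r0)\<^sup>2 + (th - t0)\<^sup>2) < a * \<tau>\<^sup>2" using Qh a by (simp add: Q_def)
  then have "(rh - r0)\<^sup>2 + (th - t0)\<^sup>2 < \<tau>\<^sup>2" using a(1) by (simp only: mult_less_cancel_left_pos)
  then have "(rh - r0)\<^sup>2 < \<tau>\<^sup>2" "(th - t0)\<^sup>2 < \<tau>\<^sup>2" using zero_le_power2[of "rh - r0"] zero_le_power2[of "th - t0"] by linarith+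
  note sq = this
  have rt': "\<bar>rh - r0\<bar> < \<tau>" "\<bar>th - t0\<bar> < \<tau>" by (rule power2_less_imp_less; use sq \<tau>(1) in simp)+
  have "(norm (xh - l))\<^sup>2 < (2 * R)\<^sup>2"
  proof -
    have "0 \<le> a * ((rh - r0)\<^sup>2 + (th - t0)\<^sup>2)" using a by simp
    then have "(norm (xh - l))\<^sup>2 < \<rho>\<^sup>2 + 2 * R\<^sup>2" using Qh unfolding Q_def by simp
    moreover have "\<rho>\<^sup>2 \<le> R\<^sup>2" "R\<^sup>2 > 0" using R \<rho> by (auto intro: power_mono)
    moreover have "(2 * R)\<^sup>2 = 4 * R\<^sup>2" by (simp add: power_mult_distrib)
    ultimately show ?thesis by linarith
  qed
  then have xl2: "norm (xh - l) < 2 * R" by (rule power2_less_imp_less) (use R \<rho> in simp)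
  define E where "E = \<epsilon> * exp (- k * Q zh)"
  have E: "E > 0" using \<epsilon> by (simp add: E_def)
  \<comment> \<open>The direction of \<open>r - t\<close>: the term \<open>\<beta> * (r - t)\<close>
    of \<open>J\<close> goes into the test function, where its contributions to the two time
    derivatives cancel.\<close>
  define e2 where "e2 = (0 :: real^'n, 1 :: real, - 1 :: real)"
  have m1: "((\<lambda>s. \<epsilon> * exp (- k * s)) has_real_derivative - k * (\<epsilon> * exp (- k * s))) (at s)"
    "((\<lambda>s. - k * (\<epsilon> * exp (- k * s))) has_real_derivative k\<^sup>2 * (\<epsilon> * exp (- k * s))) (at s)" for s
    by (rule DERIV_cong, (rule derivative_eq_intros refl)+, simp add: power2_eq_square)+
  have "continuous_on UNIV (\<lambda>s. k\<^sup>2 * (\<epsilon> * exp (- k * s)))" by (intro continuous_intros)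
  note c1 = C2fun_compose[OF C2fun_gauss_exponent[of l a r0 t0, folded Q_def] m1 this]
  have "((\<lambda>t. - \<beta> * t) has_real_derivative - \<beta>) (at t)" "((\<lambda>t. - \<beta>) has_real_derivative 0) (at t)" for t
    by (auto intro!: derivative_eq_intros)
  from C2fun_1d[OF this continuous_on_const, of e2]
  have c2: "C2fun (\<lambda>z. - \<beta> * (z \<bullet> e2)) (\<lambda>z. - \<beta> *\<^sub>R e2) (\<lambda>z h. 0)" by simp
  define Q' where "Q' = (\<lambda>z::(real^'n) \<times> real \<times> real. (2 *\<^sub>R (fst z - l), 2 * a * (fst (snd z) - r0), 2 * a * (snd (snd z) - t0)))"
  define \<phi>' \<phi>'' where "\<phi>' = (\<lambda>z. (- k * (\<epsilon> * exp (- k * Q z))) *\<^sub>R Q' z + - \<beta> *\<^sub>R e2)"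
    and "\<phi>'' = (\<lambda>z h. (k\<^sup>2 * (\<epsilon> * exp (- k * Q z)) * (Q' z \<bullet> h)) *\<^sub>R Q' z
      + (- k * (\<epsilon> * exp (- k * Q z))) *\<^sub>R (2 *\<^sub>R fst h, 2 * a * fst (snd h), 2 * a * snd (snd h)) + 0)"
  have \<phi>: "C2fun (\<lambda>z. \<epsilon> * exp (- k * Q z) + - \<beta> * (z \<bullet> e2)) \<phi>' \<phi>''"
    unfolding \<phi>'_def \<phi>''_def Q'_def by (rule C2fun_add[OF c1 c2])
  define \<eta> where "\<eta> = min (\<tau> - \<bar>rh - r0\<bar>) (min (\<tau> - \<bar>th - t0\<bar>) (2 * R - norm (xh - l)))"
  have \<eta>: "\<eta> > 0" "\<eta> \<le> \<tau> - \<bar>rh - r0\<bar>" "\<eta> \<le> \<tau> - \<bar>th - t0\<bar>" "\<eta> \<le> 2 * R - norm (xh - l)"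
    using rt' xl2 by (auto simp: \<eta>_def)
  have "\<exists>\<theta>. fst (snd (\<phi>' (xh, rh, th))) + snd (snd (\<phi>' (xh, rh, th))) + KH * norm (fst (\<phi>' (xh, rh, th)))
     - tr2 (sg \<theta> (xh, rh, th)) \<phi>'' (xh, rh, th) \<ge> - (k * E)"
  proof (rule diff_off_Sigma[OF U W V mn d xS rt(3,4) \<phi> \<eta>(1)])
    fix x r t assume b: "dist (x, r, t) (xh, rh, th) < \<eta>"
    have b1: "dist x xh < \<eta>" using dist_fst_le[of "(x, r, t)" "(xh, rh, th)"] b by simp
    have b2: "\<bar>r - rh\<bar> < \<eta>" "\<bar>t - th\<bar> < \<eta>" using dist_snd_le[of "(x, r, t)" "(xh, rh, th)"]
          dist_snd_le[of "(r, t)" "(rh, th)"] dist_fst_le[of "(r, t)" "(rh, th)"] b by (auto simp: dist_real_def)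
    have "dist l x \<le> 2 * R" using b1 \<eta>(4) dist_triangle[of l x xh] by (simp add: dist_norm norm_minus_commute)
    moreover have "\<bar>r0 - r\<bar> \<le> \<tau>" "\<bar>t0 - t\<bar> \<le> \<tau>" using b2 \<eta>(2,3) by argo+
    ultimately have "F zh \<le> F (x, r, t)" by (intro zh(2)) (auto simp: dist_real_def)
    then show "- U x r + m * W x t + n * V x t + (\<epsilon> * exp (- k * Q (x, r, t)) + - \<beta> * ((x, r, t) \<bullet> e2))
      \<le> - U xh rh + m * W xh th + n * V xh th + (\<epsilon> * exp (- k * Q (xh, rh, th)) + - \<beta> * ((xh, rh, th) \<bullet> e2))"
      by (simp add: F_def J z e2_def algebra_simps)
  qed (use k E in simp)
  then obtain \<theta> where \<theta>: "fst (snd (\<phi>' zh)) + snd (snd (\<phi>' zh)) + KH * norm (fst (\<phi>' zh)) - tr2 (sg \<theta> zh) \<phi>'' zh \<ge> - (k * E)"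
    unfolding z by blast
  have t1: "fst (snd (\<phi>' zh)) + snd (snd (\<phi>' zh)) = k * E * (2 * a * ((r0 - rh) + (t0 - th)))"
    unfolding \<phi>'_def E_def[symmetric] by (simp add: Q'_def e2_def z algebra_simps)
  have "2 * a * ((r0 - rh) + (t0 - th)) \<le> 2 * a * (2 * \<tau>)" using rt' a by (intro mult_left_mono) (auto simp: abs_less_iff)
  then have t1': "fst (snd (\<phi>' zh)) + snd (snd (\<phi>' zh)) \<le> k * E * (4 * a * \<tau>)"
    unfolding t1 using k E by (intro mult_left_mono) auto
  have f: "fst (\<phi>' zh) = (- (2 * k * E)) *\<^sub>R (xh - l)"
    unfolding \<phi>'_def E_def[symmetric] by (simp add: Q'_def e2_def z)
  have "KH * norm (fst (\<phi>' zh)) = k * E * (2 * KH * norm (xh - l))" unfolding f using k E by (simp add: abs_mult)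
  also have "\<dots> \<le> k * E * (2 * KH * (2 * R))" using k E KH(1) xl2 by (intro mult_left_mono) auto
  finally have t2: "KH * norm (fst (\<phi>' zh)) \<le> k * E * (4 * KH * R)" by simp
  let ?c = "\<lambda>j. column j (\<sigma> \<theta> xh)"
  have sgz: "sg \<theta> zh j = (?c j, 0)" for j by (simp add: sg_def z)
  have "tr2 (sg \<theta> zh) \<phi>'' zh = (\<Sum>j\<in>UNIV. k * E * (4 * k * ((xh - l) \<bullet> ?c j)\<^sup>2 - 2 * (norm (?c j))\<^sup>2))"
    unfolding tr2_def
  proof (rule sum.cong)
    fix j
    have "\<phi>'' zh (sg \<theta> zh j) = (k\<^sup>2 * E * (2 * ((xh - l) \<bullet> ?c j))) *\<^sub>R Q' zh - (k * E) *\<^sub>R (2 *\<^sub>R ?c j, 0, 0)"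
      unfolding \<phi>''_def E_def[symmetric] sgz by (simp add: Q'_def z)
    then have "sg \<theta> zh j \<bullet> \<phi>'' zh (sg \<theta> zh j) = (k\<^sup>2 * E * (2 * ((xh - l) \<bullet> ?c j))) * (2 * (?c j \<bullet> (xh - l))) - k * E * (2 * (?c j \<bullet> ?c j))"
      unfolding sgz by (simp add: Q'_def z inner_diff_right)
    also have "\<dots> = (k\<^sup>2 * E * (2 * ((xh - l) \<bullet> ?c j))) * (2 * ((xh - l) \<bullet> ?c j)) - k * E * (2 * (norm (?c j))\<^sup>2)"
      unfolding inner_commute[of "?c j" "xh - l"] power2_norm_eq_inner ..
    also have "\<dots> = k * E * (4 * k * ((xh - l) \<bullet> ?c j)\<^sup>2 - 2 * (norm (?c j))\<^sup>2)"
      unfolding power2_eq_square[of k] power2_eq_square[of "(xh - l) \<bullet> ?c j"] right_diff_distrib[of "k * E"] by simp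
    finally show "sg \<theta> zh j \<bullet> \<phi>'' zh (sg \<theta> zh j) = k * E * (4 * k * ((xh - l) \<bullet> ?c j)\<^sup>2 - 2 * (norm (?c j))\<^sup>2)" .
  qed simp
  also have "\<dots> = k * E * (4 * k * (\<Sum>j\<in>UNIV. ((xh - l) \<bullet> ?c j)\<^sup>2) - 2 * (\<Sum>j\<in>UNIV. (norm (?c j))\<^sup>2))"
    by (simp add: sum_distrib_left[symmetric] sum_subtractf)
  finally have tr: "tr2 (sg \<theta> zh) \<phi>'' zh = k * E * (4 * k * (\<Sum>j\<in>UNIV. ((xh - l) \<bullet> ?c j)\<^sup>2) - 2 * (\<Sum>j\<in>UNIV. (norm (?c j))\<^sup>2))" .
  have s1: "(\<Sum>j\<in>UNIV. ((xh - l) \<bullet> ?c j)\<^sup>2) \<ge> \<nu> * \<rho>\<^sup>2"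
  proof -
    have "(\<Sum>j\<in>UNIV. ((xh - l) \<bullet> ?c j)\<^sup>2) = (norm (transpose (\<sigma> \<theta> xh) *v (xh - l)))\<^sup>2"
    proof -
      have "(transpose (\<sigma> \<theta> xh) *v (xh - l)) $ j = (xh - l) \<bullet> ?c j" for j
        by (simp add: inner_vec_def column_def matrix_vector_mult_def transpose_def mult.commute)
      then show ?thesis unfolding power2_norm_eq_inner inner_vec_def[of "transpose (\<sigma> \<theta> xh) *v (xh - l)"]
        by (simp add: power2_eq_square)
    qed
    also have "\<dots> \<ge> \<nu> * (norm (xh - l))\<^sup>2" using \<nu>(2)[OF xS, of "xh - l" \<theta>] by (simp add: diffA_quadratic)
    moreover have "\<nu> * (norm (xh - l))\<^sup>2 \<ge> \<nu> * \<rho>\<^sup>2" using xl \<rho> \<nu>(1) by (intro mult_left_mono power_mono) (auto simp: dist_norm)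
    ultimately show ?thesis by linarith
  qed
  have "(\<Sum>j\<in>UNIV. (norm (?c j))\<^sup>2) \<le> (\<Sum>j\<in>(UNIV::'n set). C\<^sup>2)"
    by (intro sum_mono power_mono order_trans[OF norm_column_le sig_bd]) auto
  then have s2: "(\<Sum>j\<in>UNIV. (norm (?c j))\<^sup>2) \<le> N * C\<^sup>2" by (simp add: N_def)
  have "4 * k * (\<nu> * \<rho>\<^sup>2) \<le> 4 * k * (\<Sum>j\<in>UNIV. ((xh - l) \<bullet> ?c j)\<^sup>2)" using s1 k by (intro mult_left_mono) auto
  then have "k * E * (4 * k * (\<nu> * \<rho>\<^sup>2) - 2 * (N * C\<^sup>2)) \<le> tr2 (sg \<theta> zh) \<phi>'' zh"
    unfolding tr using s2 by (intro mult_left_mono) (linarith, use k E in simp)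
  then have "- (k * E) \<le> k * E * (4 * a * \<tau> + 4 * KH * R - (4 * k * (\<nu> * \<rho>\<^sup>2) - 2 * (N * C\<^sup>2)))"
    using \<theta> t1' t2 unfolding right_diff_distrib[of "k * E"] distrib_left[of "k * E"] by linarith
  also have "4 * a * \<tau> + 4 * KH * R - (4 * k * (\<nu> * \<rho>\<^sup>2) - 2 * (N * C\<^sup>2)) = - 2" using k(2) by (simp add: algebra_simps)
  finally show False using k E by (simp add: mult_less_0_iff zero_less_mult_iff)
qed

end

context bellman
begin

lemma closed_Sigma: "closed (Sigma_set \<sigma>)"
  unfolding closed_def
proof (subst open_subopen, intro ballI)
  fix x assume "x \<in> - Sigma_set \<sigma>"
  then obtain d where d: "d > 0" "x \<in> Sigma_compl \<sigma> d" using not_Sigma_compl by auto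
  from openE[OF open_Sigma_compl this(2)] obtain e where e: "e > 0" "ball x e \<subseteq> Sigma_compl \<sigma> d" .
  have "Sigma_compl \<sigma> d \<subseteq> - Sigma_set \<sigma>" using d(1) by (auto simp: Sigma_compl_def)
  then show "\<exists>T. open T \<and> x \<in> T \<and> T \<subseteq> - Sigma_set \<sigma>" using e by (intro exI[of _ "ball x e"]) auto
qed

lemma infdist_Sigma_periodic: "periodic (\<lambda>x. infdist x (Sigma_set \<sigma>))"
  unfolding periodic_def
proof (intro allI impI)
  have le: "infdist (x + k) (Sigma_set \<sigma>) \<le> infdist x (Sigma_set \<sigma>)" if k: "\<forall>i. k $ i \<in> \<int>" for x k :: "real^'n"
  proof (cases "Sigma_set \<sigma> = {}")
    case False
    have "infdist (x + k) (Sigma_set \<sigma>) \<le> dist x y" if y: "y \<in> Sigma_set \<sigma>" for y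
    proof -
      have "y + k \<in> Sigma_set \<sigma>" using y sig_per k by (simp add: Sigma_set_def diffA_def periodic_def)
      from infdist_le[OF this, of "x + k"] show ?thesis by simp
    qed
    then show ?thesis unfolding infdist_notempty[OF False, of x] using False by (intro cINF_greatest)
  qed (simp add: infdist_def)
  fix x k :: "real^'n" assume k: "\<forall>i. k $ i \<in> \<int>"
  then have "\<forall>i. (- k) $ i \<in> \<int>" by simp
  from le[OF this, of "x + k"] le[OF k, of x]
  show "infdist (x + k) (Sigma_set \<sigma>) = infdist x (Sigma_set \<sigma>)" by simp
qed

end

context bellman_erg
begin

section \<open>Minimising \<open>JJ\<close> over the limit set, and monotonicity in time\<close>

lemma ulim_joint:
  assumes z: "ulim z w" and w: "solution w" and x: "x \<longlonglongrightarrow> x0" and s: "s \<longlonglongrightarrow> s0" "\<And>n. s n \<ge> 0"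
  shows "(\<lambda>n. z n (x n) (s n)) \<longlonglongrightarrow> w x0 s0"
proof -
  have s0: "s0 \<ge> 0" by (rule LIMSEQ_le_const[OF s(1)]) (use s(2) in auto)
  have "(\<lambda>n. (x n, s n)) \<longlonglongrightarrow> (x0, s0)" by (intro tendsto_Pair x s)
  from continuous_on_tendsto_compose[OF solutionD(1)[OF w] this]
  have 1: "(\<lambda>n. w (x n) (s n)) \<longlonglongrightarrow> w x0 s0" using s(2) s0 by simp
  have "(\<lambda>n. z n (x n) (s n) - w (x n) (s n)) \<longlonglongrightarrow> 0"
  proof (rule LIMSEQ_I)
    fix e :: real assume "e > 0"
    then obtain N where N: "\<forall>n\<ge>N. \<forall>x t. t \<ge> 0 \<longrightarrow> \<bar>z n x t - w x t\<bar> \<le> e / 2" using z unfolding ulim_def by (meson half_gt_zero)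
    have "norm (z n (x n) (s n) - w (x n) (s n) - 0) < e" if "n \<ge> N" for n
      using \<open>e > 0\<close> s(2) that N by (auto intro: le_less_trans[of _ "e / 2"])
    then show "\<exists>no. \<forall>n\<ge>no. norm (z n (x n) (s n) - w (x n) (s n) - 0) < e" by blast
  qed
  from tendsto_add[OF this 1] show ?thesis by simp
qed

text \<open>\<open>J\<close> for the stationary solution \<open>v = v0 - K\<close>.\<close>

definition JJ :: "real \<Rightarrow> real \<Rightarrow> real \<Rightarrow> (real^'n \<Rightarrow> real \<Rightarrow> real) \<Rightarrow> real^'n \<Rightarrow> real \<Rightarrow> real" where
  "JJ K \<eta> \<mu> w x s = w x s - (v0 x - K) + \<eta> * s - \<mu> * (w x 0 - (v0 x - K))"

text \<open>The term \<open>\<eta> * s\<close> outgrows the bounded rest, so minimising sequences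
  have bounded times; periodicity brings the points into the unit cube, and the limit set is
  compact. The function \<open>\<zeta>\<close> allows a second minimisation that weighs in the
  distance to \<open>\<Sigma>\<close>.\<close>

lemma JJ_attained:
  assumes \<eta>: "\<eta> > 0" and \<zeta>: "continuous_on UNIV \<zeta>" "periodic \<zeta>"
  shows "\<exists>w x s. omega w \<and> s \<ge> 0 \<and> (\<forall>w' x' s'. omega w' \<longrightarrow> s' \<ge> 0 \<longrightarrow> JJ K \<eta> \<mu> w x s - \<zeta> x \<le> JJ K \<eta> \<mu> w' x' s' - \<zeta> x')"
proof -
  obtain B where B: "B > 0" "\<And>w x t. omega w \<Longrightarrow> t \<ge> 0 \<Longrightarrow> \<bar>w x t - v0 x\<bar> \<le> B" using omega_bounded by blast
  have "compact (\<zeta> ` cbox 0 1)" by (intro compact_continuous_image continuous_on_subset[OF \<zeta>(1)]) auto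
  from compact_imp_bounded[OF this] obtain Z where Z0: "\<forall>x\<in>cbox 0 1. \<bar>\<zeta> x\<bar> \<le> Z" unfolding bounded_iff by auto
  have Z: "\<bar>\<zeta> x\<bar> \<le> Z" for x using periodic_cube[OF \<zeta>(2), of x] Z0 by auto
  define F where "F w x s = JJ K \<eta> \<mu> w x s - \<zeta> x" for w x s
  define D where "D = B + \<bar>K\<bar> + \<bar>\<mu>\<bar> * (B + \<bar>K\<bar>) + Z"
  have low: "F w x s \<ge> \<eta> * s - D" if w: "omega w" and s: "s \<ge> 0" for w x s
  proof -
    have "\<bar>\<mu> * (w x 0 - v0 x + K)\<bar> \<le> \<bar>\<mu>\<bar> * (B + \<bar>K\<bar>)"
      unfolding abs_mult using B(2)[OF w order_refl, of x] by (intro mult_left_mono) auto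
    then have "\<mu> * (w x 0 - (v0 x - K)) \<le> \<bar>\<mu>\<bar> * (B + \<bar>K\<bar>)" by (simp add: abs_le_iff algebra_simps)
    then show ?thesis using B(2)[OF w s, of x] Z[of x] unfolding F_def JJ_def D_def abs_le_iff by linarith
  qed
  define S where "S = {F w x s | w x s. omega w \<and> s \<ge> 0}"
  have S: "S \<noteq> {}" "bdd_below S"
  proof -
    show "S \<noteq> {}" using omega_nonempty unfolding S_def by blast
    have "f \<ge> - D" if f: "f \<in> S" for f
    proof -
      obtain w x s where "f = F w x s" "omega w" "s \<ge> 0" using f unfolding S_def by blast
      then show ?thesis using low[of w s x] mult_nonneg_nonneg[of \<eta> s] \<eta> by linarith
    qed
    then show "bdd_below S" by (rule bdd_belowI)
  qed
  have red: "\<exists>y\<in>cbox 0 1. F w x s = F w y s" if w: "omega w" and s: "s \<ge> 0" for w x s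
  proof -
    have "periodic (\<lambda>x. F w x s)"
      using solutionD(2)[OF omega_solution[OF w] s] solutionD(2)[OF omega_solution[OF w] order_refl] solutionD(2)[OF v0 order_refl] \<zeta>(2)
      by (simp add: periodic_def F_def JJ_def)
    from periodic_cube[OF this] show ?thesis .
  qed
  have "\<exists>w x s. omega w \<and> s \<ge> 0 \<and> x \<in> cbox 0 1 \<and> F w x s < Inf S + inverse (real (Suc n))" for n
  proof -
    have "Inf S < Inf S + inverse (real (Suc n))" by simp
    then obtain f where "f \<in> S" "f < Inf S + inverse (real (Suc n))" using cInf_less_iff[OF S] by blast
    then obtain w x s where 1: "omega w" "s \<ge> 0" "F w x s < Inf S + inverse (real (Suc n))" unfolding S_def by blast
    obtain y where "y \<in> cbox 0 1" "F w x s = F w y s" using red[OF 1(1,2)] by blast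
    then show ?thesis using 1 by auto
  qed
  then have "\<forall>n. \<exists>p. omega (fst p) \<and> snd (snd p) \<ge> 0 \<and> fst (snd p) \<in> cbox 0 1 \<and> F (fst p) (fst (snd p)) (snd (snd p)) < Inf S + inverse (real (Suc n))"
    by simp
  from choice[OF this] obtain p where p: "\<And>n. omega (fst (p n))" "\<And>n. snd (snd (p n)) \<ge> 0" "\<And>n. fst (snd (p n)) \<in> cbox 0 1"
    "\<And>n. F (fst (p n)) (fst (snd (p n))) (snd (snd (p n))) < Inf S + inverse (real (Suc n))" by blast
  define s1 where "s1 = (Inf S + 1 + D) / \<eta>"
  have ps: "snd (snd (p n)) \<le> s1" for n
  proof -
    have "inverse (real (Suc n)) \<le> 1" by (simp add: inverse_le_1_iff)
    then have "\<eta> * snd (snd (p n)) \<le> Inf S + 1 + D" using low[OF p(1)[of n] p(2)[of n], of "fst (snd (p n))"] p(4)[of n] by linarith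
    then show ?thesis using \<eta> by (simp add: s1_def pos_le_divide_eq mult.commute)
  qed
  obtain r1 w where r1: "strict_mono (r1 :: nat \<Rightarrow> nat)" and w: "omega w" "ulim (\<lambda>n. fst (p (r1 n))) w"
    using omega_compact[of "\<lambda>n. fst (p n)", OF p(1)] by blast
  have "compact (cbox (0::real^'n) 1 \<times> {0..s1})" by (intro compact_Times) auto
  then have "seq_compact (cbox (0::real^'n) 1 \<times> {0..s1})" by (simp add: compact_eq_seq_compact_metric)
  from this[unfolded seq_compact_def, rule_format, of "\<lambda>n. snd (p (r1 n))"] p ps
  have "\<exists>l\<in>cbox 0 1 \<times> {0..s1}. \<exists>r. strict_mono (r :: nat \<Rightarrow> nat) \<and> ((\<lambda>n. snd (p (r1 n))) \<circ> r) \<longlonglongrightarrow> l"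
    by (simp add: mem_Times_iff)
  then obtain l r2 where r2: "strict_mono (r2 :: nat \<Rightarrow> nat)" and l: "((\<lambda>n. snd (p (r1 n))) \<circ> r2) \<longlonglongrightarrow> l"
    by blast
  let ?q = "\<lambda>n. p (r1 (r2 n))"
  have q: "ulim (\<lambda>n. fst (?q n)) w"
    using w(2) seq_suble[OF r2] unfolding ulim_def by (meson order_trans)
  have lx: "(\<lambda>n. fst (snd (?q n))) \<longlonglongrightarrow> fst l" "(\<lambda>n. snd (snd (?q n))) \<longlonglongrightarrow> snd l"
    using tendsto_fst[OF l] tendsto_snd[OF l] by (simp_all add: comp_def)
  have l0: "snd l \<ge> 0" by (rule LIMSEQ_le_const[OF lx(2)]) (use p(2) in auto)
  note ws = omega_solution[OF w(1)]
  have "(\<lambda>n. \<zeta> (fst (snd (?q n)))) \<longlonglongrightarrow> \<zeta> (fst l)" "(\<lambda>n. v0 (fst (snd (?q n)))) \<longlonglongrightarrow> v0 (fst l)"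
  proof -
    show "(\<lambda>n. \<zeta> (fst (snd (?q n)))) \<longlonglongrightarrow> \<zeta> (fst l)"
      using continuous_on_tendsto_compose[OF \<zeta>(1) lx(1)] by simp
    have "ulim (\<lambda>n x t. v0 x) (\<lambda>x t. v0 x)" by (auto simp: ulim_def)
    from ulim_joint[OF this v0 lx(1) tendsto_const[of 0]] show "(\<lambda>n. v0 (fst (snd (?q n)))) \<longlonglongrightarrow> v0 (fst l)" by simp
  qed
  moreover have "(\<lambda>n. fst (?q n) (fst (snd (?q n))) (snd (snd (?q n)))) \<longlonglongrightarrow> w (fst l) (snd l)"
    by (rule ulim_joint[OF q ws lx p(2)])
  moreover have "(\<lambda>n. fst (?q n) (fst (snd (?q n))) 0) \<longlonglongrightarrow> w (fst l) 0"
    by (rule ulim_joint[OF q ws lx(1) tendsto_const]) simp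
  ultimately have "(\<lambda>n. F (fst (?q n)) (fst (snd (?q n))) (snd (snd (?q n)))) \<longlonglongrightarrow> F w (fst l) (snd l)"
    unfolding F_def JJ_def using lx(2) by (intro tendsto_add tendsto_diff tendsto_mult tendsto_const)
  moreover have "(\<lambda>n. Inf S + inverse (real (Suc (r1 (r2 n))))) \<longlonglongrightarrow> Inf S + 0"
    using LIMSEQ_subseq_LIMSEQ[OF LIMSEQ_inverse_real_of_nat strict_mono_o[OF r1 r2]]
    by (intro tendsto_add tendsto_const) (simp add: comp_def)
  ultimately have "F w (fst l) (snd l) \<le> Inf S + 0"
    by (rule LIMSEQ_le) (use p(4) less_imp_le in blast)
  then have "F w (fst l) (snd l) \<le> F w' x' s'" if "omega w'" "s' \<ge> 0" for w' x' s'
    using cInf_lower[OF _ S(2), of "F w' x' s'"] that by (auto simp: S_def intro: order_trans)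
  then show ?thesis unfolding F_def using w(1) l0 by blast
qed

text \<open>By comparison \<open>S t\<close>, the supremum of \<open>u - v0\<close> at time
  \<open>t\<close>, is nonincreasing; let \<open>M\<close> be its infimum. Every \<open>w\<close>
  then satisfies \<open>w \<le> v0 + M\<close>, with equality somewhere at each time, and the strong
  maximum principle spreads the equality.\<close>

lemma omega_const:
  assumes Sig: "Sigma_set \<sigma> = {}"
  shows "\<exists>M. \<forall>w x t. omega w \<longrightarrow> t \<ge> 0 \<longrightarrow> w x t = v0 x + M"
proof -
  obtain B where B: "\<And>x t. t \<ge> 0 \<Longrightarrow> \<bar>u x t - v0 x\<bar> \<le> B" using u_bounded by blast
  define S where "S t = (SUP x. u x t - v0 x)" for t
  have bdd: "bdd_above (range (\<lambda>x. u x t - v0 x))" if "t \<ge> 0" for t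
    by (rule bdd_aboveI2[of _ _ B]) (use B[OF that] in \<open>auto simp: abs_le_iff\<close>)
  have S1: "u x t - v0 x \<le> S t" if "t \<ge> 0" for x t unfolding S_def by (rule cSUP_upper[OF _ bdd[OF that]]) simp
  have SB: "- B \<le> S t" if "t \<ge> 0" for t using S1[OF that, of 0] B[OF that, of 0] unfolding abs_le_iff by linarith
  have mono: "u x t \<le> v0 x + S s" if st: "0 \<le> s" "s \<le> t" for x s t
  proof -
    have "u x (t - s + s) + 0 \<le> v0 x + S s"
      by (rule comparison[OF v0 solution_shift[OF u st(1), of 0]]) (use S1[OF st(1)] st in \<open>auto simp: algebra_simps\<close>)
    then show ?thesis by simp
  qed
  define M where "M = (INF t\<in>{0..}. S t)"
  have bS: "bdd_below (S ` {0..})" by (rule bdd_belowI2[of _ "- B"]) (use SB in auto)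
  have M1: "M \<le> S t" if "t \<ge> 0" for t unfolding M_def by (rule cINF_lower[OF bS]) (use that in simp)
  have up: "w x t \<le> v0 x + M" if w: "omega w" and t: "t \<ge> 0" for w x t
  proof (rule field_le_epsilon)
    fix e :: real assume e: "e > 0"
    have "\<exists>T\<in>{0..}. S T < M + e / 2" using cINF_less_iff[OF _ bS, of "M + e / 2"] e unfolding M_def by auto
    then obtain T where T: "T \<ge> 0" "S T < M + e / 2" by auto
    obtain s where s: "s \<ge> T" "\<And>x t. t \<ge> 0 \<Longrightarrow> \<bar>u x (t + s) - w x t\<bar> \<le> e / 2" using omegaD[OF w, of "e / 2" T] e by auto
    have "u x (t + s) \<le> v0 x + S T" by (rule mono) (use s T t in auto)
    then show "w x t \<le> v0 x + M + e" using s(2)[OF t, of x] T(2) unfolding abs_le_iff by linarith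
  qed
  have att: "\<exists>x. w x t = v0 x + M" if w: "omega w" and t: "t \<ge> 0" for w t
  proof (rule ccontr)
    note ws = omega_solution[OF w]
    assume "\<not> (\<exists>x. w x t = v0 x + M)"
    then have lt: "w x t < v0 x + M" for x using up[OF w t, of x] by (metis less_le)
    have "continuous_on (cbox 0 1) (\<lambda>x. w x t - v0 x)"
      using t by (intro continuous_intros continuous_on_compose2[OF solutionD(1)[OF ws], of _ "\<lambda>x. (x, t)", simplified]
         continuous_on_compose2[OF solutionD(1)[OF v0], of _ "\<lambda>x. (x, 0)", simplified]) auto
    moreover have "cbox (0::real^'n) 1 \<noteq> {}" using periodic_cube[of "\<lambda>x. 0::real"] by (auto simp: periodic_def)
    ultimately have "\<exists>y\<in>cbox 0 1. \<forall>x\<in>cbox 0 1. w x t - v0 x \<le> w y t - v0 y"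
      by (intro continuous_attains_sup[OF compact_cbox])
    then obtain y where y: "\<And>x. x \<in> cbox 0 1 \<Longrightarrow> w x t - v0 x \<le> w y t - v0 y" by blast
    define e where "e = (v0 y + M - w y t) / 2"
    have e: "e > 0" using lt[of y] by (simp add: e_def)
    obtain s where s: "s \<ge> 0" "\<And>x t. t \<ge> 0 \<Longrightarrow> \<bar>u x (t + s) - w x t\<bar> \<le> e" using omegaD[OF w e, of 0] by auto
    have "u x (t + s) - v0 x \<le> M - e" for x
    proof -
      have "\<exists>z\<in>cbox 0 1. (w x t, v0 x) = (w z t, v0 z)"
        by (rule periodic_cube[OF periodic_pair[OF solutionD(2)[OF ws t] solutionD(2)[OF v0 order_refl]]])
      then obtain z where "z \<in> cbox 0 1" "w x t = w z t" "v0 x = v0 z" by blast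
      then have "w x t - v0 x \<le> w y t - v0 y" using y by simp
      then show ?thesis using s(2)[OF t, of x] unfolding abs_le_iff e_def by argo
    qed
    then have "S (t + s) \<le> M - e" unfolding S_def by (intro cSUP_least) auto
    then show False using M1[of "t + s"] s t e by simp
  qed
  have "w x t = v0 x + M" if w: "omega w" and t: "t \<ge> 0" for w x t
  proof (rule ccontr)
    assume "w x t \<noteq> v0 x + M"
    then have lt: "w x t < v0 x + M" using up[OF w t, of x] by simp
    \<comment> \<open>Moving the point to time \<open>1\<close> of \<open>w'\<close> leaves room for
      the time neighbourhood required by the strong maximum principle.\<close>
    obtain w' where w': "omega w'" "\<And>x s. s \<ge> 0 \<Longrightarrow> w' x (s + 1) = w x (s + t)" using omega_back[OF omega_shift[OF w t]] by blast
    note ws = omega_solution[OF w'(1)]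
    define Z where "Z z = v0 (fst z) + M - w' (fst z) (snd z)" for z
    have cZ: "continuous_on (UNIV \<times> {0<..}) Z" unfolding Z_def
      by (intro continuous_intros continuous_on_subset[OF solutionD(1)[OF ws]]
         continuous_on_compose2[OF solutionD(1)[OF v0], of _ "\<lambda>z. (fst z, 0)", simplified]) auto
    define g where "g = Z (x, 1) / 2"
    have g: "g > 0" using lt w'(2)[of 0 x] by (simp add: g_def Z_def)
    have "open (UNIV \<times> {0::real<..})" by (intro open_Times) auto
    then have "isCont Z (x, 1)" using cZ by (subst (asm) continuous_on_eq_continuous_at) auto
    from this[unfolded continuous_at_eps_delta, rule_format, OF g] obtain d where d: "d > 0" "\<And>z. dist z (x, 1) < d \<Longrightarrow> dist (Z z) (Z (x, 1)) < g"
      by blast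
    define \<rho> where "\<rho> = min d 1 / 4"
    have \<rho>: "\<rho> > 0" "\<rho> < 1" "2 * \<rho> < d" using d(1) by (auto simp: \<rho>_def min_def)
    have near: "Z (y, s) \<ge> g" if "\<bar>s - 1\<bar> \<le> \<rho>" "dist y x \<le> \<rho>" for y s
    proof -
      have "dist (y, s) (x, 1) \<le> dist y x + dist s 1" unfolding dist_Pair_Pair by (rule sqrt_sum_squares_le_sum) auto
      then have "dist (y, s) (x, 1) < d" using that \<rho> by (simp add: dist_real_def)
      from d(2)[OF this] show ?thesis unfolding g_def dist_real_def abs_less_iff by argo
    qed
    obtain x2 where x2: "w' x2 1 = v0 x2 + M" using att[OF w'(1), of 1] by auto
    show False
    \<comment> \<open>With \<open>\<Sigma>\<close> empty every point belongs to
      \<open>Sigma_compl\<close>. The stationary \<open>v0\<close> is the supersolution,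
      \<open>w'\<close> is both subsolutions with weights \<open>1 / 2\<close>, and
      \<open>\<beta> = 0\<close>.\<close>
    proof (rule strong_maximum[OF solutionD(4,3)[OF v0] solutionD(4,3)[OF ws] solutionD(4,3)[OF ws], of "1/2" "1/2" 1 \<rho> 1 1 g \<rho> "\<lambda>x r t. Z (x, t)" 0 M x x2])
      show "Z (y, s) = v0 y - 1 / 2 * w' y s - 1 / 2 * w' y s + 0 * (r - s) + M" for y r s by (simp add: Z_def)
      show "0 \<le> Z (y, s)" if "\<bar>s - 1\<bar> \<le> \<rho>" for y s using up[OF w'(1), of s y] that \<rho> by (simp add: Z_def abs_le_iff)
    qed (use \<rho> g near x2 Sig in \<open>auto simp: Sigma_compl_def Z_def\<close>)
  qed
  then show ?thesis by blast
qed

end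

context bellman_erg
begin

lemma JJ_no_zero_on_Sigma:
  assumes \<eta>: "\<eta> > 0" and \<mu>: "0 < \<mu>" "\<mu> < 1" and w: "omega w"
    and nonneg: "\<And>w x s. omega w \<Longrightarrow> s \<ge> 0 \<Longrightarrow> JJ K \<eta> \<mu> w x s \<ge> 0"
    and s: "s > 0" and zero: "JJ K \<eta> \<mu> w x s = 0"
  shows "x \<notin> Sigma_set \<sigma>"
proof
  assume x: "x \<in> Sigma_set \<sigma>"
  obtain w' where w': "omega w'" "\<And>x s. s \<ge> 0 \<Longrightarrow> w' x (s + 1) = w x s" using omega_back[OF w] by blast
  note ws = omega_solution[OF w'(1)]
  have v: "solution (\<lambda>x t. v0 x - K)" using solution_shift[OF v0 order_refl, of "- K"] by simp
  \<comment> \<open>After the backward extension, \<open>JJ\<close> compares \<open>w'\<close> with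
    itself at the independent times \<open>r\<close>, near \<open>1 + s\<close>, and
    \<open>t\<close>, near \<open>1\<close>. Neighbourhoods of size \<open>min s 1 / 2\<close> keep
    \<open>r \<ge> t \<ge> 0\<close>, where \<open>nonneg\<close> applies.\<close>
  have "\<exists>p q. (\<forall>\<theta>. \<mu> * H \<theta> x p \<le> \<eta>) \<and> (1 - \<mu> > 0 \<longrightarrow> (\<forall>\<theta>. H \<theta> x q \<le> 0)) \<and>
     (\<forall>\<gamma>>0. \<exists>\<theta>. - \<eta> + H \<theta> x (\<mu> *\<^sub>R p + (1 - \<mu>) *\<^sub>R q) \<ge> - \<gamma>)"
  proof (rule on_Sigma[OF solutionD(4,3)[OF ws] solutionD(4,3)[OF ws] solutionD(4,3)[OF v] \<mu>(1) _ _ x,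
      of _ "1 + s" 1 "\<lambda>r t. - \<eta> * (r - t)" "\<lambda>r t. - \<eta>" "\<lambda>r t. \<eta>" "min s 1 / 2"])
    show "((\<lambda>r. - \<eta> * (r - t)) has_real_derivative - \<eta>) (at r)" "((\<lambda>t. - \<eta> * (r - t)) has_real_derivative \<eta>) (at t)" for r t
      by (auto intro!: derivative_eq_intros)
    fix y r t assume "\<bar>r - (1 + s)\<bar> < min s 1 / 2" "\<bar>t - 1\<bar> < min s 1 / 2"
    then have rt: "r \<ge> t" "t \<ge> 0" unfolding abs_less_iff min_def by (auto split: if_splits)
    have "JJ K \<eta> \<mu> (\<lambda>x s. w' x (s + t)) y (r - t) \<ge> 0" by (rule nonneg) (use omega_shift[OF w'(1) rt(2)] rt in auto)
    moreover have "w' x (1 + s) = w x s" "w' x 1 = w x 0" using w'(2)[of s x] w'(2)[of 0 x] s by (simp_all add: add.commute)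
    ultimately show "w' x (1 + s) - \<mu> * w' x 1 - (1 - \<mu>) * (v0 x - K) - - \<eta> * (1 + s - 1)
        \<le> w' y r - \<mu> * w' y t - (1 - \<mu>) * (v0 y - K) - - \<eta> * (r - t)"
      using zero by (simp add: JJ_def algebra_simps)
  qed (use s \<mu> in \<open>auto intro!: continuous_intros\<close>)
  then obtain p q where p: "\<And>\<theta>. \<mu> * H \<theta> x p \<le> \<eta>" and q: "\<And>\<theta>. H \<theta> x q \<le> 0"
    and pq: "\<And>\<gamma>. \<gamma> > 0 \<Longrightarrow> \<exists>\<theta>. - \<eta> + H \<theta> x (\<mu> *\<^sub>R p + (1 - \<mu>) *\<^sub>R q) \<ge> - \<gamma>" using \<mu> by auto
  have q': "(1 - \<mu>) * H \<theta> x q \<le> 0" for \<theta> using q[of \<theta>] \<mu> by (simp add: mult_le_0_iff)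
  show False
  proof (cases "p = q")
    \<comment> \<open>Strict convexity says nothing here, but the inequality
      \<open>H \<le> 0\<close> from the stationary solution already contradicts
      \<open>H \<ge> \<eta> / 2\<close>.\<close>
    case True
    have "\<mu> *\<^sub>R p + (1 - \<mu>) *\<^sub>R q = q" unfolding True by (simp add: algebra_simps)
    then obtain \<theta> where "- \<eta> + H \<theta> x q \<ge> - (\<eta> / 2)" using pq[of "\<eta> / 2"] \<eta> by auto
    then show False using q[of \<theta>] \<eta> by linarith
  next
    case False
    define g where "g \<theta> = \<mu> * H \<theta> x p + (1 - \<mu>) * H \<theta> x q - H \<theta> x (\<mu> *\<^sub>R p + (1 - \<mu>) *\<^sub>R q)" for \<theta>
    have g: "(INF \<theta>. g \<theta>) > 0" unfolding g_def by (rule strict[OF x \<mu> False])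
    have "g \<theta> \<ge> 0" for \<theta>
      using convex_onD[OF conv[of \<theta> x], of "1 - \<mu>" p q] \<mu> unfolding g_def by simp
    then have "bdd_below (range g)" by (intro bdd_belowI2[of _ 0]) auto
    then have low: "g \<theta> \<ge> (INF \<theta>. g \<theta>)" for \<theta> by (intro cINF_lower) auto
    \<comment> \<open>The convexity gap is uniform in \<open>\<theta>\<close>, so it can be fixed
      before the almost optimal parameter is chosen.\<close>
    obtain \<theta> where "- \<eta> + H \<theta> x (\<mu> *\<^sub>R p + (1 - \<mu>) *\<^sub>R q) \<ge> - ((INF \<theta>. g \<theta>) / 2)" using pq[of "(INF \<theta>. g \<theta>) / 2"] g by auto
    then show False using low[of \<theta>] p[of \<theta>] q'[of \<theta>] g unfolding g_def[of \<theta>] by linarith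
  qed
qed

lemma omega_mono_Sigma:
  assumes Sig: "Sigma_set \<sigma> \<noteq> {}" and w: "omega w" and s: "s \<ge> 0"
  shows "w x 0 \<le> w x s"
proof (rule ccontr)
  assume "\<not> w x 0 \<le> w x s"
  then have lt: "w x s < w x 0" by simp
  then have s0: "s > 0" using s by (cases "s = 0") auto
  \<comment> \<open>Half the slope of the supposed decrease: \<open>JJ\<close> with
    \<open>\<mu> = 1\<close> is then still negative at the given point, which forces
    \<open>\<mu> < 1\<close>.\<close>
  define \<eta> where "\<eta> = (w x 0 - w x s) / (2 * s)"
  have \<eta>: "\<eta> > 0" "\<eta> * s = (w x 0 - w x s) / 2" using lt s0 by (auto simp: \<eta>_def)
  obtain B where B: "B > 0" "\<And>w x t. omega w \<Longrightarrow> t \<ge> 0 \<Longrightarrow> \<bar>w x t - v0 x\<bar> \<le> B" using omega_bounded by blast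
  \<comment> \<open>Shifts \<open>v0\<close> so that \<open>1 \<le> w - (v0 - K) \<le> D\<close> on
    the whole limit set; the two bounds together make \<open>1 / D\<close> an admissible value of
    \<open>\<mu>\<close>.\<close>
  define K where "K = B + 1"
  define D where "D = 2 * B + 1"
  have D: "D > 0" using B by (simp add: D_def)
  have wD: "1 \<le> w x t - (v0 x - K)" "w x t - (v0 x - K) \<le> D" if "omega w" "t \<ge> 0" for w x t
    using B(2)[OF that, of x] unfolding K_def D_def abs_le_iff by linarith+
  define G where "G = {\<mu>. 0 \<le> \<mu> \<and> \<mu> \<le> 1 \<and> (\<forall>w x s. omega w \<longrightarrow> s \<ge> 0 \<longrightarrow> JJ K \<eta> \<mu> w x s \<ge> 0)}"
  have bG: "bdd_above G" by (rule bdd_aboveI[of _ 1]) (auto simp: G_def)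
  have GD: "1 / D \<in> G"
    unfolding G_def
  proof (intro CollectI conjI allI impI)
    fix w x s assume w: "omega w" and s: "s \<ge> (0::real)"
    have "1 / D * (w x 0 - (v0 x - K)) \<le> 1" using wD(2)[OF w order_refl, of x] D by simp
    then show "JJ K \<eta> (1 / D) w x s \<ge> 0" using wD(1)[OF w s, of x] mult_nonneg_nonneg[of \<eta> s] \<eta> s unfolding JJ_def by linarith
  qed (use B in \<open>auto simp: D_def\<close>)
  define \<mu> where "\<mu> = Sup G"
  have \<mu>0: "\<mu> > 0" using cSup_upper[OF GD bG] D unfolding \<mu>_def by (meson divide_pos_pos less_le_trans zero_less_one)
  have nonneg: "JJ K \<eta> \<mu> w x s \<ge> 0" if w: "omega w" and s: "s \<ge> 0" for w x s
  proof -
    have pos: "w x 0 - (v0 x - K) > 0" using wD(1)[OF w order_refl, of x] by linarith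
    have "\<mu> \<le> (w x s - (v0 x - K) + \<eta> * s) / (w x 0 - (v0 x - K))"
      unfolding \<mu>_def
    proof (rule cSup_least)
      show "G \<noteq> {}" using GD by blast
      fix m assume "m \<in> G"
      then have "JJ K \<eta> m w x s \<ge> 0" using w s by (simp add: G_def)
      then show "m \<le> (w x s - (v0 x - K) + \<eta> * s) / (w x 0 - (v0 x - K))"
        using pos by (simp add: JJ_def pos_le_divide_eq)
    qed
    then show ?thesis using pos by (simp add: JJ_def pos_le_divide_eq)
  qed
  have "\<mu> \<le> 1" unfolding \<mu>_def by (rule cSup_least) (use GD in \<open>auto simp: G_def\<close>)
  moreover have "\<mu> \<noteq> 1"
  proof
    assume "\<mu> = 1"
    then have "0 \<le> w x s + \<eta> * s - w x 0" using nonneg[OF w s, of x] by (simp add: JJ_def)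
    then show False using \<eta>(2) lt by argo
  qed
  ultimately have \<mu>1: "\<mu> < 1" by simp
  have "\<exists>w1 x1 s1. omega w1 \<and> s1 \<ge> 0 \<and> (\<forall>w x s. omega w \<longrightarrow> s \<ge> 0 \<longrightarrow> JJ K \<eta> \<mu> w1 x1 s1 \<le> JJ K \<eta> \<mu> w x s)"
    using JJ_attained[OF \<eta>(1), of "\<lambda>x. 0" K \<mu>] by (simp add: periodic_def)
  then obtain w1 x1 s1 where 1: "omega w1" "s1 \<ge> 0" "\<And>w x s. omega w \<Longrightarrow> s \<ge> 0 \<Longrightarrow> JJ K \<eta> \<mu> w1 x1 s1 \<le> JJ K \<eta> \<mu> w x s"
    by blast
  have zero1: "JJ K \<eta> \<mu> w1 x1 s1 = 0"
  proof (rule ccontr)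
    define k where "k = JJ K \<eta> \<mu> w1 x1 s1"
    assume "JJ K \<eta> \<mu> w1 x1 s1 \<noteq> 0"
    then have k: "k > 0" using nonneg[OF 1(1,2), of x1] by (simp add: k_def)
    \<comment> \<open>If the minimum \<open>k\<close> were positive, \<open>\<mu>\<close> could be
      raised by up to \<open>k / D\<close>, because its factor in \<open>JJ\<close> is at most
      \<open>D\<close>.\<close>
    define e where "e = min (k / D) (1 - \<mu>)"
    have e: "e > 0" "e \<le> 1 - \<mu>" "e \<le> k / D" using k D \<mu>1 by (auto simp: e_def)
    have eD: "e * D \<le> k" using e(3) D by (simp add: pos_le_divide_eq)
    have "\<mu> + e \<in> G"
      unfolding G_def
    proof (intro CollectI conjI allI impI)
      fix w x s assume w: "omega w" and s: "s \<ge> (0::real)"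
      have "e * (w x 0 - (v0 x - K)) \<le> e * D" using wD(2)[OF w order_refl, of x] e by (intro mult_left_mono) auto
      moreover have "k \<le> JJ K \<eta> \<mu> w x s" unfolding k_def by (rule 1(3)[OF w s])
      ultimately show "JJ K \<eta> (\<mu> + e) w x s \<ge> 0" using eD unfolding JJ_def distrib_right[of \<mu> e] by linarith
    qed (use \<mu>0 e in auto)
    from cSup_upper[OF this bG] show False using e(1) by (simp add: \<mu>_def)
  qed
  \<comment> \<open>At \<open>s = 0\<close> the value of \<open>JJ\<close> is
    \<open>1 - \<mu>\<close> times a number that is at least \<open>1\<close>.\<close>
  have pos: "s > 0" if w: "omega w" and z: "JJ K \<eta> \<mu> w x s = 0" and s: "s \<ge> 0" for w x s
  proof (rule ccontr)
    assume "\<not> s > 0"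
    then have "(1 - \<mu>) * (w x 0 - (v0 x - K)) = 0" using z s by (simp add: JJ_def algebra_simps)
    then show False using \<mu>1 wD(1)[OF w order_refl, of x] by auto
  qed
  have s1: "s1 > 0" by (rule pos[OF 1(1) zero1 1(2)])
  let ?d = "\<lambda>x. infdist x (Sigma_set \<sigma>)"
  have "continuous_on UNIV (\<lambda>x. - ?d x)" "periodic (\<lambda>x. - ?d x)"
    using infdist_Sigma_periodic by (auto simp: periodic_def intro!: continuous_intros)
  \<comment> \<open>Minimising \<open>JJ\<close> plus the distance to \<open>\<Sigma>\<close> turns
    the absence of zeros on \<open>\<Sigma>\<close> into the bound \<open>JJ \<ge> \<gamma>\<close>
    within distance \<open>\<gamma>\<close> of \<open>\<Sigma>\<close>, uniformly in
    \<open>w\<close> and \<open>s\<close>.\<close>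
  from JJ_attained[OF \<eta>(1) this, of K \<mu>]
  have "\<exists>w2 x2 s2. omega w2 \<and> s2 \<ge> 0 \<and> (\<forall>w x s. omega w \<longrightarrow> s \<ge> 0 \<longrightarrow> JJ K \<eta> \<mu> w2 x2 s2 + ?d x2 \<le> JJ K \<eta> \<mu> w x s + ?d x)"
    by simp
  then obtain w2 x2 s2 where 2: "omega w2" "s2 \<ge> 0" "\<And>w x s. omega w \<Longrightarrow> s \<ge> 0 \<Longrightarrow> JJ K \<eta> \<mu> w2 x2 s2 + ?d x2 \<le> JJ K \<eta> \<mu> w x s + ?d x"
    by blast
  define \<gamma> where "\<gamma> = (JJ K \<eta> \<mu> w2 x2 s2 + ?d x2) / 2"
  have \<gamma>: "\<gamma> > 0"
  proof (rule ccontr)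
    assume "\<not> \<gamma> > 0"
    then have "JJ K \<eta> \<mu> w2 x2 s2 + ?d x2 \<le> 0" by (simp add: \<gamma>_def)
    with nonneg[OF 2(1,2), of x2] infdist_nonneg[of x2 "Sigma_set \<sigma>"]
    have "JJ K \<eta> \<mu> w2 x2 s2 = 0" "?d x2 = 0" by linarith+
    note z = this
    then have "x2 \<in> Sigma_set \<sigma>" using closed_Sigma Sig by (simp add: in_closed_iff_infdist_zero)
    moreover have "x2 \<notin> Sigma_set \<sigma>"
      by (rule JJ_no_zero_on_Sigma[OF \<eta>(1) \<mu>0 \<mu>1 2(1) nonneg pos[OF 2(1) z(1) 2(2)] z(1)])
    ultimately show False by blast
  qed
  have near: "JJ K \<eta> \<mu> w x s \<ge> \<gamma>" if "omega w" "s \<ge> 0" "?d x \<le> \<gamma>" for w x s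
    using 2(3)[OF that(1,2), of x] that(3) unfolding \<gamma>_def by argo
  \<comment> \<open>Any point of \<open>\<Sigma>\<close> can be the centre of the barrier, since
    \<open>JJ\<close> is bounded below by \<open>\<gamma>\<close> around it.\<close>
  obtain l where l: "l \<in> Sigma_set \<sigma>" using Sig by blast
  obtain w' where w': "omega w'" "\<And>x s. s \<ge> 0 \<Longrightarrow> w' x (s + 1) = w1 x s" using omega_back[OF 1(1)] by blast
  note ws = omega_solution[OF w'(1)]
  have v: "solution (\<lambda>x t. v0 x - K)" using solution_shift[OF v0 order_refl, of "- K"] by simp
  define J where "J x r t = w' x r - \<mu> * w' x t - (1 - \<mu>) * (v0 x - K) + \<eta> * (r - t) + 0" for x r t
  define \<tau> where "\<tau> = min s1 1 / 2"
  have \<tau>: "\<tau> > 0" "\<tau> < 1" "2 * \<tau> \<le> s1" using s1 by (auto simp: \<tau>_def)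
  have JJ: "J x r t = JJ K \<eta> \<mu> (\<lambda>x s. w' x (s + t)) x (r - t)" for x r t by (simp add: J_def JJ_def algebra_simps)
  have rt: "omega (\<lambda>x s. w' x (s + t))" "r - t \<ge> 0" if "\<bar>r - (1 + s1)\<bar> \<le> \<tau>" "\<bar>t - 1\<bar> \<le> \<tau>" for r t
    using omega_shift[OF w'(1), of t] that \<tau> unfolding abs_le_iff by auto
  show False
  proof (rule strong_maximum[OF solutionD(4,3)[OF ws] solutionD(4,3)[OF ws] solutionD(4,3)[OF v] \<mu>0 _ _ \<gamma> \<tau>(1) _ \<tau>(2) \<gamma> \<gamma> J_def])
    show "0 \<le> J x r t" if "\<bar>r - (1 + s1)\<bar> \<le> \<tau>" "\<bar>t - 1\<bar> \<le> \<tau>" for x r t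
      unfolding JJ by (rule nonneg[OF rt[OF that]])
    show "\<gamma> \<le> J x r t" if "\<bar>r - (1 + s1)\<bar> \<le> \<tau>" "\<bar>t - 1\<bar> \<le> \<tau>" "dist x l \<le> \<gamma>" for x r t
      unfolding JJ by (rule near[OF rt[OF that(1,2)]]) (use infdist_le[OF l, of x] that in linarith)
    show "\<gamma> \<le> J x r t" if "\<bar>r - (1 + s1)\<bar> \<le> \<tau>" "\<bar>t - 1\<bar> \<le> \<tau>" "x \<notin> Sigma_compl \<sigma> \<gamma>" for x r t
      unfolding JJ by (rule near[OF rt[OF that(1,2)]]) (use that in \<open>auto simp: Sigma_compl_def\<close>)
    show "J x1 (1 + s1) 1 = 0" using zero1 w'(2)[of s1 x1] w'(2)[of 0 x1] s1 by (simp add: J_def JJ_def algebra_simps)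
  qed (use \<mu>1 s1 \<tau> in auto)
qed

lemma omega_mono:
  assumes w: "omega w" and s: "0 \<le> s" "s \<le> t"
  shows "w x s \<le> w x t"
proof (cases "Sigma_set \<sigma> = {}")
  case True
  then obtain M where M: "\<And>w x t. omega w \<Longrightarrow> t \<ge> 0 \<Longrightarrow> w x t = v0 x + M" using omega_const by blast
  show ?thesis using M[OF w, of s x] M[OF w, of t x] s by simp
next
  case False
  from omega_mono_Sigma[OF this omega_shift[OF w s(1)], of "t - s" x] s show ?thesis by simp
qed

text \<open>A limit \<open>f\<close> of the translates of a nondecreasing \<open>w\<close> does not
  depend on time, since every time of every translate is overtaken by a later translate. Membership
  of \<open>f\<close> in the limit set bounds the distance of \<open>u\<close> to \<open>f\<close>
  for all times after some \<open>s\<close>, so no subsequence remains.\<close>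

lemma convergence: "\<exists>ui. solution (\<lambda>x t. ui x) \<and> uniform_limit UNIV (\<lambda>t x. u x t) ui at_top"
proof -
  obtain w where w: "omega w" using omega_nonempty by blast
  have "omega (\<lambda>x t. w x (t + real n))" for n by (rule omega_shift[OF w]) simp
  from omega_compact[of "\<lambda>n x t. w x (t + real n)", OF this]
  obtain r f where r: "strict_mono (r :: nat \<Rightarrow> nat)" and f: "omega f" "ulim (\<lambda>n x t. w x (t + real (r n))) f" by blast
  have lim: "(\<lambda>n. w x (t + real (r n))) \<longlonglongrightarrow> f x t" if "t \<ge> 0" for x t using ulim_tendsto[OF f(2) that] .
  have const: "f x t = f x 0" if t: "t \<ge> 0" for x t
  proof (rule antisym)
    show "f x 0 \<le> f x t" by (rule omega_mono[OF f(1) order_refl t])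
    have "incseq (\<lambda>n. w x (0 + real (r n)))"
      using r by (auto simp: incseq_def strict_mono_def intro!: omega_mono[OF w] strict_mono_less_eq[OF r, THEN iffD2])
    then have le: "w x (0 + real (r m)) \<le> f x 0" for m using lim[of 0 x] incseq_le by blast
    have "w x (t + real (r n)) \<le> f x 0" for n
    proof -
      obtain m :: nat where "t + real (r n) \<le> real m" using real_arch_simple by blast
      then have m: "t + real (r n) \<le> real (r m)" using seq_suble[OF r, of m] by linarith
      have "w x (t + real (r n)) \<le> w x (real (r m))" by (rule omega_mono[OF w _ m]) (use t in simp)
      then show ?thesis using le[of m] by simp
    qed
    then show "f x t \<le> f x 0" using LIMSEQ_le_const2[OF lim[OF t, of x]] by blast
  qed
  have "solution (\<lambda>x t. f x 0)"
  proof (rule solution_limit)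
    fix e :: real assume "e > 0"
    then have "\<bar>f x t - f x 0\<bar> \<le> e" if "t \<ge> 0" for x t using const[OF that, of x] by linarith
    then show "\<exists>z. solution z \<and> (\<forall>x t. t \<ge> 0 \<longrightarrow> \<bar>z x t - f x 0\<bar> \<le> e)" using omega_solution[OF f(1)] by blast
  qed
  moreover have "uniform_limit UNIV (\<lambda>t x. u x t) (\<lambda>x. f x 0) at_top"
  proof (rule uniform_limitI)
    fix e :: real assume e: "e > 0"
    obtain s where s: "\<And>x t. t \<ge> 0 \<Longrightarrow> \<bar>u x (t + s) - f x t\<bar> \<le> e / 2" using omegaD[OF f(1), of "e / 2" 0] e by auto
    have "dist (u x t) (f x 0) < e" if "t \<ge> s" for x t
      using s[of "t - s" x] const[of "t - s" x] that e by (simp add: dist_real_def)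
    then show "\<forall>\<^sub>F t in at_top. \<forall>x\<in>UNIV. dist (u x t) (f x 0) < e" unfolding eventually_at_top_linorder by blast
  qed
  ultimately show ?thesis by (intro exI[of _ "\<lambda>x. f x 0"] conjI)
qed

end

section \<open>Passage between the stationary and the evolution equation, and normalisation of the
  ergodic constant\<close>

lemma stationary_imp_E:
  assumes v: "visc_sol_stat \<sigma> H 0 0 v"
  shows "visc_sol_E \<sigma> H (\<lambda>x t. v x)"
proof -
  have cv: "continuous_on UNIV v" using v by (simp add: visc_sol_stat_def)
  have slice: "C2_test (\<lambda>x. phi x t0) (\<lambda>x. Dphi x t0) (\<lambda>x. D2phi x t0)" if C: "C21_test phi phit Dphi D2phi"
    for phi phit Dphi D2phi and t0 :: real
    unfolding C2_test_def
  proof (intro conjI allI)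
    fix x
    have "((\<lambda>z. phi (fst z) (snd z)) has_derivative (\<lambda>h. Dphi x t0 \<bullet> fst h + phit x t0 * snd h)) (at (x, t0))"
      using C by (simp add: C21_test_def)
    moreover have "((\<lambda>x. (x, t0)) has_derivative (\<lambda>h. (h, 0))) (at x)" by (auto intro!: derivative_eq_intros)
    ultimately show "((\<lambda>x. phi x t0) has_derivative (\<bullet>) (Dphi x t0)) (at x)"
      using has_derivative_compose[of "\<lambda>x. (x, t0)" "\<lambda>h. (h, 0)" x UNIV "\<lambda>z. phi (fst z) (snd z)" "\<lambda>h. Dphi x t0 \<bullet> fst h + phit x t0 * snd h"] by simp
    show "((\<lambda>x. Dphi x t0) has_derivative (*v) (D2phi x t0)) (at x)" using C by (simp add: C21_test_def)
    have "continuous_on UNIV (\<lambda>z. D2phi (fst z) (snd z))" using C by (simp add: C21_test_def)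
    moreover have "continuous_on UNIV (\<lambda>x. (x, t0))" by (intro continuous_intros)
    ultimately show "continuous_on UNIV (\<lambda>x. D2phi x t0)" using continuous_on_compose2 by fastforce
  qed
  have dt: "((\<lambda>t. phi x t) has_real_derivative phit x t) (at t)" if C: "C21_test phi phit Dphi D2phi"
    for phi phit Dphi D2phi and x and t :: real
  proof -
    have "((\<lambda>z. phi (fst z) (snd z)) has_derivative (\<lambda>h. Dphi x t \<bullet> fst h + phit x t * snd h)) (at (x, t))"
      using C by (simp add: C21_test_def)
    moreover have "((\<lambda>t. (x, t)) has_derivative (\<lambda>h. (0, h))) (at t)" by (auto intro!: derivative_eq_intros)
    ultimately show ?thesis
      using has_derivative_compose[of "\<lambda>t. (x, t)" "\<lambda>h. (0, h)" t UNIV "\<lambda>z. phi (fst z) (snd z)" "\<lambda>h. Dphi x t \<bullet> fst h + phit x t * snd h"]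
      by (simp add: has_field_derivative_def)
  qed
  show ?thesis
    unfolding visc_sol_E_def
  proof (intro conjI allI impI)
    show "continuous_on (UNIV \<times> {0<..}) (\<lambda>z. v (fst z))"
      by (rule continuous_on_compose2[OF cv]) (auto intro!: continuous_intros)
  next
    fix phi phit Dphi D2phi x0 t0
    assume "C21_test phi phit Dphi D2phi \<and> 0 < t0 \<and> (\<exists>e>0. \<forall>y s. dist y x0 < e \<and> \<bar>s - t0\<bar> < e \<and> 0 < s \<longrightarrow> v y - phi y s \<le> v x0 - phi x0 t0)"
    then obtain e where C: "C21_test phi phit Dphi D2phi" and t0: "0 < t0" and e: "e > 0"
      "\<And>y s. dist y x0 < e \<Longrightarrow> \<bar>s - t0\<bar> < e \<Longrightarrow> 0 < s \<Longrightarrow> v y - phi y s \<le> v x0 - phi x0 t0" by blast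
    \<comment> \<open>As \<open>v\<close> does not depend on time, the test function has an extremum
      in time at \<open>t0\<close>; so \<open>phit x0 t0 = 0\<close>, and its slice at
      \<open>t0\<close> is a stationary test function.\<close>
    have "phi x0 t0 \<le> phi x0 s" if "\<bar>t0 - s\<bar> < min e t0" for s
      using e(2)[of x0 s] e(1) that unfolding abs_less_iff by auto
    then have "phit x0 t0 = 0" using DERIV_local_min[OF dt[OF C], of "min e t0"] t0 e(1) by auto
    moreover have "\<exists>e>0. \<forall>y. dist y x0 < e \<longrightarrow> v y - phi y t0 \<le> v x0 - phi x0 t0" using e t0 by auto
    ultimately show "phit x0 t0 + Ham \<sigma> H x0 (Dphi x0 t0) (D2phi x0 t0) \<le> 0"
      using v[unfolded visc_sol_stat_def, THEN conjunct2, THEN conjunct1, rule_format, OF conjI[OF slice[OF C, of t0]]] by simp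
  next
    fix phi phit Dphi D2phi x0 t0
    assume "C21_test phi phit Dphi D2phi \<and> 0 < t0 \<and> (\<exists>e>0. \<forall>y s. dist y x0 < e \<and> \<bar>s - t0\<bar> < e \<and> 0 < s \<longrightarrow> v y - phi y s \<ge> v x0 - phi x0 t0)"
    then obtain e where C: "C21_test phi phit Dphi D2phi" and t0: "0 < t0" and e: "e > 0"
      "\<And>y s. dist y x0 < e \<Longrightarrow> \<bar>s - t0\<bar> < e \<Longrightarrow> 0 < s \<Longrightarrow> v y - phi y s \<ge> v x0 - phi x0 t0" by blast
    have "phi x0 s \<le> phi x0 t0" if "\<bar>t0 - s\<bar> < min e t0" for s
      using e(2)[of x0 s] e(1) that unfolding abs_less_iff by auto
    then have "phit x0 t0 = 0" using DERIV_local_max[OF dt[OF C], of "min e t0"] t0 e(1) by auto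
    moreover have "\<exists>e>0. \<forall>y. dist y x0 < e \<longrightarrow> v y - phi y t0 \<ge> v x0 - phi x0 t0" using e t0 by auto
    ultimately show "phit x0 t0 + Ham \<sigma> H x0 (Dphi x0 t0) (D2phi x0 t0) \<ge> 0"
      using v[unfolded visc_sol_stat_def, THEN conjunct2, THEN conjunct2, rule_format, OF conjI[OF slice[OF C, of t0]]] by simp
  qed
qed

lemma E_imp_stationary:
  assumes v: "visc_sol_E \<sigma> H (\<lambda>x t. v x)" and cv: "continuous_on UNIV v"
  shows "visc_sol_stat \<sigma> H 0 0 v"
proof -
  have ext: "C21_test (\<lambda>x t. phi x) (\<lambda>x t. 0) (\<lambda>x t. Dphi x) (\<lambda>x t. D2phi x)" if C: "C2_test phi Dphi D2phi" for phi Dphi D2phi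
    unfolding C21_test_def
  proof (intro conjI allI)
    fix x and t :: real
    have p: "(phi has_derivative (\<lambda>h. Dphi x \<bullet> h)) (at x)" "(Dphi has_derivative (\<lambda>h. D2phi x *v h)) (at x)"
      using C by (auto simp: C2_test_def)
    show "((\<lambda>z. phi (fst z)) has_derivative (\<lambda>h. Dphi x \<bullet> fst h + 0 * snd h)) (at (x, t))"
      using has_derivative_compose[of fst fst "(x, t)" UNIV phi] p(1) by (simp add: has_derivative_fst)
    show "(Dphi has_derivative (\<lambda>h. D2phi x *v h)) (at x)" by (rule p)
  next
    have cD: "continuous_on UNIV Dphi" using C unfolding C2_test_def
      by (meson continuous_on_eq_continuous_at has_derivative_continuous open_UNIV)
    have cD2: "continuous_on UNIV D2phi" using C by (simp add: C2_test_def)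
    show "continuous_on UNIV (\<lambda>z. Dphi (fst z))" "continuous_on UNIV (\<lambda>z. D2phi (fst z))"
      by (rule continuous_on_compose2[OF cD] continuous_on_compose2[OF cD2], auto intro!: continuous_intros)+
  qed auto
  show ?thesis
    unfolding visc_sol_stat_def
  proof (intro conjI allI impI cv)
    fix phi Dphi D2phi x0
    assume a: "C2_test phi Dphi D2phi \<and> (\<exists>e>0. \<forall>y. dist y x0 < e \<longrightarrow> v y - phi y \<le> v x0 - phi x0)"
    then obtain e where e: "e > 0" "\<And>y. dist y x0 < e \<Longrightarrow> v y - phi y \<le> v x0 - phi x0" by blast
    show "0 * v x0 + Ham \<sigma> H x0 (Dphi x0) (D2phi x0) \<le> 0"
      using visc_sol_E_sub[OF v ext[OF conjunct1[OF a]] zero_less_one e(1)] e(2) by simp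
  next
    fix phi Dphi D2phi x0
    assume a: "C2_test phi Dphi D2phi \<and> (\<exists>e>0. \<forall>y. dist y x0 < e \<longrightarrow> v y - phi y \<ge> v x0 - phi x0)"
    then obtain e where e: "e > 0" "\<And>y. dist y x0 < e \<Longrightarrow> v y - phi y \<ge> v x0 - phi x0" by blast
    show "0 \<le> 0 * v x0 + Ham \<sigma> H x0 (Dphi x0) (D2phi x0)"
      using visc_sol_E_super[OF v ext[OF conjunct1[OF a]] zero_less_one e(1)] e(2) by simp
  qed
qed

theorem theorem2p1:
  fixes C :: real
    and \<sigma> :: "'th::metric_space \<Rightarrow> real^'n \<Rightarrow> real^'n^'n"
    and H :: "'th \<Rightarrow> real^'n \<Rightarrow> real^'n \<Rightarrow> real"
    and u :: "real^'n \<Rightarrow> real \<Rightarrow> real"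
    and u0 :: "real^'n \<Rightarrow> real"
    and c :: real
  assumes st: "standing C \<sigma> H"
    and u_cont: "continuous_on (UNIV \<times> {0..}) (\<lambda>z. u (fst z) (snd z))"
    and u_per: "\<forall>t\<ge>0. periodic (\<lambda>x. u x t)"
    and u_lip: "\<forall>t\<ge>0. \<forall>x y. \<bar>u x t - u y t\<bar> \<le> C * dist x y"
    and u_init: "\<forall>x. u x 0 = u0 x"
    and u_sol: "visc_sol_E \<sigma> H u"
    and v_lam: "\<forall>lam>0. \<exists>v. periodic v \<and> (\<forall>x y. \<bar>v x - v y\<bar> \<le> C * dist x y) \<and>
                       visc_sol_stat \<sigma> H lam 0 v"
    and ergodic: "\<exists>v L. periodic v \<and> (\<forall>x y. \<bar>v x - v y\<bar> \<le> L * dist x y) \<and>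
                       visc_sol_stat \<sigma> H 0 c v"
    and nondeg: "\<forall>\<delta>>0. \<exists>\<nu>>0. \<forall>\<theta>. \<forall>x\<in>Sigma_compl \<sigma> \<delta>. \<forall>\<xi>.
                   \<xi> \<bullet> (diffA \<sigma> \<theta> x *v \<xi>) \<ge> \<nu> * (norm \<xi>)\<^sup>2"
    and conv: "\<forall>\<theta> x. convex_on UNIV (H \<theta> x)"
    and strict_conv: "\<forall>x\<in>Sigma_set \<sigma>. \<forall>s::real. 0 < s \<and> s < 1 \<longrightarrow> (\<forall>p q. p \<noteq> q \<longrightarrow>
         (INF \<theta>. s * H \<theta> x p + (1 - s) * H \<theta> x q - H \<theta> x (s *\<^sub>R p + (1 - s) *\<^sub>R q)) > 0)"
  shows "\<exists>u_inf. periodic u_inf \<and> visc_sol_stat \<sigma> H 0 c u_inf \<and>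
           uniform_limit UNIV (\<lambda>t x. u x t + c * t) u_inf at_top"
proof -
  obtain v L where v: "periodic v" "\<And>x y. \<bar>v x - v y\<bar> \<le> L * dist x y" "visc_sol_stat \<sigma> H 0 c v" using ergodic by blast
  \<comment> \<open>Subtracting \<open>c\<close> makes the ergodic constant zero; in convexity gaps
    and differences of \<open>H\<close> the constant cancels.\<close>
  define H' where "H' \<theta> x p = H \<theta> x p - c" for \<theta> x p
  define C' where "C' = C + \<bar>c\<bar>"
  \<comment> \<open>Covers the Lipschitz constants of both \<open>u\<close> and \<open>v\<close>;
    the absolute value is taken because the sign of \<open>L\<close> is not prescribed.\<close>
  define L' where "L' = C + \<bar>L\<bar>"
  have C: "C > 0" "C \<le> C'" using st by (auto simp: standing_def C'_def)
  interpret bellman \<sigma> H' C' L'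
  proof
    show "C' > 0" "L' > 0" using C by (auto simp: L'_def)
    show "periodic (\<sigma> \<theta>)" "periodic (\<lambda>x. H' \<theta> x p)" for \<theta> p using st by (auto simp: standing_def H'_def periodic_def)
    show "norm (\<sigma> \<theta> x) \<le> C'" for \<theta> x
    proof -
      have "norm (\<sigma> \<theta> x) \<le> C" using st by (simp add: standing_def)
      then show ?thesis using C(2) by simp
    qed
    show "norm (\<sigma> \<theta> x - \<sigma> \<theta> y) \<le> C' * dist x y" for \<theta> x y
    proof -
      have "norm (\<sigma> \<theta> x - \<sigma> \<theta> y) \<le> C * dist x y" using st by (simp add: standing_def)
      also have "\<dots> \<le> C' * dist x y" using C by (intro mult_right_mono) auto
      finally show ?thesis .
    qed
    show "\<bar>H' \<theta> x 0\<bar> \<le> C'" for \<theta> x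
    proof -
      have "\<bar>H \<theta> x 0\<bar> \<le> C" using st by (simp add: standing_def)
      then show ?thesis by (simp add: H'_def C'_def)
    qed
    show "\<exists>CR>0. \<forall>\<theta> x y p q. norm p \<le> R \<and> norm q \<le> R \<longrightarrow> \<bar>H' \<theta> x p - H' \<theta> y q\<bar> \<le> CR * (dist x y + dist p q)" if "R > 0" for R
      using st that by (simp add: standing_def H'_def)
    show "convex_on UNIV (H' \<theta> x)" for \<theta> x
    proof (rule convex_onI)
      fix t :: real and p q assume "0 < t" "t < 1"
      then have "H \<theta> x ((1 - t) *\<^sub>R p + t *\<^sub>R q) \<le> (1 - t) * H \<theta> x p + t * H \<theta> x q"
        using conv by (intro convex_onD) auto
      then show "H' \<theta> x ((1 - t) *\<^sub>R p + t *\<^sub>R q) \<le> (1 - t) * H' \<theta> x p + t * H' \<theta> x q"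
        by (simp add: H'_def algebra_simps)
    qed simp
    show "0 < (INF \<theta>. s * H' \<theta> x p + (1 - s) * H' \<theta> x q - H' \<theta> x (s *\<^sub>R p + (1 - s) *\<^sub>R q))"
      if "x \<in> Sigma_set \<sigma>" "0 < s" "s < 1" "p \<noteq> q" for x s p q
    proof -
      have "s * H' \<theta> x p + (1 - s) * H' \<theta> x q - H' \<theta> x (s *\<^sub>R p + (1 - s) *\<^sub>R q)
        = s * H \<theta> x p + (1 - s) * H \<theta> x q - H \<theta> x (s *\<^sub>R p + (1 - s) *\<^sub>R q)" for \<theta>
        unfolding H'_def by (simp add: algebra_simps)
      then show ?thesis using strict_conv that by simp
    qed
  qed (use nondeg in blast)
  have Ham': "Ham \<sigma> H' x p X = Ham \<sigma> H x p X - c" for x p X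
  proof -
    have H: "- trace (diffA \<sigma> \<theta> x ** X) + H \<theta> x p = op \<theta> x p X + c" for \<theta> by (simp add: op_def H'_def)
    have "(SUP \<theta>. op \<theta> x p X + c) = Ham \<sigma> H' x p X + c"
    proof (rule cSup_eq_non_empty)
      fix b assume "\<And>a. a \<in> range (\<lambda>\<theta>. op \<theta> x p X + c) \<Longrightarrow> a \<le> b"
      then have "op \<theta> x p X + c \<le> b" for \<theta> by blast
      then have "Ham \<sigma> H' x p X \<le> b - c" by (intro Ham_le) (simp add: le_diff_eq)
      then show "Ham \<sigma> H' x p X + c \<le> b" by simp
    qed (auto intro: op_le_Ham)
    then show ?thesis unfolding Ham_def[of \<sigma> H] H by simp
  qed
  have stat: "visc_sol_stat \<sigma> H' 0 0 f \<longleftrightarrow> visc_sol_stat \<sigma> H 0 c f" for f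
    by (simp add: visc_sol_stat_def Ham')
  have L': "C * d \<le> L' * d" "L * d \<le> L' * d" if "d \<ge> 0" for d
    using C that by (auto simp: L'_def intro!: mult_right_mono)
  interpret bellman_erg \<sigma> H' C' L' v "\<lambda>x t. u x t + c * t"
  proof
    show "solution (\<lambda>x t. v x)"
      unfolding solution_def
    proof (intro conjI allI impI v)
      show "visc_sol_E \<sigma> H' (\<lambda>x t. v x)" by (rule stationary_imp_E) (simp add: stat v)
      have "continuous_on UNIV v" using v by (simp add: visc_sol_stat_def)
      then show "continuous_on (UNIV \<times> {0..}) (\<lambda>z. v (fst z))"
        by (rule continuous_on_compose2) (auto intro!: continuous_intros)
      show "lip_t (\<lambda>x t. v x)" unfolding lip_t_def by (intro allI impI order_trans[OF v(2) L'(2)]) simp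
    qed
    show "solution (\<lambda>x t. u x t + c * t)"
      unfolding solution_def
    proof (intro conjI allI impI)
      show "visc_sol_E \<sigma> H' (\<lambda>x t. u x t + c * t)"
        using visc_sol_E_shift[OF u_sol order_refl, of H' c 0] Ham' by simp
      show "continuous_on (UNIV \<times> {0..}) (\<lambda>z. u (fst z) (snd z) + c * snd z)" by (intro continuous_intros u_cont)
      show "periodic (\<lambda>x. u x t + c * t)" if "t \<ge> 0" for t using u_per that by (simp add: periodic_def)
      have "\<bar>u x t - u y t\<bar> \<le> L' * dist x y" if "t \<ge> 0" for x y t
        by (rule order_trans[OF u_lip[rule_format, OF that] L'(1)]) simp
      then show "lip_t (\<lambda>x t. u x t + c * t)" unfolding lip_t_def by simp
    qed
  qed
  obtain f where f: "solution (\<lambda>x t. f x)" "uniform_limit UNIV (\<lambda>t x. u x t + c * t) f at_top" using convergence by blast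
  have "continuous_on UNIV f"
  proof -
    have "continuous_on UNIV (\<lambda>x :: real^'n. (x, 0 :: real))" by (intro continuous_intros)
    from continuous_on_compose2[OF solutionD(1)[OF f(1)] this] show ?thesis by auto
  qed
  then have "visc_sol_stat \<sigma> H 0 c f" using E_imp_stationary[OF solutionD(4)[OF f(1)]] stat by blast
  then show ?thesis using f(2) solutionD(2)[OF f(1) order_refl] by blast
qed

end
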